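(* For every integer $n\ge1$, let $\lambda$ be a random partition of $n$ distributed according to the $n$th Plancherel measure $\mathrm{Pl}^{(n)}$, and let $\mathbb{E}\log \mathrm{Pl}^{(n)}(\lambda)$ denote the expectation of the logarithm of the Plancherel probability of $\lambda$. For integers $\ell\ge1$ let $H_\ell=1+\frac12+\cdots+\frac1\ell$ denote the $\ell$th harmonic number, and let $\gamma$ denote Euler's constant. Then, as $n\to\infty$, $$-\frac{\mathbb{E}\log \mathrm{Pl}^{(n)}(\lambda)}{\sqrt n}=H-\left(\frac{13}{24}\log n+\frac{13\gamma}{12}+\log\sqrt{2\pi}+\frac14-\eta\right)\frac{1}{\sqrt n}+o\left(n^{-\frac12}\right),$$ where $$H=\frac{16}{3\pi^2}(4\gamma+1)+\frac{64}{\pi^2}\sum_{\ell\ge2}\frac{\ell^2}{4\ell^2-1}\left(\log\ell-H_\ell+\gamma+\frac{1}{2\ell}\right)\approx 1.87702830628$$ and $$\eta=\sum_{\ell\ge2}\ell\left(H_\ell-\log\ell-\gamma-\frac{1}{2\ell}+\frac{1}{12\ell^2}\right)\approx 0.001562493.$$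
   Context: A partition $\lambda=(\lambda_1,\ldots,\lambda_k)$ of $n$ (written $\lambda\vdash n$) with $\lambda_1\ge\cdots\ge\lambda_k\ge 1$ and $\lambda_1+\cdots+\lambda_k=n$ is identified with its Young diagram, the set of boxes $(i,j)$ (row $i$, column $j$) with $1\le i\le k$, $1\le j\le\lambda_i$. The $n$th Plancherel measure is the probability measure on partitions of $n$ given by $\mathrm{Pl}^{(n)}(\lambda)=f_\lambda^2/n!$, where $f_\lambda$ is the number of standard Young tableaux of shape $\lambda$ (fillings of $\lambda$ with $1,\ldots,n$, each used once, increasing along rows and columns). Equivalently, $\mathrm{Pl}^{(n)}(\lambda)=n!/\prod_{u\in\lambda}h_u^2$, where the hook length $h_u$ of a box $u$ is one more than the number of boxes to the right of $u$ in its row plus the number of boxes below $u$ in its column. Thus $\mathbb{E}\log \mathrm{Pl}^{(n)}(\lambda)=\sum_{\lambda\vdash n}\mathrm{Pl}^{(n)}(\lambda)\log \mathrm{Pl}^{(n)}(\lambda)$. Logarithms are natural. The symbol $H$ without subscript is the constant defined in the claim, distinct from the harmonic numbers $H_\ell$. The constant called $\eta$ here is denoted $h'(0)$ in the paper. *)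

theory Defs
  imports "HOL-Probability.Probability"
begin

definition partitions :: "nat \<Rightarrow> nat list set" where
  "partitions n = {xs. sorted_wrt (\<ge>) xs \<and> (\<forall>x\<in>set xs. x \<ge> 1) \<and> sum_list xs = n}"

text \<open>Rows and columns are numbered from 1, whereas list positions are numbered from 0.\<close>

definition young_diagram :: "nat list \<Rightarrow> (nat \<times> nat) set" where
  "young_diagram xs = {(i, j). 1 \<le> i \<and> i \<le> length xs \<and> 1 \<le> j \<and> j \<le> xs ! (i - 1)}"

text \<open>
  Fillings are taken extensional (undefined off the diagram), so that each filling of the boxes
  is represented by exactly one function.
\<close>

definition standard_young_tableaux :: "nat list \<Rightarrow> (nat \<times> nat \<Rightarrow> nat) set" where
  "standard_young_tableaux xs = {T \<in> extensional (young_diagram xs).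
     bij_betw T (young_diagram xs) {1..sum_list xs} \<and>
     (\<forall>i j j'. (i, j) \<in> young_diagram xs \<and> (i, j') \<in> young_diagram xs \<and> j < j'
        \<longrightarrow> T (i, j) < T (i, j')) \<and>
     (\<forall>i i' j. (i, j) \<in> young_diagram xs \<and> (i', j) \<in> young_diagram xs \<and> i < i'
        \<longrightarrow> T (i, j) < T (i', j))}"

definition num_syt :: "nat list \<Rightarrow> nat" where
  "num_syt xs = card (standard_young_tableaux xs)"

definition plancherel :: "nat \<Rightarrow> nat list \<Rightarrow> real" where
  "plancherel n xs = (real (num_syt xs))\<^sup>2 / fact n"

definition plancherel_measure :: "nat \<Rightarrow> nat list measure" where
  "plancherel_measure n = point_measure (partitions n) (\<lambda>xs. ennreal (plancherel n xs))"

definition expected_log_plancherel :: "nat \<Rightarrow> real" where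
  "expected_log_plancherel n = (\<integral>xs. ln (plancherel n xs) \<partial>plancherel_measure n)"

lemma finite_partitions: "finite (partitions n)"
proof (rule finite_subset)
  show "partitions n \<subseteq> {xs. set xs \<subseteq> {0..n} \<and> length xs \<le> n}"
  proof
    fix xs assume xs: "xs \<in> partitions n"
    have "length xs \<le> sum_list xs" if "\<forall>x\<in>set xs. x \<ge> 1" for xs :: "nat list"
      using that by (induction xs) auto
    then show "xs \<in> {xs. set xs \<subseteq> {0..n} \<and> length xs \<le> n}"
      using xs member_le_sum_list by (fastforce simp: partitions_def)
  qed
  show "finite {xs. set xs \<subseteq> {0..n} \<and> length xs \<le> n}"
    by (rule finite_lists_length_le) simp
qed

lemma expected_log_plancherel_eq_sum:
  "expected_log_plancherel n = (\<Sum>xs\<in>partitions n. plancherel n xs * ln (plancherel n xs))"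
  unfolding expected_log_plancherel_def plancherel_measure_def
  by (subst lebesgue_integral_point_measure_finite)
     (auto simp: finite_partitions plancherel_def)

definition entropy_summand :: "nat \<Rightarrow> real" where
  "entropy_summand l = (real l)\<^sup>2 / (4 * (real l)\<^sup>2 - 1) *
     (ln (real l) - harm l + euler_mascheroni + 1 / (2 * real l))"

definition eta_summand :: "nat \<Rightarrow> real" where
  "eta_summand l = real l *
     (harm l - ln (real l) - euler_mascheroni - 1 / (2 * real l) + 1 / (12 * (real l)\<^sup>2))"

text \<open>The series over \<open>l \<ge> 2\<close> are written with the index shifted by 2.\<close>

definition plancherel_entropy_const :: real where
  "plancherel_entropy_const = 16 / (3 * pi\<^sup>2) * (4 * euler_mascheroni + 1)
     + 64 / pi\<^sup>2 * (\<Sum>k. entropy_summand (k + 2))"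

definition plancherel_eta :: real where
  "plancherel_eta = (\<Sum>k. eta_summand (k + 2))"

end

theory Submission
  imports Defs "HOL-Computational_Algebra.Polynomial" "HOL-Real_Asymp.Real_Asymp"
begin

text \<open>
  By the hook length formula, \<open>- ln Pl = 2 (\<Sum>l. N\<^sub>l ln l) - ln n!\<close>, where \<open>N\<^sub>l\<close> counts the boxes of hook length \<open>l\<close>. The
  generating function \<open>T\<^sub>z\<close> of the contents of the addable corners minus that of the removable corners satisfies
  \<open>T\<^sub>z T\<^sub>1\<^sub>/\<^sub>z = 1 + (z + 1/z - 2) (\<Sum>l. N\<^sub>l (z\<^sup>l + z\<^sup>-\<^sup>l))\<close>. Its second moment under the Plancherel measure is computed from the
  commutation relations of the up and down operators on Young's lattice. With \<open>z = exp (2 i \<theta>)\<close> this gives the Fourier series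
  of the mean hook counts as an explicit polynomial in \<open>sin\<^sup>2 \<theta>\<close>, which is an integral of Laguerre polynomials \<open>L\<^sub>n (x\<^sup>2)\<close>.

  A decreasing energy of the Laguerre equation yields \<open>|L\<^sub>n (y)| \<le> sqrt (2 + y) exp (y / 2)\<close> and \<open>L\<^sub>n (y) \<rightarrow> 0\<close> for \<open>y > 0\<close>, so
  dominated convergence reduces all integrals over bounded intervals to exact Gaussian moments, up to \<open>o(1)\<close>.

  Up to constants and a multiple of \<open>1 / (4 l\<^sup>2 - 1)\<close>, \<open>ln l\<close> is \<open>O\<^sub>l = \<Sum>j<l. 2 / (2 j + 1)\<close> plus a remainder \<open>\<rho>\<^sub>l = O(l\<^sup>-\<^sup>3)\<close>. The
  sums of the mean hook counts against \<open>O\<^sub>l\<close> and \<open>1 / (4 l\<^sup>2 - 1)\<close> are Laguerre integrals; the sum against \<open>\<rho>\<^sub>l\<close>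
  follows by Tannery's theorem, as the mean hook counts are \<open>c\<^sub>l sqrt n - l / 2 + o(1)\<close> with error \<open>O(l)\<close> uniformly in \<open>n\<close>.
  Abel summation converts the resulting constants into the stated series, and also into series in \<open>ln (1 + 1 / l)\<close> whose
  tails are enclosed by telescoping rational functions.
\<close>

section \<open>Laguerre polynomials on the half-line\<close>

text \<open>The obstacle is that the mean hook counts are known only through a cosine polynomial and
  that their second-order term \<open>- l / 2\<close> grows. A function of \<open>l\<close> may be
  inserted termwise only if its series against \<open>l\<close> converges absolutely, which
  \<open>ln l\<close> is far from satisfying. So \<open>ln l\<close> is reduced by functions with
  exact hook sums. \<open>O_l\<close> is one, being the integral of
  \<open>(1 - cos (2 l x)) / sin x\<close> over \<open>[0, pi / 2]\<close>; it exceeds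
  \<open>ln l + gamma + 2 ln 2\<close> by about \<open>1 / (24 l^2)\<close>, and this dictates the
  factor \<open>1 / 6\<close> of \<open>1 / (4 l^2 - 1)\<close>, which is itself minus the integral
  of \<open>sin x cos (2 l x)\<close>. The integrals end at \<open>4\<close> because
  \<open>4 sin^2\<close> combines with central binomial coefficients of growth \<open>4^j\<close> to
  powers of \<open>(4 sin x)^2\<close>. The error \<open>O(l)\<close> holds uniformly because
  coefficients are extracted with \<open>sin^2 (l x)\<close>: its quotient by \<open>sin^2 x\<close>
  is a nonnegative Fejer kernel of mass proportional to \<open>l\<close>, which absorbs the
  singularity at \<open>x = 0\<close>. Of the coefficient \<open>13 / 24\<close> of
  \<open>ln n\<close>, Stirling's formula gives \<open>1 / 2\<close> and the integral of
  \<open>(1 - L_n (x^2)) / x\<close> gives \<open>1 / 24\<close>.\<close>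

definition lag_poly :: "nat \<Rightarrow> real poly" where
  "lag_poly n = (\<Sum>k\<le>n. monom (real (n choose k) * (-1) ^ k / fact k) k)"

lemma coeff_lag_poly: "coeff (lag_poly n) k = real (n choose k) * (-1) ^ k / fact k"
proof -
  have "coeff (lag_poly n) k = (\<Sum>j\<le>n. if j = k then real (n choose j) * (-1) ^ j / fact j else 0)"
    by (simp add: lag_poly_def coeff_sum)
  then show ?thesis by (simp add: binomial_eq_0)
qed

definition lag :: "nat \<Rightarrow> real \<Rightarrow> real" where
  "lag n y = (\<Sum>k\<le>n. real (n choose k) * (-1) ^ k / fact k * y ^ k)"

lemma lag_eq_poly: "lag n y = poly (lag_poly n) y"
  by (simp add: lag_def lag_poly_def poly_sum poly_monom)

lemma lag_0 [simp]: "lag n 0 = 1"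
proof -
  have "lag n 0 = (\<Sum>k\<in>{0}. real (n choose k) * (-1) ^ k / fact k * 0 ^ k)"
    unfolding lag_def by (rule sum.mono_neutral_right) auto
  then show ?thesis by simp
qed

lemma continuous_on_lag [continuous_intros]: 
  "continuous_on A f \<Longrightarrow> continuous_on A (\<lambda>x. lag n (f x))"
  unfolding lag_def by (intro continuous_intros) auto

lemma borel_measurable_lag [measurable]: "lag n \<in> borel_measurable borel"
  by (rule borel_measurable_continuous_onI) (intro continuous_intros)

text \<open>Comparison of coefficients: \<open>y p'' + (1 - y) p' + n p = 0\<close> amounts to
  \<open>(k + 1)^2 c_(k+1) = (k - n) c_k\<close>, which follows from absorption of binomial
  coefficients.\<close>

lemma laguerre_ode:
  "y * poly (pderiv (pderiv (lag_poly n))) y = (y - 1) * poly (pderiv (lag_poly n)) y - real n * poly (lag_poly n) y"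
proof -
  have "pCons 0 (pderiv (pderiv (lag_poly n))) + pderiv (lag_poly n) + smult (real n) (lag_poly n) = pCons 0 (pderiv (lag_poly n))"
  proof (rule poly_eqI)
    fix k
    have "real (Suc k) * real (Suc k) * coeff (lag_poly n) (Suc k) = (real k - real n) * coeff (lag_poly n) k"
    proof -
      have e: "real (Suc k) * real (n choose Suc k) = (real n - real k) * real (n choose k)"
      proof (cases "k \<le> n")
        case True
        have "Suc k * (n choose Suc k) = (n - k) * (n choose k)"
          by (simp only: binomial_absorb_comp binomial_absorption)
        then have "real (Suc k) * real (n choose Suc k) = real (n - k) * real (n choose k)"
          by (metis of_nat_mult)
        then show ?thesis using True by (simp add: of_nat_diff)
      qed (simp add: binomial_eq_0)
      have "real (Suc k) * real (Suc k) * coeff (lag_poly n) (Suc k) = (real (Suc k) * real (n choose Suc k)) * (-1) ^ Suc k / fact k"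
        unfolding coeff_lag_poly fact_Suc by (simp del: of_nat_Suc)
      then show ?thesis unfolding e coeff_lag_poly by (simp add: algebra_simps diff_divide_distrib)
    qed
    then show "coeff (pCons 0 (pderiv (pderiv (lag_poly n))) + pderiv (lag_poly n) + smult (real n) (lag_poly n)) k = 
       coeff (pCons 0 (pderiv (lag_poly n))) k"
      by (cases k) (simp_all add: coeff_pderiv algebra_simps)
  qed
  then have "poly (pCons 0 (pderiv (pderiv (lag_poly n))) + pderiv (lag_poly n) + smult (real n) (lag_poly n)) y = 
     poly (pCons 0 (pderiv (lag_poly n))) y" by simp
  then show ?thesis by (simp add: algebra_simps)
qed

section \<open>Energy estimates for Laguerre's equation\<close>

locale laguerre_energy =
  fixes n :: nat
begin

abbreviation "p \<equiv> poly (lag_poly n)"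
abbreviation "d \<equiv> poly (pderiv (lag_poly n))"
abbreviation "dd \<equiv> poly (pderiv (pderiv (lag_poly n)))"
text \<open>For \<open>u = exp (- y / 2) p\<close> Laguerre's equation reads
  \<open>(y u')' + (N - y / 4) u = 0\<close> with this \<open>N\<close>, and
  \<open>exp (- y / 2) v\<close> is \<open>u'\<close>. Thus \<open>en\<close> is
  \<open>(N - y / 4) u^2 + y u'^2\<close>, the energy of this self-adjoint form.\<close>

definition N :: real where "N = real n + 1 / 2"
definition v :: "real \<Rightarrow> real" where "v y = d y - p y / 2"
definition en :: "real \<Rightarrow> real" where "en y = exp (- y) * ((N - y / 4) * p y ^ 2 + y * v y ^ 2)"

lemma N_pos: "N > 0" by (simp add: N_def)

text \<open>With \<open>u = exp (- y / 2) p\<close>, the equation turns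
  \<open>2 u' (y u'' + (N - y / 4) u)\<close> into \<open>- 2 u'^2\<close>, which outweighs the
  \<open>u'^2\<close> from differentiating the factor \<open>y\<close>. Only negative squares
  remain.\<close>

lemma en_deriv: "(en has_real_derivative (- exp (- y) * (p y ^ 2 / 4 + v y ^ 2))) (at y)"
proof -
  have D: "(en has_real_derivative (exp (- y) * (- 1) * ((N - y / 4) * p y ^ 2 + y * v y ^ 2) + 
     exp (- y) * ((- 1 / 4) * p y ^ 2 + (N - y / 4) * (2 * p y * d y) + v y ^ 2 + y * (2 * v y * (dd y - d y / 2))))) (at y)"
    unfolding en_def v_def
    by (auto intro!: derivative_eq_intros simp: power2_eq_square algebra_simps)
  have key: "(- 1) * ((N - y / 4) * p y ^ 2 + y * v y ^ 2) + ((- 1 / 4) * p y ^ 2 + (N - y / 4) * (2 * p y * d y) + v y ^ 2 + y * (2 * v y * (dd y - d y / 2)))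
    = - (p y ^ 2 / 4 + v y ^ 2)"
  proof -
    have "y * (2 * v y * (dd y - d y / 2)) = 2 * v y * (y * dd y) - y * v y * d y" by (simp add: algebra_simps)
    also have "\<dots> = 2 * v y * ((y - 1) * d y - real n * p y) - y * v y * d y" by (simp only: laguerre_ode)
    finally show ?thesis by (simp only:) (simp add: v_def N_def power2_eq_square field_simps)
  qed
  have "exp (- y) * (- 1) * ((N - y / 4) * p y ^ 2 + y * v y ^ 2) + 
     exp (- y) * ((- 1 / 4) * p y ^ 2 + (N - y / 4) * (2 * p y * d y) + v y ^ 2 + y * (2 * v y * (dd y - d y / 2))) = 
     exp (- y) * ((- 1) * ((N - y / 4) * p y ^ 2 + y * v y ^ 2) + ((- 1 / 4) * p y ^ 2 + (N - y / 4) * (2 * p y * d y) + v y ^ 2 + y * (2 * v y * (dd y - d y / 2))))"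
    by (simp only: distrib_left mult.assoc)
  also have "\<dots> = - exp (- y) * (p y ^ 2 / 4 + v y ^ 2)" unfolding key by (simp add: algebra_simps)
  finally show ?thesis using D by (simp only:)
qed

lemma en_antimono: "a \<le> b \<Longrightarrow> en b \<le> en a"
proof (rule DERIV_nonpos_imp_nonincreasing[of a b en])
  fix y
  have "- exp (- y) * (p y ^ 2 / 4 + v y ^ 2) \<le> 0" by (simp add: add_nonneg_nonneg)
  then show "\<exists>z. (en has_real_derivative z) (at y) \<and> z \<le> 0" using en_deriv[of y] by blast
qed

lemma en_0: "en 0 = N"
  using lag_0[of n] by (simp add: en_def lag_eq_poly)

lemma en_le_N: "0 \<le> y \<Longrightarrow> en y \<le> N"
  using en_antimono[of 0 y] en_0 by simp

lemma exp_poly_tendsto_0: "((\<lambda>y::real. exp (- y) * poly q y) \<longlongrightarrow> 0) at_top"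
proof -
  have "((\<lambda>y::real. \<Sum>i\<le>degree q. coeff q i * (y ^ i / exp y)) \<longlongrightarrow> (\<Sum>i\<le>degree q. coeff q i * 0)) at_top"
    by (intro tendsto_intros tendsto_power_div_exp_0)
  also have "(\<lambda>y. \<Sum>i\<le>degree q. coeff q i * (y ^ i / exp y)) = (\<lambda>y. exp (- y) * poly q y)"
    by (rule ext) (simp add: poly_altdef sum_distrib_left exp_minus field_simps)
  finally show ?thesis by simp
qed

text \<open>Beyond \<open>y = 4 N\<close> the first coefficient in \<open>en\<close> is negative, so
  positivity of its parts no longer controls \<open>p\<close>. But
  \<open>exp (- y) p^2 - 2 en\<close> has the nonnegative derivative \<open>2 exp (- y) p'^2\<close>
  and tends to \<open>0\<close> at infinity, hence is never positive.\<close>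

lemma p_sq_le_en: "exp (- y) * p y ^ 2 \<le> 2 * en y"
proof -
  let ?G = "\<lambda>y. exp (- y) * p y ^ 2 - 2 * en y"
  have G': "(?G has_real_derivative 2 * exp (- y) * d y ^ 2) (at y)" for y
  proof -
    have "(?G has_real_derivative (exp (- y) * (- 1) * p y ^ 2 + exp (- y) * (2 * p y * d y) - 2 * (- exp (- y) * (p y ^ 2 / 4 + v y ^ 2)))) (at y)"
      by (auto intro!: derivative_eq_intros en_deriv simp: algebra_simps power2_eq_square)
    moreover have "exp (- y) * (- 1) * p y ^ 2 + exp (- y) * (2 * p y * d y) - 2 * (- exp (- y) * (p y ^ 2 / 4 + v y ^ 2)) = 2 * exp (- y) * d y ^ 2"
      by (simp add: v_def power2_eq_square field_simps)
    ultimately show ?thesis by simp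
  qed
  have mono: "?G a \<le> ?G b" if "a \<le> b" for a b
    by (rule DERIV_nonneg_imp_nondecreasing[OF that]) (use G' in \<open>force\<close>)
  \<comment> \<open>\<open>?G\<close> is \<open>exp (- y)\<close> times this polynomial, which is
    why it tends to \<open>0\<close>.\<close>
  let ?q = "lag_poly n ^ 2 - 2 * ((([:N, - 1/4:] * lag_poly n ^ 2) + [:0,1:] * (pderiv (lag_poly n) - smult (1/2) (lag_poly n)) ^ 2))"
  have "?G = (\<lambda>y. exp (- y) * poly ?q y)"
    by (rule ext) (simp add: en_def v_def algebra_simps)
  then have "(?G \<longlongrightarrow> 0) at_top" using exp_poly_tendsto_0[of ?q] by simp
  moreover have "eventually (\<lambda>b. ?G y \<le> ?G b) at_top"
    using eventually_ge_at_top[of y] by eventually_elim (rule mono)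
  ultimately have "?G y \<le> 0" by (rule tendsto_lowerbound) simp
  then show ?thesis by simp
qed

lemma p_sq_le: "0 \<le> y \<Longrightarrow> exp (- y) * p y ^ 2 \<le> 2 * N"
  using p_sq_le_en[of y] en_le_N[of y] by simp

text \<open>For \<open>y <= 2 N\<close> the coefficient \<open>N - y / 4\<close> is at least
  \<open>N / 2\<close>, so each of the two squares in \<open>en\<close> is controlled by
  itself.\<close>

lemma en_parts:
  assumes "0 \<le> y" "y \<le> 2 * N"
  shows "exp (- y) * p y ^ 2 \<le> 2 * en y / N" "y * (exp (- y) * v y ^ 2) \<le> en y"
proof -
  have e: "en y = (N - y / 4) * (exp (- y) * p y ^ 2) + y * (exp (- y) * v y ^ 2)"
    by (simp add: en_def algebra_simps)
  have "(N / 2) * (exp (- y) * p y ^ 2) \<le> (N - y / 4) * (exp (- y) * p y ^ 2)"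
    using assms by (intro mult_right_mono) auto
  moreover have "0 \<le> y * (exp (- y) * v y ^ 2)" using assms by simp
  ultimately have "(N / 2) * (exp (- y) * p y ^ 2) \<le> en y" using e by linarith
  moreover have "exp (- y) * p y ^ 2 * N = 2 * ((N / 2) * (exp (- y) * p y ^ 2))" by simp
  ultimately have "exp (- y) * p y ^ 2 * N \<le> 2 * en y" by linarith
  then show "exp (- y) * p y ^ 2 \<le> 2 * en y / N" by (simp only: pos_le_divide_eq[OF N_pos])
  have "0 \<le> (N - y / 4) * (exp (- y) * p y ^ 2)" using assms N_pos by (intro mult_nonneg_nonneg) auto
  then show "y * (exp (- y) * v y ^ 2) \<le> en y" using e by linarith
qed

text \<open>Up to \<open>2 N\<close> the energy gives \<open>exp (- y) p^2 <= 2\<close>; beyond,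
  \<open>p_sq_le\<close> gives \<open>2 N\<close>, which is less than \<open>y\<close>. The factor
  \<open>2 + y\<close> covers both cases and is free of \<open>n\<close>.\<close>

lemma p_bound:
  assumes "0 \<le> y" shows "\<bar>p y\<bar> \<le> sqrt (2 + y) * exp (y / 2)"
proof -
  have "exp (- y) * p y ^ 2 \<le> 2 + y"
  proof (cases "y \<le> 2 * N")
    case True
    have "2 * en y / N \<le> 2" using en_le_N[OF assms] N_pos by (simp add: field_simps)
    then show ?thesis using en_parts(1)[OF assms True] assms by simp
  qed (use p_sq_le[OF assms] in simp)
  then have "p y ^ 2 \<le> (2 + y) * exp y"
    by (simp add: exp_minus field_simps)
  also have "\<dots> = (sqrt (2 + y) * exp (y / 2)) ^ 2"
    using assms by (simp add: power_mult_distrib exp_double[symmetric])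
  finally have "\<bar>p y\<bar> \<le> \<bar>sqrt (2 + y) * exp (y / 2)\<bar>"
    by (simp add: abs_le_square_iff)
  then show ?thesis using assms by simp
qed

text \<open>The quantity \<open>x * en (x\<^sup>2)\<close> plus lower-order corrections is nonincreasing; it measures the
  squared amplitude of the oscillation and yields the decay \<open>n powr (- 1 / 4)\<close>.\<close>

definition amp :: "real \<Rightarrow> real" where
  "amp x = x * en (x\<^sup>2) + exp (- x\<^sup>2) * (x / 2 * p (x\<^sup>2) * v (x\<^sup>2) + p (x\<^sup>2) ^ 2 / (8 * x))"

text \<open>Put \<open>phi x = sqrt x * exp (- x^2 / 2) * p (x^2)\<close>. Laguerre's equation takes
  Liouville's normal form \<open>phi'' + q phi = 0\<close> with
  \<open>q = 4 N - x^2 + 1 / (4 x^2)\<close>, and \<open>4 * amp\<close> is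
  \<open>phi'^2 + q phi^2\<close>. Its derivative is \<open>q' phi^2\<close>, where
  \<open>q'\<close> is negative.\<close>

lemma amp_deriv:
  assumes "x > 0"
  shows "(amp has_real_derivative (- exp (- x\<^sup>2) * (x\<^sup>2 * p (x\<^sup>2) ^ 2 / 2 + p (x\<^sup>2) ^ 2 / (8 * x\<^sup>2)))) (at x)"
proof -
  have en': "((\<lambda>x. en (x\<^sup>2)) has_real_derivative (- exp (- x\<^sup>2) * (p (x\<^sup>2) ^ 2 / 4 + v (x\<^sup>2) ^ 2) * (2 * x))) (at x)"
    by (rule DERIV_chain2[OF en_deriv]) (auto intro!: derivative_eq_intros)
  have p': "((\<lambda>x. p (x\<^sup>2)) has_real_derivative (d (x\<^sup>2) * (2 * x))) (at x)"
    by (rule DERIV_chain2[OF poly_DERIV]) (auto intro!: derivative_eq_intros)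
  have d': "((\<lambda>x. d (x\<^sup>2)) has_real_derivative (dd (x\<^sup>2) * (2 * x))) (at x)"
    by (rule DERIV_chain2[OF poly_DERIV]) (auto intro!: derivative_eq_intros)
  have v': "((\<lambda>x. v (x\<^sup>2)) has_real_derivative (dd (x\<^sup>2) * (2 * x) - d (x\<^sup>2) * (2 * x) / 2)) (at x)"
    unfolding v_def by (intro derivative_intros p' d' DERIV_cdivide)
  define P D V E2 where "P = p (x\<^sup>2)" and "D = d (x\<^sup>2)" and "V = v (x\<^sup>2)" and "E2 = exp (- x\<^sup>2)"
  have VD: "V = D - P / 2" by (simp add: V_def D_def P_def v_def)
  have h1: "((\<lambda>x. x * en (x\<^sup>2)) has_real_derivative (1 * en (x\<^sup>2) + (- E2 * (P ^ 2 / 4 + V ^ 2) * (2 * x)) * x)) (at x)"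
    unfolding P_def V_def E2_def by (rule DERIV_mult[OF DERIV_ident en'])
  have h2: "((\<lambda>x. exp (- x\<^sup>2)) has_real_derivative (E2 * (- (2 * x)))) (at x)"
    unfolding E2_def by (auto intro!: derivative_eq_intros)
  have h3: "((\<lambda>x. x / 2) has_real_derivative (1 / 2)) (at x)" by (auto intro!: derivative_eq_intros)
  have h4: "((\<lambda>x. 8 * x) has_real_derivative 8) (at x)" by (auto intro!: derivative_eq_intros)
  note h5 = DERIV_mult[OF DERIV_mult[OF h3 p'] v']
  have x8: "8 * x \<noteq> 0" using assms by simp
  note h6 = DERIV_divide[OF DERIV_mult[OF p' p'] h4 x8]
  note h7 = DERIV_add[OF h1 DERIV_mult[OF h2 DERIV_add[OF h5 h6]]]
  have ampe: "amp = (\<lambda>x. x * en (x\<^sup>2) + exp (- x\<^sup>2) * (x / 2 * p (x\<^sup>2) * v (x\<^sup>2) + p (x\<^sup>2) * p (x\<^sup>2) / (8 * x)))"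
    by (rule ext) (simp only: amp_def power2_eq_square[of "p _"])
  have f1: "(amp has_real_derivative (en (x\<^sup>2) + x * (- E2 * (P ^ 2 / 4 + V ^ 2) * (2 * x)) + 
     (E2 * (- (2 * x)) * (x / 2 * P * V + P ^ 2 / (8 * x)) + E2 * (1 / 2 * P * V + x / 2 * (D * (2 * x)) * V + x / 2 * P * (dd (x\<^sup>2) * (2 * x) - D * (2 * x) / 2)
       + ((2 * P * (D * (2 * x))) * (8 * x) - P ^ 2 * 8) / (8 * x) ^ 2)))) (at x)"
    unfolding ampe
    by (rule DERIV_cong[OF h7]) (simp only: P_def[symmetric] V_def[symmetric] D_def[symmetric] E2_def[symmetric], simp add: power2_eq_square algebra_simps)
  have f2: "en (x\<^sup>2) = E2 * ((N - x\<^sup>2 / 4) * P ^ 2 + x\<^sup>2 * V ^ 2)"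
    by (simp add: en_def P_def V_def E2_def)
  have f3: "x / 2 * P * (dd (x\<^sup>2) * (2 * x) - D * (2 * x) / 2) = P * ((x\<^sup>2 - 1) * D - real n * P) - x\<^sup>2 * P * D / 2"
  proof -
    have "x / 2 * P * (dd (x\<^sup>2) * (2 * x) - D * (2 * x) / 2) = P * (x\<^sup>2 * dd (x\<^sup>2)) - x\<^sup>2 * P * D / 2"
      by (simp add: power2_eq_square algebra_simps)
    then show ?thesis by (simp only: laguerre_ode P_def D_def)
  qed
  have f4: "E2 * ((N - x\<^sup>2 / 4) * P ^ 2 + x\<^sup>2 * V ^ 2) + x * (- E2 * (P ^ 2 / 4 + V ^ 2) * (2 * x)) + 
     (E2 * (- (2 * x)) * (x / 2 * P * V + P ^ 2 / (8 * x)) + E2 * (1 / 2 * P * V + x / 2 * (D * (2 * x)) * V + (P * ((x\<^sup>2 - 1) * D - real n * P) - x\<^sup>2 * P * D / 2)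
       + ((2 * P * (D * (2 * x))) * (8 * x) - P ^ 2 * 8) / (8 * x) ^ 2)) = - E2 * (x\<^sup>2 * P ^ 2 / 2 + P ^ 2 / (8 * x\<^sup>2))"
    using assms unfolding VD N_def by (simp add: power2_eq_square divide_simps) (simp add: algebra_simps)
  from f1[unfolded f2 f3 f4] show ?thesis unfolding P_def E2_def .
qed

lemma amp_antimono: "0 < a \<Longrightarrow> a \<le> b \<Longrightarrow> amp b \<le> amp a"
proof (rule DERIV_nonpos_imp_nonincreasing[of a b amp])
  fix x assume "0 < a" "a \<le> x" "x \<le> b"
  then have "x > 0" by simp
  show "\<exists>y. (amp has_real_derivative y) (at x) \<and> y \<le> 0"
  proof -
    have "- exp (- x\<^sup>2) * (x\<^sup>2 * p (x\<^sup>2) ^ 2 / 2 + p (x\<^sup>2) ^ 2 / (8 * x\<^sup>2)) \<le> 0"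
      using \<open>x > 0\<close> by (simp add: add_nonneg_nonneg)
    then show ?thesis using amp_deriv[OF \<open>x > 0\<close>] by blast
  qed
qed auto

text \<open>\<open>amp\<close> is carried from the edge \<open>1 / sqrt N\<close> of the oscillatory
  region to \<open>x\<close>. It is of order \<open>sqrt N\<close> at the start, so
  \<open>en\<close> is of order \<open>sqrt N / x\<close> at \<open>x\<close>, and dividing by
  \<open>N\<close> bounds the square.\<close>

lemma p_decay:
  assumes x: "1 \<le> x * sqrt N" "x\<^sup>2 \<le> 2 * N" "0 < x"
  shows "exp (- x\<^sup>2) * p (x\<^sup>2) ^ 2 \<le> 6 / (x * sqrt N)"
proof -
  define u w where "u x = exp (- x\<^sup>2 / 2) * p (x\<^sup>2)" and "w x = x * (exp (- x\<^sup>2 / 2) * v (x\<^sup>2))" for x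
  have ee: "exp (- x\<^sup>2 / 2) ^ 2 = exp (- x\<^sup>2)" for x :: real by (simp add: exp_double[symmetric])
  have u2: "u x ^ 2 = exp (- x\<^sup>2) * p (x\<^sup>2) ^ 2" for x by (simp only: u_def power_mult_distrib ee)
  have w2: "w x ^ 2 = x\<^sup>2 * (exp (- x\<^sup>2) * v (x\<^sup>2) ^ 2)" for x by (simp only: w_def power_mult_distrib ee)
  have ampe: "amp x = x * en (x\<^sup>2) + (u x * w x / 2 + u x ^ 2 / (8 * x))" for x
  proof -
    have "u x * w x = x * (exp (- x\<^sup>2) * (p (x\<^sup>2) * v (x\<^sup>2)))"
      unfolding u_def w_def ee[of x, symmetric] power2_eq_square[of "exp _"] by (simp only: mult_ac)
    then show ?thesis by (simp add: amp_def u2 algebra_simps)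
  qed
  have Np: "sqrt N > 0" using N_pos by simp
  have uw: "\<bar>u x * w x\<bar> \<le> 3 / 2 * sqrt N" if "0 \<le> x" "x\<^sup>2 \<le> 2 * N" for x
  proof -
    have e: "en (x\<^sup>2) \<le> N" by (rule en_le_N) simp
    have "2 * en (x\<^sup>2) / N \<le> 2" using e N_pos by (simp add: field_simps)
    then have "u x ^ 2 \<le> 2" using en_parts(1)[of "x\<^sup>2"] that unfolding u2 by simp
    moreover have "w x ^ 2 \<le> N" using en_parts(2)[of "x\<^sup>2"] that e unfolding w2 by simp
    ultimately have "(u x * w x) ^ 2 \<le> 2 * N" unfolding power_mult_distrib by (intro mult_mono) auto
    also have "\<dots> \<le> (3 / 2 * sqrt N) ^ 2" using N_pos by (simp add: power_mult_distrib power_divide)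
    finally show ?thesis using Np by (metis abs_le_square_iff abs_of_pos mult_pos_pos zero_less_divide_iff zero_less_numeral)
  qed
  \<comment> \<open>The scale on which the oscillation begins. Here the three parts of
    \<open>amp\<close> contribute at most \<open>1\<close>, \<open>3 / 4\<close> and
    \<open>1 / 4\<close> times \<open>sqrt N\<close>.\<close>
  define x0 where "x0 = 1 / sqrt N"
  have x0: "x0 > 0" "x0 \<le> x" "x0\<^sup>2 \<le> 2 * N"
  proof -
    show "x0 > 0" using Np by (simp add: x0_def)
    show "x0 \<le> x" using x Np by (simp add: x0_def field_simps)
    then have "x0\<^sup>2 \<le> x\<^sup>2" using \<open>x0 > 0\<close> by (intro power_mono) auto
    then show "x0\<^sup>2 \<le> 2 * N" using x by simp
  qed
  have "amp x \<le> amp x0" by (rule amp_antimono[OF x0(1,2)])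
  also have "\<dots> \<le> 2 * sqrt N"
  proof -
    have "x0 * en (x0\<^sup>2) \<le> x0 * N" using en_le_N[of "x0\<^sup>2"] x0 by (intro mult_left_mono) auto
    also have "\<dots> = sqrt N" using N_pos by (simp add: x0_def real_div_sqrt)
    finally have "x0 * en (x0\<^sup>2) \<le> sqrt N" .
    moreover have "u x0 * w x0 / 2 \<le> 3 / 4 * sqrt N" using uw[of x0] x0 by (auto simp: abs_le_iff)
    moreover have "u x0 ^ 2 / (8 * x0) \<le> 1 / 4 * sqrt N"
    proof -
      have "u x0 ^ 2 \<le> 2 * en (x0\<^sup>2) / N" using en_parts(1)[of "x0\<^sup>2"] x0 unfolding u2 by simp
      also have "\<dots> \<le> 2" using en_le_N[of "x0\<^sup>2"] N_pos by (simp add: field_simps)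
      finally have "u x0 ^ 2 * sqrt N \<le> 2 * sqrt N" using Np by (intro mult_right_mono) auto
      then show ?thesis by (simp add: x0_def mult.commute)
    qed
    ultimately show ?thesis unfolding ampe by simp
  qed
  finally have "x * en (x\<^sup>2) + (u x * w x / 2 + u x ^ 2 / (8 * x)) \<le> 2 * sqrt N" unfolding ampe .
  moreover have "u x ^ 2 / (8 * x) \<ge> 0" using x by simp
  moreover have "u x * w x / 2 \<ge> - (3 / 4 * sqrt N)" using uw[of x] x by (auto simp: abs_le_iff)
  ultimately have en: "x * en (x\<^sup>2) \<le> 3 * sqrt N" using Np by linarith
  have "x * u x ^ 2 \<le> x * (2 * en (x\<^sup>2) / N)"
    using en_parts(1)[of "x\<^sup>2"] x unfolding u2 by (intro mult_left_mono) auto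
  also have "\<dots> = 2 / N * (x * en (x\<^sup>2))" by simp
  also have "\<dots> \<le> 2 / N * (3 * sqrt N)" using en N_pos by (intro mult_left_mono) auto
  also have "\<dots> = 6 / sqrt N" using N_pos by (simp add: field_simps)
  finally show ?thesis using x Np unfolding u2 by (simp add: field_simps)
qed

end

lemma lag_bound: "0 \<le> y \<Longrightarrow> \<bar>lag n y\<bar> \<le> sqrt (2 + y) * exp (y / 2)"
  unfolding lag_eq_poly by (rule laguerre_energy.p_bound)

lemma lag_tendsto_0:
  assumes "x \<noteq> 0" shows "(\<lambda>n. lag n (x\<^sup>2)) \<longlonglongrightarrow> 0"
proof -
  define a where "a = \<bar>x\<bar>"
  have a: "a > 0" "x\<^sup>2 = a\<^sup>2" using assms by (auto simp: a_def)
  have "(\<lambda>n. lag n (a\<^sup>2) ^ 2) \<longlonglongrightarrow> 0"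
  proof (rule tendsto_sandwich)
    show "eventually (\<lambda>n. 0 \<le> lag n (a\<^sup>2) ^ 2) sequentially" by simp
    have "filterlim (\<lambda>n. a * sqrt (real n + 1 / 2)) at_top sequentially" using a(1) by real_asymp
    then have "eventually (\<lambda>n. 1 \<le> a * sqrt (real n + 1 / 2)) sequentially" by (simp add: filterlim_at_top)
    moreover have "filterlim (\<lambda>n. 2 * (real n + 1 / 2)) at_top sequentially" by real_asymp
    then have "eventually (\<lambda>n. a\<^sup>2 \<le> 2 * (real n + 1 / 2)) sequentially" by (simp add: filterlim_at_top)
    ultimately show "eventually (\<lambda>n. lag n (a\<^sup>2) ^ 2 \<le> exp (a\<^sup>2) * (6 / (a * sqrt (real n + 1 / 2)))) sequentially"
    proof eventually_elim
      case (elim n)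
      have "exp (- a\<^sup>2) * lag n (a\<^sup>2) ^ 2 \<le> 6 / (a * sqrt (real n + 1 / 2))"
        using laguerre_energy.p_decay[of a n] elim a by (simp add: laguerre_energy.N_def lag_eq_poly)
      then have "exp (a\<^sup>2) * (exp (- a\<^sup>2) * lag n (a\<^sup>2) ^ 2) \<le> exp (a\<^sup>2) * (6 / (a * sqrt (real n + 1 / 2)))"
        by (intro mult_left_mono) auto
      then show ?case by (simp add: mult.assoc[symmetric] exp_add[symmetric])
    qed
    show "(\<lambda>n. exp (a\<^sup>2) * (6 / (a * sqrt (real n + 1 / 2)))) \<longlonglongrightarrow> 0"
    proof -
      have "(\<lambda>n. 6 / (a * sqrt (real n + 1 / 2))) \<longlonglongrightarrow> 0" using a(1) by real_asymp
      from tendsto_mult_right_zero[OF this] show ?thesis .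
    qed
  qed simp
  then have "(\<lambda>n. sqrt (lag n (a\<^sup>2) ^ 2)) \<longlonglongrightarrow> sqrt 0" by (rule tendsto_real_sqrt)
  then show ?thesis unfolding a(2) by (simp add: tendsto_rabs_zero_iff)
qed

lemma lag_dominated:
  fixes f :: "real \<Rightarrow> real"
  assumes f: "integrable lborel (\<lambda>x. f x * (sqrt (2 + x\<^sup>2) * exp (x\<^sup>2 / 2)))"
    and [measurable]: "f \<in> borel_measurable borel"
  shows "integrable lborel (\<lambda>x. f x * lag n (x\<^sup>2))" "(\<lambda>n. \<integral>x. f x * lag n (x\<^sup>2) \<partial>lborel) \<longlonglongrightarrow> 0"
proof -
  have b: "norm (f x * lag n (x\<^sup>2)) \<le> norm (f x * (sqrt (2 + x\<^sup>2) * exp (x\<^sup>2 / 2)))" for n x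
    unfolding norm_mult using lag_bound[of "x\<^sup>2" n] by (intro mult_left_mono) (auto intro: order_trans)
  have m: "(\<lambda>x. f x * lag n (x\<^sup>2)) \<in> borel_measurable lborel" for n by measurable
  show "integrable lborel (\<lambda>x. f x * lag n (x\<^sup>2))"
    by (rule Bochner_Integration.integrable_bound[OF f]) (use b m in auto)
  have "(\<lambda>n. \<integral>x. f x * lag n (x\<^sup>2) \<partial>lborel) \<longlonglongrightarrow> (\<integral>x. 0 \<partial>(lborel :: real measure))"
  proof (rule integral_dominated_convergence)
    show "integrable lborel (\<lambda>x. norm (f x * (sqrt (2 + x\<^sup>2) * exp (x\<^sup>2 / 2))))" using f by (rule integrable_norm)
    \<comment> \<open>The origin is left out because \<open>lag n 0 = 1\<close> for every
      \<open>n\<close>.\<close>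
    show "AE x in lborel. (\<lambda>n. f x * lag n (x\<^sup>2)) \<longlonglongrightarrow> 0"
      using AE_lborel_singleton[of 0] by eventually_elim (intro tendsto_mult_right_zero lag_tendsto_0)
  qed (use b m in auto)
  then show "(\<lambda>n. \<integral>x. f x * lag n (x\<^sup>2) \<partial>lborel) \<longlonglongrightarrow> 0" by simp
qed

section \<open>Exact Gaussian moments\<close>

lemma gauss_even: "has_bochner_integral lborel (\<lambda>x::real. exp (- x\<^sup>2) * x ^ (2 * k) * indicator {0..} x) (sqrt pi / 2 * (fact (2 * k) / (4 ^ k * fact k)))"
proof -
  have "(4::real) ^ k = 2 ^ (2 * k)" by (simp add: power_mult)
  then show ?thesis using gaussian_moment_even_pos[of k] by (simp add: mult_ac)
qed

lemma gauss_odd: "has_bochner_integral lborel (\<lambda>x::real. exp (- x\<^sup>2) * x ^ (2 * k + 1) * indicator {0..} x) (fact k / 2 :: real)"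
  using gaussian_moment_odd_pos[of k] by (simp add: mult_ac)

lemma integrable_gauss_quarter: "integrable lborel (\<lambda>x::real. exp (- x\<^sup>2 / 4))"
proof -
  have "integrable lborel (\<lambda>x. sqrt (4 * pi) * normal_density 0 (sqrt 2) x)"
    by (intro integrable_mult_right integrable_normal_density) auto
  also have "(\<lambda>x. sqrt (4 * pi) * normal_density 0 (sqrt 2) x) = (\<lambda>x. exp (- x\<^sup>2 / 4))"
    by (rule ext) (simp add: normal_density_def)
  finally show ?thesis .
qed

text \<open>The growth \<open>exp (x^2 / 2)\<close> allowed by \<open>lag_bound\<close> uses up half
  of the Gaussian exponent and the square root another quarter; an integrable Gaussian is left
  over.\<close>

lemma gauss_weight_bound: "exp (- x\<^sup>2) * (sqrt (2 + x\<^sup>2) * exp (x\<^sup>2 / 2)) \<le> 4 * exp (- x\<^sup>2 / 4)" for x :: real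
proof -
  have "1 + x\<^sup>2 / 4 \<le> exp (x\<^sup>2 / 4)" using exp_ge_add_one_self[of "x\<^sup>2 / 4"] by simp
  then have "2 + x\<^sup>2 \<le> 4 * exp (x\<^sup>2 / 4)" by linarith
  moreover have "sqrt (2 + x\<^sup>2) \<le> 2 + x\<^sup>2" by (rule real_le_lsqrt) (use self_le_power[of "2 + x\<^sup>2" 2] in auto)
  ultimately have "sqrt (2 + x\<^sup>2) \<le> 4 * exp (x\<^sup>2 / 4)" by simp
  then have "sqrt (2 + x\<^sup>2) * exp (- x\<^sup>2 / 2) \<le> 4 * exp (x\<^sup>2 / 4) * exp (- x\<^sup>2 / 2)"
    by (intro mult_right_mono) auto
  also have "4 * exp (x\<^sup>2 / 4) * exp (- x\<^sup>2 / 2) = 4 * exp (- x\<^sup>2 / 4)"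
    by (simp add: exp_add[symmetric] mult.assoc)
  finally have "sqrt (2 + x\<^sup>2) * exp (- x\<^sup>2 / 2) \<le> 4 * exp (- x\<^sup>2 / 4)" .
  moreover have "exp (- x\<^sup>2 / 2) = exp (- x\<^sup>2) * exp (x\<^sup>2 / 2)"
    unfolding exp_add[symmetric] by (rule arg_cong[of _ _ exp]) (simp add: field_simps)
  ultimately show ?thesis by (simp only: mult.left_commute)
qed

lemma integrable_lag_weight:
  fixes f :: "real \<Rightarrow> real"
  assumes [measurable]: "f \<in> borel_measurable borel" and b: "\<And>x. \<bar>f x\<bar> \<le> K * exp (- x\<^sup>2)"
  shows "integrable lborel (\<lambda>x. f x * (sqrt (2 + x\<^sup>2) * exp (x\<^sup>2 / 2)))" "integrable lborel f"
proof -
  have i: "integrable lborel (\<lambda>x::real. K * (4 * exp (- x\<^sup>2 / 4)))"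
    using integrable_gauss_quarter by simp
  show "integrable lborel (\<lambda>x. f x * (sqrt (2 + x\<^sup>2) * exp (x\<^sup>2 / 2)))"
  proof (rule Bochner_Integration.integrable_bound[OF i])
    show "AE x in lborel. norm (f x * (sqrt (2 + x\<^sup>2) * exp (x\<^sup>2 / 2))) \<le> norm (K * (4 * exp (- x\<^sup>2 / 4)))"
    proof (rule AE_I2)
      fix x :: real
      have K: "K \<ge> 0" using b[of 0] by simp
      have "norm (f x * (sqrt (2 + x\<^sup>2) * exp (x\<^sup>2 / 2))) \<le> (K * exp (- x\<^sup>2)) * (sqrt (2 + x\<^sup>2) * exp (x\<^sup>2 / 2))"
        unfolding norm_mult using b[of x] by (intro mult_mono) auto
      also have "\<dots> \<le> K * (4 * exp (- x\<^sup>2 / 4))"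
        using mult_left_mono[OF gauss_weight_bound[of x] K] by (simp add: mult_ac)
      finally show "norm (f x * (sqrt (2 + x\<^sup>2) * exp (x\<^sup>2 / 2))) \<le> norm (K * (4 * exp (- x\<^sup>2 / 4)))" by simp
    qed
  qed simp
  show "integrable lborel f"
  proof (rule Bochner_Integration.integrable_bound[OF i])
    show "AE x in lborel. norm (f x) \<le> norm (K * (4 * exp (- x\<^sup>2 / 4)))"
    proof (rule AE_I2)
      fix x :: real
      have K: "K \<ge> 0" using b[of 0] by simp
      have "exp (- x\<^sup>2) \<le> 4 * exp (- x\<^sup>2 / 4)"
      proof -
        have "exp (- x\<^sup>2) \<le> exp (- x\<^sup>2 / 4)" by simp
        also have "\<dots> \<le> 4 * exp (- x\<^sup>2 / 4)" by simp
        finally show ?thesis .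
      qed
      then have "K * exp (- x\<^sup>2) \<le> K * (4 * exp (- x\<^sup>2 / 4))" using K by (rule mult_left_mono)
      then show "norm (f x) \<le> norm (K * (4 * exp (- x\<^sup>2 / 4)))" using b[of x] by simp
    qed
  qed simp
qed

lemma lag_integral_tendsto_0:
  fixes f :: "real \<Rightarrow> real"
  assumes [measurable]: "f \<in> borel_measurable borel" and b: "\<And>x. \<bar>f x\<bar> \<le> K * exp (- x\<^sup>2)"
  shows "integrable lborel (\<lambda>x. f x * lag n (x\<^sup>2))" "(\<lambda>n. \<integral>x. f x * lag n (x\<^sup>2) \<partial>lborel) \<longlonglongrightarrow> 0"
  by (rule lag_dominated[OF integrable_lag_weight(1)[OF assms] assms(1)])+

text \<open>The Taylor term of order 0, and in \<open>lag_split2\<close> also that of order 1, is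
  split off because the quotients by powers of \<open>x\<close> integrated below become polynomials
  only after its removal.\<close>

lemma lag_split1: "lag n y = 1 + (\<Sum>j<n. real (n choose Suc j) * (-1) ^ Suc j / fact (Suc j) * y ^ Suc j)"
  unfolding lag_def by (cases n) (simp_all add: sum.atMost_shift del: fact_Suc power_Suc)

lemma lag_split2: "lag n y = 1 - real n * y + (\<Sum>j<n. real (n choose (j + 2)) * (-1) ^ j / fact (j + 2) * y ^ (j + 2))"
proof (cases n)
  case (Suc m)
  have "(\<Sum>j<n. real (n choose Suc j) * (-1) ^ Suc j / fact (Suc j) * y ^ Suc j) = 
    - real n * y + (\<Sum>j<m. real (n choose Suc (Suc j)) * (-1) ^ Suc (Suc j) / fact (Suc (Suc j)) * y ^ Suc (Suc j))"
    unfolding Suc by (subst sum.lessThan_Suc_shift) simp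
  also have "(\<Sum>j<m. real (n choose Suc (Suc j)) * (-1) ^ Suc (Suc j) / fact (Suc (Suc j)) * y ^ Suc (Suc j)) = 
     (\<Sum>j<n. real (n choose (j + 2)) * (-1) ^ j / fact (j + 2) * y ^ (j + 2))"
    unfolding Suc sum.lessThan_Suc by (simp add: binomial_eq_0 del: fact_Suc)
  finally show ?thesis unfolding lag_split1 by simp
qed (simp add: lag_def)

lemma lag_diff: "lag n y - lag (Suc n) y = (\<Sum>j\<le>n. real (n choose j) * (-1) ^ j / fact (Suc j) * y ^ Suc j)"
proof -
  have A: "lag n y = 1 + (\<Sum>j\<le>n. real (n choose Suc j) * (-1) ^ Suc j / fact (Suc j) * y ^ Suc j)"
    unfolding lag_split1 lessThan_Suc_atMost[symmetric] by (simp add: binomial_eq_0)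
  have B: "lag (Suc n) y = 1 + (\<Sum>j\<le>n. real (Suc n choose Suc j) * (-1) ^ Suc j / fact (Suc j) * y ^ Suc j)"
    unfolding lag_split1[of "Suc n"] lessThan_Suc_atMost ..
  have "lag n y - lag (Suc n) y = (\<Sum>j\<le>n. real (n choose Suc j) * (-1) ^ Suc j / fact (Suc j) * y ^ Suc j - real (Suc n choose Suc j) * (-1) ^ Suc j / fact (Suc j) * y ^ Suc j)"
    by (simp only: A B sum_subtractf add_diff_cancel_left)
  also have "\<dots> = (\<Sum>j\<le>n. real (n choose j) * (-1) ^ j / fact (Suc j) * y ^ Suc j)"
    by (intro sum.cong refl) (simp add: algebra_simps add_divide_distrib diff_divide_distrib del: fact_Suc)
  finally show ?thesis .
qed

lemma alt_binom_recip: "(\<Sum>j\<le>n. real (n choose j) * (-1) ^ j / real (Suc j)) = 1 / real (Suc n)"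
proof -
  have "real (Suc n) * (\<Sum>j\<le>n. real (n choose j) * (-1) ^ j / real (Suc j)) = (\<Sum>j\<le>n. real (Suc n choose Suc j) * (-1) ^ j)"
    unfolding sum_distrib_left
  proof (intro sum.cong refl)
    fix j
    have "real (Suc n) * real (n choose j) = real (Suc n choose Suc j) * real (Suc j)"
      using Suc_times_binomial_eq[of n j] by (simp only: of_nat_mult[symmetric])
    then show "real (Suc n) * (real (n choose j) * (-1) ^ j / real (Suc j)) = real (Suc n choose Suc j) * (-1) ^ j"
      by (simp add: field_simps del: of_nat_Suc binomial_Suc_Suc)
  qed
  also have "\<dots> = 1"
  proof -
    have "(\<Sum>i\<le>Suc n. (-1) ^ i * real (Suc n choose i)) = 0" by (rule choose_alternating_sum) simp
    then show ?thesis by (subst (asm) sum.atMost_Suc_shift) (simp add: sum_negf mult.commute del: binomial_Suc_Suc)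
  qed
  finally show ?thesis by (simp add: field_simps del: of_nat_Suc)
qed

lemma alt_binom_harm: "(\<Sum>j<n. real (n choose Suc j) * (-1) ^ j / real (Suc j)) = harm n"
proof (induction n)
  case (Suc n)
  have "(\<Sum>j<Suc n. real (Suc n choose Suc j) * (-1) ^ j / real (Suc j)) = 
     (\<Sum>j<Suc n. real (n choose j) * (-1) ^ j / real (Suc j)) + (\<Sum>j<Suc n. real (n choose Suc j) * (-1) ^ j / real (Suc j))"
    by (simp add: sum.distrib[symmetric] algebra_simps add_divide_distrib del: of_nat_Suc sum.lessThan_Suc)
  also have "(\<Sum>j<Suc n. real (n choose j) * (-1) ^ j / real (Suc j)) = 1 / real (Suc n)"
    using alt_binom_recip[of n] by (simp only: lessThan_Suc_atMost)
  finally show ?case using Suc by (simp add: harm_Suc binomial_eq_0 inverse_eq_divide)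
qed (simp add: harm_def)

text \<open>These coefficients arise when the moment \<open>j! / 2\<close> of an odd power meets the
  factor \<open>1 / (j + 2)!\<close> of the Laguerre polynomial. Pascal's rule gives the induction,
  and \<open>1 / (j + 1) - 1 / (j + 2)\<close> reduces the increment to
  \<open>alt_binom_harm\<close> and \<open>alt_binom_recip\<close>.\<close>

lemma alt_binom_harm2: "(\<Sum>j<n. real (n choose (j + 2)) * (-1) ^ j / (real (j + 1) * real (j + 2))) = (real n + 1) * harm n - 2 * real n"
proof (induction n)
  case (Suc n)
  have "(\<Sum>j<Suc n. real (Suc n choose (j + 2)) * (-1) ^ j / (real (j + 1) * real (j + 2))) = 
     (\<Sum>j<Suc n. real (n choose (j + 2)) * (-1) ^ j / (real (j + 1) * real (j + 2))) + (\<Sum>j<Suc n. real (n choose Suc j) * (-1) ^ j / (real (j + 1) * real (j + 2)))"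
    by (simp add: sum.distrib[symmetric] algebra_simps add_divide_distrib del: sum.lessThan_Suc)
  also have "(\<Sum>j<Suc n. real (n choose (j + 2)) * (-1) ^ j / (real (j + 1) * real (j + 2))) = (real n + 1) * harm n - 2 * real n"
    using Suc by (simp add: binomial_eq_0)
  also have "(\<Sum>j<Suc n. real (n choose Suc j) * (-1) ^ j / (real (j + 1) * real (j + 2))) = 
     (\<Sum>j<Suc n. real (n choose Suc j) * (-1) ^ j / real (Suc j) - real (n choose Suc j) * (-1) ^ j / real (Suc (Suc j)))"
  proof (intro sum.cong refl)
    fix j
    have "1 / (real (j + 1) * real (j + 2)) = 1 / real (Suc j) - 1 / real (Suc (Suc j))" by (simp add: field_simps)
    then have "c * (1 / (real (j + 1) * real (j + 2))) = c * (1 / real (Suc j) - 1 / real (Suc (Suc j)))" for c by (rule arg_cong)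
    from this[of "real (n choose Suc j) * (-1) ^ j"]
    show "real (n choose Suc j) * (-1) ^ j / (real (j + 1) * real (j + 2)) = real (n choose Suc j) * (-1) ^ j / real (Suc j) - real (n choose Suc j) * (-1) ^ j / real (Suc (Suc j))"
      by (simp add: right_diff_distrib)
  qed
  also have "\<dots> = harm n - (1 - 1 / real (Suc n))"
  proof -
    have "(\<Sum>j<Suc n. real (n choose Suc j) * (-1) ^ j / real (Suc j)) = harm n"
      using alt_binom_harm[of n] by (simp add: binomial_eq_0)
    moreover have "(\<Sum>j<Suc n. real (n choose Suc j) * (-1) ^ j / real (Suc (Suc j))) = 1 - 1 / real (Suc n)"
    proof -
      have "(\<Sum>j\<le>Suc n. real (n choose j) * (-1) ^ j / real (Suc j)) = 1 / real (Suc n)"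
        using alt_binom_recip[of n] by (simp add: binomial_eq_0)
      then show ?thesis
        by (subst (asm) sum.atMost_Suc_shift) (simp add: lessThan_Suc_atMost sum_negf algebra_simps del: of_nat_Suc sum.atMost_Suc)
    qed
    ultimately show ?thesis by (simp add: sum_subtractf del: sum.lessThan_Suc)
  qed
  finally show ?case by (simp add: harm_Suc field_simps)
qed (simp add: harm_def)

text \<open>Division by \<open>x\<close> leaves odd powers, whose Gaussian moments
  \<open>j! / 2\<close> cancel the factorials down to \<open>alt_binom_harm\<close>.\<close>

lemma integral_lag_harm:
  "has_bochner_integral lborel (\<lambda>x. exp (- x\<^sup>2) * ((1 - lag n (x\<^sup>2)) / x) * indicator {0..} x) (harm n / 2)"
proof -
  have "has_bochner_integral lborel (\<lambda>x. \<Sum>j<n. (real (n choose Suc j) * (-1) ^ j / fact (Suc j)) * (exp (- x\<^sup>2) * x ^ (2 * j + 1) * indicator {0..} x))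
     (\<Sum>j<n. (real (n choose Suc j) * (-1) ^ j / fact (Suc j)) * (fact j / 2))"
    by (intro has_bochner_integral_sum has_bochner_integral_mult_right gauss_odd)
  also have "(\<lambda>x. \<Sum>j<n. (real (n choose Suc j) * (-1) ^ j / fact (Suc j)) * (exp (- x\<^sup>2) * x ^ (2 * j + 1) * indicator {0..} x)) = 
     (\<lambda>x. exp (- x\<^sup>2) * ((1 - lag n (x\<^sup>2)) / x) * indicator {0..} x)"
  proof (rule ext)
    fix x :: real
    have "(1 - lag n (x\<^sup>2)) / x = (\<Sum>j<n. (real (n choose Suc j) * (-1) ^ j / fact (Suc j)) * x ^ (2 * j + 1))"
    proof (cases "x = 0")
      case False
      have "(x\<^sup>2) ^ Suc j / x = x ^ (2 * j + 1)" for j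
      proof -
        have e: "2 * Suc j = Suc (2 * j + 1)" by simp
        have "(x\<^sup>2) ^ Suc j = x * x ^ (2 * j + 1)" unfolding power_mult[symmetric] e by (rule power_Suc)
        then show ?thesis using False by (metis nonzero_mult_div_cancel_left)
      qed
      then have "c * (x\<^sup>2) ^ Suc j / x = c * x ^ (2 * j + 1)" for j c
        by (simp only: times_divide_eq_right[symmetric])
      moreover have "1 - lag n (x\<^sup>2) = (\<Sum>j<n. real (n choose Suc j) * (-1) ^ j / fact (Suc j) * (x\<^sup>2) ^ Suc j)"
        unfolding lag_split1 by (simp add: sum_negf del: fact_Suc)
      ultimately show ?thesis by (simp only: sum_divide_distrib)
    qed simp
    then show "(\<Sum>j<n. (real (n choose Suc j) * (-1) ^ j / fact (Suc j)) * (exp (- x\<^sup>2) * x ^ (2 * j + 1) * indicator {0..} x)) = 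
      exp (- x\<^sup>2) * ((1 - lag n (x\<^sup>2)) / x) * indicator {0..} x"
      by (simp add: sum_distrib_left sum_distrib_right mult_ac del: fact_Suc)
  qed
  also have "(\<Sum>j<n. (real (n choose Suc j) * (-1) ^ j / fact (Suc j)) * (fact j / 2)) = (\<Sum>j<n. real (n choose Suc j) * (-1) ^ j / real (Suc j)) / 2"
    unfolding sum_divide_distrib by (intro sum.cong refl) (simp add: field_simps del: of_nat_Suc)
  finally show ?thesis unfolding alt_binom_harm .
qed

text \<open>Again only odd powers remain. This integral is the source of the term of order
  \<open>n ln n\<close> that later cancels against \<open>ln (fact n)\<close>.\<close>

lemma integral_lag_harm2:
  "has_bochner_integral lborel (\<lambda>x. exp (- x\<^sup>2) * ((lag n (x\<^sup>2) - 1 + real n * x\<^sup>2) / x ^ 3) * indicator {0..} x) (((real n + 1) * harm n - 2 * real n) / 2)"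
proof -
  have "has_bochner_integral lborel (\<lambda>x. \<Sum>j<n. (real (n choose (j + 2)) * (-1) ^ j / fact (j + 2)) * (exp (- x\<^sup>2) * x ^ (2 * j + 1) * indicator {0..} x))
     (\<Sum>j<n. (real (n choose (j + 2)) * (-1) ^ j / fact (j + 2)) * (fact j / 2))"
    by (intro has_bochner_integral_sum has_bochner_integral_mult_right gauss_odd)
  also have "(\<lambda>x. \<Sum>j<n. (real (n choose (j + 2)) * (-1) ^ j / fact (j + 2)) * (exp (- x\<^sup>2) * x ^ (2 * j + 1) * indicator {0..} x)) = 
     (\<lambda>x. exp (- x\<^sup>2) * ((lag n (x\<^sup>2) - 1 + real n * x\<^sup>2) / x ^ 3) * indicator {0..} x)"
  proof (rule ext)
    fix x :: real
    have "(lag n (x\<^sup>2) - 1 + real n * x\<^sup>2) / x ^ 3 = (\<Sum>j<n. (real (n choose (j + 2)) * (-1) ^ j / fact (j + 2)) * x ^ (2 * j + 1))"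
    proof (cases "x = 0")
      case False
      have "(x\<^sup>2) ^ (j + 2) / x ^ 3 = x ^ (2 * j + 1)" for j
        using False by (simp add: power_mult[symmetric] power_add field_simps eval_nat_numeral)
      then have "c * (x\<^sup>2) ^ (j + 2) / x ^ 3 = c * x ^ (2 * j + 1)" for j c
        by (simp only: times_divide_eq_right[symmetric])
      moreover have "lag n (x\<^sup>2) - 1 + real n * x\<^sup>2 = (\<Sum>j<n. real (n choose (j + 2)) * (-1) ^ j / fact (j + 2) * (x\<^sup>2) ^ (j + 2))"
        unfolding lag_split2 by simp
      ultimately show ?thesis by (simp only: sum_divide_distrib)
    qed simp
    then show "(\<Sum>j<n. (real (n choose (j + 2)) * (-1) ^ j / fact (j + 2)) * (exp (- x\<^sup>2) * x ^ (2 * j + 1) * indicator {0..} x)) = 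
      exp (- x\<^sup>2) * ((lag n (x\<^sup>2) - 1 + real n * x\<^sup>2) / x ^ 3) * indicator {0..} x"
      by (simp add: sum_distrib_left sum_distrib_right mult_ac del: fact_Suc)
  qed
  also have "(\<Sum>j<n. (real (n choose (j + 2)) * (-1) ^ j / fact (j + 2)) * (fact j / 2)) = (\<Sum>j<n. real (n choose (j + 2)) * (-1) ^ j / (real (j + 1) * real (j + 2))) / 2"
    unfolding sum_divide_distrib
  proof (intro sum.cong refl)
    fix j
    have "fact (j + 2) = (real (j + 1) * real (j + 2)) * (fact j :: real)" by (simp add: algebra_simps)
    moreover have "c / (P * f) * (f / 2) = c / P / 2" if "f \<noteq> 0" for c P f :: real using that by simp
    ultimately show "(real (n choose (j + 2)) * (-1) ^ j / fact (j + 2)) * (fact j / 2) = real (n choose (j + 2)) * (-1) ^ j / (real (j + 1) * real (j + 2)) / 2"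
      by (metis fact_nonzero)
  qed
  finally show ?thesis unfolding alt_binom_harm2 .
qed

section \<open>Wallis integrals and central binomial coefficients\<close>

lemma has_integral_sin_cos_step:
  assumes "(f has_integral I) {0..pi/2}" and d: "\<And>x. (g has_real_derivative (c * f x - b * h x)) (at x)" and "g (pi / 2) - g 0 = 0" "b \<noteq> 0"
  shows "(h has_integral (c * I / b)) {0..pi/2}"
proof -
  have "((\<lambda>x. c * f x - b * h x) has_integral (g (pi / 2) - g 0)) {0..pi/2}"
    by (rule fundamental_theorem_of_calculus) (auto intro!: has_vector_derivative_at_within d[unfolded has_real_derivative_iff_has_vector_derivative])
  from has_integral_diff[OF has_integral_mult_right[OF assms(1), of c] this] assms(3)
  have "((\<lambda>x. b * h x) has_integral (c * I)) {0..pi/2}" by simp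
  from has_integral_mult_right[OF this, of "1 / b"] assms(4) show ?thesis by simp
qed

lemma deriv_cos_sin_power:
  "((\<lambda>x. cos x * sin x ^ (m + 1)) has_real_derivative ((real m + 1) * sin x ^ m - (real m + 2) * sin x ^ (m + 2))) (at x)"
proof -
  have D: "((\<lambda>x. cos x * sin x ^ (m + 1)) has_real_derivative (- sin x * sin x ^ (m + 1) + (real (m + 1) * (cos x * sin x ^ (m + 1 - Suc 0))) * cos x)) (at x)"
    by (rule DERIV_mult[OF DERIV_cos DERIV_power[OF DERIV_sin]])
  have key: "(real (m + 1) * (cos x * sin x ^ (m + 1 - Suc 0))) * cos x = (real m + 1) * sin x ^ m * (1 - sin x ^ 2)"
    unfolding cos_squared_eq[symmetric] by (simp add: power2_eq_square)
  show ?thesis by (rule DERIV_cong[OF D]) (subst key, simp add: algebra_simps power2_eq_square)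
qed

lemma has_integral_sin_even: "((\<lambda>x. sin x ^ (2 * k)) has_integral (pi / 2 * (real ((2 * k) choose k) / 4 ^ k))) {0..pi/2}"
proof (induction k)
  case 0
  then show ?case using has_integral_const_real[of "1::real" 0 "pi/2"] by simp
next
  case (Suc k)
  have d: "((\<lambda>x. cos x * sin x ^ (2 * k + 1)) has_real_derivative ((2 * real k + 1) * sin x ^ (2 * k) - (2 * real k + 2) * sin x ^ (2 * Suc k))) (at x)" for x
    using deriv_cos_sin_power[of "2 * k" x] by simp
  have e: "real (Suc k) * real ((2 * Suc k) choose (Suc k)) = 2 * (2 * real k + 1) * real ((2 * k) choose k)"
  proof -
    have "Suc k * ((2 * Suc k) choose (Suc k)) = 2 * Suc (2 * k) * ((2 * k) choose k)"
    proof -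
      have "Suc k * (Suc (2 * k + 1) choose Suc k) = Suc (2 * k + 1) * ((2 * k + 1) choose k)"
        using Suc_times_binomial_eq[of "2 * k + 1" k] by (simp only: mult.commute)
      also have "(2 * k + 1) choose k = Suc (2 * k) choose Suc k"
        using binomial_symmetric[of k "2 * k + 1"] by simp
      also have "Suc (2 * k + 1) * (Suc (2 * k) choose Suc k) = 2 * (Suc k * (Suc (2 * k) choose Suc k))"
      proof -
        have "Suc (2 * k + 1) = 2 * Suc k" by simp
        then show ?thesis by (simp only: mult.assoc)
      qed
      also have "Suc k * (Suc (2 * k) choose Suc k) = Suc (2 * k) * ((2 * k) choose k)"
        using Suc_times_binomial_eq[of "2 * k" k] by (simp only: mult.commute)
      finally show ?thesis by (simp del: binomial_Suc_Suc mult_Suc)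
    qed
    then have "real (Suc k * ((2 * Suc k) choose (Suc k))) = real (2 * Suc (2 * k) * ((2 * k) choose k))" by (rule arg_cong)
    then show ?thesis by (simp only: of_nat_mult of_nat_Suc of_nat_numeral add.commute[of 1])
  qed
  have L: "(2 * t + 1) * (pi / 2 * (c / q)) / (2 * t + 2) = pi / 2 * (c' / (4 * q))"
    if "(t + 1) * c' = 2 * (2 * t + 1) * c" "t \<ge> 0" "q > 0" for t c c' q :: real
  proof -
    have "c' = 2 * (2 * t + 1) * c / (t + 1)" using that by (simp add: eq_divide_eq mult.commute)
    then show ?thesis using that(2,3) by (simp add: divide_simps) (simp add: algebra_simps)
  qed
  have "(real k + 1) * real ((2 * Suc k) choose (Suc k)) = 2 * (2 * real k + 1) * real ((2 * k) choose k)"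
    using e by (simp only: of_nat_Suc add.commute[of 1])
  from L[OF this of_nat_0_le_iff, of "4 ^ k"]
  have "(2 * real k + 1) * (pi / 2 * (real ((2 * k) choose k) / 4 ^ k)) / (2 * real k + 2) = pi / 2 * (real ((2 * Suc k) choose Suc k) / 4 ^ Suc k)"
    by (simp only: power_Suc) simp
  then show ?case using has_integral_sin_cos_step[OF Suc d] by simp
qed

lemma has_integral_cos_even: "((\<lambda>x. cos x ^ (2 * k)) has_integral (pi / 2 * (real ((2 * k) choose k) / 4 ^ k))) {0..pi/2}"
proof -
  have "((\<lambda>x. sin (- 1 * x + pi / 2) ^ (2 * k)) has_integral (1 / \<bar>- 1\<bar> ^ DIM(real)) *\<^sub>R (pi / 2 * (real ((2 * k) choose k) / 4 ^ k))) ((\<lambda>x. (1 / (- 1)) *\<^sub>R x + - ((1 / (- 1)) *\<^sub>R (pi / 2))) ` cbox 0 (pi/2))"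
    using has_integral_affinity[OF has_integral_sin_even[of k, folded cbox_interval], of "- 1" "pi / 2"] by simp
  moreover have "(\<lambda>x. (1 / (- 1)) *\<^sub>R x + - ((1 / (- 1)) *\<^sub>R (pi / 2))) ` cbox 0 (pi/2) = {0..pi/2}"
  proof -
    have "(\<lambda>x. (1 / (- 1)) *\<^sub>R x + - ((1 / (- 1)) *\<^sub>R (pi / 2))) = (\<lambda>x. pi / 2 - x)" by (rule ext) simp
    then show ?thesis by (simp add: cbox_interval)
  qed
  moreover have "(\<lambda>x. sin (- 1 * x + pi / 2) ^ (2 * k)) = (\<lambda>x. cos x ^ (2 * k))"
    by (rule ext) (simp add: cos_sin_eq add.commute)
  ultimately show ?thesis by simp
qed

lemma has_integral_sin_odd: "((\<lambda>x. sin x ^ (2 * k + 1)) has_integral (4 ^ k * fact k ^ 2 / fact (2 * k + 1))) {0..pi/2}"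
proof (induction k)
  case 0
  have "((\<lambda>x. sin x) has_integral (- cos (pi/2) - - cos 0)) {0..pi/2}"
    by (rule fundamental_theorem_of_calculus) (auto intro!: derivative_eq_intros simp: has_real_derivative_iff_has_vector_derivative[symmetric])
  then show ?case by simp
next
  case (Suc k)
  have d: "((\<lambda>x. cos x * sin x ^ (2 * k + 2)) has_real_derivative ((2 * real k + 2) * sin x ^ (2 * k + 1) - (2 * real k + 3) * sin x ^ (2 * Suc k + 1))) (at x)" for x
    using deriv_cos_sin_power[of "2 * k + 1" x] by (simp add: add_ac)
  have f: "fact (2 * Suc k + 1) = (2 * real k + 3) * ((2 * real k + 2) * fact (2 * k + 1))" by (simp add: algebra_simps)
  have "(2 * real k + 2) * (4 ^ k * fact k ^ 2 / fact (2 * k + 1)) / (2 * real k + 3) = 4 ^ Suc k * fact (Suc k) ^ 2 / fact (2 * Suc k + 1)"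
    unfolding f by (simp add: divide_simps power2_eq_square) (simp add: algebra_simps)
  moreover have "(2 * real k + 3) \<noteq> 0" by linarith
  ultimately show ?case using has_integral_sin_cos_step[OF Suc d] by simp
qed

text \<open>The even Wallis integral of \<open>cos^(2 n + 2)\<close> is computed by expanding
  \<open>(1 - sin^2)^n\<close> with one factor \<open>1 - sin^2\<close> kept apart. That factor
  produces differences of consecutive Wallis integrals \<open>w_j\<close>, and these equal
  \<open>w_j / (2 (j + 1))\<close>.\<close>

lemma alt_binom_catalan: "(\<Sum>j\<le>n. real (n choose j) * (-1) ^ j * (real ((2 * j) choose j) / 4 ^ j) / real (Suc j)) = 2 * (real ((2 * Suc n) choose Suc n) / 4 ^ Suc n)"
proof -
  let ?w = "\<lambda>k. pi / 2 * (real ((2 * k) choose k) / 4 ^ k)"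
  have "((\<lambda>x. \<Sum>j\<le>n. (real (n choose j) * (-1) ^ j) * (sin x ^ (2 * j) - sin x ^ (2 * Suc j))) has_integral (\<Sum>j\<le>n. (real (n choose j) * (-1) ^ j) * (?w j - ?w (Suc j)))) {0..pi/2}"
    by (intro has_integral_sum has_integral_mult_right has_integral_diff has_integral_sin_even) auto
  also have "(\<lambda>x. \<Sum>j\<le>n. (real (n choose j) * (-1) ^ j) * (sin x ^ (2 * j) - sin x ^ (2 * Suc j))) = (\<lambda>x. cos x ^ (2 * Suc n))"
  proof (rule ext)
    fix x :: real
    have "(\<Sum>j\<le>n. (real (n choose j) * (-1) ^ j) * (sin x ^ (2 * j) - sin x ^ (2 * Suc j))) = (1 - sin x ^ 2) * (\<Sum>j\<le>n. real (n choose j) * (- (sin x ^ 2)) ^ j * 1 ^ (n - j))"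
    proof -
      have "sin x ^ (2 * j) = (sin x ^ 2) ^ j" "sin x ^ (2 * Suc j) = (sin x ^ 2) ^ j * sin x ^ 2" for j
        by (simp_all only: power_mult power_Suc2)
      moreover have "(c * (-1) ^ j) * (y ^ j - y ^ j * y) = (1 - y) * (c * (- y) ^ j * 1 ^ (n - j))" for c y :: real and j
        by (simp add: power_minus[of y] algebra_simps)
      ultimately show ?thesis unfolding sum_distrib_left by (intro sum.cong refl) (simp only:)
    qed
    also have "\<dots> = (1 - sin x ^ 2) * (- (sin x ^ 2) + 1) ^ n" by (subst binomial_ring) simp
    also have "\<dots> = cos x ^ (2 * Suc n)" unfolding power_mult cos_squared_eq by simp
    finally show "(\<Sum>j\<le>n. (real (n choose j) * (-1) ^ j) * (sin x ^ (2 * j) - sin x ^ (2 * Suc j))) = cos x ^ (2 * Suc n)" .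
  qed
  finally have "(\<Sum>j\<le>n. (real (n choose j) * (-1) ^ j) * (?w j - ?w (Suc j))) = ?w (Suc n)"
    using has_integral_unique has_integral_cos_even by blast
  moreover have "?w j - ?w (Suc j) = pi / 4 * ((real ((2 * j) choose j) / 4 ^ j) / real (Suc j))" for j
  proof -
    have "((\<lambda>x. sin x ^ (2 * Suc j)) has_integral ((2 * real j + 1) * ?w j / (2 * real j + 2))) {0..pi/2}"
    proof (rule has_integral_sin_cos_step[OF has_integral_sin_even])
      fix x :: real
      show "((\<lambda>x. cos x * sin x ^ (2 * j + 1)) has_real_derivative ((2 * real j + 1) * sin x ^ (2 * j) - (2 * real j + 2) * sin x ^ (2 * Suc j))) (at x)"
        using deriv_cos_sin_power[of "2 * j" x] by simp
    qed auto
    from has_integral_unique[OF this has_integral_sin_even] have e: "?w (Suc j) = (2 * real j + 1) * ?w j / (2 * real j + 2)" by simp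
    have "W - (2 * t + 1) * W / (2 * t + 2) = W / (2 * (t + 1))" if "t \<ge> 0" for W t :: real
      using that by (simp add: divide_simps) (simp add: algebra_simps)
    from this[of "real j" "?w j"] show ?thesis unfolding e by (simp add: add.commute)
  qed
  ultimately have "(\<Sum>j\<le>n. (real (n choose j) * (-1) ^ j) * (pi / 4 * ((real ((2 * j) choose j) / 4 ^ j) / real (Suc j)))) = ?w (Suc n)" by simp
  also have "(\<Sum>j\<le>n. (real (n choose j) * (-1) ^ j) * (pi / 4 * ((real ((2 * j) choose j) / 4 ^ j) / real (Suc j)))) = 
     pi / 4 * (\<Sum>j\<le>n. real (n choose j) * (-1) ^ j * (real ((2 * j) choose j) / 4 ^ j) / real (Suc j))"
    unfolding sum_distrib_left by (intro sum.cong refl) simp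
  finally have F: "pi / 4 * (\<Sum>j\<le>n. real (n choose j) * (-1) ^ j * (real ((2 * j) choose j) / 4 ^ j) / real (Suc j)) = ?w (Suc n)" .
  have "S = 2 * y" if "pi / 4 * S = pi / 2 * y" for S y :: real using that by simp
  from this[OF F] show ?thesis .
qed

lemma one_minus_exp_sq_bounds: "0 \<le> 1 - exp (- x\<^sup>2)" "1 - exp (- x\<^sup>2) \<le> x\<^sup>2" for x :: real
  using exp_ge_add_one_self[of "- x\<^sup>2"] by auto

text \<open>Primitives are evaluated in the gauge integral, whereas dominated convergence and the
  Gaussian moments are used for the Bochner integral.\<close>

lemma has_bochner_integral_of_henstock:
  fixes f :: "real \<Rightarrow> real"
  assumes "integrable lborel (\<lambda>x. f x * indicator {a..b} x)" "(f has_integral I) {a..b}"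
  shows "has_bochner_integral lborel (\<lambda>x. f x * indicator {a..b} x) I"
proof -
  have s: "set_integrable lborel {a..b} f"
    using assms(1) by (simp add: set_integrable_def mult.commute)
  have "(\<integral>x. f x * indicator {a..b} x \<partial>lborel) = integral {a..b} f"
    using set_borel_integral_eq_integral(2)[OF s] by (simp add: set_lebesgue_integral_def mult.commute)
  also have "\<dots> = I" using assms(2) by (rule integral_unique)
  finally show ?thesis using assms(1) by (simp add: has_bochner_integral_iff)
qed

lemma integrable_bounded_interval:
  fixes f :: "real \<Rightarrow> real"
  assumes [measurable]: "f \<in> borel_measurable borel" and "\<And>x. x \<in> {a..b} \<Longrightarrow> \<bar>f x\<bar> \<le> B"
  shows "integrable lborel (\<lambda>x. f x * indicator {a..b} x)"
proof -
  have i: "integrable lborel (\<lambda>x. B * indicator {a..b} x :: real)"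
    by (intro integrable_mult_right integrable_real_indicator) (auto simp: emeasure_lborel_Icc_eq)
  show ?thesis
    by (rule Bochner_Integration.integrable_bound[OF i])
       (use assms(2) in \<open>auto intro!: AE_I2 simp: indicator_def intro: order_trans[OF _ abs_ge_self]\<close>)
qed

lemma has_bochner_integral_inverse_square_tail:
  assumes "a > 0" shows "has_bochner_integral lborel (\<lambda>x::real. 1 / x\<^sup>2 * indicator {a..} x) (1 / a)"
proof (rule has_bochner_integral_nn_integral)
  have "(\<integral>\<^sup>+x. ennreal (1 / x\<^sup>2) * indicator {a ..} x \<partial>lborel) = ennreal (0 - (- 1 / a))"
  proof (rule nn_integral_FTC_atLeast)
    show "((\<lambda>x. - 1 / x) has_real_derivative 1 / x\<^sup>2) (at x)" if "a \<le> x" for x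
      using assms that by (auto intro!: derivative_eq_intros simp: power2_eq_square)
    show "((\<lambda>x::real. - 1 / x) \<longlongrightarrow> 0) at_top" by real_asymp
  qed auto
  moreover have "ennreal (1 / x\<^sup>2 * indicator {a..} x) = ennreal (1 / x\<^sup>2) * indicator {a..} x" for x
    by (simp add: indicator_def)
  ultimately show "(\<integral>\<^sup>+x. ennreal (1 / x\<^sup>2 * indicator {a..} x) \<partial>lborel) = ennreal (1 / a)"
    by simp
  show "(\<lambda>x::real. 1 / x\<^sup>2 * indicator {a..} x) \<in> borel_measurable lborel" by measurable
  show "AE x::real in lborel. 0 \<le> 1 / x\<^sup>2 * indicator {a..} x" by (rule AE_I2) simp
  show "0 \<le> 1 / a" using assms by simp
qed

lemma has_bochner_integral_gauss_tail:
  assumes "a > 0" shows "has_bochner_integral lborel (\<lambda>x::real. exp (- x\<^sup>2) * (1 / x ^ 3 + 1 / x) * indicator {a..} x) (exp (- a\<^sup>2) / (2 * a\<^sup>2))"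
proof (rule has_bochner_integral_nn_integral)
  have "(\<integral>\<^sup>+x. ennreal (exp (- x\<^sup>2) * (1 / x ^ 3 + 1 / x)) * indicator {a ..} x \<partial>lborel) = ennreal (0 - (- exp (- a\<^sup>2) / (2 * a\<^sup>2)))"
  proof (rule nn_integral_FTC_atLeast)
    show "((\<lambda>x. - exp (- x\<^sup>2) / (2 * x\<^sup>2)) has_real_derivative exp (- x\<^sup>2) * (1 / x ^ 3 + 1 / x)) (at x)" if "a \<le> x" for x
      using assms that by (auto intro!: derivative_eq_intros simp: divide_simps) (simp add: algebra_simps eval_nat_numeral)
    show "0 \<le> exp (- x\<^sup>2) * (1 / x ^ 3 + 1 / x)" if "a \<le> x" for x using assms that by simp
    show "((\<lambda>x::real. - exp (- x\<^sup>2) / (2 * x\<^sup>2)) \<longlongrightarrow> 0) at_top" by real_asymp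
  qed auto
  moreover have "ennreal (exp (- x\<^sup>2) * (1 / x ^ 3 + 1 / x) * indicator {a..} x) = ennreal (exp (- x\<^sup>2) * (1 / x ^ 3 + 1 / x)) * indicator {a..} x" for x
    by (simp add: indicator_def)
  ultimately show "(\<integral>\<^sup>+x. ennreal (exp (- x\<^sup>2) * (1 / x ^ 3 + 1 / x) * indicator {a..} x) \<partial>lborel) = ennreal (exp (- a\<^sup>2) / (2 * a\<^sup>2))"
    by simp
  show "(\<lambda>x::real. exp (- x\<^sup>2) * (1 / x ^ 3 + 1 / x) * indicator {a..} x) \<in> borel_measurable lborel" by measurable
  show "AE x::real in lborel. 0 \<le> exp (- x\<^sup>2) * (1 / x ^ 3 + 1 / x) * indicator {a..} x"
    by (rule AE_I2) (use assms in \<open>simp add: indicator_def\<close>)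
qed simp

text \<open>Partial integration against \<open>- 1 / x\<close> turns the integrand into
  \<open>2 exp (- x^2)\<close>, so the value is twice the Gaussian integral over the
  half-line.\<close>

lemma integral_lag_sqrt_0: "has_bochner_integral lborel (\<lambda>x::real. (1 - exp (- x\<^sup>2)) / x\<^sup>2 * indicator {0..} x) (sqrt pi)"
proof (rule has_bochner_integral_monotone_convergence_at_top)
  let ?f = "\<lambda>x::real. (1 - exp (- x\<^sup>2)) / x\<^sup>2"
  let ?I = "\<lambda>y::real. - (1 - exp (- y\<^sup>2)) / y + 2 * (\<integral>x. exp (- x\<^sup>2) * indicator {0..y} x \<partial>lborel)"
  have i: "integrable lborel (\<lambda>x. ?f x * indicator {0..y} x)" for y
  proof (rule integrable_bounded_interval[of _ _ _ 1])
    show "\<bar>?f x\<bar> \<le> 1" for x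
      using one_minus_exp_sq_bounds[of x] by (cases "x = 0") (auto simp: abs_of_nonneg divide_le_eq_1)
  qed auto
  have e: "?f x * indicator {0..} x * indicator {..y} x = ?f x * indicator {0..y} x" for x y
    by (auto simp: indicator_def)
  show "integrable lborel (\<lambda>x. ?f x * indicator {0..} x * indicator {..y} x)" for y
    unfolding e by (rule i)
  have I: "(\<integral>x. ?f x * indicator {0..} x * indicator {..y} x \<partial>lborel) = ?I y" if y: "y > 0" for y
  proof -
    let ?F = "\<lambda>x::real. - (1 - exp (- x\<^sup>2)) / x"
    have cF: "continuous_on {0..y} ?F"
    proof (rule continuous_on_eq_continuous_within[THEN iffD2], rule ballI)
      fix x assume "x \<in> {0..y}"
      show "continuous (at x within {0..y}) ?F"
      proof (cases "x = 0")
        \<comment> \<open>Division by zero makes \<open>?F 0 = 0\<close>, which is also the limit,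
          so the primitive is continuous as it stands.\<close>
        case True
        have "(?F \<longlongrightarrow> 0) (at 0)"
        proof (rule Lim_null_comparison)
          show "eventually (\<lambda>x. norm (?F x) \<le> \<bar>x\<bar>) (at 0)"
          proof (rule always_eventually, rule allI)
            fix x :: real
            have "\<bar>1 - exp (- x\<^sup>2)\<bar> \<le> x\<^sup>2" using one_minus_exp_sq_bounds[of x] by auto
            then show "norm (?F x) \<le> \<bar>x\<bar>"
              by (cases "x = 0") (auto simp: abs_mult divide_le_eq power2_eq_square)
          qed
          show "((\<lambda>x::real. \<bar>x\<bar>) \<longlongrightarrow> 0) (at 0)" by (rule tendsto_rabs_zero) (rule tendsto_ident_at)
        qed
        then have "(?F \<longlongrightarrow> 0) (at 0 within {0..y})" by (rule tendsto_within_subset) simp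
        then show ?thesis unfolding True continuous_within by simp
      next
        case False
        then show ?thesis by (intro continuous_intros) auto
      qed
    qed
    have "((\<lambda>x. ?f x - 2 * exp (- x\<^sup>2)) has_integral (?F y - ?F 0)) {0..y}"
    proof (rule fundamental_theorem_of_calculus_interior)
      fix x assume x: "x \<in> {0<..<y}"
      have "(?F has_real_derivative (?f x - 2 * exp (- x\<^sup>2))) (at x)"
        using x by (auto intro!: derivative_eq_intros simp: divide_simps) (simp add: algebra_simps power2_eq_square)
      then show "(?F has_vector_derivative (?f x - 2 * exp (- x\<^sup>2))) (at x)"
        by (simp add: has_real_derivative_iff_has_vector_derivative)
    qed (use y cF in auto)
    moreover have "((\<lambda>x. 2 * exp (- x\<^sup>2)) has_integral (2 * (\<integral>x. exp (- x\<^sup>2) * indicator {0..y} x \<partial>lborel))) {0..y}"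
    proof -
      have "integrable lborel (\<lambda>x::real. exp (- x\<^sup>2) * indicator {0..y} x)"
        by (rule integrable_bounded_interval[of _ _ _ 1]) auto
      then have s: "set_integrable lborel {0..y} (\<lambda>x. exp (- x\<^sup>2))" by (simp add: set_integrable_def mult.commute)
      have "((\<lambda>x. exp (- x\<^sup>2)) has_integral (\<integral>x. exp (- x\<^sup>2) * indicator {0..y} x \<partial>lborel)) {0..y}"
        using integrable_integral[OF set_borel_integral_eq_integral(1)[OF s]] set_borel_integral_eq_integral(2)[OF s]
        by (simp add: set_lebesgue_integral_def mult.commute)
      then show ?thesis by (rule has_integral_mult_right)
    qed
    ultimately have "(?f has_integral ?I y) {0..y}"
      using has_integral_add[of "\<lambda>x. ?f x - 2 * exp (- x\<^sup>2)" "?F y - ?F 0" "{0..y}" "\<lambda>x. 2 * exp (- x\<^sup>2)"] by simp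
    from has_bochner_integral_of_henstock[OF i this] show ?thesis
      unfolding e by (simp add: has_bochner_integral_iff)
  qed
  have "((\<lambda>y. \<integral>x. indicator {..y} x *\<^sub>R (exp (- x\<^sup>2) * x ^ (2 * 0) * indicator {0..} x) \<partial>lborel) \<longlongrightarrow> (\<integral>x. exp (- x\<^sup>2) * x ^ (2 * 0) * indicator {0..} x \<partial>(lborel::real measure))) at_top"
    by (rule tendsto_integral_at_top) (use gauss_even[of 0] in \<open>auto simp: has_bochner_integral_iff\<close>)
  also have "(\<integral>x. exp (- x\<^sup>2) * x ^ (2 * 0) * indicator {0..} x \<partial>(lborel::real measure)) = sqrt pi / 2"
    using gauss_even[of 0] by (simp add: has_bochner_integral_iff)
  also have "(\<lambda>y. \<integral>x. indicator {..y} x *\<^sub>R (exp (- x\<^sup>2) * x ^ (2 * 0) * indicator {0..} x) \<partial>lborel) = (\<lambda>y::real. \<integral>x. exp (- x\<^sup>2) * indicator {0..y} x \<partial>lborel)"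
    by (intro ext Bochner_Integration.integral_cong) (auto simp: indicator_def)
  finally have G: "((\<lambda>y::real. \<integral>x. exp (- x\<^sup>2) * indicator {0..y} x \<partial>lborel) \<longlongrightarrow> sqrt pi / 2) at_top" .
  have "((\<lambda>y::real. - (1 - exp (- y\<^sup>2)) / y) \<longlongrightarrow> 0) at_top" by real_asymp
  from tendsto_add[OF this tendsto_mult[OF tendsto_const[of 2] G]]
  have "(?I \<longlongrightarrow> sqrt pi) at_top" by simp
  then show "((\<lambda>y. \<integral>x. ?f x * indicator {0..} x * indicator {..y} x \<partial>lborel) \<longlongrightarrow> sqrt pi) at_top"
    by (rule Lim_transform_eventually) (rule eventually_mono[OF eventually_gt_at_top[of 0]], simp only: I)
  show "AE x::real in lborel. 0 \<le> ?f x * indicator {0..} x"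
    by (rule AE_I2) (use one_minus_exp_sq_bounds in simp)
  show "(\<lambda>x::real. ?f x * indicator {0..} x) \<in> borel_measurable borel" by measurable
qed simp

text \<open>Induction over \<open>n\<close>: by \<open>lag_diff\<close> the increment of the
  integrand is a Gaussian times an even polynomial, and \<open>alt_binom_catalan\<close> sums its
  moments to the next central binomial term.\<close>

lemma integral_lag_sqrt:
  "has_bochner_integral lborel (\<lambda>x. (1 - exp (- x\<^sup>2) * lag n (x\<^sup>2)) / x\<^sup>2 * indicator {0..} x) (sqrt pi * (\<Sum>m\<le>n. real ((2 * m) choose m) / 4 ^ m))"
proof (induction n)
  case 0
  then show ?case using integral_lag_sqrt_0 by (simp add: lag_def)
next
  case (Suc n)
  have "has_bochner_integral lborel (\<lambda>x. \<Sum>j\<le>n. (real (n choose j) * (-1) ^ j / fact (Suc j)) * (exp (- x\<^sup>2) * x ^ (2 * j) * indicator {0..} x))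
    (\<Sum>j\<le>n. (real (n choose j) * (-1) ^ j / fact (Suc j)) * (sqrt pi / 2 * (fact (2 * j) / (4 ^ j * fact j))))"
    by (intro has_bochner_integral_sum has_bochner_integral_mult_right gauss_even)
  also have "(\<Sum>j\<le>n. (real (n choose j) * (-1) ^ j / fact (Suc j)) * (sqrt pi / 2 * (fact (2 * j) / (4 ^ j * fact j)))) = 
    (sqrt pi / 2) * (\<Sum>j\<le>n. real (n choose j) * (-1) ^ j * (real ((2 * j) choose j) / 4 ^ j) / real (Suc j))"
    unfolding sum_distrib_left
  proof (intro sum.cong refl)
    fix j
    have c: "real ((2 * j) choose j) = fact (2 * j) / (fact j * fact j)"
      by (subst binomial_fact) (auto simp: mult_2)
    have "(N * s / (S * f)) * (p / 2 * (F / (q * f))) = p / 2 * (N * s * ((F / (f * f)) / q) / S)" for N s S f p F q :: real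
      by (simp only: divide_inverse inverse_mult_distrib mult_ac)
    then show "(real (n choose j) * (-1) ^ j / fact (Suc j)) * (sqrt pi / 2 * (fact (2 * j) / (4 ^ j * fact j))) = 
      sqrt pi / 2 * (real (n choose j) * (-1) ^ j * (real ((2 * j) choose j) / 4 ^ j) / real (Suc j))"
      unfolding c fact_Suc of_nat_mult by blast
  qed
  also have "\<dots> = sqrt pi * (real ((2 * Suc n) choose Suc n) / 4 ^ Suc n)"
  proof -
    have "(s / 2) * (2 * c) = s * c" for s c :: real by simp
    then show ?thesis unfolding alt_binom_catalan by blast
  qed
  finally have 1: "has_bochner_integral lborel (\<lambda>x. \<Sum>j\<le>n. (real (n choose j) * (-1) ^ j / fact (Suc j)) * (exp (- x\<^sup>2) * x ^ (2 * j) * indicator {0..} x))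
    (sqrt pi * (real ((2 * Suc n) choose Suc n) / 4 ^ Suc n))" .
  from has_bochner_integral_add[OF Suc this]
  have "has_bochner_integral lborel (\<lambda>x. (1 - exp (- x\<^sup>2) * lag n (x\<^sup>2)) / x\<^sup>2 * indicator {0..} x + (\<Sum>j\<le>n. (real (n choose j) * (-1) ^ j / fact (Suc j)) * (exp (- x\<^sup>2) * x ^ (2 * j) * indicator {0..} x)))
     (sqrt pi * (\<Sum>m\<le>Suc n. real ((2 * m) choose m) / 4 ^ m))"
    by (simp only: distrib_left sum.atMost_Suc)
  moreover have "AE x in lborel. (1 - exp (- x\<^sup>2) * lag n (x\<^sup>2)) / x\<^sup>2 * indicator {0..} x + (\<Sum>j\<le>n. (real (n choose j) * (-1) ^ j / fact (Suc j)) * (exp (- x\<^sup>2) * x ^ (2 * j) * indicator {0..} x)) = 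
     (1 - exp (- x\<^sup>2) * lag (Suc n) (x\<^sup>2)) / x\<^sup>2 * indicator {0..} x"
    using AE_lborel_singleton[of "0::real"]
  proof eventually_elim
    case (elim x)
    have "(x\<^sup>2) ^ Suc j / x\<^sup>2 = x ^ (2 * j)" for j using elim by (simp add: power_mult)
    then have "c * (x\<^sup>2) ^ Suc j / x\<^sup>2 = c * x ^ (2 * j)" for c j by (simp only: times_divide_eq_right[symmetric])
    then have "(lag n (x\<^sup>2) - lag (Suc n) (x\<^sup>2)) / x\<^sup>2 = (\<Sum>j\<le>n. real (n choose j) * (-1) ^ j / fact (Suc j) * x ^ (2 * j))"
      unfolding lag_diff by (simp only: sum_divide_distrib)
    then have "(\<Sum>j\<le>n. (real (n choose j) * (-1) ^ j / fact (Suc j)) * (exp (- x\<^sup>2) * x ^ (2 * j) * indicator {0..} x)) = 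
       exp (- x\<^sup>2) * ((lag n (x\<^sup>2) - lag (Suc n) (x\<^sup>2)) / x\<^sup>2) * indicator {0..} x"
      by (simp add: sum_distrib_left sum_distrib_right mult_ac del: fact_Suc)
    then show ?case by (simp only:) (simp add: algebra_simps diff_divide_distrib add_divide_distrib)
  qed
  ultimately show ?case by (subst (asm) has_bochner_integral_cong_AE) auto
qed

lemma sum_central_binomial: "(\<Sum>m\<le>n. real ((2 * m) choose m) / 4 ^ m) = (2 * real n + 1) * (real ((2 * n) choose n) / 4 ^ n)"
proof (induction n)
  case (Suc n)
  have "((\<lambda>x. sin x ^ (2 * Suc n)) has_integral ((2 * real n + 1) * (pi / 2 * (real ((2 * n) choose n) / 4 ^ n)) / (2 * real n + 2))) {0..pi/2}"
    by (rule has_integral_sin_cos_step[OF has_integral_sin_even, where g = "\<lambda>x. cos x * sin x ^ (2 * n + 1)"])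
      (use deriv_cos_sin_power[of "2 * n"] in auto)
  from has_integral_unique[OF this has_integral_sin_even]
  have "(2 * real n + 1) * (pi / 2 * (real ((2 * n) choose n) / 4 ^ n)) / (2 * real n + 2) = pi / 2 * (real ((2 * Suc n) choose Suc n) / 4 ^ Suc n)" .
  moreover have "t * W + W' = (t + 2) * W'" if "t * (pi / 2 * W) / (t + 1) = pi / 2 * W'" "t > 0" for t W W' :: real
  proof -
    have "pi * (t * W) = pi * ((t + 1) * W')" using that by (simp add: field_simps)
    then have "t * W = (t + 1) * W'" by (subst (asm) mult_left_cancel) auto
    then show ?thesis by (simp add: algebra_simps)
  qed
  from this[of "2 * real n + 1" "real ((2 * n) choose n) / 4 ^ n" "real ((2 * Suc n) choose Suc n) / 4 ^ Suc n"] calculation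
  have "(2 * real n + 1) * (real ((2 * n) choose n) / 4 ^ n) + real ((2 * Suc n) choose Suc n) / 4 ^ Suc n = (2 * real n + 1 + 2) * (real ((2 * Suc n) choose Suc n) / 4 ^ Suc n)"
    by (simp add: add_ac del: binomial_Suc_Suc power_Suc)
  then show ?case using Suc by (simp add: add_ac del: binomial_Suc_Suc power_Suc)
qed simp

text \<open>Both \<open>(2 n + 1) w^2\<close> and \<open>2 n w^2\<close> tend to
  \<open>2 / pi\<close> by the Wallis product, the former decreasing and the latter
  increasing.\<close>

lemma central_binomial_bounds:
  assumes "n > 0"
  defines "w \<equiv> real ((2 * n) choose n) / 4 ^ n"
  shows "2 / pi \<le> (2 * real n + 1) * w\<^sup>2" "2 * real n * w\<^sup>2 \<le> 2 / pi"
proof -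
  define a where "a n = real ((2 * n) choose n) / 4 ^ n" for n :: nat
  have step: "a (Suc n) = (2 * real n + 1) / (2 * real n + 2) * a n" for n
  proof -
    have "a (Suc n) = (\<Sum>m\<le>Suc n. real ((2 * m) choose m) / 4 ^ m) - (\<Sum>m\<le>n. real ((2 * m) choose m) / 4 ^ m)"
      by (simp add: a_def)
    also have "\<dots> = (2 * real n + 3) * a (Suc n) - (2 * real n + 1) * a n"
      unfolding sum_central_binomial a_def by (simp del: binomial_Suc_Suc power_Suc add: add_ac)
    finally have "(2 * real n + 2) * a (Suc n) = (2 * real n + 1) * a n" by (simp add: algebra_simps)
    then show ?thesis by (simp add: field_simps)
  qed
  have wal: "(\<Prod>k=1..n. (4*real k^2) / (4*real k^2 - 1)) * ((2 * real n + 1) * a n ^ 2) = 1" for n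
  proof (induction n)
    case (Suc n)
    have p: "(\<Prod>k=1..Suc n. (4*real k^2) / (4*real k^2 - 1)) = (\<Prod>k=1..n. (4*real k^2) / (4*real k^2 - 1)) * ((4*real (Suc n)^2) / (4*real (Suc n)^2 - 1))"
      by simp
    define t where "t = real n"
    have t: "t \<ge> 0" by (simp add: t_def)
    have d: "4 * (t + 1)\<^sup>2 - 1 = (2 * t + 1) * (2 * t + 3)" by (simp add: power2_eq_square algebra_simps)
    have "(4 * (t + 1)\<^sup>2) / (4 * (t + 1)\<^sup>2 - 1) * ((2 * t + 3) * ((2 * t + 1) / (2 * t + 2) * A)\<^sup>2) = (2 * t + 1) * A\<^sup>2" for A
    proof -
      have "(2 * t + 2) = 2 * (t + 1)" by simp
      then show ?thesis unfolding d using t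
        by (simp only: power_mult_distrib power_divide) (simp add: divide_simps power2_eq_square)
    qed
    from this[of "a n"]
    have "((4*real (Suc n)^2) / (4*real (Suc n)^2 - 1)) * ((2 * real (Suc n) + 1) * a (Suc n) ^ 2) = (2 * real n + 1) * a n ^ 2"
      unfolding step by (simp add: t_def add_ac)
    then show ?case unfolding p mult.assoc using Suc by (simp only:)
  qed (simp add: a_def)
  have lim: "(\<lambda>n. (2 * real n + 1) * a n ^ 2) \<longlonglongrightarrow> 2 / pi"
  proof -
    have "(\<lambda>n. 1 / (\<Prod>k=1..n. (4*real k^2) / (4*real k^2 - 1))) \<longlonglongrightarrow> 1 / (pi / 2)"
      by (intro tendsto_divide tendsto_const wallis) simp
    also have "(\<lambda>n. 1 / (\<Prod>k=1..n. (4*real k^2) / (4*real k^2 - 1))) = (\<lambda>n. (2 * real n + 1) * a n ^ 2)"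
    proof (rule ext)
      fix n :: nat
      show "1 / (\<Prod>k=1..n. (4*real k^2) / (4*real k^2 - 1)) = (2 * real n + 1) * a n ^ 2"
        using inverse_unique[OF wal[of n]] by (simp only: inverse_eq_divide)
    qed
    finally show ?thesis by simp
  qed
  have a0: "a n > 0" for n by (simp add: a_def)
  have dec: "decseq (\<lambda>n. (2 * real n + 1) * a n ^ 2)"
  proof (rule decseq_SucI)
    fix n
    have "(2 * t + 3) * ((2 * t + 1) / (2 * t + 2) * A) ^ 2 \<le> (2 * t + 1) * A ^ 2" if "t \<ge> 0" for t A :: real
    proof -
      have "(2 * t + 3) * ((2 * t + 1) / (2 * t + 2) * A) ^ 2 = ((2 * t + 3) * (2 * t + 1) / (2 * t + 2) ^ 2) * ((2 * t + 1) * A ^ 2)"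
        by (simp add: power2_eq_square divide_inverse mult_ac)
      also have "\<dots> \<le> 1 * ((2 * t + 1) * A ^ 2)"
      proof (rule mult_right_mono)
        have "(2 * t + 3) * (2 * t + 1) \<le> (2 * t + 2) ^ 2" by (simp add: power2_eq_square algebra_simps)
        then show "(2 * t + 3) * (2 * t + 1) / (2 * t + 2) ^ 2 \<le> 1" using that by (simp add: divide_le_eq_1_pos)
      qed (use that in auto)
      finally show ?thesis by simp
    qed
    from this[of "real n" "a n"] show "(2 * real (Suc n) + 1) * a (Suc n) ^ 2 \<le> (2 * real n + 1) * a n ^ 2"
      unfolding step by (simp add: add_ac)
  qed
  show "2 / pi \<le> (2 * real n + 1) * w\<^sup>2"
    using decseq_ge[OF dec lim, of n] by (simp add: a_def w_def)
  have lim2: "(\<lambda>n. 2 * real n * a n ^ 2) \<longlonglongrightarrow> 2 / pi"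
  proof -
    have "(\<lambda>n. 2 * real n / (2 * real n + 1)) \<longlonglongrightarrow> 1" by real_asymp
    from tendsto_mult[OF this lim]
    have "(\<lambda>n. 2 * real n / (2 * real n + 1) * ((2 * real n + 1) * a n ^ 2)) \<longlonglongrightarrow> 2 / pi" by simp
    moreover have "t / (t + 1) * ((t + 1) * A) = t * A" if "t \<ge> 0" for t A :: real using that by simp
    then have "2 * real n / (2 * real n + 1) * ((2 * real n + 1) * a n ^ 2) = 2 * real n * a n ^ 2" for n by simp
    ultimately show ?thesis by (simp only:)
  qed
  have inc: "incseq (\<lambda>n. 2 * real n * a n ^ 2)"
  proof (rule incseq_SucI)
    fix n
    have "2 * t * A ^ 2 \<le> 2 * (t + 1) * ((2 * t + 1) / (2 * t + 2) * A) ^ 2" if t: "t \<ge> 0" for t A :: real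
    proof -
      have "2 * t \<le> (2 * t + 1) ^ 2 / (2 * t + 2)"
        using t by (simp add: pos_le_divide_eq power2_eq_square algebra_simps)
      then have "2 * t * A ^ 2 \<le> (2 * t + 1) ^ 2 / (2 * t + 2) * A ^ 2" by (rule mult_right_mono) simp
      also have "(2 * t + 1) ^ 2 / (2 * t + 2) = (2 * t + 2) * ((2 * t + 1) / (2 * t + 2)) ^ 2"
        using t by (simp add: power2_eq_square)
        finally show ?thesis unfolding power_mult_distrib by (simp only: distrib_left mult_1_right mult.assoc)
    qed
    from this[of "real n" "a n"] show "2 * real n * a n ^ 2 \<le> 2 * real (Suc n) * a (Suc n) ^ 2"
      unfolding step by (simp add: add_ac)
  qed
  show "2 * real n * w\<^sup>2 \<le> 2 / pi"
    using incseq_le[OF inc lim2, of n] by (simp add: a_def w_def)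
qed

definition lag_sqrt :: "nat \<Rightarrow> real" where
  "lag_sqrt n = sqrt pi * (\<Sum>m\<le>n. real ((2 * m) choose m) / 4 ^ m)"

lemma lag_sqrt_bounds:
  assumes "n > 0" shows "2 * sqrt (real n) \<le> lag_sqrt n" "lag_sqrt n \<le> 2 * sqrt (real n) + 1 / sqrt (real n)"
proof -
  define w where "w = real ((2 * n) choose n) / 4 ^ n"
  have w: "w > 0" by (simp add: w_def)
  have b: "2 / pi \<le> (2 * real n + 1) * w\<^sup>2" "2 * real n * w\<^sup>2 \<le> 2 / pi"
    using central_binomial_bounds[OF assms] by (simp_all add: w_def)
  have l: "lag_sqrt n = sqrt pi * ((2 * real n + 1) * w)" by (simp add: lag_sqrt_def sum_central_binomial w_def)
  have l2: "lag_sqrt n ^ 2 = pi * (2 * real n + 1) * ((2 * real n + 1) * w\<^sup>2)"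
    unfolding l power_mult_distrib by (simp add: power2_eq_square)
  have lp: "lag_sqrt n \<ge> 0" unfolding l using w by simp
  have "(2 * sqrt (real n))\<^sup>2 \<le> lag_sqrt n ^ 2"
  proof -
    have "(2 * sqrt (real n))\<^sup>2 = 4 * real n" by (simp add: power_mult_distrib)
    also have "\<dots> \<le> pi * (2 * real n + 1) * (2 / pi)" by simp
    also have "\<dots> \<le> lag_sqrt n ^ 2" unfolding l2 using b(1) by (intro mult_left_mono) auto
    finally show ?thesis .
  qed
  then show "2 * sqrt (real n) \<le> lag_sqrt n" using lp by (rule power2_le_imp_le)
  have "lag_sqrt n ^ 2 \<le> ((2 * real n + 1) / sqrt (real n)) ^ 2"
  proof -
    have "w\<^sup>2 \<le> 1 / (pi * real n)" using b(2) assms by (simp add: field_simps)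
    then have "pi * (2 * real n + 1) ^ 2 * w\<^sup>2 \<le> pi * (2 * real n + 1) ^ 2 * (1 / (pi * real n))" by (intro mult_left_mono) auto
    also have "\<dots> = ((2 * real n + 1) / sqrt (real n)) ^ 2" by (simp add: power_divide)
    finally show ?thesis unfolding l2 by (simp add: power2_eq_square mult_ac)
  qed
  then have "lag_sqrt n \<le> (2 * real n + 1) / sqrt (real n)" by (rule power2_le_imp_le) simp
  also have "\<dots> = 2 * sqrt (real n) + 1 / sqrt (real n)" by (simp add: add_divide_distrib real_div_sqrt mult.commute[of 2] times_divide_eq_left[symmetric] del: times_divide_eq_left)
  finally show "lag_sqrt n \<le> 2 * sqrt (real n) + 1 / sqrt (real n)" .
qed

lemma lag_sqrt_tendsto: "(\<lambda>n. lag_sqrt n - 2 * sqrt (real n)) \<longlonglongrightarrow> 0"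
proof (rule tendsto_sandwich)
  show "eventually (\<lambda>n. 0 \<le> lag_sqrt n - 2 * sqrt (real n)) sequentially"
    using lag_sqrt_bounds(1) by (auto intro: eventually_mono[OF eventually_gt_at_top[of 0]])
  show "eventually (\<lambda>n. lag_sqrt n - 2 * sqrt (real n) \<le> 1 / sqrt (real n)) sequentially"
  proof (rule eventually_mono[OF eventually_gt_at_top[of 0]])
    show "lag_sqrt n - 2 * sqrt (real n) \<le> 1 / sqrt (real n)" if "0 < n" for n
      using lag_sqrt_bounds(2)[OF that] by linarith
  qed
  show "(\<lambda>n. 1 / sqrt (real n)) \<longlonglongrightarrow> 0" by real_asymp
qed simp

lemma lag_sqrt_error: "\<bar>lag_sqrt n - 2 * sqrt (real n)\<bar> \<le> 2"
proof (cases "n = 0")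
  case True
  have "sqrt pi \<le> 2" using pi_less_4 by (intro real_le_lsqrt) auto
  then show ?thesis using True by (simp add: lag_sqrt_def)
next
  case False
  then have "1 / sqrt (real n) \<le> 1" by simp
  moreover have "n > 0" using False by simp
  ultimately show ?thesis using lag_sqrt_bounds[of n] by (auto simp del: divide_le_eq_1_pos)
qed

section \<open>Laguerre integrals over bounded intervals\<close>

text \<open>The difference between an integral over \<open>[0, a]\<close> and the corresponding Gaussian-weighted integral over
\<open>[0, \<infinity>)\<close>, whose exact value is known, is an integral against such a weight. It is dominated by a Gaussian, so its
integral against \<open>lag n (x\<^sup>2)\<close> vanishes in the limit.\<close>

definition lag_cut :: "real \<Rightarrow> (real \<Rightarrow> real) \<Rightarrow> (real \<Rightarrow> real) \<Rightarrow> real \<Rightarrow> real" where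
  "lag_cut a u w x = u x * indicator {0..a} x - exp (- x\<^sup>2) * w x * indicator {a<..} x"

lemma lag_cut_measurable [measurable]:
  assumes [measurable]: "u \<in> borel_measurable borel" "w \<in> borel_measurable borel"
  shows "lag_cut a u w \<in> borel_measurable borel"
  unfolding lag_cut_def by measurable

lemma lag_cut_bound:
  assumes "a > 0" and u: "\<And>x. x \<in> {0..a} \<Longrightarrow> \<bar>u x\<bar> \<le> M" and w: "\<And>x. x > a \<Longrightarrow> \<bar>w x\<bar> \<le> M'"
  shows "\<bar>lag_cut a u w x\<bar> \<le> (M * exp (a\<^sup>2) + M') * exp (- x\<^sup>2)"
proof -
  have M: "M \<ge> 0" "M' \<ge> 0" using u[of 0] w[of "a + 1"] assms(1) by auto
  consider "x \<in> {0..a}" | "x > a" | "x < 0" by force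
  then show ?thesis
  proof cases
    case 1
    then have "x\<^sup>2 \<le> a\<^sup>2" by (intro power_mono) auto
    then have "1 \<le> exp (a\<^sup>2) * exp (- x\<^sup>2)" by (simp add: exp_add[symmetric])
    then have "M * 1 \<le> M * (exp (a\<^sup>2) * exp (- x\<^sup>2))" using M by (intro mult_left_mono) auto
    moreover have "\<bar>lag_cut a u w x\<bar> = \<bar>u x\<bar>" using 1 by (simp add: lag_cut_def indicator_def)
    moreover have "0 \<le> M' * exp (- x\<^sup>2)" using M by simp
    ultimately show ?thesis using u[OF 1] by (simp add: distrib_right)
  next
    case 2
    then have "\<bar>lag_cut a u w x\<bar> = \<bar>w x\<bar> * exp (- x\<^sup>2)" by (simp add: lag_cut_def indicator_def abs_mult)
    also have "\<dots> \<le> M' * exp (- x\<^sup>2)" using w[OF 2] by (rule mult_right_mono) simp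
    also have "\<dots> \<le> (M * exp (a\<^sup>2) + M') * exp (- x\<^sup>2)" using M by (intro mult_right_mono) auto
    finally show ?thesis .
  next
    case 3
    then show ?thesis using M assms(1) by (simp add: lag_cut_def indicator_def)
  qed
qed

lemma lag_cut_asymp:
  assumes "a > 0" "\<And>x. x \<in> {0..a} \<Longrightarrow> \<bar>u x\<bar> \<le> M" "\<And>x. x > a \<Longrightarrow> \<bar>w x\<bar> \<le> M'"
    and [measurable]: "u \<in> borel_measurable borel" "w \<in> borel_measurable borel"
  shows "integrable lborel (lag_cut a u w)" "integrable lborel (\<lambda>x. lag_cut a u w x * lag n (x\<^sup>2))"
    "(\<lambda>n. \<integral>x. lag_cut a u w x * lag n (x\<^sup>2) \<partial>lborel) \<longlonglongrightarrow> 0"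
proof -
  have b: "\<bar>lag_cut a u w x\<bar> \<le> (M * exp (a\<^sup>2) + M') * exp (- x\<^sup>2)" for x
    using assms(1-3) by (rule lag_cut_bound)
  show "integrable lborel (lag_cut a u w)"
    by (rule integrable_lag_weight(2)[where K = "M * exp (a\<^sup>2) + M'"]) (use b in auto)
  show "integrable lborel (\<lambda>x. lag_cut a u w x * lag n (x\<^sup>2))"
    "(\<lambda>n. \<integral>x. lag_cut a u w x * lag n (x\<^sup>2) \<partial>lborel) \<longlonglongrightarrow> 0"
    by (rule lag_integral_tendsto_0[where K = "M * exp (a\<^sup>2) + M'"]; use b in simp)+
qed

abbreviation lag_cut1 :: "real \<Rightarrow> real \<Rightarrow> real" where
  "lag_cut1 a \<equiv> lag_cut a (\<lambda>x. (1 - exp (- x\<^sup>2)) / x) (\<lambda>x. 1 / x)"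

abbreviation lag_cut2 :: "real \<Rightarrow> real \<Rightarrow> real" where
  "lag_cut2 a \<equiv> lag_cut a (\<lambda>x. (1 - exp (- x\<^sup>2)) / x\<^sup>2) (\<lambda>x. 1 / x\<^sup>2)"

text \<open>\<open>(1 - exp (- x^2)) / x ^ 3\<close> behaves like \<open>1 / x\<close> at the
  origin; subtracting \<open>exp (- x^2) / x\<close> makes it bounded. The tail weight changes
  accordingly, and the compensating integral is that of \<open>integral_lag_harm\<close>.\<close>

abbreviation lag_cut3 :: "real \<Rightarrow> real \<Rightarrow> real" where
  "lag_cut3 a \<equiv> lag_cut a (\<lambda>x. (1 - exp (- x\<^sup>2)) / x ^ 3 - exp (- x\<^sup>2) / x) (\<lambda>x. 1 / x ^ 3 + 1 / x)"

lemma lag_cut1_bounds: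
  fixes a x :: real
  assumes "a > 0"
  shows "x \<in> {0..a} \<Longrightarrow> \<bar>(1 - exp (- x\<^sup>2)) / x\<bar> \<le> a" "x > a \<Longrightarrow> \<bar>1 / x\<bar> \<le> 1 / a"
proof -
  assume x: "x \<in> {0..a}"
  show "\<bar>(1 - exp (- x\<^sup>2)) / x\<bar> \<le> a"
  proof (cases "x = 0")
    case False
    then have "(1 - exp (- x\<^sup>2)) / x \<le> x\<^sup>2 / x" using x one_minus_exp_sq_bounds[of x] by (intro divide_right_mono) auto
    also have "\<dots> = x" by (simp add: power2_eq_square)
    finally show ?thesis using x one_minus_exp_sq_bounds[of x] by simp
  qed (use assms in simp)
next
  assume "x > a"
  then show "\<bar>1 / x\<bar> \<le> 1 / a" using assms by (simp add: frac_le)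
qed

lemma lag_cut2_bounds:
  fixes a x :: real
  assumes "a > 0"
  shows "x \<in> {0..a} \<Longrightarrow> \<bar>(1 - exp (- x\<^sup>2)) / x\<^sup>2\<bar> \<le> 1" "x > a \<Longrightarrow> \<bar>1 / x\<^sup>2\<bar> \<le> 1 / a\<^sup>2"
proof -
  show "\<bar>(1 - exp (- x\<^sup>2)) / x\<^sup>2\<bar> \<le> 1"
    using one_minus_exp_sq_bounds[of x] by (cases "x = 0") (auto simp: abs_of_nonneg divide_le_eq_1)
  assume "x > a"
  then show "\<bar>1 / x\<^sup>2\<bar> \<le> 1 / a\<^sup>2" using assms by (simp add: frac_le power_mono)
qed

lemma lag_cut3_bounds:
  fixes a x :: real
  assumes "a > 0"
  shows "x \<in> {0..a} \<Longrightarrow> \<bar>(1 - exp (- x\<^sup>2)) / x ^ 3 - exp (- x\<^sup>2) / x\<bar> \<le> a" "x > a \<Longrightarrow> \<bar>1 / x ^ 3 + 1 / x\<bar> \<le> 1 / a ^ 3 + 1 / a"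
proof -
  assume x: "x \<in> {0..a}"
  show "\<bar>(1 - exp (- x\<^sup>2)) / x ^ 3 - exp (- x\<^sup>2) / x\<bar> \<le> a"
  proof (cases "x = 0")
    case False
    then have x0: "x > 0" using x by (simp add: less_le)
    let ?E = "exp (- x\<^sup>2)"
    have e: "(1 - ?E) / x ^ 3 - ?E / x = (1 - (1 + x\<^sup>2) * ?E) / x ^ 3"
      using x0 by (simp add: field_simps eval_nat_numeral)
    have "(1 + x\<^sup>2) * ?E \<le> exp (x\<^sup>2) * ?E" using exp_ge_add_one_self[of "x\<^sup>2"] by (intro mult_right_mono) auto
    also have "\<dots> = 1" by (simp add: exp_minus)
    finally have 1: "0 \<le> (1 - (1 + x\<^sup>2) * ?E) / x ^ 3" using x0 by simp
    have "(1 + x\<^sup>2) * (1 - x\<^sup>2) \<le> (1 + x\<^sup>2) * ?E" using exp_ge_add_one_self[of "- x\<^sup>2"] by (intro mult_left_mono) auto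
    moreover have "(1 + x\<^sup>2) * (1 - x\<^sup>2) = 1 - x ^ 4" by (simp add: algebra_simps eval_nat_numeral)
    ultimately have "1 - (1 + x\<^sup>2) * ?E \<le> x ^ 4" by simp
    then have "(1 - (1 + x\<^sup>2) * ?E) / x ^ 3 \<le> x ^ 4 / x ^ 3" using x0 by (intro divide_right_mono) auto
    also have "\<dots> = x" using x0 by (simp add: eval_nat_numeral)
    finally show ?thesis unfolding e using 1 x by simp
  qed (use assms in simp)
next
  assume x: "x > a"
  then have "1 / x ^ 3 \<le> 1 / a ^ 3" "1 / x \<le> 1 / a" using assms by (auto intro!: frac_le power_mono)
  moreover have "0 \<le> 1 / x ^ 3" "0 \<le> 1 / x" using assms x by auto
  ultimately show "\<bar>1 / x ^ 3 + 1 / x\<bar> \<le> 1 / a ^ 3 + 1 / a" by linarith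
qed

text \<open>The substitution \<open>t = 1 - x^2 / n\<close> gives half the integral of
  \<open>(1 - t^n) / (1 - t)\<close> over the unit interval, the classical integral for harmonic
  numbers.\<close>

lemma integral_harm:
  assumes n: "n > 0"
  shows "((\<lambda>x. (1 - (1 - x\<^sup>2 / real n) ^ n) / x) has_integral (harm n / 2)) {0..sqrt (real n)}"
proof -
  let ?F = "\<lambda>x. - (1/2) * (\<Sum>j<n. (1 - x\<^sup>2 / real n) ^ Suc j / real (Suc j))"
  have D: "(?F has_real_derivative ((1 - (1 - x\<^sup>2 / real n) ^ n) / x)) (at x)" for x
  proof -
    have d: "((\<lambda>x. (1 - x\<^sup>2 / real n) ^ Suc j / real (Suc j)) has_real_derivative ((1 - x\<^sup>2 / real n) ^ j * (- (2 * x) / real n))) (at x)" for j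
    proof -
      have i: "((\<lambda>x. 1 - x\<^sup>2 / real n) has_real_derivative (- (2 * x) / real n)) (at x)"
        using n by (auto intro!: derivative_eq_intros)
      show ?thesis by (rule DERIV_cong[OF DERIV_cdivide[OF DERIV_power[OF i]]]) (simp del: of_nat_Suc)
    qed
    have "(?F has_real_derivative (- (1/2) * (\<Sum>j<n. (1 - x\<^sup>2 / real n) ^ j * (- (2 * x) / real n)))) (at x)"
      by (intro DERIV_cmult DERIV_sum d)
    also have "- (1/2) * (\<Sum>j<n. (1 - x\<^sup>2 / real n) ^ j * (- (2 * x) / real n)) = (\<Sum>j<n. (1 - x\<^sup>2 / real n) ^ j) * (x / real n)"
      unfolding sum_distrib_right[symmetric] by simp
    also have "\<dots> = (1 - (1 - x\<^sup>2 / real n) ^ n) / x"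
    proof (cases "x = 0")
      case False
      have "(1 - (1 - x\<^sup>2 / real n) ^ n) = (x\<^sup>2 / real n) * (\<Sum>j<n. (1 - x\<^sup>2 / real n) ^ j)"
        by (subst one_diff_power_eq) simp
      then show ?thesis using False by (simp add: power2_eq_square)
    qed simp
    finally show ?thesis .
  qed
  have "((\<lambda>x. (1 - (1 - x\<^sup>2 / real n) ^ n) / x) has_integral (?F (sqrt (real n)) - ?F 0)) {0..sqrt (real n)}"
  proof (rule fundamental_theorem_of_calculus)
    show "(?F has_vector_derivative ((1 - (1 - x\<^sup>2 / real n) ^ n) / x)) (at x within {0..sqrt (real n)})" for x
      by (rule has_vector_derivative_at_within, rule D[unfolded has_real_derivative_iff_has_vector_derivative])
  qed simp
  also have "?F (sqrt (real n)) - ?F 0 = harm n / 2"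
  proof -
    have "(\<Sum>j<n. 1 / real (Suc j)) = (harm n :: real)"
      unfolding harm_def inverse_eq_divide by (rule sum.reindex_bij_witness[of _ "\<lambda>i. i - 1" Suc]) auto
    then show ?thesis using n by simp
  qed
  finally show ?thesis .
qed

text \<open>\<open>exp (- x^2)\<close> is the limit of \<open>(1 - x^2 / n)^n\<close>. With that
  power in its place, on \<open>[0, sqrt n]\<close>, the integral is
  \<open>harm n / 2 - ln (sqrt n / a)\<close>, and Euler's constant appears in the limit.\<close>

lemma integral_lag_cut1:
  assumes a: "a > 0"
  shows "(\<integral>x. lag_cut1 a x \<partial>lborel) = euler_mascheroni / 2 + ln a"
proof -
  define r where "r n x = (1 - x\<^sup>2 / real n) ^ n" for n and x :: real
  define f where "f n x = (1 - r n x) / x * indicator {0..sqrt (real n)} x - 1 / x * indicator {a..sqrt (real n)} x" for n and x :: real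
  \<comment> \<open>From \<open>n = m\<close> on, the interval \<open>[0, sqrt n]\<close> contains
    the cut point \<open>a\<close>.\<close>
  obtain m :: nat where m: "a\<^sup>2 < real m" using reals_Archimedean2 by blast
  then have m0: "m > 0" by (intro gr0I) simp
  have r01: "0 \<le> r n x" "r n x \<le> exp (- x\<^sup>2)" "1 - x\<^sup>2 \<le> r n x" if "0 \<le> x" "x \<le> sqrt (real n)" "n > 0" for n x
  proof -
    have x2: "x\<^sup>2 \<le> real n" using power_mono[OF that(2) that(1), of 2] by simp
    then have y: "0 \<le> 1 - x\<^sup>2 / real n" using that by (simp add: divide_le_eq_1)
    then show "0 \<le> r n x" by (simp add: r_def)
    have "r n x \<le> exp (- x\<^sup>2 / real n) ^ n" unfolding r_def
      using exp_ge_add_one_self[of "- x\<^sup>2 / real n"] y by (intro power_mono) auto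
    also have "\<dots> = exp (- x\<^sup>2)" using that by (simp add: exp_of_nat_mult[symmetric])
    finally show "r n x \<le> exp (- x\<^sup>2)" .
    have "1 + real n * (- x\<^sup>2 / real n) \<le> (1 + (- x\<^sup>2 / real n)) ^ n"
      by (rule Bernoulli_inequality) (use y in auto)
    then show "1 - x\<^sup>2 \<le> r n x" using that by (simp add: r_def)
  qed
  have fm: "f n \<in> borel_measurable borel" for n unfolding f_def r_def by measurable
  have I: "(\<integral>x. f n x \<partial>lborel) = harm n / 2 - (ln (sqrt (real n)) - ln a)" if "n \<ge> m" for n
  proof -
    have n0: "n > 0" using that m0 by simp
    have an: "a \<le> sqrt (real n)" using that m a by (intro real_le_rsqrt) auto
    have b: "\<bar>(1 - r n x) / x\<bar> \<le> sqrt (real n)" if "x \<in> {0..sqrt (real n)}" for x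
    proof (cases "x = 0")
      case False
      have "0 \<le> x" using that by simp
      with False have x: "x > 0" by linarith
      have "r n x \<le> 1" by (rule order_trans[OF r01(2)]) (use that n0 in auto)
      moreover have "(1 - r n x) / x \<le> x\<^sup>2 / x" using r01(3)[of x n] that n0 x by (intro divide_right_mono) auto
      then have "(1 - r n x) / x \<le> x" by (simp add: power2_eq_square)
      ultimately show ?thesis using that x by (simp add: abs_of_nonneg)
    qed simp
    have "has_bochner_integral lborel (\<lambda>x. (1 - r n x) / x * indicator {0..sqrt (real n)} x) (harm n / 2)"
      unfolding r_def
      by (rule has_bochner_integral_of_henstock[OF integrable_bounded_interval[OF _ b[unfolded r_def]] integral_harm[OF n0]]) auto
    moreover have "has_bochner_integral lborel (\<lambda>x. 1 / x * indicator {a..sqrt (real n)} x) (ln (sqrt (real n)) - ln a)"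
      using an a by (intro has_bochner_integral_FTC_Icc_real) (auto intro!: derivative_eq_intros continuous_intros)
    ultimately have "has_bochner_integral lborel (f n) (harm n / 2 - (ln (sqrt (real n)) - ln a))"
      unfolding f_def by (rule has_bochner_integral_diff)
    then show ?thesis by (rule has_bochner_integral_integral_eq)
  qed
  let ?K = "\<lambda>x. (a * exp (a\<^sup>2) + 1 / a) * exp (- x\<^sup>2) :: real"
  have lim: "(\<lambda>n. \<integral>x. f (n + m) x \<partial>lborel) \<longlonglongrightarrow> (\<integral>x. lag_cut1 a x \<partial>lborel)"
  proof (rule integral_dominated_convergence)
    show "integrable lborel ?K"
      by (rule integrable_lag_weight(2)[where K = "a * exp (a\<^sup>2) + 1 / a"]) (use a in \<open>auto simp: abs_of_nonneg\<close>)
    show "AE x in lborel. (\<lambda>n. f (n + m) x) \<longlonglongrightarrow> lag_cut1 a x"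
      using AE_lborel_singleton[of a]
    proof eventually_elim
      case (elim x)
      have rl: "(\<lambda>n. r n x) \<longlonglongrightarrow> exp (- x\<^sup>2)"
        using tendsto_exp_limit_sequentially[of "- x\<^sup>2"] by (simp add: r_def)
      obtain k :: nat where k: "x\<^sup>2 < real k" using reals_Archimedean2 by blast
      have sq: "x \<le> sqrt (real n)" if "n \<ge> k" for n
        using k that by (intro real_le_rsqrt) auto
      consider "x < 0" | "x \<in> {0..a}" | "x > a" by force
      then have "(\<lambda>n. f n x) \<longlonglongrightarrow> lag_cut1 a x"
      proof cases
        case 1
        then show ?thesis using a by (simp add: f_def lag_cut_def indicator_def)
      next
        case 2
        have "(\<lambda>n. (1 - r n x) / x) \<longlonglongrightarrow> (1 - exp (- x\<^sup>2)) / x"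
          unfolding divide_inverse by (intro tendsto_intros rl)
        moreover have "eventually (\<lambda>n. f n x = (1 - r n x) / x) sequentially"
          using eventually_ge_at_top[of k] by eventually_elim (use 2 elim sq in \<open>auto simp: f_def indicator_def\<close>)
        ultimately have "(\<lambda>n. f n x) \<longlonglongrightarrow> (1 - exp (- x\<^sup>2)) / x" by (simp add: tendsto_cong)
        then show ?thesis using 2 by (simp add: lag_cut_def indicator_def)
      next
        case 3
        have "(\<lambda>n. - r n x * (1 / x)) \<longlonglongrightarrow> - exp (- x\<^sup>2) * (1 / x)" by (intro tendsto_intros rl)
        moreover have "eventually (\<lambda>n. f n x = - r n x * (1 / x)) sequentially"
          using eventually_ge_at_top[of k] by eventually_elim (use 3 sq a in \<open>auto simp: f_def indicator_def diff_divide_distrib\<close>)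
        ultimately have "(\<lambda>n. f n x) \<longlonglongrightarrow> - exp (- x\<^sup>2) * (1 / x)" by (simp add: tendsto_cong)
        then show ?thesis using 3 a by (simp add: lag_cut_def indicator_def)
      qed
      then show ?case by (rule LIMSEQ_ignore_initial_segment)
    qed
    fix n0 :: nat
    define n where "n = n0 + m"
    have n: "n > 0" "a \<le> sqrt (real n)" using m m0 a by (auto simp: n_def intro!: real_le_rsqrt)
    show "AE x in lborel. norm (f (n0 + m) x) \<le> ?K x"
      using AE_lborel_singleton[of a]
    proof eventually_elim
      case (elim x)
      \<comment> \<open>In the shape of a \<open>lag_cut\<close> the truncated integrand falls under
        \<open>lag_cut_bound\<close>, with a bound free of \<open>n\<close>. The indicators disagree
        only at \<open>x = a\<close>, hence the exception.\<close>
      have "f n x = lag_cut a (\<lambda>x. (1 - r n x) / x) (\<lambda>x. if x \<le> sqrt (real n) then exp (x\<^sup>2) * r n x / x else 0) x"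
        using a n(2) elim by (auto simp: f_def lag_cut_def indicator_def diff_divide_distrib exp_minus)
      also have "\<bar>\<dots>\<bar> \<le> ?K x"
      proof (rule lag_cut_bound[OF a])
        fix x assume x: "x \<in> {0..a}"
        show "\<bar>(1 - r n x) / x\<bar> \<le> a"
        proof (cases "x = 0")
          case False
          then have x0: "x > 0" using x by (simp add: less_le)
          have xs: "x \<le> sqrt (real n)" using x n by simp
          have "r n x \<le> 1" by (rule order_trans[OF r01(2)]) (use x xs n in auto)
          moreover have "(1 - r n x) / x \<le> x\<^sup>2 / x" using r01(3)[of x n] x n xs x0 by (intro divide_right_mono) auto
          then have "(1 - r n x) / x \<le> x" by (simp add: power2_eq_square)
          ultimately show ?thesis using x x0 by (simp add: abs_of_nonneg)
        qed (use a in simp)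
      next
        fix x assume x: "x > a"
        show "\<bar>if x \<le> sqrt (real n) then exp (x\<^sup>2) * r n x / x else 0\<bar> \<le> 1 / a"
        proof (cases "x \<le> sqrt (real n)")
          case True
          have "exp (x\<^sup>2) * r n x \<le> exp (x\<^sup>2) * exp (- x\<^sup>2)"
            using r01(2)[of x n] True x a n by (intro mult_left_mono) auto
          also have "\<dots> = 1" by (simp add: exp_minus)
          finally have "exp (x\<^sup>2) * r n x / x \<le> 1 / a" using x a by (intro frac_le) auto
          moreover have "0 \<le> exp (x\<^sup>2) * r n x / x" using r01(1)[of x n] True x a n by auto
          ultimately show ?thesis using True by simp
        qed (use a in simp)
      qed
      finally show ?case by (simp add: n_def)
    qed
  qed (use fm in auto)
  have "(\<lambda>n. (harm n - ln (real n)) / 2 + ln a :: real) \<longlonglongrightarrow> euler_mascheroni / 2 + ln a"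
    by (intro tendsto_intros euler_mascheroni_LIMSEQ) simp
  then have "(\<lambda>n. (harm (n + m) - ln (real (n + m))) / 2 + ln a :: real) \<longlonglongrightarrow> euler_mascheroni / 2 + ln a"
    by (rule LIMSEQ_ignore_initial_segment)
  moreover have "(\<integral>x. f (n + m) x \<partial>lborel) = (harm (n + m) - ln (real (n + m))) / 2 + ln a" for n
    using m0 by (subst I) (auto simp: ln_sqrt diff_divide_distrib)
  ultimately show ?thesis using lim by (simp only:) (rule LIMSEQ_unique)
qed

text \<open>\<open>- (1 - exp (- x^2)) / (2 x^2)\<close> is a primitive on \<open>(0, a]\<close>,
  and the tail is \<open>has_bochner_integral_gauss_tail\<close>; the terms with
  \<open>exp (- a^2)\<close> cancel.\<close>

lemma integral_lag_cut3:
  assumes a: "a > 0"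
  shows "(\<integral>x. lag_cut3 a x \<partial>lborel) = 1 / 2 - 1 / (2 * a\<^sup>2)"
proof -
  let ?h = "\<lambda>x::real. (1 - exp (- x\<^sup>2)) / x ^ 3 - exp (- x\<^sup>2) / x"
  \<comment> \<open>Plain division would give \<open>0\<close> at the origin, whereas the limit is
    \<open>- 1 / 2\<close>.\<close>
  let ?F = "\<lambda>x::real. if x = 0 then - 1 / 2 else - (1 - exp (- x\<^sup>2)) / (2 * x\<^sup>2)"
  have cF: "continuous_on {0..a} ?F"
  proof (rule continuous_on_eq_continuous_within[THEN iffD2], rule ballI)
    fix x assume x: "x \<in> {0..a}"
    show "continuous (at x within {0..a}) ?F"
    proof (cases "x = 0")
      case True
      have "((\<lambda>x::real. - (1 - exp (- x\<^sup>2)) / (2 * x\<^sup>2)) \<longlongrightarrow> - 1 / 2) (at_right 0)" by real_asymp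
      moreover have "eventually (\<lambda>x::real. ?F x = - (1 - exp (- x\<^sup>2)) / (2 * x\<^sup>2)) (at_right 0)"
        by (auto simp: eventually_at_filter)
      ultimately have "(?F \<longlongrightarrow> - 1 / 2) (at_right 0)" by (simp add: tendsto_cong)
      then show ?thesis unfolding True continuous_within using a by (simp add: at_within_Icc_at_right)
    next
      case False
      then have x0: "x > 0" using x by (simp add: less_le)
      have "isCont (\<lambda>x. - (1 - exp (- x\<^sup>2)) / (2 * x\<^sup>2)) x" using x0 by (intro continuous_intros) auto
      moreover have "eventually (\<lambda>y. - (1 - exp (- y\<^sup>2)) / (2 * y\<^sup>2) = ?F y) (nhds x)"
        using eventually_nhds_in_open[of "{0<..}" x] x0 by (auto elim!: eventually_mono)
      ultimately have "isCont ?F x" using isCont_cong by fast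
      then show ?thesis by (rule continuous_at_imp_continuous_at_within)
    qed
  qed
  have "(?h has_integral (?F a - ?F 0)) {0..a}"
  proof (rule fundamental_theorem_of_calculus_interior)
    fix x assume x: "x \<in> {0<..<a}"
    have "((\<lambda>x. - (1 - exp (- x\<^sup>2)) / (2 * x\<^sup>2)) has_real_derivative ?h x) (at x)"
      using x by (auto intro!: derivative_eq_intros simp: divide_simps) (simp add: algebra_simps eval_nat_numeral)
    moreover have "eventually (\<lambda>y. - (1 - exp (- y\<^sup>2)) / (2 * y\<^sup>2) = ?F y) (nhds x)"
      using eventually_nhds_in_open[of "{0<..}" x] x by (auto elim!: eventually_mono)
    ultimately have "(?F has_real_derivative ?h x) (at x)" by (subst (asm) DERIV_cong_ev[OF refl _ refl]) auto
    then show "(?F has_vector_derivative ?h x) (at x)"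
      by (simp add: has_real_derivative_iff_has_vector_derivative)
  qed (use a cF in auto)
  then have "has_bochner_integral lborel (\<lambda>x. ?h x * indicator {0..a} x) (?F a - ?F 0)"
    by (rule has_bochner_integral_of_henstock[OF integrable_bounded_interval[OF _ lag_cut3_bounds(1)[OF a]], rotated -1]) auto
  from has_bochner_integral_diff[OF this has_bochner_integral_gauss_tail[OF a]]
  have "has_bochner_integral lborel (\<lambda>x. ?h x * indicator {0..a} x - exp (- x\<^sup>2) * (1 / x ^ 3 + 1 / x) * indicator {a..} x) (?F a - ?F 0 - exp (- a\<^sup>2) / (2 * a\<^sup>2))" .
  moreover have "AE x in lborel. ?h x * indicator {0..a} x - exp (- x\<^sup>2) * (1 / x ^ 3 + 1 / x) * indicator {a..} x = lag_cut3 a x"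
    using AE_lborel_singleton[of a] by eventually_elim (auto simp: lag_cut_def indicator_def)
  ultimately have "has_bochner_integral lborel (lag_cut3 a) (?F a - ?F 0 - exp (- a\<^sup>2) / (2 * a\<^sup>2))"
    by (subst (asm) has_bochner_integral_cong_AE) auto
  then show ?thesis using a by (simp add: has_bochner_integral_iff diff_divide_distrib)
qed

lemma lag_cut1_asymp:
  assumes a: "a > 0"
  shows "integrable lborel (lag_cut1 a)" "integrable lborel (\<lambda>x. lag_cut1 a x * lag n (x\<^sup>2))"
    "(\<lambda>n. \<integral>x. lag_cut1 a x * lag n (x\<^sup>2) \<partial>lborel) \<longlonglongrightarrow> 0"
  by (rule lag_cut_asymp[OF a lag_cut1_bounds[OF a]]; (measurable | assumption))+

lemma lag_cut2_asymp:
  assumes a: "a > 0"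
  shows "integrable lborel (lag_cut2 a)" "integrable lborel (\<lambda>x. lag_cut2 a x * lag n (x\<^sup>2))"
    "(\<lambda>n. \<integral>x. lag_cut2 a x * lag n (x\<^sup>2) \<partial>lborel) \<longlonglongrightarrow> 0"
  by (rule lag_cut_asymp[OF a lag_cut2_bounds[OF a]]; (measurable | assumption))+

lemma lag_cut3_asymp:
  assumes a: "a > 0"
  shows "integrable lborel (lag_cut3 a)" "integrable lborel (\<lambda>x. lag_cut3 a x * lag n (x\<^sup>2))"
    "(\<lambda>n. \<integral>x. lag_cut3 a x * lag n (x\<^sup>2) \<partial>lborel) \<longlonglongrightarrow> 0"
  by (rule lag_cut_asymp[OF a lag_cut3_bounds[OF a]]; (measurable | assumption))+

text \<open>The integral of \<open>(1 - lag n (x^2)) / x ^ j\<close> over \<open>[0, a]\<close>, as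
  a finite sum so that hook sums can be matched term by term. It is used for \<open>j <= 2\<close>,
  where the subtraction in the exponent is exact.\<close>

definition lag_moment :: "nat \<Rightarrow> nat \<Rightarrow> real \<Rightarrow> real" where
  "lag_moment j n a = (\<Sum>k<n. real (n choose Suc k) * (-1) ^ k / fact (Suc k) * (a ^ Suc (2 * k + 2 - j) / real (Suc (2 * k + 2 - j))))"

text \<open>The analogue for \<open>x ^ 3\<close>, where the Taylor term \<open>- n x^2\<close> has
  to be removed as well for the integral to converge at the origin.\<close>

definition lag_moment3 :: "nat \<Rightarrow> real \<Rightarrow> real" where
  "lag_moment3 n a = (\<Sum>k<n. real (n choose (k + 2)) * (-1) ^ k / fact (k + 2) * (a ^ Suc (2 * k + 1) / real (Suc (2 * k + 1))))"

lemma has_bochner_integral_power0: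
  "0 \<le> a \<Longrightarrow> has_bochner_integral lborel (\<lambda>x::real. x ^ k * indicator {0..a} x) (a ^ Suc k / real (Suc k))"
proof -
  assume a: "0 \<le> a"
  have "((\<lambda>x. x ^ Suc k / real (Suc k)) has_real_derivative x ^ k) (at x)" for x
    by (rule DERIV_cong[OF DERIV_cdivide[OF DERIV_pow]]) (simp del: of_nat_Suc)
  then have "has_bochner_integral lborel (\<lambda>x. x ^ k * indicator {0..a} x) (a ^ Suc k / real (Suc k) - 0 ^ Suc k / real (Suc k))"
    by (intro has_bochner_integral_FTC_Icc_real[of 0 a "\<lambda>x. x ^ Suc k / real (Suc k)"] a continuous_intros)
  then show ?thesis by simp
qed

lemma lag_moment_integral:
  assumes "0 \<le> a" "j \<le> 2"
  shows "has_bochner_integral lborel (\<lambda>x. (1 - lag n (x\<^sup>2)) / x ^ j * indicator {0..a} x) (lag_moment j n a)"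
proof -
  have "has_bochner_integral lborel (\<lambda>x. \<Sum>k<n. real (n choose Suc k) * (-1) ^ k / fact (Suc k) * (x ^ (2 * k + 2 - j) * indicator {0..a} x)) (lag_moment j n a)"
    unfolding lag_moment_def
    by (intro has_bochner_integral_sum has_bochner_integral_mult_right has_bochner_integral_power0 assms)
  \<comment> \<open>At the origin a term \<open>x ^ 0 = 1\<close> can face a quotient that is
    \<open>0\<close>, so equality is claimed almost everywhere.\<close>
  moreover have "AE x in lborel. (\<Sum>k<n. real (n choose Suc k) * (-1) ^ k / fact (Suc k) * (x ^ (2 * k + 2 - j) * indicator {0..a} x)) = 
    (1 - lag n (x\<^sup>2)) / x ^ j * indicator {0..a} x"
    using AE_lborel_singleton[of "0::real"]
  proof eventually_elim
    case (elim x)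
    have "(x\<^sup>2) ^ Suc k / x ^ j = x ^ (2 * k + 2 - j)" for k
    proof -
      have "(x\<^sup>2) ^ Suc k = x ^ (2 * k + 2)" unfolding power_mult[symmetric] by simp
      then show ?thesis using elim assms(2) power_diff[of x j "2 * k + 2"] by simp
    qed
    then have "c * (x\<^sup>2) ^ Suc k / x ^ j = c * x ^ (2 * k + 2 - j)" for k c
      by (simp only: times_divide_eq_right[symmetric])
    moreover have "1 - lag n (x\<^sup>2) = (\<Sum>k<n. real (n choose Suc k) * (-1) ^ k / fact (Suc k) * (x\<^sup>2) ^ Suc k)"
      unfolding lag_split1 by (simp add: sum_negf del: fact_Suc)
    ultimately have "(1 - lag n (x\<^sup>2)) / x ^ j = (\<Sum>k<n. real (n choose Suc k) * (-1) ^ k / fact (Suc k) * x ^ (2 * k + 2 - j))"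
      by (simp only: sum_divide_distrib)
    then show ?case by (simp only: sum_distrib_right mult.assoc)
  qed
  ultimately show ?thesis by (subst (asm) has_bochner_integral_cong_AE) auto
qed

lemma lag_moment3_integral:
  assumes "0 \<le> a"
  shows "has_bochner_integral lborel (\<lambda>x. (lag n (x\<^sup>2) - 1 + real n * x\<^sup>2) / x ^ 3 * indicator {0..a} x) (lag_moment3 n a)"
proof -
  have "has_bochner_integral lborel (\<lambda>x. \<Sum>k<n. real (n choose (k + 2)) * (-1) ^ k / fact (k + 2) * (x ^ (2 * k + 1) * indicator {0..a} x)) (lag_moment3 n a)"
    unfolding lag_moment3_def
    by (intro has_bochner_integral_sum has_bochner_integral_mult_right has_bochner_integral_power0 assms)
  moreover have "AE x in lborel. (\<Sum>k<n. real (n choose (k + 2)) * (-1) ^ k / fact (k + 2) * (x ^ (2 * k + 1) * indicator {0..a} x)) = 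
    (lag n (x\<^sup>2) - 1 + real n * x\<^sup>2) / x ^ 3 * indicator {0..a} x"
    using AE_lborel_singleton[of "0::real"]
  proof eventually_elim
    case (elim x)
    have "(x\<^sup>2) ^ (j + 2) / x ^ 3 = x ^ (2 * j + 1)" for j
      using elim by (simp add: power_mult[symmetric] power_add field_simps eval_nat_numeral)
    then have "c * (x\<^sup>2) ^ (j + 2) / x ^ 3 = c * x ^ (2 * j + 1)" for j c
      by (simp only: times_divide_eq_right[symmetric])
    moreover have "lag n (x\<^sup>2) - 1 + real n * x\<^sup>2 = (\<Sum>j<n. real (n choose (j + 2)) * (-1) ^ j / fact (j + 2) * (x\<^sup>2) ^ (j + 2))"
      unfolding lag_split2 by simp
    ultimately have "(lag n (x\<^sup>2) - 1 + real n * x\<^sup>2) / x ^ 3 = (\<Sum>k<n. real (n choose (k + 2)) * (-1) ^ k / fact (k + 2) * x ^ (2 * k + 1))"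
      by (simp only: sum_divide_distrib)
    then show ?case by (simp only: sum_distrib_right mult.assoc)
  qed
  ultimately show ?thesis by (subst (asm) has_bochner_integral_cong_AE) auto
qed

lemma lag_moment0_tendsto:
  assumes a: "a > 0" shows "(\<lambda>n. lag_moment 0 n a) \<longlonglongrightarrow> a"
proof -
  have L: "integrable lborel (\<lambda>x. lag_cut a (\<lambda>_. 1) (\<lambda>_. 0) x * lag n (x\<^sup>2))"
    "(\<lambda>n. \<integral>x. lag_cut a (\<lambda>_. 1) (\<lambda>_. 0) x * lag n (x\<^sup>2) \<partial>lborel) \<longlonglongrightarrow> 0" for n
    by (rule lag_cut_asymp[OF a, where M = 1 and M' = 0]; simp)+
  have "lag_moment 0 n a = a - (\<integral>x. lag_cut a (\<lambda>_. 1) (\<lambda>_. 0) x * lag n (x\<^sup>2) \<partial>lborel)" for n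
  proof -
    have "has_bochner_integral lborel (\<lambda>x. x ^ 0 * indicator {0..a} x - lag_cut a (\<lambda>_. 1) (\<lambda>_. 0) x * lag n (x\<^sup>2)) (a ^ Suc 0 / real (Suc 0) - (\<integral>x. lag_cut a (\<lambda>_. 1) (\<lambda>_. 0) x * lag n (x\<^sup>2) \<partial>lborel))"
      by (intro has_bochner_integral_diff has_bochner_integral_power0 has_bochner_integral_integrable L(1)) (use a in auto)
    also have "(\<lambda>x. x ^ 0 * indicator {0..a} x - lag_cut a (\<lambda>_. 1) (\<lambda>_. 0) x * lag n (x\<^sup>2)) = (\<lambda>x. (1 - lag n (x\<^sup>2)) / x ^ 0 * indicator {0..a} x)"
      by (rule ext) (simp add: lag_cut_def indicator_def)
    finally show ?thesis using has_bochner_integral_eq[OF _ lag_moment_integral[of a 0 n]] a by auto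
  qed
  moreover have "(\<lambda>n. a - (\<integral>x. lag_cut a (\<lambda>_. 1) (\<lambda>_. 0) x * lag n (x\<^sup>2) \<partial>lborel)) \<longlonglongrightarrow> a - 0"
    by (intro tendsto_intros L(2))
  ultimately show ?thesis by simp
qed

text \<open>On \<open>[0, a]\<close> the integrand equals the Gaussian-weighted one on the half-line
  plus \<open>lag_cut1 a\<close> minus \<open>lag_cut1 a * lag n (x^2)\<close>. The first two have
  exact integrals, and the third integral vanishes in the limit.\<close>

lemma lag_moment1_tendsto:
  assumes a: "a > 0" shows "(\<lambda>n. lag_moment 1 n a - harm n / 2) \<longlonglongrightarrow> euler_mascheroni / 2 + ln a"
proof -
  note L = lag_cut1_asymp[OF a]
  let ?I = "\<lambda>n. \<integral>x. lag_cut1 a x * lag n (x\<^sup>2) \<partial>lborel"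
  have "lag_moment 1 n a = harm n / 2 + (\<integral>x. lag_cut1 a x \<partial>lborel) - ?I n" for n
  proof -
    have "has_bochner_integral lborel (\<lambda>x. exp (- x\<^sup>2) * ((1 - lag n (x\<^sup>2)) / x) * indicator {0..} x + lag_cut1 a x - lag_cut1 a x * lag n (x\<^sup>2))
       (harm n / 2 + (\<integral>x. lag_cut1 a x \<partial>lborel) - ?I n)"
      by (intro has_bochner_integral_diff has_bochner_integral_add integral_lag_harm has_bochner_integral_integrable L)
    also have "(\<lambda>x. exp (- x\<^sup>2) * ((1 - lag n (x\<^sup>2)) / x) * indicator {0..} x + lag_cut1 a x - lag_cut1 a x * lag n (x\<^sup>2)) = 
      (\<lambda>x. (1 - lag n (x\<^sup>2)) / x ^ 1 * indicator {0..a} x)"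
    proof (rule ext)
      fix x
      have "E * ((1 - P) / x) + (1 - E) / x - (1 - E) / x * P = (1 - P) / x" for E P :: real
        by (simp add: divide_inverse algebra_simps)
      moreover have "E * ((1 - P) / x) - E * (1 / x) + E * (1 / x) * P = 0" for E P :: real
        by (simp add: divide_inverse algebra_simps)
      ultimately show "exp (- x\<^sup>2) * ((1 - lag n (x\<^sup>2)) / x) * indicator {0..} x + lag_cut1 a x - lag_cut1 a x * lag n (x\<^sup>2) = 
        (1 - lag n (x\<^sup>2)) / x ^ 1 * indicator {0..a} x"
        using a by (simp add: lag_cut_def indicator_def)
    qed
    finally show ?thesis using has_bochner_integral_eq[OF _ lag_moment_integral[of a 1 n]] a by auto
  qed
  moreover have "(\<lambda>n. (\<integral>x. lag_cut1 a x \<partial>lborel) - ?I n) \<longlonglongrightarrow> euler_mascheroni / 2 + ln a - 0"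
    unfolding integral_lag_cut1[OF a] by (intro tendsto_intros L)
  ultimately show ?thesis by simp
qed

text \<open>Here the Gaussian multiplies \<open>lag\<close> alone and not the constant
  \<open>1\<close>; the tail of \<open>1 / x^2\<close> beyond \<open>a\<close> then accounts for
  \<open>1 / a\<close>.\<close>

lemma lag_moment2_eq:
  assumes a: "a > 0"
  shows "lag_moment 2 n a = lag_sqrt n - 1 / a - (\<integral>x. lag_cut2 a x * lag n (x\<^sup>2) \<partial>lborel)"
proof -
  note L = lag_cut2_asymp[OF a]
  let ?I = "\<lambda>n. \<integral>x. lag_cut2 a x * lag n (x\<^sup>2) \<partial>lborel"
  have "has_bochner_integral lborel (\<lambda>x. (1 - exp (- x\<^sup>2) * lag n (x\<^sup>2)) / x\<^sup>2 * indicator {0..} x - 1 / x\<^sup>2 * indicator {a..} x - lag_cut2 a x * lag n (x\<^sup>2))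
     (lag_sqrt n - 1 / a - ?I n)"
    unfolding lag_sqrt_def
    by (intro has_bochner_integral_diff integral_lag_sqrt has_bochner_integral_inverse_square_tail has_bochner_integral_integrable L a)
  moreover have "AE x in lborel. (1 - exp (- x\<^sup>2) * lag n (x\<^sup>2)) / x\<^sup>2 * indicator {0..} x - 1 / x\<^sup>2 * indicator {a..} x - lag_cut2 a x * lag n (x\<^sup>2) = 
    (1 - lag n (x\<^sup>2)) / x\<^sup>2 * indicator {0..a} x"
    using AE_lborel_singleton[of a]
  proof eventually_elim
    case (elim x)
    have "(1 - E * P) / y - (1 - E) / y * P = (1 - P) / y" for E P y :: real
      by (simp add: divide_inverse algebra_simps)
    moreover have "(1 - E * P) / y - 1 / y + E * (1 / y) * P = 0" for E P y :: real
      by (simp add: divide_inverse algebra_simps)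
    ultimately show ?case using a elim by (simp add: lag_cut_def indicator_def)
  qed
  ultimately have "has_bochner_integral lborel (\<lambda>x. (1 - lag n (x\<^sup>2)) / x\<^sup>2 * indicator {0..a} x) (lag_sqrt n - 1 / a - ?I n)"
    by (subst (asm) has_bochner_integral_cong_AE) auto
  then show ?thesis using has_bochner_integral_eq[OF _ lag_moment_integral[of a 2 n]] a by auto
qed

lemma lag_moment2_tendsto:
  assumes a: "a > 0" shows "(\<lambda>n. lag_moment 2 n a - 2 * sqrt (real n)) \<longlonglongrightarrow> - 1 / a"
proof -
  note L = lag_cut2_asymp[OF a]
  have "(\<lambda>n. (lag_sqrt n - 2 * sqrt (real n)) - 1 / a - (\<integral>x. lag_cut2 a x * lag n (x\<^sup>2) \<partial>lborel)) \<longlonglongrightarrow> 0 - 1 / a - 0"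
    by (intro tendsto_intros L lag_sqrt_tendsto)
  then show ?thesis unfolding lag_moment2_eq[OF a] by (simp add: algebra_simps)
qed

lemma sqrt_gauss_bound: "sqrt (2 + x\<^sup>2) * exp (x\<^sup>2 / 2) \<le> 2 * exp (x\<^sup>2)" for x :: real
proof -
  have "2 + x\<^sup>2 \<le> 2 * (1 + x\<^sup>2)" by simp
  also have "\<dots> \<le> 2 * exp (x\<^sup>2)" using exp_ge_add_one_self[of "x\<^sup>2"] by (intro mult_left_mono) auto
  also have "\<dots> \<le> (2 * exp (x\<^sup>2 / 2))\<^sup>2" by (simp add: power_mult_distrib exp_double[symmetric])
  finally have "sqrt (2 + x\<^sup>2) \<le> 2 * exp (x\<^sup>2 / 2)" by (intro real_le_lsqrt) auto
  then have "sqrt (2 + x\<^sup>2) * exp (x\<^sup>2 / 2) \<le> 2 * exp (x\<^sup>2 / 2) * exp (x\<^sup>2 / 2)" by (rule mult_right_mono) simp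
  also have "\<dots> = 2 * exp (x\<^sup>2)" by (simp add: exp_add[symmetric])
  finally show ?thesis .
qed

text \<open>Uniformity as \<open>a\<close> approaches \<open>0\<close> is essential, since
  \<open>a\<close> becomes \<open>4 sin x\<close>; the factor \<open>a\<close> absorbs the blow-up
  \<open>3 / a\<close>. The two numbers are the values at \<open>a = 4\<close> of
  \<open>2 a + 3\<close> and \<open>2 exp 16 a^2\<close>, where \<open>exp 16\<close> comes from
  bounding the Laguerre polynomial for arguments up to \<open>4^2\<close>.\<close>

lemma lag_moment2_error:
  assumes a: "0 < a" "a \<le> 4"
  shows "a * \<bar>lag_moment 2 n a - 2 * sqrt (real n)\<bar> \<le> 11 + 32 * exp 16"
proof -
  note L = lag_cut2_asymp[OF a(1)]
  let ?I = "\<integral>x. lag_cut2 a x * lag n (x\<^sup>2) \<partial>lborel"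
  have B: "has_bochner_integral lborel (\<lambda>x. (2 * exp 16) * (x ^ 0 * indicator {0..a} x) + 2 * (1 / x\<^sup>2 * indicator {a..} x)) ((2 * exp 16) * (a ^ Suc 0 / real (Suc 0)) + 2 * (1 / a))"
    by (intro has_bochner_integral_add has_bochner_integral_mult_right has_bochner_integral_power0 has_bochner_integral_inverse_square_tail) (use a in auto)
  have le: "\<bar>lag_cut2 a x * lag n (x\<^sup>2)\<bar> \<le> (2 * exp 16) * (x ^ 0 * indicator {0..a} x) + 2 * (1 / x\<^sup>2 * indicator {a..} x)" for x
  proof -
    have P: "\<bar>lag n (x\<^sup>2)\<bar> \<le> 2 * exp (x\<^sup>2)" using lag_bound[of "x\<^sup>2" n] sqrt_gauss_bound[of x] by simp
    consider "x < 0" | "x \<in> {0..a}" | "x > a" by force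
    then show ?thesis
    proof cases
      case 1
      then show ?thesis using a by (simp add: lag_cut_def indicator_def)
    next
      case 2
      have "x\<^sup>2 \<le> 4\<^sup>2" using 2 a by (intro power_mono) auto
      then have "\<bar>lag n (x\<^sup>2)\<bar> \<le> 2 * exp 16" using P by (intro order_trans[OF P]) simp
      then have "\<bar>(1 - exp (- x\<^sup>2)) / x\<^sup>2\<bar> * \<bar>lag n (x\<^sup>2)\<bar> \<le> 1 * (2 * exp 16)"
        using lag_cut2_bounds(1)[OF a(1) 2] by (intro mult_mono) auto
      moreover have "0 \<le> 2 * (1 / x\<^sup>2 * indicator {a..} x)" by simp
      ultimately show ?thesis using 2 by (auto simp: lag_cut_def indicator_def abs_mult intro: order_trans)
    next
      case 3
      have "\<bar>exp (- x\<^sup>2) * (1 / x\<^sup>2) * lag n (x\<^sup>2)\<bar> = exp (- x\<^sup>2) / x\<^sup>2 * \<bar>lag n (x\<^sup>2)\<bar>" by (simp add: abs_mult)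
      also have "\<dots> \<le> exp (- x\<^sup>2) / x\<^sup>2 * (2 * exp (x\<^sup>2))" using P by (intro mult_left_mono) auto
      also have "\<dots> = 2 * (1 / x\<^sup>2)" by (simp add: exp_minus)
      finally show ?thesis using 3 a by (simp add: lag_cut_def indicator_def)
    qed
  qed
  have "\<bar>?I\<bar> \<le> (\<integral>x. \<bar>lag_cut2 a x * lag n (x\<^sup>2)\<bar> \<partial>lborel)" by (rule integral_abs_bound)
  also have "\<dots> \<le> (\<integral>x. (2 * exp 16) * (x ^ 0 * indicator {0..a} x) + 2 * (1 / x\<^sup>2 * indicator {a..} x) \<partial>lborel)"
    by (intro integral_mono integrable_abs L le) (use B in \<open>auto simp: has_bochner_integral_iff\<close>)
  also have "\<dots> = 2 * exp 16 * a + 2 / a" using has_bochner_integral_integral_eq[OF B] by simp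
  finally have I: "\<bar>?I\<bar> \<le> 2 * exp 16 * a + 2 / a" .
  have "\<bar>lag_moment 2 n a - 2 * sqrt (real n)\<bar> \<le> 2 + 1 / a + (2 * exp 16 * a + 2 / a)"
    unfolding lag_moment2_eq[OF a(1)] 
  proof -
    have "0 \<le> 1 / a" "2 / a = 2 * (1 / a)" using a by auto
    then show "\<bar>lag_sqrt n - 1 / a - ?I - 2 * sqrt (real n)\<bar> \<le> 2 + 1 / a + (2 * exp 16 * a + 2 / a)"
      using lag_sqrt_error[of n] I by linarith
  qed
  then have "a * \<bar>lag_moment 2 n a - 2 * sqrt (real n)\<bar> \<le> a * (2 + 1 / a + (2 * exp 16 * a + 2 / a))"
    using a by (intro mult_left_mono) auto
  also have "\<dots> = 2 * a + 3 + 2 * exp 16 * (a * a)" using a by (simp add: field_simps)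
  also have "\<dots> \<le> 2 * 4 + 3 + 2 * exp 16 * (4 * 4)" using a by (intro add_mono mult_left_mono mult_mono) auto
  finally show ?thesis by simp
qed

text \<open>As for \<open>lag_moment1_tendsto\<close>, with more pieces: the removed Taylor term
  leaves \<open>n / x\<close>, which \<open>n * lag_cut1 a\<close> cuts off, and the regularisation
  in \<open>lag_cut3\<close> costs one copy of \<open>integral_lag_harm\<close>.\<close>

lemma lag_moment3_tendsto:
  assumes a: "a > 0"
  shows "(\<lambda>n. lag_moment3 n a - (((real n + 1) * harm n - 2 * real n) / 2 + real n * (euler_mascheroni / 2 + ln a) - harm n / 2)) \<longlonglongrightarrow> 1 / (2 * a\<^sup>2) - 1 / 2"
proof -
  note L1 = lag_cut1_asymp[OF a]
  note L = lag_cut3_asymp[OF a]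
  let ?I = "\<lambda>n. \<integral>x. lag_cut3 a x * lag n (x\<^sup>2) \<partial>lborel"
  have "lag_moment3 n a = ((real n + 1) * harm n - 2 * real n) / 2 + real n * (\<integral>x. lag_cut1 a x \<partial>lborel) - harm n / 2 + ?I n - (\<integral>x. lag_cut3 a x \<partial>lborel)" for n
  proof -
    let ?f = "\<lambda>x. exp (- x\<^sup>2) * ((lag n (x\<^sup>2) - 1 + real n * x\<^sup>2) / x ^ 3) * indicator {0..} x + real n * lag_cut1 a x
       - exp (- x\<^sup>2) * ((1 - lag n (x\<^sup>2)) / x) * indicator {0..} x + lag_cut3 a x * lag n (x\<^sup>2) - lag_cut3 a x"
    have "has_bochner_integral lborel ?f
       (((real n + 1) * harm n - 2 * real n) / 2 + real n * (\<integral>x. lag_cut1 a x \<partial>lborel) - harm n / 2 + ?I n - (\<integral>x. lag_cut3 a x \<partial>lborel))"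
      by (intro has_bochner_integral_diff has_bochner_integral_add has_bochner_integral_mult_right integral_lag_harm integral_lag_harm2 has_bochner_integral_integrable L L1)
    also have "?f = (\<lambda>x. (lag n (x\<^sup>2) - 1 + real n * x\<^sup>2) / x ^ 3 * indicator {0..a} x)"
    proof (rule ext)
      fix x :: real
      have c: "x\<^sup>2 * inverse (x ^ 3) = inverse x" by (cases "x = 0") (auto simp: field_simps eval_nat_numeral)
      have "E * ((P - 1 + m * x\<^sup>2) / x ^ 3) + m * ((1 - E) / x) - E * ((1 - P) / x) + ((1 - E) / x ^ 3 - E / x) * P - ((1 - E) / x ^ 3 - E / x)
        = (P - 1 + m * x\<^sup>2) / x ^ 3" for E P m :: real
      proof -
        have "m * ((1 - E) / x) = (1 - E) * (m * x\<^sup>2) / x ^ 3" 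
          unfolding divide_inverse c[symmetric] by (simp only: mult_ac mult_1_left)
        then show ?thesis by (simp add: divide_inverse algebra_simps)
      qed
      moreover have "E * ((P - 1 + m * x\<^sup>2) / x ^ 3) - m * (E * (1 / x)) - E * ((1 - P) / x) - E * (1 / x ^ 3 + 1 / x) * P + E * (1 / x ^ 3 + 1 / x) = 0" for E P m :: real
      proof -
        have "m * (E * (1 / x)) = E * (m * x\<^sup>2) / x ^ 3" 
          unfolding divide_inverse c[symmetric] by (simp only: mult_ac mult_1_left)
        then show ?thesis using c by (auto simp: divide_inverse algebra_simps)
      qed
      ultimately show "?f x = (lag n (x\<^sup>2) - 1 + real n * x\<^sup>2) / x ^ 3 * indicator {0..a} x"
        using a by (simp add: lag_cut_def indicator_def)
    qed
    finally show ?thesis using has_bochner_integral_eq[OF _ lag_moment3_integral[of a n]] a by auto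
  qed
  moreover have "(\<lambda>n. ?I n - (\<integral>x. lag_cut3 a x \<partial>lborel)) \<longlonglongrightarrow> 0 - (1 / 2 - 1 / (2 * a\<^sup>2))"
    unfolding integral_lag_cut3[OF a] by (intro tendsto_intros L)
  moreover have "X - (h + c - k) = I - J" if "X = h + c - k + I - J" for X h c k I J :: real using that by simp
  ultimately show ?thesis unfolding integral_lag_cut1[OF a] by simp
qed

section \<open>Young's lattice and its up and down operators\<close>

text \<open>A partition is the function listing its row lengths, with rows indexed from 0.\<close>

typedef par = "{f::nat\<Rightarrow>nat. (\<forall>i. f (Suc i) \<le> f i) \<and> (\<exists>m. \<forall>i\<ge>m. f i = 0)}"
  morphisms row Abs_par
  by (rule exI[of _ "\<lambda>_. 0"]) auto

lemma row_Suc_le: "row p (Suc i) \<le> row p i"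
  using row[of p] by auto

lemma row_antimono: "i \<le> j \<Longrightarrow> row p j \<le> row p i"
  by (rule lift_Suc_antimono_le[of "row p"]) (auto simp: row_Suc_le)

definition rows :: "par \<Rightarrow> nat" where
  "rows p = (LEAST m. \<forall>i\<ge>m. row p i = 0)"

lemma row_eq_0: "rows p \<le> i \<Longrightarrow> row p i = 0"
proof -
  have "\<exists>m. \<forall>i\<ge>m. row p i = 0" using row[of p] by auto
  from LeastI_ex[OF this] show "rows p \<le> i \<Longrightarrow> row p i = 0" unfolding rows_def by blast
qed

lemma par_eqI: "(\<And>i. row p i = row q i) \<Longrightarrow> p = q"
  using row_inject[of p q] by auto

definition addable :: "par \<Rightarrow> nat set" where
  "addable p = {i. i = 0 \<or> row p i < row p (i - 1)}"

definition removable :: "par \<Rightarrow> nat set" where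
  "removable p = {i. row p (Suc i) < row p i}"

definition add_box :: "par \<Rightarrow> nat \<Rightarrow> par" where
  "add_box p i = Abs_par ((row p)(i := Suc (row p i)))"

definition remove_box :: "par \<Rightarrow> nat \<Rightarrow> par" where
  "remove_box p i = Abs_par ((row p)(i := row p i - 1))"

definition empty_par :: par where
  "empty_par = Abs_par (\<lambda>_. 0)"

lemma row_empty_par [simp]: "row empty_par i = 0"
  unfolding empty_par_def by (subst Abs_par_inverse) auto

lemma row_add_box: 
  assumes "i \<in> addable p"
  shows "row (add_box p i) = (row p)(i := Suc (row p i))"
proof -
  have "(row p)(i := Suc (row p i)) \<in> {f. (\<forall>i. f (Suc i) \<le> f i) \<and> (\<exists>m. \<forall>i\<ge>m. f i = 0)}"
  proof (rule CollectI, intro conjI allI)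
    fix j
    show "((row p)(i := Suc (row p i))) (Suc j) \<le> ((row p)(i := Suc (row p i))) j"
      using assms row_Suc_le[of p j] row_Suc_le[of p i]
      by (auto simp: addable_def le_Suc_eq split: if_splits)
    show "\<exists>m. \<forall>j\<ge>m. ((row p)(i := Suc (row p i))) j = 0"
      by (rule exI[of _ "max (Suc i) (rows p)"]) (auto simp: row_eq_0)
  qed
  then show ?thesis unfolding add_box_def by (rule Abs_par_inverse)
qed

lemma row_remove_box: 
  assumes "i \<in> removable p"
  shows "row (remove_box p i) = (row p)(i := row p i - 1)"
proof -
  have "(row p)(i := row p i - 1) \<in> {f. (\<forall>i. f (Suc i) \<le> f i) \<and> (\<exists>m. \<forall>i\<ge>m. f i = 0)}"
  proof (rule CollectI, intro conjI allI)
    fix j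
    show "((row p)(i := row p i - 1)) (Suc j) \<le> ((row p)(i := row p i - 1)) j"
      using assms row_Suc_le[of p j] row_Suc_le[of p i]
      by (cases "j = i"; cases "Suc j = i") (auto simp: removable_def)
    show "\<exists>m. \<forall>j\<ge>m. ((row p)(i := row p i - 1)) j = 0"
      by (rule exI[of _ "rows p"]) (auto simp: row_eq_0)
  qed
  then show ?thesis unfolding remove_box_def by (rule Abs_par_inverse)
qed

lemma addable_le_rows: "i \<in> addable p \<Longrightarrow> i \<le> rows p"
  using row_eq_0[of p "i - 1"] by (fastforce simp: addable_def)

lemma removable_less_rows: "i \<in> removable p \<Longrightarrow> i < rows p"
  using row_eq_0[of p i] by (force simp: removable_def not_less)

lemma finite_addable [simp]: "finite (addable p)"
  by (rule finite_subset[of _ "{..rows p}"]) (auto dest: addable_le_rows)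

lemma finite_removable [simp]: "finite (removable p)"
  by (rule finite_subset[of _ "{..rows p}"]) (auto dest: removable_less_rows)

lemma removable_add_box: "i \<in> addable p \<Longrightarrow> i \<in> removable (add_box p i)"
  using row_Suc_le[of p i] by (auto simp: removable_def row_add_box)

lemma addable_remove_box: "i \<in> removable p \<Longrightarrow> i \<in> addable (remove_box p i)"
  using row_antimono[of "i - 1" i p] by (cases i) (auto simp: addable_def removable_def row_remove_box)

lemma remove_add_box: "i \<in> addable p \<Longrightarrow> remove_box (add_box p i) i = p"
  by (rule par_eqI) (auto simp: row_remove_box removable_add_box row_add_box)

lemma add_remove_box: "i \<in> removable p \<Longrightarrow> add_box (remove_box p i) i = p"
  by (rule par_eqI) (auto simp: row_remove_box addable_remove_box row_add_box removable_def)

text \<open>Two boxes in different rows interact only if the added one lies in the row directly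
  below the removed one; then both sides say \<open>row p i + 1 < row p j\<close>.\<close>

lemma add_remove_swap_iff:
  assumes "i \<noteq> j"
  shows "(i \<in> addable p \<and> j \<in> removable (add_box p i)) \<longleftrightarrow> (j \<in> removable p \<and> i \<in> addable (remove_box p j))"
proof -
  consider "i = Suc j" | "j = Suc i" | "i \<noteq> Suc j" "j \<noteq> Suc i" by blast
  then show ?thesis
  proof cases
    case 1
    have "i \<in> addable p \<and> j \<in> removable (add_box p i) \<longleftrightarrow> Suc (row p i) < row p j"
      by (auto simp: 1 addable_def removable_def row_add_box)
    moreover have "j \<in> removable p \<and> i \<in> addable (remove_box p j) \<longleftrightarrow> Suc (row p i) < row p j"
      by (auto simp: 1 addable_def removable_def row_remove_box)
    ultimately show ?thesis by simp
  next
    case 2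
    show ?thesis using assms by (cases "i \<in> addable p"; cases "j \<in> removable p")
        (simp_all add: row_add_box row_remove_box addable_def[of "remove_box p j"] 
           removable_def[of "add_box p i"], auto simp: 2 addable_def removable_def)
  next
    case 3
    have "j \<in> removable (add_box p i) \<longleftrightarrow> j \<in> removable p" if "i \<in> addable p"
      using assms 3 by (simp add: removable_def row_add_box[OF that])
    moreover have "i \<in> addable (remove_box p j) \<longleftrightarrow> i \<in> addable p" if "j \<in> removable p"
      using assms 3 by (cases i) (simp_all add: addable_def row_remove_box[OF that])
    ultimately show ?thesis by blast
  qed
qed

lemma add_remove_swap:
  assumes "i \<noteq> j" "i \<in> addable p" "j \<in> removable (add_box p i)"
  shows "remove_box (add_box p i) j = add_box (remove_box p j) i"
proof -
  have "j \<in> removable p" "i \<in> addable (remove_box p j)"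
    using add_remove_swap_iff[OF assms(1)] assms by auto
  then show ?thesis using assms by (intro par_eqI) (auto simp: row_remove_box row_add_box)
qed

text \<open>A function on partitions stands for the formal sum of partitions with these coefficients, so \<open>Uop\<close> adds a box and
\<open>Dop\<close> removes one, each weighted by a function of the content of the box.\<close>

definition Dop :: "(int \<Rightarrow> complex) \<Rightarrow> (par \<Rightarrow> complex) \<Rightarrow> par \<Rightarrow> complex" where
  "Dop \<phi> F p = (\<Sum>i\<in>addable p. \<phi> (int (row p i) - int i) * F (add_box p i))"

definition Uop :: "(int \<Rightarrow> complex) \<Rightarrow> (par \<Rightarrow> complex) \<Rightarrow> par \<Rightarrow> complex" where
  "Uop \<phi> F p = (\<Sum>i\<in>removable p. \<phi> (int (row p i) - 1 - int i) * F (remove_box p i))"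

definition corner_sum :: "(int \<Rightarrow> complex) \<Rightarrow> par \<Rightarrow> complex" where
  "corner_sum \<phi> p = (\<Sum>i\<in>addable p. \<phi> (int (row p i) - int i)) - (\<Sum>i\<in>removable p. \<phi> (int (row p i) - 1 - int i))"

text \<open>Adding in row \<open>i\<close> and removing in another row \<open>j\<close> commute, so
  those terms cancel. What remains is adding and removing the same box: one term for each corner,
  with opposite signs for the two kinds.\<close>

lemma Dop_Uop:
  "Dop \<phi> (Uop \<psi> F) p = Uop \<psi> (Dop \<phi> F) p + corner_sum (\<lambda>c. \<phi> c * \<psi> c) p * F p"
proof -
  let ?ca = "\<lambda>i. int (row p i) - int i" and ?cr = "\<lambda>i. int (row p i) - 1 - int i"
  let ?t = "\<lambda>i j. \<phi> (?ca i) * (\<psi> (?cr j) * F (remove_box (add_box p i) j))"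
  define R where "R = (\<Sum>(i,j)\<in>(SIGMA i:addable p. removable (add_box p i) - {i}). ?t i j)"
  have "Dop \<phi> (Uop \<psi> F) p = (\<Sum>i\<in>addable p. \<phi> (?ca i) * \<psi> (?ca i) * F p + (\<Sum>j\<in>removable (add_box p i) - {i}. ?t i j))"
    unfolding Dop_def
  proof (intro sum.cong refl)
    fix i assume i: "i \<in> addable p"
    have "Uop \<psi> F (add_box p i) = \<psi> (?ca i) * F p 
       + (\<Sum>j\<in>removable (add_box p i) - {i}. \<psi> (?cr j) * F (remove_box (add_box p i) j))"
      unfolding Uop_def using i removable_add_box[OF i]
      by (subst sum.remove[of _ i]) (auto simp: row_add_box remove_add_box intro!: sum.cong)
    then show "\<phi> (?ca i) * Uop \<psi> F (add_box p i) = 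
       \<phi> (?ca i) * \<psi> (?ca i) * F p + (\<Sum>j\<in>removable (add_box p i) - {i}. ?t i j)"
      by (simp add: algebra_simps sum_distrib_left)
  qed
  also have "\<dots> = (\<Sum>i\<in>addable p. \<phi> (?ca i) * \<psi> (?ca i)) * F p + R"
    unfolding R_def by (simp add: sum.distrib sum_distrib_right sum.Sigma)
  finally have 1: "Dop \<phi> (Uop \<psi> F) p = (\<Sum>i\<in>addable p. \<phi> (?ca i) * \<psi> (?ca i)) * F p + R" .
  let ?s = "\<lambda>j i. \<psi> (?cr j) * (\<phi> (?ca i) * F (add_box (remove_box p j) i))"
  have "Uop \<psi> (Dop \<phi> F) p = (\<Sum>j\<in>removable p. \<phi> (?cr j) * \<psi> (?cr j) * F p + (\<Sum>i\<in>addable (remove_box p j) - {j}. ?s j i))"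
    unfolding Uop_def
  proof (intro sum.cong refl)
    fix j assume j: "j \<in> removable p"
    have "Dop \<phi> F (remove_box p j) = \<phi> (?cr j) * F p 
       + (\<Sum>i\<in>addable (remove_box p j) - {j}. \<phi> (?ca i) * F (add_box (remove_box p j) i))"
      unfolding Dop_def using j addable_remove_box[OF j]
      by (subst sum.remove[of _ j]) (auto simp: row_remove_box add_remove_box removable_def of_nat_diff intro!: sum.cong)
    then show "\<psi> (?cr j) * Dop \<phi> F (remove_box p j) = 
       \<phi> (?cr j) * \<psi> (?cr j) * F p + (\<Sum>i\<in>addable (remove_box p j) - {j}. ?s j i)"
      by (simp add: algebra_simps sum_distrib_left)
  qed
  also have "\<dots> = (\<Sum>j\<in>removable p. \<phi> (?cr j) * \<psi> (?cr j)) * F p 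
      + (\<Sum>(j,i)\<in>(SIGMA j:removable p. addable (remove_box p j) - {j}). ?s j i)"
    by (simp add: sum.distrib sum_distrib_right sum.Sigma)
  also have "(\<Sum>(j,i)\<in>(SIGMA j:removable p. addable (remove_box p j) - {j}). ?s j i) = R"
    unfolding R_def
    by (rule sum.reindex_bij_witness[of _ "\<lambda>(i,j). (j,i)" "\<lambda>(i,j). (j,i)"])
      (use add_remove_swap_iff[of _ _ p] add_remove_swap[of _ _ p] in \<open>auto simp: mult_ac\<close>, metis+)
  finally show ?thesis using 1 by (simp add: corner_sum_def algebra_simps)
qed

text \<open>Non-addable rows \<open>i\<close> and non-removable rows \<open>i - 1\<close> cancel.\<close>

lemma corner_sum_eq:
  assumes "rows p \<le> m"
  shows "corner_sum \<phi> p = \<phi> (- int m) + (\<Sum>i<m. \<phi> (int (row p i) - int i) - \<phi> (int (row p i) - 1 - int i))"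
proof -
  let ?ca = "\<lambda>i. \<phi> (int (row p i) - int i)" and ?cr = "\<lambda>i. \<phi> (int (row p i) - 1 - int i)"
  have A: "(\<Sum>i\<in>{..m}. ?ca i) = (\<Sum>i\<in>addable p. ?ca i) + (\<Sum>i\<in>{..m} - addable p. ?ca i)"
    using assms addable_le_rows[of _ p] by (subst sum.subset_diff[of "addable p"]) (fastforce simp: add.commute)+
  have B: "(\<Sum>i\<in>{..<m}. ?cr i) = (\<Sum>i\<in>removable p. ?cr i) + (\<Sum>i\<in>{..<m} - removable p. ?cr i)"
    using assms removable_less_rows[of _ p] by (subst sum.subset_diff[of "removable p"]) (fastforce simp: add.commute)+
  have C: "(\<Sum>i\<in>{..m} - addable p. ?ca i) = (\<Sum>i\<in>{..<m} - removable p. ?cr i)"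
  proof (rule sum.reindex_bij_witness[of _ Suc "\<lambda>i. i - 1"])
    fix i assume "i \<in> {..m} - addable p"
    then have i: "i > 0" "i \<le> m" "row p (i - 1) \<le> row p i" by (auto simp: addable_def)
    then have e: "row p i = row p (i - 1)" using row_antimono[of "i - 1" i p] by auto
    show "Suc (i - 1) = i" using i by simp
    show "i - 1 \<in> {..<m} - removable p" using i by (auto simp: removable_def)
    show "?cr (i - 1) = ?ca i" using i e by (simp add: of_nat_diff)
  next
    fix i assume "i \<in> {..<m} - removable p"
    then show "Suc i \<in> {..m} - addable p" by (auto simp: addable_def removable_def)
  qed auto
  have "(\<Sum>i\<le>m. ?ca i) = (\<Sum>i<m. ?ca i) + \<phi> (- int m)"
    using row_eq_0[OF assms] by (simp add: lessThan_Suc_atMost[symmetric])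
  then have "(\<Sum>i\<in>addable p. ?ca i) = (\<Sum>i<m. ?ca i) + \<phi> (- int m) - (\<Sum>i\<in>{..<m} - removable p. ?cr i)"
    using A C by (simp add: algebra_simps)
  then show ?thesis using B unfolding corner_sum_def by (simp add: sum_subtractf)
qed

lemma rows_add_box_le: "i \<in> addable p \<Longrightarrow> rows (add_box p i) \<le> Suc (rows p)"
  unfolding rows_def[of "add_box p i"]
  by (rule Least_le) (use addable_le_rows[of i p] row_eq_0[of p] in \<open>auto simp: row_add_box\<close>)

text \<open>\<open>corner_sum_eq\<close> is a sum over rows of first differences in the content, so
  lengthening one row changes it by a second difference.\<close>

lemma corner_sum_add_box:
  assumes "i \<in> addable p"
  shows "corner_sum \<phi> (add_box p i) = corner_sum \<phi> p + 
    (let c = int (row p i) - int i in \<phi> (c + 1) - 2 * \<phi> c + \<phi> (c - 1))"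
proof -
  define m where "m = Suc (rows p)"
  have m: "rows p \<le> m" "rows (add_box p i) \<le> m" "i < m"
    using rows_add_box_le[OF assms] addable_le_rows[OF assms] by (auto simp: m_def)
  let ?g = "\<lambda>p i. \<phi> (int (row p i) - int i) - \<phi> (int (row p i) - 1 - int i)"
  have "(\<Sum>j<m. ?g (add_box p i) j) = ?g (add_box p i) i + (\<Sum>j\<in>{..<m}-{i}. ?g p j)"
    using m assms by (subst sum.remove[of _ i]) (auto simp: row_add_box intro!: sum.cong)
  moreover have "(\<Sum>j<m. ?g p j) = ?g p i + (\<Sum>j\<in>{..<m}-{i}. ?g p j)"
    using m by (subst sum.remove[of _ i]) auto
  moreover have "?g (add_box p i) i = \<phi> (int (row p i) - int i + 1) - \<phi> (int (row p i) - int i)"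
    by (simp add: row_add_box[OF assms] algebra_simps)
  ultimately show ?thesis
    using m by (simp add: corner_sum_eq Let_def) (simp add: algebra_simps)
qed

lemma corner_sum_1: "corner_sum (\<lambda>_. 1) p = 1"
  by (simp add: corner_sum_eq[of p "rows p"])

definition psize :: "par \<Rightarrow> nat" where "psize p = (\<Sum>i<rows p. row p i)"

lemma psize_eq: "rows p \<le> m \<Longrightarrow> psize p = (\<Sum>i<m. row p i)"
  unfolding psize_def by (rule sum.mono_neutral_left) (auto simp: row_eq_0)

lemma psize_add_box: 
  assumes "i \<in> addable p" shows "psize (add_box p i) = Suc (psize p)"
proof -
  define m where "m = Suc (rows p)"
  have m: "rows p \<le> m" "rows (add_box p i) \<le> m" "i < m"
    using rows_add_box_le[OF assms] addable_le_rows[OF assms] by (auto simp: m_def)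
  have "(\<Sum>j<m. row (add_box p i) j) = Suc (row p i) + (\<Sum>j\<in>{..<m}-{i}. row p j)"
    using m assms by (subst sum.remove[of _ i]) (auto simp: row_add_box intro!: sum.cong)
  moreover have "(\<Sum>j<m. row p j) = row p i + (\<Sum>j\<in>{..<m}-{i}. row p j)"
    using m by (subst sum.remove[of _ i]) auto
  ultimately show ?thesis using m by (simp add: psize_eq)
qed

lemma psize_remove_box:
  assumes "i \<in> removable p" shows "Suc (psize (remove_box p i)) = psize p"
  using psize_add_box[OF addable_remove_box[OF assms]] add_remove_box[OF assms] by simp

lemma psize_remove_box':
  assumes "i \<in> removable p" shows "psize (remove_box p i) = psize p - 1"
  using psize_remove_box[OF assms] by simp

lemma removable_less_row: "i \<in> removable p \<Longrightarrow> 0 < row p i"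
  by (auto simp: removable_def)

definition pars :: "nat \<Rightarrow> par set" where "pars n = {p. psize p = n}"

lemma removable_nonempty: 
  assumes "p \<noteq> empty_par" shows "removable p \<noteq> {}"
proof -
  have "\<exists>i. row p i \<noteq> 0" using assms par_eqI[of p empty_par] by (metis row_empty_par)
  then have "rows p \<noteq> 0" using row_eq_0[of p] by (metis le0)
  then have "row p (rows p - 1) \<noteq> 0"
    using not_less_Least[of "rows p - 1" "\<lambda>m. \<forall>i\<ge>m. row p i = 0"] row_eq_0[of p]
    unfolding rows_def[symmetric] by (metis One_nat_def Suc_pred diff_less le_neq_implies_less lessI not_less_eq_eq neq0_conv le_antisym)
  then have "rows p - 1 \<in> removable p" using \<open>rows p \<noteq> 0\<close> row_eq_0[of p "rows p"] by (auto simp: removable_def)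
  then show ?thesis by auto
qed

lemma psize_empty [simp]: "psize empty_par = 0"
  by (simp add: psize_def)

lemma psize_eq_0_iff: "psize p = 0 \<longleftrightarrow> p = empty_par"
proof
  assume "psize p = 0"
  show "p = empty_par"
  proof (rule ccontr)
    assume "p \<noteq> empty_par"
    then obtain i where "i \<in> removable p" using removable_nonempty by auto
    from psize_remove_box[OF this] \<open>psize p = 0\<close> show False by simp
  qed
qed auto

lemma pars_0: "pars 0 = {empty_par}"
  by (auto simp: pars_def psize_eq_0_iff)

lemma pars_Suc: "pars (Suc n) = (\<lambda>(p,i). add_box p i) ` (SIGMA p:pars n. addable p)"
proof (intro equalityI subsetI)
  fix p assume p: "p \<in> pars (Suc n)"
  then have "p \<noteq> empty_par" by (auto simp: pars_def)
  then obtain i where i: "i \<in> removable p" using removable_nonempty by auto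
  show "p \<in> (\<lambda>(p,i). add_box p i) ` (SIGMA p:pars n. addable p)"
    using p psize_remove_box[OF i] addable_remove_box[OF i] add_remove_box[OF i]
    by (intro image_eqI[of _ _ "(remove_box p i, i)"]) (auto simp: pars_def)
qed (auto simp: pars_def psize_add_box)

lemma finite_pars [simp]: "finite (pars n)"
  by (induction n) (auto simp: pars_0 pars_Suc)

text \<open>Bilinear, without conjugation, so that the adjoint of \<open>Uop \<phi>\<close> is
  \<open>Dop \<phi>\<close> with the same complex weight.\<close>

definition level_inner :: "nat \<Rightarrow> (par \<Rightarrow> complex) \<Rightarrow> (par \<Rightarrow> complex) \<Rightarrow> complex" where
  "level_inner n F G = (\<Sum>p\<in>pars n. F p * G p)"

text \<open>Both sides run over the pairs of partitions that differ by one box. The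
  \<open>- 1\<close> in the content of a removable corner makes the weights agree.\<close>

lemma level_inner_adjoint: "level_inner (Suc n) (Uop \<phi> F) G = level_inner n F (Dop \<phi> G)"
proof -
  have "level_inner (Suc n) (Uop \<phi> F) G = (\<Sum>(p,i)\<in>(SIGMA p:pars (Suc n). removable p). 
      \<phi> (int (row p i) - 1 - int i) * F (remove_box p i) * G p)"
    unfolding level_inner_def Uop_def by (simp add: sum_distrib_right sum.Sigma)
  also have "\<dots> = (\<Sum>(p,i)\<in>(SIGMA p:pars n. addable p). F p * (\<phi> (int (row p i) - int i) * G (add_box p i)))"
    using removable_less_row
    by (intro sum.reindex_bij_witness[of _ "\<lambda>(p,i). (add_box p i, i)" "\<lambda>(p,i). (remove_box p i, i)"])
      (auto simp: pars_def remove_add_box add_remove_box psize_add_box removable_add_box addable_remove_box row_remove_box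
        of_nat_diff Suc_leI psize_remove_box')
  also have "\<dots> = level_inner n F (Dop \<phi> G)"
    unfolding level_inner_def Dop_def by (simp add: sum_distrib_left sum.Sigma)
  finally show ?thesis .
qed

definition linear_op :: "((par \<Rightarrow> complex) \<Rightarrow> par \<Rightarrow> complex) \<Rightarrow> bool" where
  "linear_op A \<longleftrightarrow> (\<forall>F G c d. A (\<lambda>p. c * F p + d * G p) = (\<lambda>p. c * A F p + d * A G p))"

lemma linear_opD: "linear_op A \<Longrightarrow> A (\<lambda>p. c * F p + d * G p) q = c * A F q + d * A G q"
  by (simp add: linear_op_def)

lemma linear_op_0: "linear_op A \<Longrightarrow> A (\<lambda>p. 0) q = 0"
  using linear_opD[of A 0 "\<lambda>_. 0" 0 "\<lambda>_. 0"] by simp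

lemma linear_op_add: "linear_op A \<Longrightarrow> A (\<lambda>p. F p + G p) q = A F q + A G q"
  using linear_opD[of A 1 F 1 G] by simp

lemma linear_op_diff: "linear_op A \<Longrightarrow> A (\<lambda>p. F p - G p) q = A F q - A G q"
  using linear_opD[of A 1 F "-1" G] by simp

lemma linear_op_scale: "linear_op A \<Longrightarrow> A (\<lambda>p. c * F p) q = c * A F q"
  using linear_opD[of A c F 0 F] by simp

lemma linear_op_sum: "linear_op A \<Longrightarrow> A (\<lambda>p. \<Sum>k\<in>S. F k p) q = (\<Sum>k\<in>S. A (F k) q)"
proof (induction S rule: infinite_finite_induct)
  case (insert x T)
  then show ?case using linear_op_add[of A "F x" "\<lambda>p. \<Sum>k\<in>T. F k p"] by simp
qed (simp_all add: linear_op_0)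

lemma linear_op_sum_scale: "linear_op A \<Longrightarrow> A (\<lambda>p. \<Sum>k\<in>S. c k * F k p) q = (\<Sum>k\<in>S. c k * A (F k) q)"
  using linear_op_sum[of A "\<lambda>k p. c k * F k p"] by (simp add: linear_op_scale[of A])

lemma linear_Dop [simp]: "linear_op (Dop \<phi>)"
  by (auto simp: linear_op_def Dop_def algebra_simps sum.distrib sum_distrib_left intro!: ext)

lemma linear_Uop [simp]: "linear_op (Uop \<phi>)"
  by (auto simp: linear_op_def Uop_def algebra_simps sum.distrib sum_distrib_left intro!: ext)

lemma linear_op_funpow: "linear_op A \<Longrightarrow> linear_op (A ^^ n)"
  by (induction n) (auto simp: linear_op_def)

abbreviation "up_op \<equiv> Uop (\<lambda>_. 1)"
abbreviation "down_op \<equiv> Dop (\<lambda>_. 1)"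

definition tsum :: "complex \<Rightarrow> par \<Rightarrow> complex" where
  "tsum z = corner_sum (\<lambda>c. z powi c)"

text \<open>The eigenvalue on \<open>z powi c\<close> of the second difference in
  \<open>corner_sum_add_box\<close>.\<close>

definition zeta :: "complex \<Rightarrow> complex" where
  "zeta z = z + 1 / z - 2"

definition mult_tsum :: "complex \<Rightarrow> (par \<Rightarrow> complex) \<Rightarrow> par \<Rightarrow> complex" where
  "mult_tsum z F p = tsum z p * F p"

abbreviation "down_op_z z \<equiv> Dop (\<lambda>c. z powi c)"

lemma linear_Tm [simp]: "linear_op (mult_tsum z)"
  by (auto simp: linear_op_def mult_tsum_def algebra_simps)

lemma D_U: "down_op (up_op F) = (\<lambda>p. up_op (down_op F) p + F p)"
  by (rule ext) (simp add: Dop_Uop corner_sum_1)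

lemma Dz_U: "down_op_z z (up_op F) = (\<lambda>p. up_op (down_op_z z F) p + mult_tsum z F p)"
  by (rule ext) (simp add: Dop_Uop mult_tsum_def tsum_def)

lemma tsum_add_box:
  assumes "i \<in> addable p" "z \<noteq> 0"
  shows "tsum z (add_box p i) = tsum z p + zeta z * z powi (int (row p i) - int i)"
proof -
  define c where "c = int (row p i) - int i"
  have "z powi (c + 1) - 2 * z powi c + z powi (c - 1) = zeta z * z powi c"
    using assms(2) by (simp add: zeta_def power_int_add power_int_diff field_simps)
  then show ?thesis using corner_sum_add_box[OF assms(1), of "\<lambda>c. z powi c"]
    by (simp add: tsum_def c_def Let_def)
qed

lemma Dop_Tm:
  assumes "z \<noteq> 0"
  shows "Dop \<phi> (mult_tsum z F) p = mult_tsum z (Dop \<phi> F) p + zeta z * Dop (\<lambda>c. \<phi> c * z powi c) F p"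
  by (simp add: Dop_def mult_tsum_def tsum_add_box assms algebra_simps sum.distrib sum_distrib_left)

lemma D_Tm: "z \<noteq> 0 \<Longrightarrow> down_op (mult_tsum z F) = (\<lambda>p. mult_tsum z (down_op F) p + zeta z * down_op_z z F p)"
  by (rule ext) (simp add: Dop_Tm)

text \<open>Iterated commutators with \<open>up_op\<close>, starting from multiplication by
  \<open>tsum z\<close>.\<close>

fun Xop :: "complex \<Rightarrow> nat \<Rightarrow> (par \<Rightarrow> complex) \<Rightarrow> par \<Rightarrow> complex" where
  "Xop z 0 F = mult_tsum z F"
| "Xop z (Suc k) F = (\<lambda>p. Xop z k (up_op F) p - up_op (Xop z k F) p)"

lemma linear_Xop [simp]: "linear_op (Xop z k)"
proof (induction k)
  case (Suc k)
  show ?case unfolding linear_op_def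
    by (auto simp: linear_op_def[THEN iffD1, OF Suc, rule_format] linear_op_def[THEN iffD1, OF linear_Uop, rule_format] algebra_simps)
qed (simp add: linear_op_def[THEN iffD1, OF linear_Tm, rule_format] linear_op_def)

lemma linear_U_funpow: "linear_op (up_op ^^ n)"
  by (rule linear_op_funpow) simp

lemmas op_linear = 
  linear_op_add[OF linear_Uop] linear_op_add[OF linear_Dop] linear_op_add[OF linear_Tm] 
  linear_op_add[OF linear_Xop] linear_op_add[OF linear_U_funpow]
  linear_op_diff[OF linear_Uop] linear_op_diff[OF linear_Dop] linear_op_diff[OF linear_Xop]
  linear_op_scale[OF linear_Uop] linear_op_scale[OF linear_Dop] linear_op_scale[OF linear_Xop] 
  linear_op_scale[OF linear_U_funpow]
  linear_op_0[OF linear_Uop] linear_op_0[OF linear_Dop] linear_op_0[OF linear_Xop] linear_op_0[OF linear_U_funpow]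

text \<open>The Jacobi identity. Write \<open>D\<close>, \<open>U\<close>, \<open>T\<close> for
  \<open>down_op\<close>, \<open>up_op\<close> and multiplication by \<open>tsum z\<close>, and
  \<open>D_z\<close> for \<open>down_op_z z\<close>. Then \<open>[D, U] = 1\<close>,
  \<open>[D, T] = zeta D_z\<close> and \<open>[D_z, U] = T\<close> start the induction, and
  commutation with \<open>D\<close> lowers the index by one.\<close>

lemma D_Xop:
  assumes z: "z \<noteq> 0"
  shows "down_op (Xop z (Suc k) F) = (\<lambda>p. Xop z (Suc k) (down_op F) p + zeta z * Xop z k F p)"
proof (induction k arbitrary: F)
  case 0
  show ?case
    by (rule ext) (simp add: op_linear D_Tm[OF z] D_U Dz_U op_linear algebra_simps)
next
  case (Suc k)
  show ?case
  proof (rule ext)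
    fix p
    have "down_op (Xop z (Suc (Suc k)) F) p = down_op (Xop z (Suc k) (up_op F)) p - down_op (up_op (Xop z (Suc k) F)) p"
      by (subst Xop.simps(2)) (simp add: op_linear del: Xop.simps)
    also have "\<dots> = Xop z (Suc k) (down_op (up_op F)) p + zeta z * Xop z k (up_op F) p - up_op (down_op (Xop z (Suc k) F)) p - Xop z (Suc k) F p"
      by (simp add: Suc.IH D_U del: Xop.simps)
    also have "Xop z (Suc k) (down_op (up_op F)) p = Xop z (Suc k) (up_op (down_op F)) p + Xop z (Suc k) F p"
      by (simp add: D_U op_linear del: Xop.simps)
    also have "up_op (down_op (Xop z (Suc k) F)) p = up_op (Xop z (Suc k) (down_op F)) p + zeta z * up_op (Xop z k F) p"
      unfolding Suc.IH using linear_opD[OF linear_Uop, where c=1 and d="zeta z"] by (simp del: Xop.simps)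
    also have "Xop z (Suc k) (up_op (down_op F)) p + Xop z (Suc k) F p + zeta z * Xop z k (up_op F) p -
        (up_op (Xop z (Suc k) (down_op F)) p + zeta z * up_op (Xop z k F) p) - Xop z (Suc k) F p
      = Xop z (Suc (Suc k)) (down_op F) p + zeta z * Xop z (Suc k) F p"
      by (simp only: Xop.simps) (simp add: algebra_simps)
    finally show "down_op (Xop z (Suc (Suc k)) F) p = Xop z (Suc (Suc k)) (down_op F) p + zeta z * Xop z (Suc k) F p" .
  qed
qed

definition vac :: "par \<Rightarrow> complex" where "vac p = (if p = empty_par then 1 else 0)"

text \<open>\<open>down_op\<close> annihilates \<open>vac\<close>, so by \<open>D_Xop\<close> it
  sends \<open>qv z (Suc k)\<close> to \<open>zeta z * qv z k\<close>. The inner products below are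
  computed from this ladder.\<close>

definition qv :: "complex \<Rightarrow> nat \<Rightarrow> par \<Rightarrow> complex" where "qv z k = Xop z k vac"

lemma add_box_nonempty: "i \<in> addable p \<Longrightarrow> add_box p i \<noteq> empty_par"
  using psize_add_box[of i p] by auto

lemma Dop_vac: "Dop \<phi> vac = (\<lambda>_. 0)"
  by (auto simp: Dop_def vac_def add_box_nonempty intro!: sum.neutral ext)

lemma D_qv: "z \<noteq> 0 \<Longrightarrow> down_op (qv z (Suc k)) = (\<lambda>p. zeta z * qv z k p)"
  unfolding qv_def by (simp add: D_Xop Dop_vac op_linear del: Xop.simps)

lemma tsum_empty: "tsum z empty_par = 1"
  using corner_sum_eq[of empty_par 0 "\<lambda>c. z powi c"] by (simp add: tsum_def rows_def)

lemma D_qv_0: "z \<noteq> 0 \<Longrightarrow> down_op (qv z 0) = (\<lambda>p. 0)"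
proof -
  have "qv z 0 = vac" unfolding qv_def by (auto simp: mult_tsum_def vac_def tsum_empty)
  then show ?thesis by (simp add: Dop_vac)
qed

text \<open>The binomial expansion obtained by moving the multiplication to the right through the
  powers of \<open>up_op\<close>. On \<open>vac\<close> it expresses the product in terms of the
  \<open>qv z k\<close>.\<close>

lemma mult_tsum_funpow_U:
  "mult_tsum z ((up_op ^^ n) F) p = (\<Sum>k\<le>n. of_nat (n choose k) * (up_op ^^ (n - k)) (Xop z k F) p)"
proof (induction n arbitrary: F p)
  case (Suc n)
  let ?f = "\<lambda>k j. (up_op ^^ k) (Xop z j F) p"
  have "mult_tsum z ((up_op ^^ Suc n) F) p = (\<Sum>k\<le>n. of_nat (n choose k) * (up_op ^^ (n - k)) (Xop z k (up_op F)) p)"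
    by (simp only: funpow_Suc_right o_apply Suc)
  also have "\<dots> = (\<Sum>k\<le>n. of_nat (n choose k) * (?f (Suc n - k) k + ?f (n - k) (Suc k)))"
  proof (intro sum.cong refl arg_cong2[of _ _ _ _ "(*)"])
    fix k assume k: "k \<in> {..n}"
    have "Xop z k (up_op F) = (\<lambda>p. up_op (Xop z k F) p + Xop z (Suc k) F p)" by (auto intro!: ext)
    moreover have "(up_op ^^ (n - k)) (up_op G) = up_op ((up_op ^^ (n - k)) G)" for G by (metis funpow_swap1)
    ultimately show "(up_op ^^ (n - k)) (Xop z k (up_op F)) p = ?f (Suc n - k) k + ?f (n - k) (Suc k)"
      using k by (simp add: op_linear Suc_diff_le del: Xop.simps)
  qed
  also have "\<dots> = (\<Sum>k\<le>n. of_nat (n choose k) * ?f (Suc n - k) k) + (\<Sum>k\<le>n. of_nat (n choose k) * ?f (Suc n - Suc k) (Suc k))"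
    by (simp add: algebra_simps sum.distrib)
  also have "(\<Sum>k\<le>n. of_nat (n choose k) * ?f (Suc n - k) k) = (\<Sum>k\<le>Suc n. of_nat (n choose k) * ?f (Suc n - k) k)"
    by simp
  also have "\<dots> = ?f (Suc n) 0 + (\<Sum>k\<le>n. of_nat (n choose Suc k) * ?f (Suc n - Suc k) (Suc k))"
    by (subst sum.atMost_Suc_shift) simp
  also have "?f (Suc n) 0 + (\<Sum>k\<le>n. of_nat (n choose Suc k) * ?f (Suc n - Suc k) (Suc k)) +
     (\<Sum>k\<le>n. of_nat (n choose k) * ?f (Suc n - Suc k) (Suc k)) =
     ?f (Suc n) 0 + (\<Sum>k\<le>n. of_nat (Suc n choose Suc k) * ?f (Suc n - Suc k) (Suc k))"
    by (simp add: sum.distrib[symmetric] algebra_simps)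
  also have "\<dots> = (\<Sum>k\<le>Suc n. of_nat (Suc n choose k) * ?f (Suc n - k) k)"
    by (subst sum.atMost_Suc_shift) simp
  finally show ?case .
qed simp

lemma D_funpow_U: "down_op ((up_op ^^ b) F) = (\<lambda>p. (up_op ^^ b) (down_op F) p + of_nat b * (up_op ^^ (b - 1)) F p)"
proof (induction b)
  case (Suc b)
  have "of_nat b * up_op ((up_op ^^ (b - 1)) F) p = of_nat b * (up_op ^^ b) F p" for p
    by (cases b) auto
  then show ?case
    by (intro ext) (simp add: D_U Suc.IH op_linear algebra_simps)
qed simp

lemma D_funpow_U_vac: "down_op ((up_op ^^ Suc n) vac) = (\<lambda>p. of_nat (Suc n) * (up_op ^^ n) vac p)"
  by (rule ext) (subst D_funpow_U, simp add: Dop_vac op_linear del: funpow.simps)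

text \<open>An integer index with value \<open>0\<close> below zero lets the sum in
  \<open>gram\<close> run over a fixed range.\<close>

definition qv_gram :: "complex \<Rightarrow> complex \<Rightarrow> int \<Rightarrow> complex" where
  "qv_gram z w k = (if k < 0 then 0 else level_inner (nat k) (qv z (nat k)) (qv w (nat k)))"

lemma level_inner_add_right: "level_inner n F (\<lambda>p. c * G p + d * H p) = c * level_inner n F G + d * level_inner n F H"
  by (simp add: level_inner_def algebra_simps sum.distrib sum_distrib_left)

lemma level_inner_commute: "level_inner n F G = level_inner n G F"
  by (simp add: level_inner_def mult.commute)

lemma level_inner_sum_right: "level_inner n F (\<lambda>p. \<Sum>k\<in>S. c k * G k p) = (\<Sum>k\<in>S. c k * level_inner n F (G k))"
  unfolding level_inner_def by (simp add: sum_distrib_left mult_ac) (subst sum.swap, simp add: sum_distrib_left mult_ac)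

lemma level_inner_sum_left: "level_inner n (\<lambda>p. \<Sum>k\<in>S. c k * G k p) F = (\<Sum>k\<in>S. c k * level_inner n (G k) F)"
  using level_inner_sum_right[where n=n and F=F and S=S and c=c and G=G] by (simp add: level_inner_commute[of n F])

text \<open>The induction step of \<open>gram\<close> in isolation. Pascal's rule in
  \<open>a\<close> and \<open>b C(b - 1, j) j! = (j + 1)! C(b, j + 1)\<close> merge the two
  contributions of \<open>down_op\<close> into the next sum.\<close>

lemma qv_gram_step:
  fixes f :: "nat \<Rightarrow> complex" and a b :: nat and \<zeta> :: complex
  assumes that: "a \<le> N"
  shows "\<zeta> * (\<Sum>j\<le>N. fact j * of_nat (a choose j) * of_nat (b choose j) * \<zeta> ^ (a + b - 2 * j) * f j)
       + of_nat b * (\<Sum>j\<le>N. fact j * of_nat (a choose j) * of_nat ((b - 1) choose j) * \<zeta> ^ (a + (b - 1) - 2 * j) * f (Suc j))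
     = (\<Sum>j\<le>Suc N. fact j * of_nat (Suc a choose j) * of_nat (b choose j) * \<zeta> ^ (Suc a + b - 2 * j) * f j)"
proof (cases b)
  case 0
  have "(\<Sum>j\<le>N. fact j * of_nat (a choose j) * of_nat (0 choose j) * \<zeta> ^ (a + 0 - 2 * j) * f j) = \<zeta> ^ a * f 0"
    by (subst sum.remove[of _ 0]) (auto simp: binomial_eq_0 intro!: sum.neutral)
  moreover have "(\<Sum>j\<le>Suc N. fact j * of_nat (Suc a choose j) * of_nat (0 choose j) * \<zeta> ^ (Suc a + 0 - 2 * j) * f j) = \<zeta> ^ Suc a * f 0"
    by (subst sum.remove[of _ 0]) (auto simp: binomial_eq_0 intro!: sum.neutral)
  ultimately show ?thesis using 0 by simp
next
  case (Suc b')
  have 1: "\<zeta> * (\<Sum>j\<le>N. fact j * of_nat (a choose j) * of_nat (b choose j) * \<zeta> ^ (a + b - 2 * j) * f j)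
    = (\<Sum>j\<le>Suc N. fact j * of_nat (a choose j) * of_nat (b choose j) * \<zeta> ^ (Suc a + b - 2 * j) * f j)"
  proof -
    have "\<zeta> * (fact j * of_nat (a choose j) * of_nat (b choose j) * \<zeta> ^ (a + b - 2 * j) * f j) = 
       fact j * of_nat (a choose j) * of_nat (b choose j) * \<zeta> ^ (Suc a + b - 2 * j) * f j" for j
    \<comment> \<open>Outside this range a binomial coefficient vanishes, so the truncated
      subtraction in the exponent does no harm.\<close>
    proof (cases "j \<le> a \<and> j \<le> b")
      case True
      then have "Suc a + b - 2 * j = Suc (a + b - 2 * j)" by linarith
      then show ?thesis by simp
    qed (auto simp: binomial_eq_0)
    then show ?thesis using that by (simp only: sum_distrib_left) (simp add: binomial_eq_0)
  qed
  have 2: "of_nat b * (\<Sum>j\<le>N. fact j * of_nat (a choose j) * of_nat ((b - 1) choose j) * \<zeta> ^ (a + (b - 1) - 2 * j) * f (Suc j))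
    = (\<Sum>j\<le>N. fact (Suc j) * of_nat (a choose j) * of_nat (b choose Suc j) * \<zeta> ^ (Suc a + b - 2 * Suc j) * f (Suc j))"
  proof -
    have "of_nat b * (fact j * of_nat (a choose j) * of_nat ((b - 1) choose j) * \<zeta> ^ (a + (b - 1) - 2 * j) * f (Suc j))
       = fact (Suc j) * of_nat (a choose j) * of_nat (b choose Suc j) * \<zeta> ^ (Suc a + b - 2 * Suc j) * f (Suc j)" for j
    proof -
      have e: "of_nat b * of_nat ((b - 1) choose j) = (of_nat (Suc j) * of_nat (b choose Suc j) :: complex)"
        using Suc_times_binomial_eq[of b' j] Suc by (simp only: of_nat_mult[symmetric]) (simp add: mult.commute)
      have "of_nat b * (fact j * of_nat (a choose j) * of_nat ((b - 1) choose j) * \<zeta> ^ (a + (b - 1) - 2 * j) * f (Suc j))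
        = (of_nat b * of_nat ((b - 1) choose j)) * (fact j * of_nat (a choose j) * \<zeta> ^ (a + (b - 1) - 2 * j) * f (Suc j))"
        by (simp only: mult_ac)
      also have "\<dots> = fact (Suc j) * of_nat (a choose j) * of_nat (b choose Suc j) * \<zeta> ^ (Suc a + b - 2 * Suc j) * f (Suc j)"
        unfolding e using Suc by (simp add: mult_ac)
      finally show ?thesis .
    qed
    then show ?thesis by (simp only: sum_distrib_left)
  qed
  have "(\<Sum>j\<le>Suc N. fact j * of_nat (Suc a choose j) * of_nat (b choose j) * \<zeta> ^ (Suc a + b - 2 * j) * f j)
     = \<zeta> ^ (Suc a + b) * f 0 + (\<Sum>j\<le>N. fact (Suc j) * of_nat (Suc a choose Suc j) * of_nat (b choose Suc j) * \<zeta> ^ (Suc a + b - 2 * Suc j) * f (Suc j))"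
    by (subst sum.atMost_Suc_shift) simp
  moreover have "(\<Sum>j\<le>Suc N. fact j * of_nat (a choose j) * of_nat (b choose j) * \<zeta> ^ (Suc a + b - 2 * j) * f j)
     = \<zeta> ^ (Suc a + b) * f 0 + (\<Sum>j\<le>N. fact (Suc j) * of_nat (a choose Suc j) * of_nat (b choose Suc j) * \<zeta> ^ (Suc a + b - 2 * Suc j) * f (Suc j))"
    by (subst sum.atMost_Suc_shift) simp
  ultimately show ?thesis unfolding 1 2 
    by (simp add: sum.distrib[symmetric] algebra_simps del: fact_Suc power_Suc)
qed

text \<open>Normal ordering: an \<open>up_op\<close> moved across becomes a \<open>down_op\<close>,
  which either contracts with one of the \<open>b\<close> copies of \<open>up_op\<close> or lowers
  \<open>qv w l\<close> with a factor \<zeta>. The index \<open>j\<close> counts the contractions,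
  and \<open>N\<close> may be any bound of \<open>a\<close>, so that different terms can share one
  range.\<close>

lemma gram:
  assumes zw: "z \<noteq> 0" "w \<noteq> 0" "zeta z = \<zeta>" "zeta w = \<zeta>" and "a + k = b + l" "a \<le> N"
  shows "level_inner (a + k) ((up_op ^^ a) (qv z k)) ((up_op ^^ b) (qv w l)) =
    (\<Sum>j\<le>N. fact j * of_nat (a choose j) * of_nat (b choose j) * \<zeta> ^ (a + b - 2 * j) * qv_gram z w (int l - int a + int j))"
  using assms(5,6)
proof (induction a arbitrary: b l N)
  case 0
  \<comment> \<open>With no \<open>up_op\<close> left on the first vector, each one on the second
    lowers \<open>qv z\<close> and yields a factor \<zeta>.\<close>
  have D0: "level_inner k (qv z k) ((up_op ^^ b) (qv w l)) = \<zeta> ^ b * level_inner l (qv z l) (qv w l)" if "k = b + l" for k b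
    using that
  proof (induction b arbitrary: k)
    case (Suc b)
    have "level_inner k (qv z k) ((up_op ^^ Suc b) (qv w l)) = level_inner (b + l) (down_op (qv z (Suc (b + l)))) ((up_op ^^ b) (qv w l))"
      using level_inner_adjoint[of "b + l" "\<lambda>_. 1" "(up_op ^^ b) (qv w l)" "qv z (Suc (b + l))"] Suc.prems
      by (simp add: level_inner_commute[of _ "qv z (Suc (b + l))"] level_inner_commute[of _ "down_op (qv z (Suc (b + l)))"])
    also have "\<dots> = \<zeta> * level_inner (b + l) (qv z (b + l)) ((up_op ^^ b) (qv w l))"
      by (simp add: D_qv zw) (simp add: level_inner_def sum_distrib_left mult_ac)
    finally show ?case using Suc.IH[of "b + l"] by simp
  qed simp
  have "(\<Sum>j\<le>N. fact j * of_nat (0 choose j) * of_nat (b choose j) * \<zeta> ^ (0 + b - 2 * j) * qv_gram z w (int l - int 0 + int j))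
     = \<zeta> ^ b * qv_gram z w (int l)"
    by (subst sum.remove[of _ 0]) (auto simp: binomial_eq_0 intro!: sum.neutral)
  then show ?case using D0[of k b] 0 by (simp add: qv_gram_def)
next
  case (Suc a)
  then obtain N' where N: "N = Suc N'" "a \<le> N'" by (cases N) auto
  have "level_inner (Suc a + k) ((up_op ^^ Suc a) (qv z k)) ((up_op ^^ b) (qv w l)) = 
      level_inner (a + k) ((up_op ^^ a) (qv z k)) (down_op ((up_op ^^ b) (qv w l)))"
    by (simp add: level_inner_adjoint)
  also have "\<dots> = level_inner (a + k) ((up_op ^^ a) (qv z k)) ((up_op ^^ b) (down_op (qv w l))) 
     + of_nat b * level_inner (a + k) ((up_op ^^ a) (qv z k)) ((up_op ^^ (b - 1)) (qv w l))"
    unfolding D_funpow_U using level_inner_add_right[of _ _ 1] by simp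
  also have "level_inner (a + k) ((up_op ^^ a) (qv z k)) ((up_op ^^ b) (down_op (qv w l))) =
    \<zeta> * (\<Sum>j\<le>N'. fact j * of_nat (a choose j) * of_nat (b choose j) * \<zeta> ^ (a + b - 2 * j) * qv_gram z w (int l - int (Suc a) + int j))"
  proof (cases l)
    case 0
    have "(\<Sum>j\<le>N'. fact j * of_nat (a choose j) * of_nat (b choose j) * \<zeta> ^ (a + b - 2 * j) * qv_gram z w (int l - int (Suc a) + int j)) = 0"
      by (intro sum.neutral) (auto simp: 0 qv_gram_def)
    then show ?thesis using 0 by (simp add: D_qv_0 zw op_linear level_inner_def)
  next
    case (Suc l')
    have "level_inner (a + k) ((up_op ^^ a) (qv z k)) ((up_op ^^ b) (down_op (qv w l))) = \<zeta> * level_inner (a + k) ((up_op ^^ a) (qv z k)) ((up_op ^^ b) (qv w l'))"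
      by (simp add: Suc D_qv zw) (simp add: level_inner_def op_linear sum_distrib_left mult_ac)
    then show ?thesis using Suc.IH[of b l' N'] Suc.prems N Suc by simp
  qed
  also have "of_nat b * level_inner (a + k) ((up_op ^^ a) (qv z k)) ((up_op ^^ (b - 1)) (qv w l)) =
    of_nat b * (\<Sum>j\<le>N'. fact j * of_nat (a choose j) * of_nat ((b - 1) choose j) * \<zeta> ^ (a + (b - 1) - 2 * j) * qv_gram z w (int l - int (Suc a) + int (Suc j)))"
    using Suc.IH[of "b - 1" l N'] Suc.prems N by (cases b) (auto simp: algebra_simps)
  finally show ?case
    unfolding N using qv_gram_step[of a N' \<zeta> b "\<lambda>j. qv_gram z w (int l - int (Suc a) + int j)"] N by (simp only:)
qed

section \<open>The second moment of the corner generating function\<close>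

text \<open>The coefficient at \<open>p\<close> counts the ways to grow \<open>p\<close> from the
  empty partition box by box, that is, the standard tableaux of shape \<open>p\<close>.\<close>

definition up_power :: "nat \<Rightarrow> par \<Rightarrow> complex" where "up_power n = (up_op ^^ n) vac"

text \<open>The double sum that is left once all contractions are taken out. The shift
  \<open>e = 0\<close> belongs to two multiplications by \<open>tsum\<close>, \<open>e = 1\<close>
  to a multiplication paired with \<open>down_op_z\<close>, whose expansion has shifted binomial
  coefficients.\<close>

definition binom_gram :: "complex \<Rightarrow> complex \<Rightarrow> nat \<Rightarrow> nat \<Rightarrow> complex" where
  "binom_gram z w e n = (\<Sum>k\<le>n. \<Sum>l\<le>n. of_nat (n choose k) * of_nat ((n + e) choose (l + e)) * zeta z ^ ((n - k) + (n - l)) 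
      * qv_gram z w (int k + int l - int n))"

lemma mult_tsum_fv: "mult_tsum z (up_power n) = (\<lambda>p. \<Sum>k\<le>n. of_nat (n choose k) * (up_op ^^ (n - k)) (qv z k) p)"
  unfolding up_power_def qv_def by (rule ext) (rule mult_tsum_funpow_U)

lemma choose_mult_shift:
  assumes "l \<le> n" shows "((n + e) choose (l + e)) * ((n - l) choose j) = ((n + e) choose j) * ((n + e - j) choose (l + e))"
proof (cases "l + j \<le> n")
  case True
  have "((n + e) choose (l + e)) * ((n - l) choose j) = ((n + e) choose (l + e + j)) * ((l + e + j) choose (l + e))"
    using choose_mult[of "l + e" "l + e + j" "n + e"] True by simp
  also have "\<dots> = ((n + e) choose (l + e + j)) * ((l + e + j) choose j)"
    using binomial_symmetric[of j "l + e + j"] by simp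
  also have "\<dots> = ((n + e) choose j) * ((n + e - j) choose (l + e))"
    using choose_mult[of j "l + e + j" "n + e"] True by simp
  finally show ?thesis .
qed (use assms in \<open>auto simp: binomial_eq_0\<close>)

text \<open>With \<open>j\<close> contractions from \<open>gram\<close>,
  \<open>choose_mult_shift\<close> moves their binomial coefficients out of the inner sums; a sum of
  the same kind at \<open>n - j\<close> remains.\<close>

lemma gram_sum:
  assumes zw: "z \<noteq> 0" "w \<noteq> 0" "zeta z = \<zeta>" "zeta w = \<zeta>"
  shows "(\<Sum>k\<le>n. \<Sum>l\<le>n. of_nat (n choose k) * of_nat ((n + e) choose (l + e)) * level_inner n ((up_op ^^ (n - k)) (qv z k)) ((up_op ^^ (n - l)) (qv w l)))
    = (\<Sum>j\<le>n. fact j * of_nat (n choose j) * of_nat ((n + e) choose j) * binom_gram z w e (n - j))"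
proof -
  let ?t = "\<lambda>k l j. of_nat (n choose k) * of_nat ((n + e) choose (l + e)) * 
       (fact j * of_nat ((n - k) choose j) * of_nat ((n - l) choose j) * \<zeta> ^ ((n - k) + (n - l) - 2 * j) * qv_gram z w (int l - int (n - k) + int j))"
  have "(\<Sum>k\<le>n. \<Sum>l\<le>n. of_nat (n choose k) * of_nat ((n + e) choose (l + e)) * level_inner n ((up_op ^^ (n - k)) (qv z k)) ((up_op ^^ (n - l)) (qv w l)))
    = (\<Sum>k\<le>n. \<Sum>l\<le>n. \<Sum>j\<le>n. ?t k l j)"
  proof (intro sum.cong refl)
    fix k l assume "k \<in> {..n}" "l \<in> {..n}"
    then show "of_nat (n choose k) * of_nat ((n + e) choose (l + e)) * level_inner n ((up_op ^^ (n - k)) (qv z k)) ((up_op ^^ (n - l)) (qv w l)) = (\<Sum>j\<le>n. ?t k l j)"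
      using gram[OF zw, of "n - k" k "n - l" l n] by (simp add: sum_distrib_left)
  qed
  also have "\<dots> = (\<Sum>k\<le>n. \<Sum>j\<le>n. \<Sum>l\<le>n. ?t k l j)" by (intro sum.cong refl sum.swap)
  also have "\<dots> = (\<Sum>j\<le>n. \<Sum>k\<le>n. \<Sum>l\<le>n. ?t k l j)" by (rule sum.swap)
  also have "\<dots> = (\<Sum>j\<le>n. fact j * of_nat (n choose j) * of_nat ((n + e) choose j) * binom_gram z w e (n - j))"
  proof (intro sum.cong refl)
    fix j assume j: "j \<in> {..n}"
    have "(\<Sum>k\<le>n. \<Sum>l\<le>n. ?t k l j) = (\<Sum>k\<le>n-j. \<Sum>l\<le>n. ?t k l j)"
    proof (rule sum.mono_neutral_right, simp, simp, intro ballI sum.neutral)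
      fix k l assume "k \<in> {..n} - {..n-j}"
      then have "(n - k) choose j = 0" by (auto intro!: binomial_eq_0)
      then show "?t k l j = 0" by simp
    qed
    also have "\<dots> = (\<Sum>k\<le>n-j. \<Sum>l\<le>n-j. ?t k l j)"
      by (intro sum.cong refl sum.mono_neutral_right) (auto simp: binomial_eq_0)
    also have "\<dots> = (\<Sum>k\<le>n-j. \<Sum>l\<le>n-j. fact j * of_nat (n choose j) * of_nat ((n + e) choose j) *
       (of_nat ((n - j) choose k) * of_nat ((n - j + e) choose (l + e)) * zeta z ^ ((n - j - k) + (n - j - l)) 
      * qv_gram z w (int k + int l - int (n - j))))"
    proof (intro sum.cong refl)
      fix k l assume k: "k \<in> {..n-j}" and l: "l \<in> {..n-j}"
      have 1: "of_nat (n choose k) * of_nat ((n - k) choose j) = (of_nat (n choose j) * of_nat ((n - j) choose k) :: complex)"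
        using choose_mult_shift[of k n 0 j] k by (simp only: of_nat_mult[symmetric]) simp
      have 2: "of_nat ((n + e) choose (l + e)) * of_nat ((n - l) choose j) = (of_nat ((n + e) choose j) * of_nat ((n - j + e) choose (l + e)) :: complex)"
        using choose_mult_shift[of l n e j] l j by (simp only: of_nat_mult[symmetric]) simp
      have "?t k l j = fact j * (of_nat (n choose k) * of_nat ((n - k) choose j)) * (of_nat ((n + e) choose (l + e)) * of_nat ((n - l) choose j)) *
        (\<zeta> ^ ((n - k) + (n - l) - 2 * j) * qv_gram z w (int l - int (n - k) + int j))" by (simp add: mult_ac)
      also have "\<dots> = fact j * (of_nat (n choose j) * of_nat ((n - j) choose k)) * (of_nat ((n + e) choose j) * of_nat ((n - j + e) choose (l + e))) *
        (\<zeta> ^ ((n - j - k) + (n - j - l)) * qv_gram z w (int k + int l - int (n - j)))"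
      proof -
        have "int l - int (n - k) + int j = int k + int l - int (n - j)" using k l j by auto
        moreover have "(n - k) + (n - l) - 2 * j = (n - j - k) + (n - j - l)" using k l j by auto
        ultimately show ?thesis by (simp only: 1 2)
      qed
      also have "\<dots> = fact j * of_nat (n choose j) * of_nat ((n + e) choose j) *
       (of_nat ((n - j) choose k) * of_nat ((n - j + e) choose (l + e)) * zeta z ^ ((n - j - k) + (n - j - l)) 
      * qv_gram z w (int k + int l - int (n - j)))"
        by (simp only: zw mult_ac)
      finally show "?t k l j = fact j * of_nat (n choose j) * of_nat ((n + e) choose j) *
       (of_nat ((n - j) choose k) * of_nat ((n - j + e) choose (l + e)) * zeta z ^ ((n - j - k) + (n - j - l)) 
      * qv_gram z w (int k + int l - int (n - j)))"
        .
    qed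
    also have "\<dots> = fact j * of_nat (n choose j) * of_nat ((n + e) choose j) * binom_gram z w e (n - j)"
      by (simp only: binom_gram_def sum_distrib_left)
    finally show "(\<Sum>k\<le>n. \<Sum>l\<le>n. ?t k l j) = fact j * of_nat (n choose j) * of_nat ((n + e) choose j) * binom_gram z w e (n - j)" .
  qed
  finally show ?thesis .
qed

text \<open>\<open>qv_gram\<close> and the power of \<open>zeta z\<close> depend only on
  \<open>p = k + l - n\<close>, so the sum over the pairs with a given \<open>p\<close> is
  Vandermonde's convolution.\<close>

lemma binom_gram_eq: "binom_gram z w e n = (\<Sum>p\<le>n. qv_gram z w (int p) * zeta z ^ (n - p) * of_nat ((2 * n + e) choose (n - p)))"
proof -
  let ?t = "\<lambda>k l. of_nat (n choose k) * of_nat ((n + e) choose (l + e)) * zeta z ^ ((n - k) + (n - l)) 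
      * qv_gram z w (int k + int l - int n)"
  have "binom_gram z w e n = (\<Sum>(k,l)\<in>{..n}\<times>{..n}. ?t k l)"
    unfolding binom_gram_def by (rule sum.cartesian_product)
  also have "\<dots> = (\<Sum>(k,l)\<in>{(k,l). k \<le> n \<and> l \<le> n \<and> n \<le> k + l}. ?t k l)"
    by (rule sum.mono_neutral_right) (auto simp: qv_gram_def split: if_splits)
  also have "\<dots> = (\<Sum>(p,i)\<in>(SIGMA p:{..n}. {..n-p}). ?t (p + i) (n - i))"
    by (rule sum.reindex_bij_witness[of _ "\<lambda>(p,i). (p + i, n - i)" "\<lambda>(k,l). (k + l - n, n - l)"]) auto
  also have "\<dots> = (\<Sum>p\<le>n. \<Sum>i\<le>n-p. ?t (p + i) (n - i))" by (rule sum.Sigma[symmetric]) auto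
  also have "\<dots> = (\<Sum>p\<le>n. qv_gram z w (int p) * zeta z ^ (n - p) * of_nat ((2 * n + e) choose (n - p)))"
  proof (intro sum.cong refl)
    fix p assume p: "p \<in> {..n}"
    have "(\<Sum>i\<le>n-p. ?t (p + i) (n - i)) = (\<Sum>i\<le>n-p. qv_gram z w (int p) * zeta z ^ (n - p) * of_nat (((n + e) choose i) * (n choose (n - p - i))))"
    proof (intro sum.cong refl)
      fix i assume i: "i \<in> {..n-p}"
      have "n choose (p + i) = n choose (n - p - i)" using binomial_symmetric[of "p + i" n] i p by simp
      moreover have "(n + e) choose (n - i + e) = (n + e) choose i"
        using binomial_symmetric[of i "n + e"] i p by simp
      moreover have "(n - (p + i)) + (n - (n - i)) = n - p" using i p by auto
      moreover have "int (p + i) + int (n - i) - int n = int p" using i p by auto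
      ultimately show "?t (p + i) (n - i) = qv_gram z w (int p) * zeta z ^ (n - p) * of_nat (((n + e) choose i) * (n choose (n - p - i)))"
        by (simp only: of_nat_mult mult_ac)
    qed
    also have "\<dots> = qv_gram z w (int p) * zeta z ^ (n - p) * of_nat ((2 * n + e) choose (n - p))"
      using vandermonde[of "n + e" n "n - p"] by (simp only: sum_distrib_left[symmetric] of_nat_sum[symmetric]) (simp add: mult_2 add_ac)
    finally show "(\<Sum>i\<le>n-p. ?t (p + i) (n - i)) = qv_gram z w (int p) * zeta z ^ (n - p) * of_nat ((2 * n + e) choose (n - p))" .
  qed
  finally show ?thesis .
qed

text \<open>The Plancherel mean of \<open>tsum z * tsum w\<close> times \<open>fact n\<close>, the
  normalisation being \<open>level_inner_fv\<close>.\<close>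

definition corner_moment :: "complex \<Rightarrow> complex \<Rightarrow> nat \<Rightarrow> complex" where
  "corner_moment z w n = level_inner n (mult_tsum z (up_power n)) (mult_tsum w (up_power n))"

lemma level_inner_sum_sum: "level_inner n (\<lambda>p. \<Sum>k\<in>A. c k * F k p) (\<lambda>p. \<Sum>l\<in>B. d l * H l p) = (\<Sum>k\<in>A. \<Sum>l\<in>B. c k * d l * level_inner n (F k) (H l))"
  by (simp add: level_inner_sum_left level_inner_sum_right sum_distrib_left mult_ac)

lemma corner_moment_eq:
  assumes "z \<noteq> 0" "w \<noteq> 0" "zeta z = \<zeta>" "zeta w = \<zeta>"
  shows "corner_moment z w n = fact n * (\<Sum>i\<le>n. of_nat (n choose i) * binom_gram z w 0 i / fact i)"
proof -
  have "corner_moment z w n = (\<Sum>j\<le>n. fact j * of_nat (n choose j) * of_nat (n choose j) * binom_gram z w 0 (n - j))"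
    using gram_sum[OF assms, of n 0] unfolding corner_moment_def mult_tsum_fv by (simp add: level_inner_sum_sum)
  also have "\<dots> = (\<Sum>j\<le>n. fact n * (of_nat (n choose (n - j)) * binom_gram z w 0 (n - j) / fact (n - j)))"
  proof (intro sum.cong refl)
    fix j assume j: "j \<in> {..n}"
    have "fact j * of_nat (n choose j) = (fact n / fact (n - j) :: complex)"
      using j by (simp add: binomial_fact)
    moreover have "n choose j = n choose (n - j)" using j binomial_symmetric[of j n] by simp
    ultimately show "fact j * of_nat (n choose j) * of_nat (n choose j) * binom_gram z w 0 (n - j) = 
      fact n * (of_nat (n choose (n - j)) * binom_gram z w 0 (n - j) / fact (n - j))"
      by simp
  qed
  also have "\<dots> = (\<Sum>i\<le>n. fact n * (of_nat (n choose i) * binom_gram z w 0 i / fact i))"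
    by (rule sum.reindex_bij_witness[of _ "\<lambda>i. n - i" "\<lambda>i. n - i"]) auto
  finally show ?thesis by (simp add: sum_distrib_left)
qed

text \<open>\<open>zeta z * down_op_z z\<close> is the commutator of \<open>down_op\<close> with
  multiplication by \<open>tsum z\<close>. Both orders of that product are known on
  \<open>up_power\<close>, and \<open>zeta z\<close> is divided out.\<close>

lemma Dz_fv:
  assumes z: "z \<noteq> 0" "zeta z \<noteq> 0"
  shows "down_op_z z (up_power (Suc n)) p = (\<Sum>l\<le>n. of_nat (Suc n choose Suc l) * (up_op ^^ (n - l)) (qv z l) p)"
proof -
  let ?q = "\<lambda>i l. (up_op ^^ i) (qv z l) p"
  have "down_op (mult_tsum z (up_power (Suc n))) p = (\<Sum>k\<le>Suc n. of_nat (Suc n choose k) * down_op ((up_op ^^ (Suc n - k)) (qv z k)) p)"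
    unfolding mult_tsum_fv by (rule linear_op_sum_scale) simp
  also have "\<dots> = (\<Sum>k\<le>Suc n. of_nat (Suc n choose k) * (up_op ^^ (Suc n - k)) (down_op (qv z k)) p) 
      + (\<Sum>k\<le>Suc n. of_nat (Suc n choose k) * (of_nat (Suc n - k) * ?q (n - k) k))"
  proof -
    have "Suc n - k - 1 = n - k" for k by simp
    then show ?thesis by (simp only: D_funpow_U distrib_left sum.distrib)
  qed
  also have "(\<Sum>k\<le>Suc n. of_nat (Suc n choose k) * (of_nat (Suc n - k) * ?q (n - k) k)) = 
     (\<Sum>k\<le>n. of_nat (Suc n) * (of_nat (n choose k) * ?q (n - k) k))"
  proof -
    have "of_nat (Suc n choose k) * of_nat (Suc n - k) = (of_nat (Suc n) * of_nat (n choose k) :: complex)" if "k \<le> n" for k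
      using binomial_absorb_comp[of "Suc n" k] by (simp only: of_nat_mult[symmetric]) (simp add: mult.commute)
    then show ?thesis by (simp add: mult.assoc[symmetric] del: of_nat_Suc binomial_Suc_Suc)
  qed
  also have "(\<Sum>k\<le>Suc n. of_nat (Suc n choose k) * (up_op ^^ (Suc n - k)) (down_op (qv z k)) p) 
     = zeta z * (\<Sum>l\<le>n. of_nat (Suc n choose Suc l) * ?q (n - l) l)"
    by (subst sum.atMost_Suc_shift) (simp add: D_qv_0 D_qv z op_linear sum_distrib_left mult_ac del: funpow.simps binomial_Suc_Suc)
  finally have 1: "down_op (mult_tsum z (up_power (Suc n))) p = zeta z * (\<Sum>l\<le>n. of_nat (Suc n choose Suc l) * ?q (n - l) l) 
      + (\<Sum>k\<le>n. of_nat (Suc n) * (of_nat (n choose k) * ?q (n - k) k))" .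
  have "down_op (mult_tsum z (up_power (Suc n))) p = mult_tsum z (down_op (up_power (Suc n))) p + zeta z * down_op_z z (up_power (Suc n)) p"
    by (simp add: D_Tm z)
  also have "mult_tsum z (down_op (up_power (Suc n))) p = of_nat (Suc n) * mult_tsum z (up_power n) p"
    unfolding up_power_def D_funpow_U_vac by (simp add: mult_tsum_def mult_ac)
  also have "\<dots> = (\<Sum>k\<le>n. of_nat (Suc n) * (of_nat (n choose k) * ?q (n - k) k))"
    unfolding mult_tsum_fv by (simp only: sum_distrib_left)
  finally show ?thesis using 1 z by simp
qed

lemma level_inner_fv: "level_inner n (up_power n) (up_power n) = fact n"
proof (induction n)
  case 0
  show ?case by (simp add: level_inner_def up_power_def pars_0 vac_def)
next
  case (Suc n)
  have "level_inner (Suc n) (up_power (Suc n)) (up_power (Suc n)) = level_inner n (up_power n) (down_op (up_power (Suc n)))"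
    unfolding up_power_def by (simp add: level_inner_adjoint)
  also have "\<dots> = of_nat (Suc n) * level_inner n (up_power n) (up_power n)"
    unfolding up_power_def D_funpow_U_vac by (simp add: level_inner_def sum_distrib_left mult_ac)
  finally show ?case by (simp add: Suc)
qed

text \<open>One \<open>up_op\<close> is moved over as \<open>down_op\<close>. For
  \<open>w = 1 / z\<close> the doubly commuted term has weight
  \<open>z powi c * w powi c = 1\<close>, so it is a plain \<open>down_op\<close> and contributes
  the inhomogeneous term with \<open>zeta z ^ 2\<close>.\<close>

lemma corner_moment_Suc:
  assumes zw: "z \<noteq> 0" "w = 1 / z" "zeta z \<noteq> 0"
  shows "corner_moment z w (Suc n) = of_nat (Suc n) * corner_moment z w n + zeta z * (level_inner n (mult_tsum z (up_power n)) (down_op_z w (up_power (Suc n))) + level_inner n (mult_tsum w (up_power n)) (down_op_z z (up_power (Suc n))))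
    + zeta z ^ 2 * fact (Suc n)"
proof -
  have w: "w \<noteq> 0" "zeta w = zeta z" using zw by (auto simp: zeta_def)
  let ?F = "up_power (Suc n)"
  have p1: "z powi c * w powi c = 1" for c using zw by (simp add: power_int_divide_distrib)
  have "corner_moment z w (Suc n) = level_inner (Suc n) (up_op (up_power n)) (mult_tsum z (mult_tsum w ?F))"
    unfolding corner_moment_def by (simp add: level_inner_def mult_tsum_def up_power_def mult_ac)
  also have "\<dots> = level_inner n (up_power n) (down_op (mult_tsum z (mult_tsum w ?F)))" by (rule level_inner_adjoint)
  also have "down_op (mult_tsum z (mult_tsum w ?F)) = (\<lambda>p. mult_tsum z (mult_tsum w (down_op ?F)) p + zeta z * mult_tsum z (down_op_z w ?F) p + zeta z * mult_tsum w (down_op_z z ?F) p + zeta z ^ 2 * down_op ?F p)"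
  proof (rule ext)
    fix p
    have "down_op (mult_tsum z (mult_tsum w ?F)) p = mult_tsum z (down_op (mult_tsum w ?F)) p + zeta z * down_op_z z (mult_tsum w ?F) p"
      by (simp add: D_Tm zw)
    also have "down_op_z z (mult_tsum w ?F) p = mult_tsum w (down_op_z z ?F) p + zeta z * down_op ?F p"
      using Dop_Tm[OF w(1), of "\<lambda>c. z powi c" ?F p] w(2) p1 by simp
    also have "mult_tsum z (down_op (mult_tsum w ?F)) p = mult_tsum z (mult_tsum w (down_op ?F)) p + zeta z * mult_tsum z (down_op_z w ?F) p"
      unfolding mult_tsum_def[of z] using D_Tm[OF w(1), of ?F] w(2) by (simp add: algebra_simps)
    finally show "down_op (mult_tsum z (mult_tsum w ?F)) p = mult_tsum z (mult_tsum w (down_op ?F)) p + zeta z * mult_tsum z (down_op_z w ?F) p + zeta z * mult_tsum w (down_op_z z ?F) p + zeta z ^ 2 * down_op ?F p"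
      by (simp add: algebra_simps power2_eq_square)
  qed
  also have "down_op ?F = (\<lambda>p. of_nat (Suc n) * up_power n p)" unfolding up_power_def by (rule D_funpow_U_vac)
  also have "level_inner n (up_power n) (\<lambda>p. mult_tsum z (mult_tsum w (\<lambda>p. of_nat (Suc n) * up_power n p)) p + zeta z * mult_tsum z (down_op_z w ?F) p + zeta z * mult_tsum w (down_op_z z ?F) p + zeta z ^ 2 * (of_nat (Suc n) * up_power n p))
    = of_nat (Suc n) * corner_moment z w n + zeta z * (level_inner n (mult_tsum z (up_power n)) (down_op_z w ?F) + level_inner n (mult_tsum w (up_power n)) (down_op_z z ?F))
    + zeta z ^ 2 * (of_nat (Suc n) * level_inner n (up_power n) (up_power n))"
    by (simp only: level_inner_def corner_moment_def mult_tsum_def sum.distrib[symmetric] sum_distrib_left) (rule sum.cong, simp_all add: algebra_simps)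
  finally show ?thesis by (simp add: level_inner_fv)
qed

lemma qv_gram_commute: "qv_gram z w k = qv_gram w z k"
  by (simp add: qv_gram_def level_inner_commute)

text \<open>Two evaluations of the second moment are compared, \<open>corner_moment_eq\<close> and
  the recursion \<open>corner_moment_Suc\<close>. Their difference says that the binomial transform
  of the sequence \<open>E\<close> is constant.\<close>

lemma binom_gram_recurrence:
  assumes zw: "z \<noteq> 0" "w = 1 / z" "zeta z \<noteq> 0"
  shows "binom_gram z w 0 (Suc n) - 2 * zeta z * binom_gram z w 1 n = (if n = 0 then zeta z ^ 2 else 0)"
proof -
  have w: "w \<noteq> 0" "zeta w = zeta z" using zw by (auto simp: zeta_def)
  have VC: "binom_gram w z 1 n = binom_gram z w 1 n" for n unfolding binom_gram_eq using w by (simp add: qv_gram_commute)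
  have M: "level_inner n (mult_tsum x (up_power n)) (down_op_z y (up_power (Suc n))) = fact (Suc n) * (\<Sum>i\<le>n. of_nat (n choose i) * binom_gram x y 1 i / fact (Suc i))"
    if xy: "x \<noteq> 0" "y \<noteq> 0" "zeta x = zeta z" "zeta y = zeta z" for x y n
  proof -
    have "level_inner n (mult_tsum x (up_power n)) (down_op_z y (up_power (Suc n))) = (\<Sum>k\<le>n. \<Sum>l\<le>n. of_nat (n choose k) * of_nat ((n + 1) choose (l + 1)) * level_inner n ((up_op ^^ (n - k)) (qv x k)) ((up_op ^^ (n - l)) (qv y l)))"
    proof -
      have "down_op_z y (up_power (Suc n)) = (\<lambda>p. \<Sum>l\<le>n. of_nat ((n + 1) choose (l + 1)) * (up_op ^^ (n - l)) (qv y l) p)"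
        using Dz_fv[of y n] xy zw by (intro ext) (simp del: binomial_Suc_Suc)
      then show ?thesis unfolding mult_tsum_fv by (simp only: level_inner_sum_sum)
    qed
    also have "\<dots> = (\<Sum>j\<le>n. fact j * of_nat (n choose j) * of_nat ((n + 1) choose j) * binom_gram x y 1 (n - j))"
      by (rule gram_sum[OF xy])
    also have "\<dots> = (\<Sum>j\<le>n. fact (Suc n) * (of_nat (n choose (n - j)) * binom_gram x y 1 (n - j) / fact (Suc (n - j))))"
    proof (intro sum.cong refl)
      fix j assume j: "j \<in> {..n}"
      have "fact j * of_nat ((n + 1) choose j) = (fact (n + 1) / fact (n + 1 - j) :: complex)"
        using j by (subst binomial_fact) (auto simp: field_simps)
      moreover have "n choose j = n choose (n - j)" using j binomial_symmetric[of j n] by simp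
      moreover have "n + 1 - j = Suc (n - j)" using j by auto
      moreover have "fact j * of_nat (n choose j) * of_nat ((n + 1) choose j) * binom_gram x y 1 (n - j) = 
         (fact j * of_nat ((n + 1) choose j)) * of_nat (n choose j) * binom_gram x y 1 (n - j)" by (simp only: mult_ac)
      ultimately show "fact j * of_nat (n choose j) * of_nat ((n + 1) choose j) * binom_gram x y 1 (n - j) = 
        fact (Suc n) * (of_nat (n choose (n - j)) * binom_gram x y 1 (n - j) / fact (Suc (n - j)))"
        by (simp del: fact_Suc binomial_Suc_Suc add: mult.commute mult.left_commute)
    qed
    also have "\<dots> = (\<Sum>i\<le>n. fact (Suc n) * (of_nat (n choose i) * binom_gram x y 1 i / fact (Suc i)))"
      by (rule sum.reindex_bij_witness[of _ "\<lambda>i. n - i" "\<lambda>i. n - i"]) auto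
    finally show ?thesis by (simp only: sum_distrib_left)
  qed
  define E where "E i = (binom_gram z w 0 (Suc i) - 2 * zeta z * binom_gram z w 1 i) / fact (Suc i)" for i
  have S: "(\<Sum>i\<le>n. of_nat (n choose i) * E i) = zeta z ^ 2" for n
  proof -
    let ?v = "\<lambda>i. binom_gram z w 0 i / fact i"
    have "corner_moment z w (Suc n) = fact (Suc n) * ((\<Sum>i\<le>n. of_nat (n choose i) * ?v i) + (\<Sum>i\<le>n. of_nat (n choose i) * ?v (Suc i)))"
    proof -
      have "(\<Sum>i\<le>Suc n. of_nat (Suc n choose i) * ?v i) = ?v 0 + (\<Sum>i\<le>n. of_nat (Suc n choose Suc i) * ?v (Suc i))"
        by (subst sum.atMost_Suc_shift) simp
      also have "\<dots> = (?v 0 + (\<Sum>i\<le>n. of_nat (n choose Suc i) * ?v (Suc i))) + (\<Sum>i\<le>n. of_nat (n choose i) * ?v (Suc i))"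
        by (simp add: algebra_simps sum.distrib add_divide_distrib del: fact_Suc)
      also have "?v 0 + (\<Sum>i\<le>n. of_nat (n choose Suc i) * ?v (Suc i)) = (\<Sum>i\<le>Suc n. of_nat (n choose i) * ?v i)"
        by (subst sum.atMost_Suc_shift) simp
      also have "\<dots> = (\<Sum>i\<le>n. of_nat (n choose i) * ?v i)" by (simp add: binomial_eq_0)
      finally show ?thesis using corner_moment_eq[OF zw(1) w(1) refl w(2), of "Suc n"] by simp
    qed
    moreover have "of_nat (Suc n) * corner_moment z w n = fact (Suc n) * (\<Sum>i\<le>n. of_nat (n choose i) * ?v i)"
      using corner_moment_eq[OF zw(1) w(1) refl w(2), of n] by simp
    moreover have "corner_moment z w (Suc n) = of_nat (Suc n) * corner_moment z w n + zeta z * (2 * fact (Suc n) * (\<Sum>i\<le>n. of_nat (n choose i) * binom_gram z w 1 i / fact (Suc i))) + zeta z ^ 2 * fact (Suc n)"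
      unfolding corner_moment_Suc[OF zw] using M[OF zw(1) w(1) refl w(2)] M[OF w(1) zw(1) w(2) refl] VC by simp
    ultimately have "fact (Suc n) * (\<Sum>i\<le>n. of_nat (n choose i) * ?v (Suc i)) = 
       fact (Suc n) * (zeta z * 2 * (\<Sum>i\<le>n. of_nat (n choose i) * binom_gram z w 1 i / fact (Suc i)) + zeta z ^ 2)"
      by (simp only: distrib_left) (simp add: algebra_simps del: fact_Suc)
    then have "(\<Sum>i\<le>n. of_nat (n choose i) * ?v (Suc i)) = zeta z * 2 * (\<Sum>i\<le>n. of_nat (n choose i) * binom_gram z w 1 i / fact (Suc i)) + zeta z ^ 2"
      by (simp del: fact_Suc)
    then show ?thesis unfolding E_def
      by (simp add: diff_divide_distrib right_diff_distrib sum_subtractf sum_distrib_left mult_ac del: fact_Suc)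
  qed
  \<comment> \<open>A constant binomial transform forces \<open>E\<close> to vanish except at
    \<open>0\<close>.\<close>
  have "E n = (if n = 0 then zeta z ^ 2 else 0)"
  proof (induction n rule: less_induct)
    case (less n)
    show ?case
    proof (cases n)
      case 0
      then show ?thesis using S[of 0] by simp
    next
      case (Suc m)
      have "(\<Sum>i\<le>n. of_nat (n choose i) * E i) = (\<Sum>i\<le>m. of_nat (n choose i) * E i) + E n" unfolding Suc by simp
      also have "(\<Sum>i\<le>m. of_nat (n choose i) * E i) = (\<Sum>i\<le>m. if i = 0 then zeta z ^ 2 else 0)"
        using less Suc by (intro sum.cong) auto
      finally show ?thesis using S[of n] Suc by simp
    qed
  qed
  then show ?thesis by (cases n) (auto simp: E_def simp del: fact_Suc)
qed

lemma choose_central_step: "P < N \<Longrightarrow> (N + P + 1) * ((2 * N) choose (N - Suc P)) = (N - P) * ((2 * N) choose (N - P))"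
proof -
  assume "P < N"
  then have e: "Suc (N - Suc P + (N + P)) = 2 * N" "Suc (N - Suc P) = N - P" by auto
  show ?thesis using Suc_times_binomial_add[of "N - Suc P" "N + P"] unfolding e by simp
qed

text \<open>All partial sums have a closed form, by induction with
  \<open>choose_central_step\<close>; at \<open>P = N\<close> the factor \<open>N - P\<close>
  removes the boundary term. The same holds for \<open>alt_sum_choose2\<close>.\<close>

lemma alt_sum_choose1:
  assumes "P \<le> N"
  shows "2 * (2 * of_nat N - 1) * (\<Sum>p\<le>P. (-1)^p * of_nat p * of_nat ((2 * N) choose (N - p))) =
    ((-1)^P * (of_nat N - of_nat P) * (2 * of_nat P + 1) * of_nat ((2 * N) choose (N - P)) - of_nat N * of_nat ((2 * N) choose N) :: complex)"
  using assms
proof (induction P)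
  case (Suc P)
  let ?c = "of_nat ((2 * N) choose (N - Suc P)) :: complex"
  have "(of_nat (N + P + 1) * ?c :: complex) = of_nat (N - P) * of_nat ((2 * N) choose (N - P))"
    using choose_central_step[of P N] Suc.prems by (simp only: of_nat_mult[symmetric])
  moreover have "of_nat (N + P + 1) = (of_nat N + of_nat P + 1 :: complex)" by simp
  moreover have "of_nat (N - P) = (of_nat N - of_nat P :: complex)" using Suc.prems by (simp add: of_nat_diff)
  ultimately have e: "(of_nat N - of_nat P) * of_nat ((2 * N) choose (N - P)) = (of_nat N + of_nat P + 1) * ?c"
    by metis
  have "2 * (2 * of_nat N - 1) * (\<Sum>p\<le>Suc P. (-1)^p * of_nat p * of_nat ((2 * N) choose (N - p))) =
     (-1)^P * (2 * of_nat P + 1) * ((of_nat N - of_nat P) * of_nat ((2 * N) choose (N - P))) - of_nat N * of_nat ((2 * N) choose N)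
      + 2 * (2 * of_nat N - 1) * ((-1)^Suc P * of_nat (Suc P) * ?c)"
    using Suc by (simp add: algebra_simps)
  then show ?case unfolding e by (simp add: algebra_simps)
qed simp

lemma alt_sum_choose2:
  assumes "P \<le> N"
  shows "2 * (of_nat N - 1) * (\<Sum>p\<le>P. (-1)^p * of_nat p * of_nat p * of_nat ((2 * N) choose (N - p))) =
    ((-1)^P * (of_nat N - of_nat P) * (of_nat P + 1) * of_nat P * of_nat ((2 * N) choose (N - P)) :: complex)"
  using assms
proof (induction P)
  case (Suc P)
  let ?c = "of_nat ((2 * N) choose (N - Suc P)) :: complex"
  have "(of_nat (N + P + 1) * ?c :: complex) = of_nat (N - P) * of_nat ((2 * N) choose (N - P))"
    using choose_central_step[of P N] Suc.prems by (simp only: of_nat_mult[symmetric])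
  moreover have "of_nat (N + P + 1) = (of_nat N + of_nat P + 1 :: complex)" by simp
  moreover have "of_nat (N - P) = (of_nat N - of_nat P :: complex)" using Suc.prems by (simp add: of_nat_diff)
  ultimately have e: "(of_nat N - of_nat P) * of_nat ((2 * N) choose (N - P)) = (of_nat N + of_nat P + 1) * ?c"
    by metis
  have "2 * (of_nat N - 1) * (\<Sum>p\<le>Suc P. (-1)^p * of_nat p * of_nat p * of_nat ((2 * N) choose (N - p))) =
     (-1)^P * (of_nat P + 1) * of_nat P * ((of_nat N - of_nat P) * of_nat ((2 * N) choose (N - P)))
      + 2 * (of_nat N - 1) * ((-1)^Suc P * of_nat (Suc P) * of_nat (Suc P) * ?c)"
    using Suc by (simp add: algebra_simps)
  then show ?case unfolding e by (simp add: algebra_simps)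
qed simp

lemma choose_diff_central:
  assumes "p \<le> N" "N > 0"
  shows "of_nat N * (of_nat ((2 * N) choose (N - p)) - (if p < N then 2 * of_nat ((2 * N - 1) choose (N - 1 - p)) else 0)) = 
     (of_nat p * of_nat ((2 * N) choose (N - p)) :: complex)"
proof (cases "p < N")
  case True
  then have "(2 * N) * ((2 * N - 1) choose (N - 1 - p)) = (N - p) * ((2 * N) choose (N - p))"
    using Suc_times_binomial_eq[of "2 * N - 1" "N - 1 - p"] assms by (simp add: mult.commute Suc_diff_Suc del: binomial_Suc_Suc mult_Suc mult_Suc_right)
  then have "(2 * of_nat N * of_nat ((2 * N - 1) choose (N - 1 - p)) :: complex) = of_nat (N - p) * of_nat ((2 * N) choose (N - p))"
    by (metis of_nat_mult of_nat_numeral)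
  then show ?thesis using True by (simp add: algebra_simps of_nat_diff)
qed (use assms in auto)

text \<open>The recurrence for \<open>binom_gram\<close> determines \<open>qv_gram\<close> at
  \<open>N\<close> from the smaller arguments, since it enters with the nonzero factor
  \<open>N\<close>. The claimed values satisfy the same relation by
  \<open>alt_sum_choose2\<close>.\<close>

lemma qv_gram_eq:
  assumes zw: "z \<noteq> 0" "w = 1 / z" "zeta z \<noteq> 0"
  shows "qv_gram z w (int p) = (if p = 0 then 1 else - ((-1) ^ p) * of_nat p * zeta z ^ (p + 1))"
proof (induction p rule: less_induct)
  case (less N)
  let ?\<zeta> = "zeta z"
  have w: "w \<noteq> 0" "zeta w = zeta z" using zw by (auto simp: zeta_def)
  let ?cand = "\<lambda>p. if p = 0 then 1 else - ((-1) ^ p) * of_nat p * ?\<zeta> ^ (p + 1)"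
  show ?case
  proof (cases N)
    case 0
    then show ?thesis by (simp add: qv_gram_def level_inner_def pars_0 qv_def mult_tsum_def vac_def tsum_empty)
  next
    case (Suc n)
    let ?c = "\<lambda>p. of_nat p * of_nat ((2 * N) choose (N - p)) :: complex"
    let ?d = "\<lambda>p. of_nat ((2 * N) choose (N - p)) - (if p < N then 2 * of_nat ((2 * N - 1) choose (N - 1 - p)) else 0) :: complex"
    have "binom_gram z w 0 N - 2 * ?\<zeta> * binom_gram z w 1 n = (\<Sum>p\<le>N. qv_gram z w (int p) * ?\<zeta> ^ (N - p) * ?d p)"
    proof -
      have "2 * ?\<zeta> * binom_gram z w 1 n = (\<Sum>p\<le>n. qv_gram z w (int p) * ?\<zeta> ^ (N - p) * (2 * of_nat ((2 * N - 1) choose (N - 1 - p))))"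
        unfolding binom_gram_eq sum_distrib_left by (intro sum.cong refl) (simp add: Suc Suc_diff_le)
      also have "\<dots> = (\<Sum>p\<le>N. qv_gram z w (int p) * ?\<zeta> ^ (N - p) * (if p < N then 2 * of_nat ((2 * N - 1) choose (N - 1 - p)) else 0))"
        by (simp add: Suc)
      finally show ?thesis unfolding binom_gram_eq by (simp add: right_diff_distrib sum_subtractf)
    qed
    then have "(if n = 0 then ?\<zeta> ^ 2 else 0) = (\<Sum>p\<le>N. qv_gram z w (int p) * ?\<zeta> ^ (N - p) * ?d p)"
      using binom_gram_recurrence[OF zw, of n] Suc by simp
    then have "of_nat N * (if n = 0 then ?\<zeta> ^ 2 else 0) = (\<Sum>p\<le>N. qv_gram z w (int p) * ?\<zeta> ^ (N - p) * (of_nat N * ?d p))"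
    proof -
      assume "(if n = 0 then ?\<zeta> ^ 2 else 0) = (\<Sum>p\<le>N. qv_gram z w (int p) * ?\<zeta> ^ (N - p) * ?d p)"
      then have "(if n = 0 then ?\<zeta> ^ 2 else 0) = (\<Sum>p\<le>N. qv_gram z w (int p) * ?\<zeta> ^ (N - p) * ?d p)"
      using binom_gram_recurrence[OF zw, of n] Suc by simp
    then have "of_nat N * (if n = 0 then ?\<zeta> ^ 2 else 0) = of_nat N * (\<Sum>p\<le>N. qv_gram z w (int p) * ?\<zeta> ^ (N - p) * ?d p)"
        by (rule arg_cong)
      also have "\<dots> = (\<Sum>p\<le>N. qv_gram z w (int p) * ?\<zeta> ^ (N - p) * (of_nat N * ?d p))"
        unfolding sum_distrib_left by (intro sum.cong refl) (simp only: mult_ac)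
      finally show ?thesis .
    qed
    also have "\<dots> = (\<Sum>p\<le>N. qv_gram z w (int p) * ?\<zeta> ^ (N - p) * ?c p)"
      by (intro sum.cong refl) (use choose_diff_central[of _ N] Suc in simp)
    also have "\<dots> = (\<Sum>p\<le>n. ?cand p * ?\<zeta> ^ (N - p) * ?c p) + qv_gram z w (int N) * of_nat N"
      unfolding Suc sum.atMost_Suc using less Suc by (intro arg_cong2[of _ _ _ _ "(+)"] sum.cong) (auto simp del: binomial_Suc_Suc)
    finally have 1: "of_nat N * (if n = 0 then ?\<zeta> ^ 2 else 0) = (\<Sum>p\<le>n. ?cand p * ?\<zeta> ^ (N - p) * ?c p) + qv_gram z w (int N) * of_nat N" .
    have "(\<Sum>p\<le>N. ?cand p * ?\<zeta> ^ (N - p) * ?c p) = (\<Sum>p\<le>N. - (?\<zeta> ^ (N + 1) * ((-1)^p * of_nat p * of_nat p * of_nat ((2 * N) choose (N - p)))))"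
    proof (intro sum.cong refl)
      fix p assume p: "p \<in> {..N}"
      obtain r where r: "N = p + r" using p le_Suc_ex by auto
      show "?cand p * ?\<zeta> ^ (N - p) * ?c p = - (?\<zeta> ^ (N + 1) * ((-1)^p * of_nat p * of_nat p * of_nat ((2 * N) choose (N - p))))"
        unfolding r by (simp add: mult_ac power_add)
    qed
    also have "\<dots> = - (?\<zeta> ^ (N + 1) * (\<Sum>p\<le>N. (-1)^p * of_nat p * of_nat p * of_nat ((2 * N) choose (N - p))))"
      by (simp add: sum_negf sum_distrib_left)
    also have "\<dots> = of_nat N * (if n = 0 then ?\<zeta> ^ 2 else 0)"
    \<comment> \<open>\<open>alt_sum_choose2\<close> carries the factor \<open>N - 1\<close>, so
      \<open>N = 1\<close> is checked directly.\<close>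
    proof (cases n)
      case (Suc n')
      have "2 * (of_nat N - 1) * (\<Sum>p\<le>N. (-1)^p * of_nat p * of_nat p * of_nat ((2 * N) choose (N - p))) = (0 :: complex)"
        using alt_sum_choose2[of N N] by simp
      moreover have "(of_nat N - 1 :: complex) \<noteq> 0" using \<open>N = Suc n\<close> Suc by (simp del: of_nat_Suc add: of_nat_Suc[of n])
      ultimately show ?thesis using Suc by simp
    qed (simp add: \<open>N = Suc n\<close> power2_eq_square)
    finally have 3: "(\<Sum>p\<le>N. ?cand p * ?\<zeta> ^ (N - p) * ?c p) = of_nat N * (if n = 0 then ?\<zeta> ^ 2 else 0)" .
    have sp: "(\<Sum>p\<le>N. g p) = (\<Sum>p\<le>n. g p) + g N" for g :: "nat \<Rightarrow> complex" 
      unfolding Suc by (rule sum.atMost_Suc)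
    have e: "?cand N * ?\<zeta> ^ (N - N) * ?c N = ?cand N * of_nat N" by simp
    have 2: "(\<Sum>p\<le>n. ?cand p * ?\<zeta> ^ (N - p) * ?c p) + ?cand N * of_nat N = of_nat N * (if n = 0 then ?\<zeta> ^ 2 else 0)"
      using 3[unfolded sp] unfolding e .
    have eq: "qv_gram z w (int N) * of_nat N = ?cand N * of_nat N" 
      by (rule add_left_imp_eq[OF trans[OF 1[symmetric] 2[symmetric]]])
    have "(of_nat N :: complex) \<noteq> 0" using Suc by (simp only: of_nat_eq_0_iff)
    from mult_right_cancel[OF this] eq show ?thesis by blast
  qed
qed

lemma central_binomial_step:
  assumes "N > 0" shows "N * ((2 * N) choose N) = 2 * (2 * N - 1) * ((2 * N - 2) choose (N - 1))"
proof -
  obtain m where m: "N = Suc m" using assms by (cases N) auto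
  have 1: "Suc m * (Suc (2 * m + 1) choose Suc m) = Suc (2 * m + 1) * ((2 * m + 1) choose m)"
    using Suc_times_binomial_eq[of "2 * m + 1" m] by (simp only: mult.commute)
  have 2: "Suc m * (Suc (2 * m) choose Suc m) = Suc (2 * m) * ((2 * m) choose m)"
    using Suc_times_binomial_eq[of "2 * m" m] by (simp only: mult.commute)
  have 3: "(2 * m + 1) choose m = Suc (2 * m) choose Suc m"
    using binomial_symmetric[of m "2 * m + 1"] by simp
  have e: "Suc (2 * m + 1) = 2 * Suc m" by simp
  have "Suc m * (Suc (2 * m + 1) choose Suc m) = Suc (2 * m + 1) * (Suc (2 * m) choose Suc m)"
    using 1 3 by metis
  also have "\<dots> = 2 * (Suc m * (Suc (2 * m) choose Suc m))" by (simp only: e mult.assoc)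
  finally have "Suc m * (Suc (2 * m + 1) choose Suc m) = 2 * (Suc (2 * m) * ((2 * m) choose m))"
    unfolding 2 .
  then show ?thesis unfolding m by (simp del: binomial_Suc_Suc mult_Suc)
qed

text \<open>With the values of \<open>qv_gram\<close>, all terms but \<open>p = 0\<close> carry the
  same power of \<open>zeta z\<close>; their alternating sum is \<open>alt_sum_choose1\<close> over
  the full range.\<close>

lemma binom_gram_closed:
  assumes zw: "z \<noteq> 0" "w = 1 / z" "zeta z \<noteq> 0" and "N > 0"
  shows "binom_gram z w 0 N = zeta z ^ N * (of_nat ((2 * N) choose N) + zeta z * of_nat ((2 * N - 2) choose (N - 1)))"
proof -
  let ?\<zeta> = "zeta z"
  have "binom_gram z w 0 N = (\<Sum>p\<le>N. (if p = 0 then ?\<zeta> ^ N * of_nat ((2 * N) choose N) else 0) - ?\<zeta> ^ (N + 1) * ((-1) ^ p * of_nat p * of_nat ((2 * N) choose (N - p))))"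
    unfolding binom_gram_eq
  proof (intro sum.cong refl)
    fix p assume p: "p \<in> {..N}"
    obtain r where r: "N = p + r" using p le_Suc_ex by auto
    show "qv_gram z w (int p) * ?\<zeta> ^ (N - p) * of_nat (2 * N + 0 choose (N - p)) =
        (if p = 0 then ?\<zeta> ^ N * of_nat ((2 * N) choose N) else 0) - ?\<zeta> ^ (N + 1) * ((-1) ^ p * of_nat p * of_nat ((2 * N) choose (N - p)))"
      unfolding qv_gram_eq[OF zw] r by (simp add: mult_ac power_add)
  qed
  also have "\<dots> = ?\<zeta> ^ N * of_nat ((2 * N) choose N) - ?\<zeta> ^ (N + 1) * (\<Sum>p\<le>N. (-1) ^ p * of_nat p * of_nat ((2 * N) choose (N - p)))"
    by (simp add: sum_subtractf sum_distrib_left)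
  also have "(\<Sum>p\<le>N. (-1) ^ p * of_nat p * of_nat ((2 * N) choose (N - p))) = (- of_nat ((2 * N - 2) choose (N - 1)) :: complex)"
  proof -
    have "(of_nat N * of_nat ((2 * N) choose N) :: complex) = 2 * of_nat (2 * N - 1) * of_nat ((2 * N - 2) choose (N - 1))"
      using central_binomial_step[OF assms(4)] by (metis of_nat_mult of_nat_numeral)
    moreover have n0: "(of_nat (2 * N - 1) :: complex) = 2 * of_nat N - 1" using assms(4) by (simp add: of_nat_diff)
    ultimately have e: "2 * of_nat (2 * N - 1) * (\<Sum>p\<le>N. (-1) ^ p * of_nat p * of_nat ((2 * N) choose (N - p))) = 2 * of_nat (2 * N - 1) * (- of_nat ((2 * N - 2) choose (N - 1)) :: complex)"
      using alt_sum_choose1[of N N] by simp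
    have "(of_nat (2 * N - 1) :: complex) \<noteq> 0" using assms(4) by (subst of_nat_eq_0_iff) simp
    then have "2 * (of_nat (2 * N - 1) :: complex) \<noteq> 0" by (simp only: mult_eq_0_iff) simp
    from mult_left_cancel[OF this] e show ?thesis by blast
  qed
  finally show ?thesis by (simp add: algebra_simps)
qed

theorem corner_moment_closed:
  assumes zw: "z \<noteq> 0" "w = 1 / z" "zeta z \<noteq> 0"
  shows "corner_moment z w n = fact n * (1 + (\<Sum>k=1..n. of_nat (n choose k) / fact k * zeta z ^ k * 
     (of_nat ((2 * k) choose k) + zeta z * of_nat ((2 * k - 2) choose (k - 1)))))"
proof -
  have w: "w \<noteq> 0" "zeta w = zeta z" using zw by (auto simp: zeta_def)
  have V0: "binom_gram z w 0 0 = 1" unfolding binom_gram_eq using qv_gram_eq[OF zw, of 0] by simp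
  have "(\<Sum>i\<le>n. of_nat (n choose i) * binom_gram z w 0 i / fact i) = 1 + (\<Sum>i=1..n. of_nat (n choose i) * binom_gram z w 0 i / fact i)"
    by (simp add: V0 atMost_atLeast0 sum.atLeast_Suc_atMost)
  also have "(\<Sum>i=1..n. of_nat (n choose i) * binom_gram z w 0 i / fact i) = (\<Sum>k=1..n. of_nat (n choose k) / fact k * zeta z ^ k * 
     (of_nat ((2 * k) choose k) + zeta z * of_nat ((2 * k - 2) choose (k - 1))))"
    by (intro sum.cong refl) (simp add: binom_gram_closed[OF zw])
  finally show ?thesis using corner_moment_eq[OF zw(1) w(1) refl w(2)] by simp
qed

section \<open>The hook length formula\<close>

text \<open>The weights are the residues of \<open>1\<close> minus the product of
  \<open>1 - 1 / (z - x i)\<close>. Their sum and first moment are the leading coefficients of that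
  function at infinity. One induction proves all three claims, because inserting a node uses the
  partial fractions at that node.\<close>

lemma interpolation_weights:
  fixes x :: "'b \<Rightarrow> 'a::field_char_0"
  assumes "finite A" "inj_on x A"
  defines "w \<equiv> \<lambda>A i. \<Prod>j\<in>A-{i}. 1 - 1 / (x i - x j)"
  shows interpolation_weights_partial_fraction: 
      "\<And>z. z \<notin> x ` A \<Longrightarrow> (\<Sum>i\<in>A. w A i / (z - x i)) = 1 - (\<Prod>i\<in>A. 1 - 1 / (z - x i))"
    and interpolation_weights_sum: "(\<Sum>i\<in>A. w A i) = of_nat (card A)"
    and interpolation_weights_moment: "2 * (\<Sum>i\<in>A. x i * w A i) = 2 * (\<Sum>i\<in>A. x i) - of_nat (card A) * (of_nat (card A) - 1)"
proof -
  have "(\<forall>z. z \<notin> x ` A \<longrightarrow> (\<Sum>i\<in>A. w A i / (z - x i)) = 1 - (\<Prod>i\<in>A. 1 - 1 / (z - x i))) \<and>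
    (\<Sum>i\<in>A. w A i) = of_nat (card A) \<and>
    2 * (\<Sum>i\<in>A. x i * w A i) = 2 * (\<Sum>i\<in>A. x i) - of_nat (card A) * (of_nat (card A) - 1)"
    using assms(1,2)
  proof (induction A)
    case (insert b A)
    have inj: "inj_on x A" and b: "x b \<notin> x ` A" using insert by auto
    note IH = insert.IH[OF inj]
    define Q where "Q z = (\<Prod>i\<in>A. 1 - 1 / (z - x i))" for z
    have wb: "w (insert b A) b = Q (x b)" using insert by (simp add: w_def Q_def)
    have wi: "w (insert b A) i = w A i + w A i / (x b - x i)" if "i \<in> A" for i
    proof -
      have "insert b A - {i} = insert b (A - {i})" using that insert by auto
      moreover have "x i - x b \<noteq> 0" using that b by (metis imageI right_minus_eq)
      ultimately show ?thesis using insert that by (simp add: w_def field_simps)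
    qed
    have PF: "(\<Sum>i\<in>A. w A i / (z - x i)) = 1 - Q z" if "z \<notin> x ` A" for z
      using IH that by (simp add: Q_def)
    have S1: "(\<Sum>i\<in>A. w (insert b A) i) = of_nat (card A) + 1 - Q (x b)"
      using IH PF[OF b] by (simp add: wi sum.distrib)
    have S2: "(\<Sum>i\<in>A. x i * w (insert b A) i) = (\<Sum>i\<in>A. x i * w A i) - of_nat (card A) + x b * (1 - Q (x b))"
    proof -
      have "x i * w (insert b A) i = x i * w A i - w A i + x b * (w A i / (x b - x i))" if "i \<in> A" for i
      proof -
        have "x b - x i \<noteq> 0" using that b by auto
        then show ?thesis by (simp add: wi[OF that] field_simps)
      qed
      then have "(\<Sum>i\<in>A. x i * w (insert b A) i) = (\<Sum>i\<in>A. x i * w A i - w A i + x b * (w A i / (x b - x i)))"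
        by (intro sum.cong refl)
      also have "\<dots> = (\<Sum>i\<in>A. x i * w A i) - (\<Sum>i\<in>A. w A i) + x b * (\<Sum>i\<in>A. w A i / (x b - x i))"
        by (simp only: sum.distrib sum_subtractf sum_distrib_left)
      finally show ?thesis using IH PF[OF b] by simp
    qed
    have "(\<Sum>i\<in>insert b A. w (insert b A) i / (z - x i)) = 1 - (\<Prod>i\<in>insert b A. 1 - 1 / (z - x i))"
      if z: "z \<notin> x ` insert b A" for z
    proof -
      have zb: "z - x b \<noteq> 0" using z by auto
      have "w (insert b A) i / (z - x i) = w A i / (z - x i) + (1 / (z - x b)) * (w A i / (x b - x i) - w A i / (z - x i))"
        if "i \<in> A" for i
      proof -
        have nz: "x b - x i \<noteq> 0" "z - x i \<noteq> 0" using that b z by auto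
        then have f: "1 / (x b - x i) - 1 / (z - x i) = (z - x b) / ((x b - x i) * (z - x i))"
          by (simp add: field_simps)
        have "(1 / (z - x b)) * (w A i / (x b - x i) - w A i / (z - x i)) = (1 / (z - x b)) * (w A i * (1 / (x b - x i) - 1 / (z - x i)))"
          by (simp add: right_diff_distrib)
        also have "\<dots> = w A i / ((x b - x i) * (z - x i))" unfolding f using zb by simp
        finally have "(1 / (z - x b)) * (w A i / (x b - x i) - w A i / (z - x i)) = w A i / ((x b - x i) * (z - x i))" .
        with nz show ?thesis by (simp add: wi[OF that] add_divide_distrib)
      qed
      then have "(\<Sum>i\<in>A. w (insert b A) i / (z - x i)) = 1 - Q z + (1 / (z - x b)) * ((1 - Q (x b)) - (1 - Q z))"
      proof -
        assume "\<And>i. i \<in> A \<Longrightarrow> w (insert b A) i / (z - x i) = w A i / (z - x i) + (1 / (z - x b)) * (w A i / (x b - x i) - w A i / (z - x i))"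
        then have "(\<Sum>i\<in>A. w (insert b A) i / (z - x i)) = (\<Sum>i\<in>A. w A i / (z - x i) + (1 / (z - x b)) * (w A i / (x b - x i) - w A i / (z - x i)))"
          by (intro sum.cong refl)
        also have "\<dots> = (\<Sum>i\<in>A. w A i / (z - x i)) + (1 / (z - x b)) * ((\<Sum>i\<in>A. w A i / (x b - x i)) - (\<Sum>i\<in>A. w A i / (z - x i)))"
          by (simp only: sum.distrib sum_subtractf[symmetric] sum_distrib_left)
        finally show ?thesis using PF[OF b] PF[of z] z by simp
      qed
      moreover have "(\<Sum>i\<in>insert b A. w (insert b A) i / (z - x i)) = Q (x b) / (z - x b) + (\<Sum>i\<in>A. w (insert b A) i / (z - x i))"
        using insert.hyps by (simp add: wb)
      moreover have "(\<Prod>i\<in>insert b A. 1 - 1 / (z - x i)) = (1 - 1 / (z - x b)) * Q z"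
        using insert.hyps by (simp add: Q_def)
      ultimately show ?thesis by (simp only:) (simp add: divide_inverse algebra_simps)
    qed
    moreover have "(\<Sum>i\<in>insert b A. w (insert b A) i) = of_nat (card (insert b A))"
      using insert S1 by (simp add: wb)
    moreover have "2 * (\<Sum>i\<in>insert b A. x i * w (insert b A) i) = 2 * (\<Sum>i\<in>insert b A. x i) - of_nat (card (insert b A)) * (of_nat (card (insert b A)) - 1)"
    proof -
      have "2 * (\<Sum>i\<in>insert b A. x i * w (insert b A) i) = 2 * (\<Sum>i\<in>A. x i * w A i) - 2 * of_nat (card A) + 2 * x b"
      proof -
        have "(\<Sum>i\<in>insert b A. x i * w (insert b A) i) = x b * Q (x b) + (\<Sum>i\<in>A. x i * w (insert b A) i)"
          using insert.hyps by (simp add: wb)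
        then show ?thesis unfolding S2 by (simp only:) (simp add: algebra_simps)
      qed
      also have "2 * (\<Sum>i\<in>A. x i * w A i) = 2 * (\<Sum>i\<in>A. x i) - of_nat (card A) * (of_nat (card A) - 1)"
        using IH by simp
      finally show ?thesis using insert by (simp add: algebra_simps)
    qed
    ultimately show ?case by blast
  qed simp
  then show "\<And>z. z \<notin> x ` A \<Longrightarrow> (\<Sum>i\<in>A. w A i / (z - x i)) = 1 - (\<Prod>i\<in>A. 1 - 1 / (z - x i))"
    "(\<Sum>i\<in>A. w A i) = of_nat (card A)"
    "2 * (\<Sum>i\<in>A. x i * w A i) = 2 * (\<Sum>i\<in>A. x i) - of_nat (card A) * (of_nat (card A) - 1)"
    by blast+
qed

text \<open>The beta-numbers of \<open>p\<close> padded to \<open>m\<close> rows, a strictly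
  decreasing sequence that encodes the partition as beads on a line.\<close>

definition bead :: "nat \<Rightarrow> par \<Rightarrow> nat \<Rightarrow> nat" where
  "bead m p i = row p i + (m - 1 - i)"

lemma bead_strict: "i < j \<Longrightarrow> j < m \<Longrightarrow> bead m p j < bead m p i"
  using row_antimono[of i j p] by (simp add: bead_def)

lemma bead_inj: "inj_on (bead m p) {..<m}"
proof (rule inj_onI)
  fix i j assume "i \<in> {..<m}" "j \<in> {..<m}" "bead m p i = bead m p j"
  then show "i = j" using bead_strict[of i j m p] bead_strict[of j i m p] by (cases i j rule: linorder_cases) auto
qed

definition pairs :: "nat \<Rightarrow> (nat \<times> nat) set" where "pairs m = {(i,j). i < j \<and> j < m}"

lemma finite_pairs [simp]: "finite (pairs m)"
  by (rule finite_subset[of _ "{..<m} \<times> {..<m}"]) (auto simp: pairs_def)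

text \<open>Frobenius' formula for the number of standard tableaux divided by the factorial of the
  size.\<close>

definition hook_quot :: "nat \<Rightarrow> par \<Rightarrow> real" where
  "hook_quot m p = (\<Prod>(i,j)\<in>pairs m. real (bead m p i) - real (bead m p j)) / (\<Prod>i<m. fact (bead m p i))"

lemma eq_mult_of_divide_eq: "a / b = c \<Longrightarrow> b > 0 \<Longrightarrow> a = b * c" for a b c :: real
  by (auto simp: field_simps)

lemma vandermonde_pos: "(\<Prod>(i,j)\<in>pairs m. real (bead m p i) - real (bead m p j)) > 0"
  by (rule prod_pos) (auto simp: pairs_def bead_strict)

lemma hook_quot_pos: "hook_quot m p > 0"
  unfolding hook_quot_def by (intro divide_pos_pos vandermonde_pos prod_pos) simp

text \<open>Removing a box lowers one bead by one. The Vandermonde factors with this bead produce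
  the interpolation weight, and its factorial produces the factor \<open>bead m p i\<close>.\<close>

lemma hook_quot_remove:
  assumes i: "i \<in> removable p" "i < m"
  shows "hook_quot m (remove_box p i) = hook_quot m p * (real (bead m p i) * (\<Prod>j\<in>{..<m}-{i}. 1 - 1 / (real (bead m p i) - real (bead m p j))))"
proof -
  let ?x = "\<lambda>i. real (bead m p i)" and ?y = "\<lambda>j. real (bead m (remove_box p i) j)"
  have ri: "row p i > 0" using i by (auto simp: removable_def)
  have y: "?y j = (if j = i then ?x i - 1 else ?x j)" for j
    using i ri by (auto simp: bead_def row_remove_box of_nat_diff)
  have ne: "?x a \<noteq> ?x b" if "a < m" "b < m" "a \<noteq> b" for a b
    using bead_inj[of m p] that by (auto simp: inj_on_def)
  have "(\<Prod>(a,b)\<in>pairs m. ?y a - ?y b) / (\<Prod>(a,b)\<in>pairs m. ?x a - ?x b) = (\<Prod>(a,b)\<in>pairs m. (?y a - ?y b) / (?x a - ?x b))"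
    unfolding prod_dividef[symmetric] by (rule prod.cong) auto
  also have "\<dots> = (\<Prod>(a,b)\<in>{(a,b)\<in>pairs m. a = i \<or> b = i}. (?y a - ?y b) / (?x a - ?x b))"
  proof (rule prod.mono_neutral_right)
    have "(?y a - ?y b) / (?x a - ?x b) = 1" if "(a, b) \<in> pairs m" "a \<noteq> i" "b \<noteq> i" for a b
    proof -
      have "?x a - ?x b \<noteq> 0" using ne[of a b] that by (auto simp: pairs_def)
      then show ?thesis using that by (simp add: y)
    qed
    note * = this
    show "\<forall>ab\<in>pairs m - {(a,b)\<in>pairs m. a = i \<or> b = i}. (case ab of (a, b) \<Rightarrow> (?y a - ?y b) / (?x a - ?x b)) = 1"
    proof
      fix ab assume ab: "ab \<in> pairs m - {(a,b)\<in>pairs m. a = i \<or> b = i}"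
      obtain a b where e: "ab = (a, b)" by (cases ab)
      have "(a, b) \<in> pairs m" "a \<noteq> i" "b \<noteq> i" using ab by (auto simp: e)
      from *[OF this] show "(case ab of (a, b) \<Rightarrow> (?y a - ?y b) / (?x a - ?x b)) = 1" by (simp only: e split)
    qed
  qed auto
  also have "\<dots> = (\<Prod>j\<in>{..<m}-{i}. 1 - 1 / (?x i - ?x j))"
  proof (rule prod.reindex_bij_witness[of _ "\<lambda>j. if j < i then (j, i) else (i, j)" "\<lambda>(a,b). if a = i then b else a"], goal_cases)
    case (5 ab)
    obtain a b where ab: "ab = (a, b)" by (cases ab)
    have "?x a - ?x b \<noteq> 0" "?x b - ?x a \<noteq> 0" using 5 ne[of a b] by (auto simp: ab pairs_def)
    then have "(?x a - 1 - ?x b) / (?x a - ?x b) = 1 - 1 / (?x a - ?x b)" "(?x a - (?x b - 1)) / (?x a - ?x b) = 1 - 1 / (?x b - ?x a)"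
      by (simp_all add: divide_simps) (simp add: algebra_simps)
    then show ?case using 5 by (auto simp: ab y pairs_def)
  qed (use i in \<open>auto simp: pairs_def split: if_splits\<close>)
  finally have V: "(\<Prod>(a,b)\<in>pairs m. ?y a - ?y b) = (\<Prod>(a,b)\<in>pairs m. ?x a - ?x b) * (\<Prod>j\<in>{..<m}-{i}. 1 - 1 / (?x i - ?x j))"
    by (rule eq_mult_of_divide_eq[OF _ vandermonde_pos])
  have "fact (bead m p i) = ?x i * (fact (bead m (remove_box p i) i) :: real)"
  proof -
    have "bead m p i = Suc (bead m (remove_box p i) i)" using ri i by (simp add: bead_def row_remove_box)
    then show ?thesis by simp
  qed
  moreover have "(\<Prod>j\<in>{..<m}-{i}. fact (bead m (remove_box p i) j)) = (\<Prod>j\<in>{..<m}-{i}. fact (bead m p j) :: real)"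
    using i by (intro prod.cong) (auto simp: bead_def row_remove_box)
  moreover have "(\<Prod>j<m. fact (bead m p j) :: real) = fact (bead m p i) * (\<Prod>j\<in>{..<m}-{i}. fact (bead m p j))"
    using i by (subst prod.remove[of _ i]) auto
  moreover have "(\<Prod>j<m. fact (bead m (remove_box p i) j) :: real) = fact (bead m (remove_box p i) i) * (\<Prod>j\<in>{..<m}-{i}. fact (bead m (remove_box p i) j))"
    using i by (subst prod.remove[of _ i]) auto
  moreover have "?x i \<noteq> 0" using ri by (simp add: bead_def)
  ultimately have F: "(\<Prod>j<m. fact (bead m p j) :: real) = ?x i * (\<Prod>j<m. fact (bead m (remove_box p i) j))"
    by simp
  show ?thesis unfolding hook_quot_def V F using \<open>?x i \<noteq> 0\<close> by (simp add: field_simps)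
qed

lemma sum_bead:
  assumes "rows p \<le> m"
  shows "2 * (\<Sum>i<m. real (bead m p i)) = 2 * real (psize p) + real m * (real m - 1)"
proof -
  have "(\<Sum>i<m. real (m - 1 - i)) = (\<Sum>i<m. real i)"
    by (rule sum.reindex_bij_witness[of _ "\<lambda>i. m - 1 - i" "\<lambda>i. m - 1 - i"]) auto
  moreover have "2 * (\<Sum>i<m. real i) = real m * (real m - 1)"
    by (induction m) (auto simp: algebra_simps)
  moreover have "(\<Sum>i<m. real (bead m p i)) = (\<Sum>i<m. real (row p i)) + (\<Sum>i<m. real (m - 1 - i))"
    by (simp only: bead_def of_nat_add sum.distrib)
  moreover have "(\<Sum>i<m. real (row p i)) = real (psize p)" using psize_eq[OF assms] by simp
  ultimately show ?thesis by (simp only: distrib_left)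
qed

text \<open>The sum may run over all rows: if row \<open>i\<close> is not removable, the next bead
  occupies the position just below its bead, so the weight has a zero factor, or it is the last bead
  and sits at \<open>0\<close>. The first moment of the weights is then the sum of the beads minus
  \<open>m (m - 1) / 2\<close>, which is the size.\<close>

lemma sum_hook_quot_remove:
  assumes "rows p \<le> m"
  shows "(\<Sum>i\<in>removable p. hook_quot m (remove_box p i)) = real (psize p) * hook_quot m p"
proof -
  let ?x = "\<lambda>i. real (bead m p i)"
  let ?w = "\<lambda>i. \<Prod>j\<in>{..<m}-{i}. 1 - 1 / (?x i - ?x j)"
  have sub: "removable p \<subseteq> {..<m}" using assms removable_less_rows[of _ p] by fastforce
  have "(\<Sum>i\<in>removable p. hook_quot m (remove_box p i)) = hook_quot m p * (\<Sum>i\<in>removable p. ?x i * ?w i)"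
    using sub by (simp add: hook_quot_remove subset_iff sum_distrib_left)
  also have "(\<Sum>i\<in>removable p. ?x i * ?w i) = (\<Sum>i<m. ?x i * ?w i)"
  proof (rule sum.mono_neutral_left)
    show "\<forall>i\<in>{..<m} - removable p. ?x i * ?w i = 0"
    proof
      fix i assume i: "i \<in> {..<m} - removable p"
      then have e: "row p (Suc i) = row p i" using row_Suc_le[of p i] by (auto simp: removable_def)
      show "?x i * ?w i = 0"
      proof (cases "Suc i < m")
        case True
        then have "?x i - ?x (Suc i) = 1" using e by (simp add: bead_def of_nat_diff)
        then have "?w i = 0" using True by (intro prod_zero bexI[of _ "Suc i"]) auto
        then show ?thesis by simp
      next
        case False
        then have "m = Suc i" using i by auto
        then have "?x i = 0" using e row_eq_0[of p "Suc i"] assms by (simp add: bead_def)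
        then show ?thesis by simp
      qed
    qed
  qed (use sub in auto)
  also have "\<dots> = real (psize p)"
  proof -
    have "inj_on ?x {..<m}" using bead_inj[of m p] by (auto simp: inj_on_def)
    from interpolation_weights_moment[OF _ this] sum_bead[OF assms] show ?thesis by simp
  qed
  finally show ?thesis by (simp add: mult.commute)
qed

text \<open>The beads are \<open>m - 1, ..., 0\<close>, and numerator and denominator are both the
  product of the factorials below \<open>m\<close>.\<close>

lemma hook_quot_empty: "hook_quot m empty_par = 1"
proof -
  have f: "(\<Prod>(i,j)\<in>pairs (Suc m). real (Suc m - 1 - i) - real (Suc m - 1 - j)) = fact m * (\<Prod>(i,j)\<in>pairs m. real (m - 1 - i) - real (m - 1 - j))" for m
  proof -
    have P: "pairs (Suc m) = (\<lambda>j. (0, Suc j)) ` {..<m} \<union> (\<lambda>(i,j). (Suc i, Suc j)) ` pairs m"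
    proof (intro equalityI subsetI)
      fix ab assume "ab \<in> pairs (Suc m)"
      then obtain a b where ab: "ab = (a, Suc b)" "a \<le> b" "b < m" by (cases ab; cases "snd ab") (auto simp: pairs_def)
      then show "ab \<in> (\<lambda>j. (0, Suc j)) ` {..<m} \<union> (\<lambda>(i,j). (Suc i, Suc j)) ` pairs m"
        by (cases a) (auto simp: pairs_def image_iff)
    qed (auto simp: pairs_def)
    have "(\<Prod>(i,j)\<in>pairs (Suc m). real (Suc m - 1 - i) - real (Suc m - 1 - j)) = 
      (\<Prod>(i,j)\<in>(\<lambda>j. (0, Suc j)) ` {..<m}. real (Suc m - 1 - i) - real (Suc m - 1 - j)) *
      (\<Prod>(i,j)\<in>(\<lambda>(i,j). (Suc i, Suc j)) ` pairs m. real (Suc m - 1 - i) - real (Suc m - 1 - j))"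
      unfolding P by (rule prod.union_disjoint) auto
    also have "(\<Prod>(i,j)\<in>(\<lambda>j. (0::nat, Suc j)) ` {..<m}. real (Suc m - 1 - i) - real (Suc m - 1 - j)) = (\<Prod>j<m. real (Suc j))"
      by (subst prod.reindex) (auto simp: inj_on_def of_nat_diff intro!: prod.cong)
    also have "(\<Prod>j<m. real (Suc j)) = fact m"
      by (simp only: fact_prod_Suc of_nat_prod) (simp add: lessThan_atLeast0)
    also have "(\<Prod>(i,j)\<in>(\<lambda>(i,j). (Suc i, Suc j)) ` pairs m. real (Suc m - 1 - i) - real (Suc m - 1 - j)) = (\<Prod>(i,j)\<in>pairs m. real (m - 1 - i) - real (m - 1 - j))"
      by (subst prod.reindex) (auto simp: inj_on_def intro!: prod.cong)
    finally show ?thesis .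
  qed
  have g: "(\<Prod>i<Suc m. fact (Suc m - 1 - i) :: real) = fact m * (\<Prod>i<m. fact (m - 1 - i))" for m
    by (subst prod.lessThan_Suc_shift) simp
  have "(\<Prod>(i,j)\<in>pairs m. real (m - 1 - i) - real (m - 1 - j)) = (\<Prod>i<m. fact (m - 1 - i))"
    by (induction m) (simp_all only: f g, simp add: pairs_def)
  moreover have "(\<Prod>i<m. fact (m - 1 - i) :: real) > 0" by (rule prod_pos) simp
  ultimately show ?thesis by (simp add: hook_quot_def bead_def)
qed

lemma rows_remove_box_le: "i \<in> removable p \<Longrightarrow> rows (remove_box p i) \<le> rows p"
  unfolding rows_def[of "remove_box p i"]
  by (rule Least_le) (auto simp: row_remove_box row_eq_0)

lemma up_power_Suc: "up_power (Suc n) p = (\<Sum>i\<in>removable p. up_power n (remove_box p i))"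
  by (simp add: up_power_def Uop_def)

text \<open>Both sides obey the branching rule over removable boxes and agree on the empty
  partition.\<close>

lemma up_power_eq_hook_quot:
  "psize p = n \<Longrightarrow> rows p \<le> m \<Longrightarrow> up_power n p = of_real (fact n * hook_quot m p)"
proof (induction n arbitrary: p)
  case 0
  then have "p = empty_par" by (simp add: psize_eq_0_iff)
  then show ?case by (simp add: up_power_def vac_def hook_quot_empty)
next
  case (Suc n)
  have "up_power (Suc n) p = (\<Sum>i\<in>removable p. of_real (fact n * hook_quot m (remove_box p i)))"
    unfolding up_power_Suc
  proof (intro sum.cong refl Suc.IH)
    fix i assume i: "i \<in> removable p"
    show "psize (remove_box p i) = n" using psize_remove_box[OF i] Suc.prems by simp
    show "rows (remove_box p i) \<le> m" using rows_remove_box_le[OF i] Suc.prems by simp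
  qed
  also have "\<dots> = of_real (fact n * (\<Sum>i\<in>removable p. hook_quot m (remove_box p i)))"
    by (simp add: sum_distrib_left)
  also have "\<dots> = of_real (fact (Suc n) * hook_quot m p)"
    using sum_hook_quot_remove[OF Suc.prems(2)] Suc.prems by (simp add: algebra_simps)
  finally show ?case .
qed

section \<open>Standard Young tableaux\<close>

text \<open>Tableaux on an arbitrary set of boxes, so that the induction can take out a box without
  returning to partitions.\<close>

definition syt :: "(nat \<times> nat) set \<Rightarrow> (nat \<times> nat \<Rightarrow> nat) set" where
  "syt S = {T \<in> extensional S. bij_betw T S {1..card S} \<and>
     (\<forall>i j j'. (i, j) \<in> S \<and> (i, j') \<in> S \<and> j < j' \<longrightarrow> T (i, j) < T (i, j')) \<and>
     (\<forall>i i' j. (i, j) \<in> S \<and> (i', j) \<in> S \<and> i < i' \<longrightarrow> T (i, j) < T (i', j))}"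

definition corners :: "(nat \<times> nat) set \<Rightarrow> (nat \<times> nat) set" where
  "corners S = {(i, j) \<in> S. (\<forall>j'. j < j' \<longrightarrow> (i, j') \<notin> S) \<and> (\<forall>i'. i < i' \<longrightarrow> (i', j) \<notin> S)}"

lemma finite_syt: "finite S \<Longrightarrow> finite (syt S)"
  by (rule finite_subset[OF _ finite_PiE[of S "\<lambda>_. {1..card S}"]]) (auto simp: syt_def PiE_def bij_betw_def)

lemma syt_restrict:
  assumes S: "finite S" and T: "T \<in> syt S" "c \<in> S" "T c = card S"
  shows "c \<in> corners S" "restrict T (S - {c}) \<in> syt (S - {c})"
proof -
  have le: "T x \<le> card S" if "x \<in> S" for x using T that by (auto simp: syt_def bij_betw_def)
  show "c \<in> corners S"
    unfolding corners_def
  proof (cases c, clarify, intro conjI allI impI notI)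
    fix i j assume c: "c = (i, j)"
    show "(i, j) \<in> S" using c T by simp
    { fix j' assume "j < j'" "(i, j') \<in> S"
      then have "T (i, j) < T (i, j')" using T c unfolding syt_def by blast
      then show False using le[OF \<open>(i, j') \<in> S\<close>] T c by simp }
    { fix i' assume "i < i'" "(i', j) \<in> S"
      then have "T (i, j) < T (i', j)" using T c unfolding syt_def by blast
      then show False using le[OF \<open>(i', j) \<in> S\<close>] T c by simp }
  qed
  have b: "bij_betw T S {1..card S}" using T by (auto simp: syt_def)
  have "bij_betw T (S - {c}) ({1..card S} - {T c})"
    using inj_on_image_set_diff[of T S S "{c}"] b T by (auto simp: bij_betw_def intro: inj_on_subset)
  moreover have "{1..card S} - {T c} = {1..card (S - {c})}" using T S by (auto simp: card_Diff_singleton)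
  ultimately have "bij_betw (restrict T (S - {c})) (S - {c}) {1..card (S - {c})}"
    by (subst bij_betw_cong[of _ _ T]) auto
  then show "restrict T (S - {c}) \<in> syt (S - {c})"
    using T by (auto simp: syt_def restrict_def extensional_def)
qed

lemma syt_extend:
  assumes S: "finite S" and c: "c \<in> corners S" and T: "T \<in> syt (S - {c})"
  shows "T(c := card S) \<in> syt S"
proof -
  have cS: "c \<in> S" using c by (auto simp: corners_def)
  have card: "card (S - {c}) = card S - 1" "card S > 0" using cS S by (auto simp: card_gt_0_iff)
  have b: "bij_betw T (S - {c}) {1..card S - 1}" using T card by (simp add: syt_def)
  have "bij_betw (T(c := card S)) (insert c (S - {c})) (insert (card S) {1..card S - 1})"
  proof -
    have "bij_betw (T(c := card S)) (S - {c}) {1..card S - 1}"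
      by (subst bij_betw_cong[of _ _ T]) (use b in auto)
    from notIn_Un_bij_betw[of c "S - {c}" "T(c := card S)" "{1..card S - 1}", OF _ _ this] show ?thesis
      using card by auto
  qed
  moreover have "insert c (S - {c}) = S" "insert (card S) {1..card S - 1} = {1..card S}" using cS card by auto
  ultimately have bij: "bij_betw (T(c := card S)) S {1..card S}" by simp
  have lt: "T x < card S" if "x \<in> S" "x \<noteq> c" for x
  proof -
    have "T x \<in> {1..card S - 1}" using bij_betwE[OF b] that by blast
    then show ?thesis using card by auto
  qed
  show ?thesis
    unfolding syt_def
  proof (rule CollectI, intro conjI allI impI)
    show "T(c := card S) \<in> extensional S" using T cS by (auto simp: syt_def extensional_def)
    show "bij_betw (T(c := card S)) S {1..card S}" by (rule bij)
    { fix i j j' assume a: "(i, j) \<in> S \<and> (i, j') \<in> S \<and> j < j'"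
      then have "(i, j) \<noteq> c" using c by (auto simp: corners_def)
      then show "(T(c := card S)) (i, j) < (T(c := card S)) (i, j')"
        using a T lt[of "(i, j)"] by (auto simp: syt_def) }
    { fix i i' j assume a: "(i, j) \<in> S \<and> (i', j) \<in> S \<and> i < i'"
      then have "(i, j) \<noteq> c" using c by (auto simp: corners_def)
      then show "(T(c := card S)) (i, j) < (T(c := card S)) (i', j)"
        using a T lt[of "(i, j)"] by (auto simp: syt_def) }
  qed
qed

text \<open>The largest entry sits in a corner, and deleting it is a bijection onto the tableaux on
  the remaining boxes. This is the recursion that \<open>up_power\<close> satisfies.\<close>

lemma card_syt:
  assumes S: "finite S" "S \<noteq> {}"
  shows "card (syt S) = (\<Sum>c\<in>corners S. card (syt (S - {c})))"
proof -
  have "syt S = (\<Union>c\<in>corners S. {T \<in> syt S. T c = card S})"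
  proof (intro equalityI subsetI)
    fix T assume T: "T \<in> syt S"
    have "card S \<in> {1..card S}" using S by (auto simp: Suc_le_eq card_gt_0_iff)
    then have "card S \<in> T ` S" using T by (auto simp: syt_def bij_betw_def)
    then obtain c where "c \<in> S" "T c = card S" by auto
    then show "T \<in> (\<Union>c\<in>corners S. {T \<in> syt S. T c = card S})"
      using syt_restrict(1)[OF S(1) T, of c] T by blast
  qed auto
  then have "card (syt S) = card (\<Union>c\<in>corners S. {T \<in> syt S. T c = card S})" by simp
  also have "\<dots> = (\<Sum>c\<in>corners S. card {T \<in> syt S. T c = card S})"
  proof (rule card_UN_disjoint)
    show "finite (corners S)" by (rule finite_subset[OF _ S(1)]) (auto simp: corners_def)
    show "\<forall>c\<in>corners S. finite {T \<in> syt S. T c = card S}" using finite_syt[OF S(1)] by auto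
    show "\<forall>c\<in>corners S. \<forall>d\<in>corners S. c \<noteq> d \<longrightarrow> {T \<in> syt S. T c = card S} \<inter> {T \<in> syt S. T d = card S} = {}"
    proof (intro ballI impI)
      fix c d assume cd: "c \<in> corners S" "d \<in> corners S" "c \<noteq> d"
      have "T c \<noteq> T d" if "T \<in> syt S" for T
        using that cd unfolding syt_def bij_betw_def inj_on_def corners_def by blast
      note * = this
      show "{T \<in> syt S. T c = card S} \<inter> {T \<in> syt S. T d = card S} = {}"
      proof (rule equals0I)
        fix T assume "T \<in> {T \<in> syt S. T c = card S} \<inter> {T \<in> syt S. T d = card S}"
        then show False using *[of T] by simp
      qed
    qed
  qed
  also have "\<dots> = (\<Sum>c\<in>corners S. card (syt (S - {c})))"
  proof (intro sum.cong refl)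
    fix c assume c: "c \<in> corners S"
    then have cS: "c \<in> S" by (auto simp: corners_def)
    have "bij_betw (\<lambda>T. restrict T (S - {c})) {T \<in> syt S. T c = card S} (syt (S - {c}))"
    proof (rule bij_betw_byWitness[where f' = "\<lambda>T. T(c := card S)"])
      show "\<forall>T\<in>{T \<in> syt S. T c = card S}. (restrict T (S - {c}))(c := card S) = T"
        by (auto simp: syt_def extensional_def restrict_def fun_eq_iff)
      show "\<forall>T\<in>syt (S - {c}). restrict (T(c := card S)) (S - {c}) = T"
        by (auto simp: syt_def extensional_def restrict_def fun_eq_iff)
      show "(\<lambda>T. restrict T (S - {c})) ` {T \<in> syt S. T c = card S} \<subseteq> syt (S - {c})"
        using syt_restrict(2)[OF S(1) _ cS] by blast
      show "(\<lambda>T. T(c := card S)) ` syt (S - {c}) \<subseteq> {T \<in> syt S. T c = card S}"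
        using syt_extend[OF S(1) c] by auto
    qed
    then show "card {T \<in> syt S. T c = card S} = card (syt (S - {c}))" by (rule bij_betw_same_card)
  qed
  finally show ?thesis .
qed

text \<open>Boxes are numbered from 1 to match \<open>young_diagram\<close>, while the rows of a
  \<open>par\<close> are numbered from 0.\<close>

definition diagram :: "par \<Rightarrow> (nat \<times> nat) set" where
  "diagram p = {(i, j). 1 \<le> i \<and> 1 \<le> j \<and> j \<le> row p (i - 1)}"

lemma diagram_remove_box:
  assumes "i \<in> removable p" shows "diagram (remove_box p i) = diagram p - {(Suc i, row p i)}"
  using assms by (fastforce simp: diagram_def row_remove_box removable_def split: if_splits)

lemma corners_diagram: "corners (diagram p) = (\<lambda>i. (Suc i, row p i)) ` removable p"
proof (intro equalityI subsetI)
  fix c assume "c \<in> corners (diagram p)"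
  then obtain i j where c: "c = (Suc i, j)" "1 \<le> j" "j \<le> row p i" 
    "\<And>j'. j < j' \<Longrightarrow> (Suc i, j') \<notin> diagram p" "\<And>i'. Suc i < i' \<Longrightarrow> (i', j) \<notin> diagram p"
    by (cases c; cases "fst c") (auto simp: corners_def diagram_def)
  have "j = row p i" using c(2,3) c(4)[of "row p i"] by (force simp: diagram_def)
  moreover have "row p (Suc i) < j" using c(2) c(5)[of "Suc (Suc i)"] by (auto simp: diagram_def)
  ultimately show "c \<in> (\<lambda>i. (Suc i, row p i)) ` removable p" using c by (auto simp: removable_def)
next
  fix c assume "c \<in> (\<lambda>i. (Suc i, row p i)) ` removable p"
  then obtain i where i: "c = (Suc i, row p i)" "row p (Suc i) < row p i" by (auto simp: removable_def)
  have "row p (i' - 1) < row p i" if "Suc i < i'" for i' 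
  proof -
    have "Suc i \<le> i' - 1" using that by simp
    from row_antimono[OF this, of p] i show ?thesis by simp
  qed
  then show "c \<in> corners (diagram p)" using i by (force simp: corners_def diagram_def)
qed

lemma diagram_empty: "diagram p = {} \<longleftrightarrow> p = empty_par"
proof
  assume "diagram p = {}"
  then have "(Suc i, row p i) \<notin> diagram p" for i by simp
  then have *: "\<not> 1 \<le> row p i" for i by (simp add: diagram_def)
  have "row p i = 0" for i using *[of i] by simp
  then show "p = empty_par" by (intro par_eqI) simp
qed (auto simp: diagram_def)

lemma card_diagram: "finite (diagram p) \<and> card (diagram p) = psize p"
proof (induction "psize p" arbitrary: p)
  case 0
  then show ?case using diagram_empty[of p] psize_eq_0_iff[of p] by auto
next
  case (Suc n)
  then obtain i where i: "i \<in> removable p" using removable_nonempty[of p] by fastforce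
  have s: "n = psize (remove_box p i)" using psize_remove_box[OF i] Suc by simp
  have "(Suc i, row p i) \<in> diagram p" using i by (auto simp: diagram_def removable_def)
  then have "diagram p = insert (Suc i, row p i) (diagram (remove_box p i))" "(Suc i, row p i) \<notin> diagram (remove_box p i)"
    using diagram_remove_box[OF i] by auto
  then show ?case using Suc.hyps(1)[OF s] s Suc(2) by simp
qed

lemma card_syt_diagram: "of_nat (card (syt (diagram p))) = up_power (psize p) p"
proof (induction "psize p" arbitrary: p)
  case 0
  then have p: "p = empty_par" by (metis psize_eq_0_iff)
  then have "diagram p = {}" by (simp add: diagram_empty)
  then have "syt (diagram p) = {\<lambda>_. undefined}" by (auto simp: syt_def bij_betw_def)
  then show ?case using p by (simp add: up_power_def vac_def)
next
  case (Suc n)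
  then have "diagram p \<noteq> {}" by (auto simp: diagram_empty)
  then have "card (syt (diagram p)) = (\<Sum>i\<in>removable p. card (syt (diagram p - {(Suc i, row p i)})))"
    using card_syt[of "diagram p"] card_diagram[of p] by (simp add: corners_diagram sum.reindex inj_on_def)
  also have "\<dots> = (\<Sum>i\<in>removable p. card (syt (diagram (remove_box p i))))"
    by (intro sum.cong refl) (simp add: diagram_remove_box)
  finally have "of_nat (card (syt (diagram p))) = (\<Sum>i\<in>removable p. of_nat (card (syt (diagram (remove_box p i)))) :: complex)" by simp
  also have "\<dots> = (\<Sum>i\<in>removable p. up_power n (remove_box p i))"
  proof (intro sum.cong refl)
    fix i assume i: "i \<in> removable p"
    have "n = psize (remove_box p i)" using psize_remove_box[OF i] Suc by simp
    from Suc.hyps(1)[OF this] this show "of_nat (card (syt (diagram (remove_box p i)))) = up_power n (remove_box p i)" by simp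
  qed
  finally show ?case using Suc(2)[symmetric] by (simp add: up_power_Suc)
qed

definition par_of :: "nat list \<Rightarrow> par" where
  "par_of xs = Abs_par (\<lambda>i. if i < length xs then xs ! i else 0)"

definition list_of :: "par \<Rightarrow> nat list" where
  "list_of p = map (row p) [0..<rows p]"

lemma row_par_of:
  assumes "sorted_wrt (\<ge>) xs" shows "row (par_of xs) i = (if i < length xs then xs ! i else 0)"
proof -
  have "(\<lambda>i. if i < length xs then xs ! i else 0) \<in> {f. (\<forall>i. f (Suc i) \<le> f i) \<and> (\<exists>m. \<forall>i\<ge>m. f i = 0)}"
    using assms by (auto simp: sorted_wrt_iff_nth_less intro!: exI[of _ "length xs"])
  from Abs_par_inverse[OF this] show ?thesis by (simp add: par_of_def)
qed

lemma rows_par_of: 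
  assumes "sorted_wrt (\<ge>) xs" "\<forall>x\<in>set xs. x \<ge> 1" shows "rows (par_of xs) = length xs"
proof (rule antisym)
  show "rows (par_of xs) \<le> length xs"
    unfolding rows_def by (rule Least_le) (simp add: row_par_of[OF assms(1)])
  show "length xs \<le> rows (par_of xs)"
  proof (rule ccontr)
    assume "\<not> length xs \<le> rows (par_of xs)"
    then have l: "rows (par_of xs) < length xs" by simp
    then have "xs ! rows (par_of xs) = 0" using row_eq_0[of "par_of xs" "rows (par_of xs)"] by (simp add: row_par_of[OF assms(1)])
    then show False using assms(2) nth_mem[OF l] by auto
  qed
qed

lemma row_pos: "i < rows p \<Longrightarrow> row p i > 0"
proof (rule ccontr)
  assume i: "i < rows p" and "\<not> row p i > 0"
  then have "\<forall>j\<ge>i. row p j = 0" using row_antimono[of i _ p] by fastforce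
  then have "rows p \<le> i" unfolding rows_def by (rule Least_le)
  with i show False by simp
qed

lemma bij_partitions: "bij_betw par_of (partitions n) (pars n)"
proof (rule bij_betw_byWitness[where f' = list_of])
  show "\<forall>xs\<in>partitions n. list_of (par_of xs) = xs"
    by (auto simp: partitions_def list_of_def rows_par_of row_par_of intro!: nth_equalityI)
  have srt: "sorted_wrt (\<ge>) (list_of p)" for p
    by (auto simp: list_of_def sorted_wrt_iff_nth_less row_antimono)
  then show "\<forall>p\<in>pars n. par_of (list_of p) = p"
    by (auto intro!: par_eqI simp: row_par_of) (auto simp: list_of_def row_eq_0)
  show "par_of ` partitions n \<subseteq> pars n"
  proof clarify
    fix xs assume xs: "xs \<in> partitions n"
    then have "psize (par_of xs) = (\<Sum>i<length xs. xs ! i)"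
      by (auto simp: psize_def partitions_def rows_par_of row_par_of)
    then show "par_of xs \<in> pars n" using xs by (simp add: pars_def partitions_def sum_list_sum_nth lessThan_atLeast0)
  qed
  show "list_of ` pars n \<subseteq> partitions n"
    using srt row_pos by (force simp: partitions_def pars_def psize_def list_of_def sum_list_sum_nth lessThan_atLeast0 Suc_le_eq)
qed

lemma num_syt_eq:
  assumes "xs \<in> partitions n" shows "of_nat (num_syt xs) = up_power n (par_of xs)"
proof -
  have s: "sorted_wrt (\<ge>) xs" "sum_list xs = n" using assms by (auto simp: partitions_def)
  have d: "young_diagram xs = diagram (par_of xs)"
    by (auto simp: young_diagram_def diagram_def row_par_of[OF s(1)] split: if_splits)
  have p: "psize (par_of xs) = n" using bij_partitions assms by (auto simp: bij_betw_def pars_def)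
  then have "standard_young_tableaux xs = syt (diagram (par_of xs))"
    using card_diagram[of "par_of xs"] s by (simp add: standard_young_tableaux_def syt_def d)
  then show ?thesis using card_syt_diagram[of "par_of xs"] p by (simp add: num_syt_def)
qed

definition par_dim :: "par \<Rightarrow> real" where "par_dim p = fact (psize p) * hook_quot (rows p) p"

text \<open>\<open>up_power\<close> does not involve \<open>m\<close>, so comparison with it shows
  that padding has no effect.\<close>

lemma hook_quot_indep: "rows p \<le> m \<Longrightarrow> hook_quot m p = hook_quot (rows p) p"
proof -
  assume "rows p \<le> m"
  from up_power_eq_hook_quot[OF refl this] up_power_eq_hook_quot[OF refl order.refl, of p]
  have "(of_real (fact (psize p) * hook_quot m p) :: complex) = of_real (fact (psize p) * hook_quot (rows p) p)" by metis
  then show ?thesis unfolding of_real_eq_iff by simp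
qed

lemma up_power_eq_dimr: "psize p = n \<Longrightarrow> up_power n p = of_real (par_dim p)"
  using up_power_eq_hook_quot[of p n "rows p"] by (simp add: par_dim_def)

lemma plancherel_eq:
  assumes "xs \<in> partitions n" shows "plancherel n xs = par_dim (par_of xs) ^ 2 / fact n"
proof -
  have "psize (par_of xs) = n" using bij_partitions assms by (auto simp: bij_betw_def pars_def)
  then have "(of_real (real (num_syt xs)) :: complex) = of_real (par_dim (par_of xs))"
    using num_syt_eq[OF assms] up_power_eq_dimr by simp
  then have "real (num_syt xs) = par_dim (par_of xs)" unfolding of_real_eq_iff .
  then show ?thesis by (simp add: plancherel_def)
qed

definition par_plancherel :: "par \<Rightarrow> real" where "par_plancherel p = par_dim p ^ 2 / fact (psize p)"

lemma expected_log_plancherel_pars: "expected_log_plancherel n = (\<Sum>p\<in>pars n. par_plancherel p * ln (par_plancherel p))"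
proof -
  have "(\<Sum>p\<in>pars n. par_plancherel p * ln (par_plancherel p)) = (\<Sum>xs\<in>partitions n. par_plancherel (par_of xs) * ln (par_plancherel (par_of xs)))"
    by (rule sum.reindex_bij_betw[OF bij_partitions, symmetric])
  also have "\<dots> = (\<Sum>xs\<in>partitions n. plancherel n xs * ln (plancherel n xs))"
  proof (intro sum.cong refl)
    fix xs assume xs: "xs \<in> partitions n"
    have "psize (par_of xs) = n" using bij_partitions xs by (auto simp: bij_betw_def pars_def)
    then show "par_plancherel (par_of xs) * ln (par_plancherel (par_of xs)) = plancherel n xs * ln (plancherel n xs)"
      by (simp add: plancherel_eq[OF xs] par_plancherel_def)
  qed
  finally show ?thesis by (simp add: expected_log_plancherel_eq_sum)
qed

lemma sum_pl: "(\<Sum>p\<in>pars n. par_plancherel p) = 1"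
proof -
  have "level_inner n (up_power n) (up_power n) = of_real (\<Sum>p\<in>pars n. par_dim p ^ 2)"
    unfolding level_inner_def of_real_sum by (intro sum.cong refl) (simp add: pars_def up_power_eq_dimr power2_eq_square)
  then have "(of_real (\<Sum>p\<in>pars n. par_dim p ^ 2) :: complex) = of_real (fact n)" using level_inner_fv[of n] by simp
  then have "(\<Sum>p\<in>pars n. par_dim p ^ 2) = fact n" unfolding of_real_eq_iff .
  moreover have "(\<Sum>p\<in>pars n. par_plancherel p) = (\<Sum>p\<in>pars n. par_dim p ^ 2) / fact n"
    unfolding sum_divide_distrib by (intro sum.cong refl) (simp add: par_plancherel_def pars_def)
  ultimately show ?thesis by simp
qed

section \<open>Mean hook counts\<close>

definition beads :: "nat \<Rightarrow> par \<Rightarrow> nat set" where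
  "beads m p = bead m p ` {..<m}"

text \<open>Hooks of length \<open>l\<close> correspond to beads \<open>b\<close> for which \<open>b - l\<close> is a vacant position. The value does not
depend on \<open>m\<close> once \<open>m\<close> is at least the number of rows.\<close>

definition hook_count :: "nat \<Rightarrow> par \<Rightarrow> nat \<Rightarrow> nat" where
  "hook_count m p l = card {i. i < m \<and> l \<le> bead m p i \<and> bead m p i - l \<notin> beads m p}"

text \<open>From a bead at position \<open>x\<close>, each distance in \<open>1..x\<close> leads to
  a vacant position, which is a hook, or to another bead, which gives a pair. \<open>F\<close>
  stands for \<open>ln\<close> in the hook length formula and for \<open>z ^ l + w ^ l\<close> in
  the product formula for \<open>tsum\<close>.\<close>

lemma sum_hook_count:
  fixes F :: "nat \<Rightarrow> 'a::{comm_ring_1}"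
  assumes L: "\<And>i. i < m \<Longrightarrow> bead m p i \<le> L"
  shows "(\<Sum>l=1..L. of_nat (hook_count m p l) * F l) = 
     (\<Sum>i<m. \<Sum>d=1..bead m p i. F d) - (\<Sum>(i,j)\<in>pairs m. F (bead m p i - bead m p j))"
proof -
  let ?x = "bead m p" and ?B = "beads m p"
  have "(\<Sum>l=1..L. of_nat (hook_count m p l) * F l) = (\<Sum>l=1..L. \<Sum>i\<in>{i. i < m \<and> l \<le> ?x i \<and> ?x i - l \<notin> ?B}. F l)"
    by (simp add: hook_count_def)
  also have "\<dots> = (\<Sum>(l,i)\<in>(SIGMA l:{1..L}. {i. i < m \<and> l \<le> ?x i \<and> ?x i - l \<notin> ?B}). F l)"
    by (rule sum.Sigma) auto
  also have "\<dots> = (\<Sum>(i,d)\<in>(SIGMA i:{..<m}. {d. 1 \<le> d \<and> d \<le> ?x i \<and> ?x i - d \<notin> ?B}). F d)"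
    by (rule sum.reindex_bij_witness[of _ "\<lambda>(i,d). (d,i)" "\<lambda>(l,i). (i,l)"]) (use L in \<open>force+\<close>)
  also have "\<dots> = (\<Sum>i<m. \<Sum>d\<in>{d. 1 \<le> d \<and> d \<le> ?x i \<and> ?x i - d \<notin> ?B}. F d)"
    by (rule sum.Sigma[symmetric]) (auto intro!: finite_subset[of _ "{..?x _}"])
  also have "\<dots> = (\<Sum>i<m. (\<Sum>d=1..?x i. F d) - (\<Sum>d\<in>{d. 1 \<le> d \<and> d \<le> ?x i \<and> ?x i - d \<in> ?B}. F d))"
  proof (intro sum.cong refl)
    fix i
    have "(\<Sum>d=1..?x i. F d) = (\<Sum>d\<in>{d. 1 \<le> d \<and> d \<le> ?x i \<and> ?x i - d \<notin> ?B} \<union> {d. 1 \<le> d \<and> d \<le> ?x i \<and> ?x i - d \<in> ?B}. F d)"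
      by (rule sum.cong) auto
    also have "\<dots> = (\<Sum>d\<in>{d. 1 \<le> d \<and> d \<le> ?x i \<and> ?x i - d \<notin> ?B}. F d) + (\<Sum>d\<in>{d. 1 \<le> d \<and> d \<le> ?x i \<and> ?x i - d \<in> ?B}. F d)"
      by (rule sum.union_disjoint) (auto intro!: finite_subset[of _ "{..?x _}"])
    finally show "(\<Sum>d\<in>{d. 1 \<le> d \<and> d \<le> ?x i \<and> ?x i - d \<notin> ?B}. F d) = 
       (\<Sum>d=1..?x i. F d) - (\<Sum>d\<in>{d. 1 \<le> d \<and> d \<le> ?x i \<and> ?x i - d \<in> ?B}. F d)" by simp
  qed
  also have "\<dots> = (\<Sum>i<m. \<Sum>d=1..?x i. F d) - (\<Sum>i<m. \<Sum>d\<in>{d. 1 \<le> d \<and> d \<le> ?x i \<and> ?x i - d \<in> ?B}. F d)"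
    by (rule sum_subtractf)
  also have "(\<Sum>i<m. \<Sum>d\<in>{d. 1 \<le> d \<and> d \<le> ?x i \<and> ?x i - d \<in> ?B}. F d) = (\<Sum>i<m. \<Sum>j\<in>{i<..<m}. F (?x i - ?x j))"
  proof (rule sum.cong[OF refl])
    fix i assume i: "i \<in> {..<m}"
    have "bij_betw (\<lambda>j. ?x i - ?x j) {i<..<m} {d. 1 \<le> d \<and> d \<le> ?x i \<and> ?x i - d \<in> ?B}"
      unfolding bij_betw_def
    proof (intro conjI equalityI subsetI)
      show "inj_on (\<lambda>j. ?x i - ?x j) {i<..<m}"
      proof (rule inj_onI)
        fix j k assume jk: "j \<in> {i<..<m}" "k \<in> {i<..<m}" "?x i - ?x j = ?x i - ?x k"
        then have "?x j = ?x k" using bead_strict[of i j m p] bead_strict[of i k m p] by auto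
        then show "j = k" using bead_inj[of m p] jk by (auto simp: inj_on_def)
      qed
      fix d assume "d \<in> (\<lambda>j. ?x i - ?x j) ` {i<..<m}"
      then show "d \<in> {d. 1 \<le> d \<and> d \<le> ?x i \<and> ?x i - d \<in> ?B}"
        using bead_strict[of i _ m p] by (auto simp: beads_def less_imp_le_nat Suc_le_eq)
    next
      fix d assume d: "d \<in> {d. 1 \<le> d \<and> d \<le> ?x i \<and> ?x i - d \<in> ?B}"
      then obtain j where j: "j < m" "?x i - d = ?x j" by (auto simp: beads_def)
      have "i < j" using j d bead_strict[of j i m p] i by (cases i j rule: linorder_cases) auto
      then show "d \<in> (\<lambda>j. ?x i - ?x j) ` {i<..<m}" using j d by (intro image_eqI[of _ _ j]) auto
    qed
    then show "(\<Sum>d\<in>{d. 1 \<le> d \<and> d \<le> ?x i \<and> ?x i - d \<in> ?B}. F d) = (\<Sum>j\<in>{i<..<m}. F (?x i - ?x j))"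
      by (rule sum.reindex_bij_betw[symmetric])
  qed
  also have "\<dots> = (\<Sum>(i,j)\<in>(SIGMA i:{..<m}. {i<..<m}). F (?x i - ?x j))"
    by (rule sum.Sigma) auto
  also have "(SIGMA i:{..<m}. {i<..<m}) = pairs m" by (auto simp: pairs_def)
  finally show ?thesis .
qed

text \<open>For \<open>F = ln\<close>, the right-hand side of \<open>sum_hook_count\<close> is minus
  the logarithm of Frobenius' quotient; the result is the hook length formula.\<close>

lemma ln_hook_quot:
  assumes L: "\<And>i. i < m \<Longrightarrow> bead m p i \<le> L"
  shows "ln (hook_quot m p) = - (\<Sum>l=1..L. real (hook_count m p l) * ln (real l))"
proof -
  have "ln (\<Prod>(i,j)\<in>pairs m. real (bead m p i) - real (bead m p j)) = (\<Sum>(i,j)\<in>pairs m. ln (real (bead m p i - bead m p j)))"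
  proof -
    have pos: "bead m p j < bead m p i" if "(i, j) \<in> pairs m" for i j using that by (auto simp: pairs_def bead_strict)
    have "ln (\<Prod>(i,j)\<in>pairs m. real (bead m p i) - real (bead m p j)) = (\<Sum>ij\<in>pairs m. ln (case ij of (i,j) \<Rightarrow> real (bead m p i) - real (bead m p j)))"
      by (rule ln_prod) (auto dest!: pos)
    also have "\<dots> = (\<Sum>(i,j)\<in>pairs m. ln (real (bead m p i - bead m p j)))"
      by (intro sum.cong refl) (auto dest!: pos simp: of_nat_diff)
    finally show ?thesis .
  qed
  moreover have "ln (\<Prod>i<m. fact (bead m p i) :: real) = (\<Sum>i<m. \<Sum>d=1..bead m p i. ln (real d))"
    by (subst ln_prod) (auto simp: fact_prod intro!: sum.cong ln_prod)
  moreover have P: "(\<Prod>i<m. fact (bead m p i) :: real) \<noteq> 0" by simp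
  ultimately show ?thesis
    using sum_hook_count[OF L, of "\<lambda>l. ln (real l)"]
    unfolding hook_quot_def
      ln_div if_P[OF conjI[OF vandermonde_pos[THEN less_imp_neq, symmetric] P]]
    by simp
qed

lemma tsum_beads:
  assumes z: "z \<noteq> 0" and m: "rows p \<le> m"
  shows "tsum z p = z powi (- int m) * (1 + (z - 1) * (\<Sum>i<m. z ^ bead m p i))"
proof -
  have "z powi (int (row p i) - int i) - z powi (int (row p i) - 1 - int i) = z powi (- int m) * ((z - 1) * z ^ bead m p i)"
    if "i < m" for i
  proof -
    have e: "int (row p i) - int i = - int m + 1 + int (bead m p i)" "int (row p i) - 1 - int i = - int m + int (bead m p i)"
      using that by (auto simp: bead_def of_nat_diff)
    show ?thesis unfolding e power_int_add[OF disjI1[OF z]] by (simp add: algebra_simps)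
  qed
  then show ?thesis unfolding tsum_def corner_sum_eq[OF m]
    by (simp add: sum_distrib_left distrib_left)
qed

lemma zeta_geometric:
  assumes "z \<noteq> 0" "w = 1 / z"
  shows "zeta z * (\<Sum>d=1..x. z ^ d + w ^ d) = (z - 1) * (z ^ x - 1) + (w - 1) * (w ^ x - 1)"
proof (induction x)
  case (Suc x)
  have zw: "z * w = 1" using assms by simp
  have "zeta z * (\<Sum>d=1..Suc x. z ^ d + w ^ d) = (z - 1) * (z ^ x - 1) + (w - 1) * (w ^ x - 1) + (z + w - 2) * (z * z ^ x + w * w ^ x)"
    using Suc assms by (simp add: zeta_def algebra_simps)
  also have "\<dots> = (z - 1) * (z ^ Suc x - 1) + (w - 1) * (w ^ Suc x - 1) + (z * w - 1) * (z ^ x + w ^ x)"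
    by (simp add: algebra_simps)
  finally show ?case using zw by simp
qed simp

text \<open>\<open>A\<close> and \<open>B\<close> are the power sums of the beads. Because
  \<open>z * w = 1\<close>, the cross term has the coefficient
  \<open>(z - 1) (w - 1) = - zeta z\<close>, and \<open>A * B\<close> consists of \<open>m\<close>
  diagonal terms and a sum over pairs, the one in \<open>sum_hook_count\<close>.\<close>

lemma tsum_mult:
  assumes z: "z \<noteq> 0" "w = 1 / z" and m: "rows p \<le> m" and L: "\<And>i. i < m \<Longrightarrow> bead m p i \<le> L"
  shows "tsum z p * tsum w p = 1 + zeta z * (\<Sum>l=1..L. of_nat (hook_count m p l) * (z ^ l + w ^ l))"
proof -
  let ?x = "bead m p"
  define A B where "A = (\<Sum>i<m. z ^ ?x i)" and "B = (\<Sum>i<m. w ^ ?x i)"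
  have w: "w \<noteq> 0" using z by auto
  have zw: "z * w = 1" using z by simp
  have "z powi (- int m) * w powi (- int m) = 1"
    using zw by (simp add: power_int_mult_distrib[symmetric])
  moreover have "tsum z p * tsum w p = (z powi (- int m) * w powi (- int m)) * ((1 + (z - 1) * A) * (1 + (w - 1) * B))"
    unfolding tsum_beads[OF z(1) m] tsum_beads[OF w m] A_def B_def by (simp add: mult_ac)
  ultimately have 1: "tsum z p * tsum w p = (1 + (z - 1) * A) * (1 + (w - 1) * B)" by simp
  have "(\<Sum>(i,j)\<in>pairs m. z ^ (?x i - ?x j) + w ^ (?x i - ?x j)) = (\<Sum>(i,j)\<in>pairs m. z ^ ?x i * w ^ ?x j) + (\<Sum>(i,j)\<in>pairs m. z ^ ?x j * w ^ ?x i)"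
    unfolding sum.distrib[symmetric]
  proof (intro sum.cong refl, clarify)
    fix i j assume "(i, j) \<in> pairs m"
    then have "?x j \<le> ?x i" using bead_strict[of i j m p] by (auto simp: pairs_def)
    then obtain d where d: "?x i = ?x j + d" using le_Suc_ex by blast
    have "z ^ ?x j * w ^ ?x j = 1" using zw by (simp add: power_mult_distrib[symmetric])
    then have "z ^ (?x j + d) * w ^ ?x j = z ^ d" "z ^ ?x j * w ^ (?x j + d) = w ^ d"
      by (simp_all add: power_add)
    then show "z ^ (?x i - ?x j) + w ^ (?x i - ?x j) = z ^ ?x i * w ^ ?x j + z ^ ?x j * w ^ ?x i"
      unfolding d by simp
  qed
  also have "\<dots> = A * B - of_nat m"
  proof -
    have "A * B = (\<Sum>(i,j)\<in>{..<m}\<times>{..<m}. z ^ ?x i * w ^ ?x j)"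
      unfolding A_def B_def by (simp add: sum_product sum.cartesian_product)
    also have "{..<m}\<times>{..<m} = pairs m \<union> ((\<lambda>(i,j). (j,i)) ` pairs m \<union> (\<lambda>i. (i,i)) ` {..<m})"
      by (auto simp: pairs_def image_iff)
    also have "(\<Sum>(i,j)\<in>pairs m \<union> ((\<lambda>(i,j). (j,i)) ` pairs m \<union> (\<lambda>i. (i,i)) ` {..<m}). z ^ ?x i * w ^ ?x j)
       = (\<Sum>(i,j)\<in>pairs m. z ^ ?x i * w ^ ?x j) + ((\<Sum>(i,j)\<in>(\<lambda>(i,j). (j,i)) ` pairs m. z ^ ?x i * w ^ ?x j) + (\<Sum>(i,j)\<in>(\<lambda>i. (i,i)) ` {..<m}. z ^ ?x i * w ^ ?x j))"
      by (subst sum.union_disjoint, simp, simp, force simp: pairs_def, subst sum.union_disjoint, simp, simp, force simp: pairs_def, rule refl)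
    also have "(\<Sum>(i,j)\<in>(\<lambda>(i,j). (j,i)) ` pairs m. z ^ ?x i * w ^ ?x j) = (\<Sum>(i,j)\<in>pairs m. z ^ ?x j * w ^ ?x i)"
      by (subst sum.reindex) (auto simp: inj_on_def intro!: sum.cong)
    also have "(\<Sum>(i,j)\<in>(\<lambda>i. (i,i)) ` {..<m}. z ^ ?x i * w ^ ?x j) = of_nat m"
      by (subst sum.reindex) (auto simp: inj_on_def power_mult_distrib[symmetric] zw)
    finally show ?thesis by (simp add: algebra_simps)
  qed
  finally have P: "(\<Sum>(i,j)\<in>pairs m. z ^ (?x i - ?x j) + w ^ (?x i - ?x j)) = A * B - of_nat m" .
  have "zeta z * (\<Sum>l=1..L. of_nat (hook_count m p l) * (z ^ l + w ^ l)) = 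
     (\<Sum>i<m. zeta z * (\<Sum>d=1..?x i. z ^ d + w ^ d)) - zeta z * (A * B - of_nat m)"
    using sum_hook_count[OF L, of "\<lambda>l. z ^ l + w ^ l"] P by (simp add: right_diff_distrib sum_distrib_left)
  also have "(\<Sum>i<m. zeta z * (\<Sum>d=1..?x i. z ^ d + w ^ d)) = (z - 1) * (A - of_nat m) + (w - 1) * (B - of_nat m)"
    unfolding zeta_geometric[OF z] by (simp add: A_def B_def sum.distrib sum_distrib_left[symmetric] sum_subtractf)
  finally have 2: "zeta z * (\<Sum>l=1..L. of_nat (hook_count m p l) * (z ^ l + w ^ l)) = 
     (z - 1) * (A - of_nat m) + (w - 1) * (B - of_nat m) - zeta z * (A * B - of_nat m)" .
  have zt: "zeta z = z + w - 2" by (simp add: zeta_def z(2))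
  have eq: "(1 + (z - 1) * A) * (1 + (w - 1) * B) = 1 + (z - 1) * A + (w - 1) * B + (z * w - z - w + 1) * (A * B)"
    by (simp add: algebra_simps)
  show ?thesis unfolding 1 2 eq zw unfolding zt by (simp add: algebra_simps)
qed

lemma rows_le_psize: "rows p \<le> psize p"
proof -
  have "(\<Sum>i<rows p. 1) \<le> psize p" unfolding psize_def by (rule sum_mono) (use row_pos[of _ p] in \<open>fastforce simp: Suc_le_eq\<close>)
  then show ?thesis by simp
qed

lemma bead_le: "psize p = n \<Longrightarrow> i < n \<Longrightarrow> bead n p i \<le> 2 * n"
proof -
  assume n: "psize p = n" "i < n"
  have "row p i \<le> psize p" 
  proof (cases "i < rows p")
    case True
    then show ?thesis unfolding psize_def by (intro member_le_sum) auto
  qed (simp add: row_eq_0)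
  then show ?thesis using n by (simp add: bead_def)
qed

text \<open>\<open>n\<close> rows suffice for every partition of \<open>n\<close>, and then no bead
  exceeds \<open>2 n\<close>. This is the origin of the range \<open>1..2 * n\<close> in all hook
  sums.\<close>

definition mean_hooks :: "nat \<Rightarrow> nat \<Rightarrow> real" where
  "mean_hooks n l = (\<Sum>p\<in>pars n. par_plancherel p * real (hook_count n p l))"

lemma expected_log_eq:
  "- expected_log_plancherel n = 2 * (\<Sum>l=1..2*n. mean_hooks n l * ln (real l)) - ln (fact n)"
proof -
  have "par_plancherel p * ln (par_plancherel p) = par_plancherel p * ln (fact n) - 2 * (\<Sum>l=1..2*n. par_plancherel p * real (hook_count n p l) * ln (real l))"
    if p: "p \<in> pars n" for p
  proof -
    have n: "psize p = n" using p by (simp add: pars_def)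
    have d: "par_dim p = fact n * hook_quot n p"
      using hook_quot_indep[of p n] rows_le_psize[of p] n by (simp add: par_dim_def)
    have "ln (par_dim p) = ln (fact n) - (\<Sum>l=1..2*n. real (hook_count n p l) * ln (real l))"
      unfolding d using hook_quot_pos[of n p] ln_hook_quot[of n p "2 * n", OF bead_le[OF n]] by (simp add: ln_mult)
    moreover have "ln (par_plancherel p) = 2 * ln (par_dim p) - ln (fact n)"
      unfolding par_plancherel_def n using hook_quot_pos[of n p] by (simp add: d ln_div ln_realpow)
    ultimately have "ln (par_plancherel p) = ln (fact n) - 2 * (\<Sum>l=1..2*n. real (hook_count n p l) * ln (real l))" by simp
    then show ?thesis by (simp add: right_diff_distrib sum_distrib_left mult_ac)
  qed
  then have "expected_log_plancherel n = (\<Sum>p\<in>pars n. par_plancherel p * ln (fact n) - 2 * (\<Sum>l=1..2*n. par_plancherel p * real (hook_count n p l) * ln (real l)))"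
    unfolding expected_log_plancherel_pars by (intro sum.cong refl)
  also have "\<dots> = (\<Sum>p\<in>pars n. par_plancherel p) * ln (fact n) - 2 * (\<Sum>p\<in>pars n. \<Sum>l=1..2*n. par_plancherel p * real (hook_count n p l) * ln (real l))"
    by (simp add: sum_subtractf sum_distrib_left sum_distrib_right)
  also have "(\<Sum>p\<in>pars n. \<Sum>l=1..2*n. par_plancherel p * real (hook_count n p l) * ln (real l)) = (\<Sum>l=1..2*n. mean_hooks n l * ln (real l))"
    unfolding mean_hooks_def sum_distrib_right by (rule sum.swap)
  finally show ?thesis by (simp add: sum_pl)
qed

text \<open>At \<open>z = cis (2 \<theta>)\<close>, \<open>zeta z\<close> is
  \<open>- 4 sin^2 \<theta>\<close>, and \<open>z ^ l + w ^ l\<close> is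
  \<open>2 cos (2 l \<theta>)\<close>. The identity for the second moment has to be divided by
  \<open>zeta z\<close>, whence the exclusion of its zeros.\<close>

lemma hook_fourier_aux:
  assumes "sin \<theta> \<noteq> 0"
  shows "(\<Sum>l=1..2*n. mean_hooks n l * cos (2 * real l * \<theta>)) = 
    (\<Sum>k=1..n. real (n choose k) / fact k * (- 4 * sin \<theta> ^ 2) ^ (k - 1) * 
      (real ((2 * k) choose k) - 4 * sin \<theta> ^ 2 * real ((2 * k - 2) choose (k - 1)))) / 2"
proof -
  define z w where "z = cis (2 * \<theta>)" and "w = 1 / z"
  define s where "s = - 4 * sin \<theta> ^ 2"
  have z: "z \<noteq> 0" by (simp add: z_def)
  have w: "w = cis (- 2 * \<theta>)" unfolding w_def z_def by (simp add: complex_eq_iff Re_divide Im_divide)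
  have zeta: "zeta z = of_real s"
    unfolding zeta_def w_def[symmetric] w unfolding z_def s_def
    by (simp add: complex_eq_iff cos_double_sin)
  have s0: "s \<noteq> 0" using assms by (simp add: s_def)
  have zl: "z ^ l + w ^ l = of_real (2 * cos (2 * real l * \<theta>))" for l
  proof -
    have "cis a ^ l + cis (- a) ^ l = of_real (2 * cos (real l * a))" for a
      by (rule complex_eqI) (simp_all add: cos_n_Re_cis_pow_n[symmetric] sin_n_Im_cis_pow_n[symmetric])
    from this[of "2 * \<theta>"] show ?thesis unfolding w z_def by (simp add: mult_ac)
  qed
  have "corner_moment z w n = (\<Sum>p\<in>pars n. of_real (par_dim p ^ 2) * (tsum z p * tsum w p))"
    unfolding corner_moment_def level_inner_def by (intro sum.cong refl) (simp add: pars_def mult_tsum_def up_power_eq_dimr power2_eq_square)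
  also have "\<dots> = (\<Sum>p\<in>pars n. of_real (par_dim p ^ 2 * (1 + s * (\<Sum>l=1..2*n. real (hook_count n p l) * (2 * cos (2 * real l * \<theta>))))))"
  proof (intro sum.cong refl)
    fix p assume "p \<in> pars n"
    then have n: "psize p = n" by (simp add: pars_def)
    have "tsum z p * tsum w p = of_real (1 + s * (\<Sum>l=1..2*n. real (hook_count n p l) * (2 * cos (2 * real l * \<theta>))))"
      using tsum_mult[OF z w_def _ bead_le[OF n]] rows_le_psize[of p] n by (simp add: zl zeta)
    then show "of_real (par_dim p ^ 2) * (tsum z p * tsum w p) = of_real (par_dim p ^ 2 * (1 + s * (\<Sum>l=1..2*n. real (hook_count n p l) * (2 * cos (2 * real l * \<theta>)))))"
      by simp
  qed
  also have "\<dots> = of_real (\<Sum>p\<in>pars n. fact n * (par_plancherel p * (1 + s * (\<Sum>l=1..2*n. real (hook_count n p l) * (2 * cos (2 * real l * \<theta>))))))"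
    unfolding of_real_sum by (intro sum.cong refl) (simp add: par_plancherel_def pars_def)
  also have "(\<Sum>p\<in>pars n. fact n * (par_plancherel p * (1 + s * (\<Sum>l=1..2*n. real (hook_count n p l) * (2 * cos (2 * real l * \<theta>)))))) = 
     fact n * ((\<Sum>p\<in>pars n. par_plancherel p) + 2 * s * (\<Sum>p\<in>pars n. \<Sum>l=1..2*n. par_plancherel p * real (hook_count n p l) * cos (2 * real l * \<theta>)))"
    by (simp add: distrib_left sum.distrib sum_distrib_left mult_ac)
  also have "(\<Sum>p\<in>pars n. \<Sum>l=1..2*n. par_plancherel p * real (hook_count n p l) * cos (2 * real l * \<theta>)) = (\<Sum>l=1..2*n. mean_hooks n l * cos (2 * real l * \<theta>))"
    unfolding mean_hooks_def sum_distrib_right by (rule sum.swap)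
  also have "(\<Sum>p\<in>pars n. par_plancherel p) = 1" by (rule sum_pl)
  finally have 1: "corner_moment z w n = of_real (fact n * (1 + 2 * s * (\<Sum>l=1..2*n. mean_hooks n l * cos (2 * real l * \<theta>))))" .
  have "corner_moment z w n = of_real (fact n * (1 + (\<Sum>k=1..n. real (n choose k) / fact k * s ^ k * 
     (real ((2 * k) choose k) + s * real ((2 * k - 2) choose (k - 1))))))"
    using corner_moment_closed[OF z w_def, of n] s0 by (simp add: zeta)
  then have "fact n * (1 + 2 * s * (\<Sum>l=1..2*n. mean_hooks n l * cos (2 * real l * \<theta>))) = fact n * (1 + (\<Sum>k=1..n. real (n choose k) / fact k * s ^ k * 
     (real ((2 * k) choose k) + s * real ((2 * k - 2) choose (k - 1)))))"
    unfolding 1 of_real_eq_iff .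
  then have "2 * s * (\<Sum>l=1..2*n. mean_hooks n l * cos (2 * real l * \<theta>)) = (\<Sum>k=1..n. real (n choose k) / fact k * s ^ k * 
     (real ((2 * k) choose k) + s * real ((2 * k - 2) choose (k - 1))))" by simp
  also have "\<dots> = s * (\<Sum>k=1..n. real (n choose k) / fact k * s ^ (k - 1) * 
     (real ((2 * k) choose k) + s * real ((2 * k - 2) choose (k - 1))))"
    unfolding sum_distrib_left
  proof (intro sum.cong refl)
    fix k assume "k \<in> {1..n}"
    then have "s ^ k = s * s ^ (k - 1)" by (cases k) auto
    then show "real (n choose k) / fact k * s ^ k * (real ((2 * k) choose k) + s * real ((2 * k - 2) choose (k - 1))) =
       s * (real (n choose k) / fact k * s ^ (k - 1) * (real ((2 * k) choose k) + s * real ((2 * k - 2) choose (k - 1))))" by simp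
  qed
  finally show ?thesis using s0 by (simp add: s_def)
qed

text \<open>Both sides are continuous, and the excluded zeros of \<open>sin\<close> are
  isolated.\<close>

lemma hook_fourier:
  "(\<Sum>l=1..2*n. mean_hooks n l * cos (2 * real l * \<theta>)) = 
    (\<Sum>k=1..n. real (n choose k) / fact k * (- 4 * sin \<theta> ^ 2) ^ (k - 1) * 
      (real ((2 * k) choose k) - 4 * sin \<theta> ^ 2 * real ((2 * k - 2) choose (k - 1)))) / 2"
  (is "?f \<theta> = ?g \<theta>")
proof (cases "sin \<theta> = 0")
  case True
  have "isCont ?f \<theta>" "isCont ?g \<theta>" by (auto intro!: continuous_intros)
  then have f: "(?f \<longlongrightarrow> ?f \<theta>) (at \<theta>)" and g: "(?g \<longlongrightarrow> ?g \<theta>) (at \<theta>)" by (auto simp: isCont_def)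
  have "eventually (\<lambda>x. sin x \<noteq> 0) (at \<theta>)"
  proof -
    have "sin x \<noteq> 0" if "x \<noteq> \<theta>" "dist x \<theta> < pi" for x
    proof
      assume "sin x = 0"
      then have "sin (x - \<theta>) = 0" using True by (simp add: sin_diff)
      moreover have "- pi < x - \<theta>" "x - \<theta> < pi" using that by (auto simp: dist_real_def abs_less_iff)
      ultimately show False using sin_eq_0_pi[of "x - \<theta>"] that by auto
    qed
    then show ?thesis unfolding eventually_at by (intro exI[of _ pi]) auto
  qed
  then have "eventually (\<lambda>x. ?g x = ?f x) (at \<theta>)" by eventually_elim (use hook_fourier_aux in simp)
  from tendsto_unique[OF _ f] tendsto_cong[OF this] g show ?thesis by auto
qed (rule hook_fourier_aux)

lemma sum_mean_hooks: "(\<Sum>l=1..2*n. mean_hooks n l) = real n"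
proof (cases n)
  case (Suc m)
  have "(\<Sum>k=1..n. real (n choose k) / fact k * (- 4 * sin (0::real) ^ 2) ^ (k - 1) * (real ((2 * k) choose k) - 4 * sin 0 ^ 2 * real ((2 * k - 2) choose (k - 1)))) = 
    (\<Sum>k\<in>{1}. real (n choose k) / fact k * (- 4 * sin (0::real) ^ 2) ^ (k - 1) * (real ((2 * k) choose k) - 4 * sin 0 ^ 2 * real ((2 * k - 2) choose (k - 1))))"
    by (rule sum.mono_neutral_right) (auto simp: Suc)
  then show ?thesis using hook_fourier[of n 0] by simp
qed simp

section \<open>Hook sums as Laguerre integrals\<close>

lemma has_integral_FTC_deriv:
  assumes "a \<le> b" "\<And>x. (F has_real_derivative f x) (at x)"
  shows "(f has_integral (F b - F a)) {a..b}"
  by (rule fundamental_theorem_of_calculus[OF assms(1)])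
     (rule has_vector_derivative_at_within, rule assms(2)[unfolded has_real_derivative_iff_has_vector_derivative])

lemma has_integral_cos_multiple:
  assumes "m > 0" shows "((\<lambda>x. cos (2 * real m * x)) has_integral 0) {0..pi/2}"
proof -
  have d: "((\<lambda>x. sin (2 * real m * x) / (2 * real m)) has_real_derivative cos (2 * real m * x)) (at x)" for x
    using assms by (auto intro!: derivative_eq_intros)
  have "((\<lambda>x. cos (2 * real m * x)) has_integral (sin (2 * real m * (pi / 2)) / (2 * real m) - sin (2 * real m * 0) / (2 * real m))) {0..pi/2}"
    by (rule has_integral_FTC_deriv[OF _ d]) simp
  then show ?thesis using sin_npi[of m] by simp
qed

lemma has_integral_sin_odd_multiple:
  "((\<lambda>x. sin ((2 * real j + 1) * x)) has_integral (1 / (2 * real j + 1))) {0..pi/2}"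
proof -
  have d: "((\<lambda>x. - cos ((2 * real j + 1) * x) / (2 * real j + 1)) has_real_derivative sin ((2 * real j + 1) * x)) (at x)" for x
    by (auto intro!: derivative_eq_intros)
  have "cos ((2 * real j + 1) * (pi / 2)) = cos (real j * pi + pi / 2)" by (simp add: algebra_simps)
  also have "\<dots> = 0" unfolding cos_add using sin_npi[of j] by simp
  finally have c: "cos ((2 * real j + 1) * (pi / 2)) = 0" .
  have "((\<lambda>x. sin ((2 * real j + 1) * x)) has_integral (- cos ((2 * real j + 1) * (pi / 2)) / (2 * real j + 1) - - cos ((2 * real j + 1) * 0) / (2 * real j + 1))) {0..pi/2}"
    by (rule has_integral_FTC_deriv[OF _ d]) simp
  then show ?thesis unfolding c by simp
qed

lemma has_integral_sin_cos_multiple: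
  assumes "l > 0" shows "((\<lambda>x. sin x * cos (2 * real l * x)) has_integral (- 1 / (4 * (real l)\<^sup>2 - 1))) {0..pi/2}"
proof -
  obtain j where j: "l = Suc j" using assms by (cases l) auto
  have e: "sin x * cos (2 * real l * x) = (sin ((2 * real l + 1) * x) - sin ((2 * real j + 1) * x)) / 2" for x
  proof -
    have "(2 * real l + 1) * x = 2 * real l * x + x" "(2 * real j + 1) * x = 2 * real l * x - x"
      by (simp_all add: j algebra_simps)
    then show ?thesis by (simp add: sin_add sin_diff)
  qed
  have "((\<lambda>x. (sin ((2 * real l + 1) * x) - sin ((2 * real j + 1) * x)) / 2) has_integral (1 / (2 * real l + 1) - 1 / (2 * real j + 1)) / 2) {0..pi/2}"
    by (intro has_integral_divide has_integral_diff has_integral_sin_odd_multiple)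
  moreover have "(1 / (2 * real l + 1) - 1 / (2 * real j + 1)) / 2 = - 1 / (4 * (real l)\<^sup>2 - 1)"
  proof -
    have f: "4 * (real l)\<^sup>2 - 1 = (2 * real l + 1) * (2 * real j + 1)" by (simp add: j power2_eq_square algebra_simps)
    have "2 * real j + 1 - (2 * real l + 1) = - 2" by (simp add: j)
    then have "(1 / a - 1 / b) / 2 = - 1 / (a * b)" if "a = 2 * real l + 1" "b = 2 * real j + 1" for a b
      using that by (simp add: divide_simps)
    then show ?thesis unfolding f by blast
  qed
  ultimately show ?thesis by (simp only: e)
qed

lemma has_integral_cos_cos_multiple:
  assumes "l > 0" "m > 0"
  shows "((\<lambda>x. cos (2 * real l * x) * cos (2 * real m * x)) has_integral (if l = m then pi / 4 else 0)) {0..pi/2}"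
proof -
  have d: "((\<lambda>x. cos (2 * real l * x - 2 * real m * x)) has_integral (if l = m then pi / 2 else 0)) {0..pi/2}"
  proof -
    consider "l = m" | "l > m" | "l < m" by linarith
    then show ?thesis
    proof cases
      case 1
      then show ?thesis using has_integral_const_real[of "1::real" 0 "pi/2"] by simp
    next
      case 2
      then have "2 * real l * x - 2 * real m * x = 2 * real (l - m) * x" for x by (simp add: algebra_simps)
      then show ?thesis using has_integral_cos_multiple[of "l - m"] 2 by simp
    next
      case 3
      then have "2 * real l * x - 2 * real m * x = - (2 * real (m - l) * x)" for x by (simp add: algebra_simps)
      then show ?thesis using has_integral_cos_multiple[of "m - l"] 3 by simp
    qed
  qed
  have "2 * real l * x + 2 * real m * x = 2 * real (l + m) * x" for x by (simp add: algebra_simps)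
  then have s: "((\<lambda>x. cos (2 * real l * x + 2 * real m * x)) has_integral 0) {0..pi/2}"
    using has_integral_cos_multiple[of "l + m"] assms by simp
  have "((\<lambda>x. (cos (2 * real l * x - 2 * real m * x) + cos (2 * real l * x + 2 * real m * x)) / 2) has_integral ((if l = m then pi / 2 else 0) + 0) / 2) {0..pi/2}"
    by (intro has_integral_divide has_integral_add d s)
  then show ?thesis by (simp add: cos_add cos_diff split: if_splits)
qed

definition odd_harm :: "nat \<Rightarrow> real" where
  "odd_harm l = (\<Sum>j<l. 2 / (2 * real j + 1))"

text \<open>Each \<open>2 sin x sin ((2 j + 1) x)\<close> is a difference of consecutive cosines, so
  the sum telescopes.\<close>

lemma sin_times_sum_sin: "sin x * (\<Sum>j<l. 2 * sin ((2 * real j + 1) * x)) = 1 - cos (2 * real l * x)"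
proof (induction l)
  case (Suc l)
  have "2 * real l * x = (2 * real l + 1) * x - x" "2 * real (Suc l) * x = (2 * real l + 1) * x + x" by (simp_all add: algebra_simps)
  then have "sin x * (2 * sin ((2 * real l + 1) * x)) = cos (2 * real l * x) - cos (2 * real (Suc l) * x)"
    by (simp only: cos_diff cos_add) simp
  then show ?case using Suc by (simp add: distrib_left)
qed simp

lemma has_integral_sum_sin: "((\<lambda>x. \<Sum>j<l. 2 * sin ((2 * real j + 1) * x)) has_integral odd_harm l) {0..pi/2}"
proof -
  have "((\<lambda>x. \<Sum>j<l. 2 * sin ((2 * real j + 1) * x)) has_integral (\<Sum>j<l. 2 * (1 / (2 * real j + 1)))) {0..pi/2}"
    by (intro has_integral_sum has_integral_mult_right has_integral_sin_odd_multiple) auto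
  then show ?thesis by (simp add: odd_harm_def)
qed

definition lag_coeff :: "nat \<Rightarrow> nat \<Rightarrow> real" where
  "lag_coeff n j = real (n choose Suc j) * (-1) ^ j / fact (Suc j)"

lemma lag_split: "1 - lag n y = (\<Sum>j<n. lag_coeff n j * y ^ Suc j)"
  unfolding lag_split1 lag_coeff_def by (simp add: sum_negf del: fact_Suc)

definition hook_cos :: "nat \<Rightarrow> real \<Rightarrow> real" where
  "hook_cos n x = (\<Sum>l=1..2*n. mean_hooks n l * cos (2 * real l * x))"

lemma hook_cos_eq:
  "hook_cos n x = (\<Sum>j<n. lag_coeff n j * (4 * (sin x)\<^sup>2) ^ j * (real ((2 * j + 2) choose (j + 1)) - 4 * (sin x)\<^sup>2 * real ((2 * j) choose j))) / 2"
proof -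
  have "(\<Sum>k=1..n. real (n choose k) / fact k * (- 4 * (sin x)\<^sup>2) ^ (k - 1) * (real ((2*k) choose k) - 4 * (sin x)\<^sup>2 * real ((2*k-2) choose (k-1))))
     = (\<Sum>j<n. lag_coeff n j * (4 * (sin x)\<^sup>2) ^ j * (real ((2 * j + 2) choose (j + 1)) - 4 * (sin x)\<^sup>2 * real ((2 * j) choose j)))"
  proof (rule sum.reindex_bij_witness[of _ Suc "\<lambda>k. k - 1"])
    fix k assume "k \<in> {1..n}"
    then obtain j where j: "k = Suc j" by (cases k) auto
    have "(- 4 * (sin x)\<^sup>2) ^ j = (-1) ^ j * (4 * (sin x)\<^sup>2) ^ j"
      using power_minus[of "4 * (sin x)\<^sup>2" j] by simp
    then show "lag_coeff n (k - 1) * (4 * (sin x)\<^sup>2) ^ (k - 1) * (real ((2 * (k - 1) + 2) choose (k - 1 + 1)) - 4 * (sin x)\<^sup>2 * real ((2 * (k - 1)) choose (k - 1)))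
       = real (n choose k) / fact k * (- 4 * (sin x)\<^sup>2) ^ (k - 1) * (real ((2*k) choose k) - 4 * (sin x)\<^sup>2 * real ((2*k-2) choose (k-1)))"
      unfolding j lag_coeff_def by (simp del: fact_Suc binomial_Suc_Suc)
  qed auto
  then show ?thesis unfolding hook_cos_def hook_fourier by simp
qed

abbreviation (input) odd_wallis :: "nat \<Rightarrow> real" where
  "odd_wallis k \<equiv> 4 ^ k * (fact k)\<^sup>2 / fact (2 * k + 1)"

lemma central_binomial_fact: "real ((2 * j) choose j) = fact (2 * j) / (fact j)\<^sup>2"
  by (subst binomial_fact) (auto simp: mult_2 power2_eq_square)

text \<open>In this and the next three products, the factorials of a central binomial coefficient
  and of an odd Wallis integral cancel up to a power of 4 and a rational function of the index. That
  is how Laguerre integrals emerge from the hook sums.\<close>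

lemma wallis_binomial0: "real ((2 * m) choose m) * odd_wallis m = 4 ^ m / (2 * real m + 1)"
proof -
  have F: "fact (2 * m + 1) = (2 * real m + 1) * (fact (2 * m) :: real)" by simp
  have "G / f\<^sup>2 * (q * f\<^sup>2 / (t * G)) = q / t" if "G \<noteq> 0" "f \<noteq> 0" for t G f q :: real
    using that by simp
  then show ?thesis unfolding central_binomial_fact F using fact_nonzero by blast
qed

lemma wallis_binomial1: "real ((2 * j + 2) choose (j + 1)) * odd_wallis j = 2 * 4 ^ j / (real j + 1)"
proof -
  have e: "2 * (j + 1) = 2 * j + 2" by simp
  have 1: "fact (2 * j + 2) = (2 * (real j + 1)) * (fact (2 * j + 1) :: real)" by (simp add: algebra_simps)
  have 2: "fact (j + 1) = (real j + 1) * (fact j :: real)" by simp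
  have "(2 * t * F) / (t * f)\<^sup>2 * (q * f\<^sup>2 / F) = 2 * q / t" if "F \<noteq> 0" "f \<noteq> 0" "t > 0" for t F f q :: real
    using that by (simp add: power2_eq_square)
  moreover have "real j + 1 > 0" by simp
  ultimately show ?thesis
    unfolding central_binomial_fact[of "j + 1", unfolded e] 1 2 using fact_nonzero by blast
qed

lemma wallis_binomial2: "real ((2 * j) choose j) * odd_wallis (j + 1) = 2 * 4 ^ j * (real j + 1) / ((2 * real j + 1) * (2 * real j + 3))"
proof -
  have 1: "fact (2 * (j + 1) + 1) = (2 * real j + 3) * (2 * (real j + 1)) * (2 * real j + 1) * (fact (2 * j) :: real)" by (simp add: algebra_simps)
  have 2: "fact (j + 1) = (real j + 1) * (fact j :: real)" by simp
  have 3: "(4::real) ^ (j + 1) = 4 * 4 ^ j" by simp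
  have "G / f\<^sup>2 * (4 * q * (t * f)\<^sup>2 / (b * (2 * t) * a * G)) = 2 * q * t / (a * b)" if "G \<noteq> 0" "f \<noteq> 0" "t > 0" "a > 0" "b > 0" for t G f q a b :: real
    using that by (simp add: power2_eq_square divide_simps)
  moreover have "real j + 1 > 0" "2 * real j + 1 > 0" "2 * real j + 3 > 0" by simp_all
  ultimately show ?thesis
    unfolding central_binomial_fact 1 2 3 using fact_nonzero by blast
qed

lemma wallis_binomial3: "real ((2 * j + 4) choose (j + 2)) * odd_wallis j = 4 * 4 ^ j * (2 * real j + 3) / ((real j + 1) * (real j + 2))"
proof -
  have e: "2 * (j + 2) = 2 * j + 4" by simp
  have 1: "fact (2 * j + 4) = (2 * (real j + 2)) * (2 * real j + 3) * (2 * (real j + 1)) * (fact (2 * j + 1) :: real)"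
    by (simp add: eval_nat_numeral) (simp add: algebra_simps)
  have 2: "fact (j + 2) = (real j + 2) * (real j + 1) * (fact j :: real)" by (simp add: algebra_simps)
  have "(2 * s * b * (2 * t) * F) / (s * t * f)\<^sup>2 * (q * f\<^sup>2 / F) = 4 * q * b / (t * s)" if "F \<noteq> 0" "f \<noteq> 0" "t > 0" "s > 0" for t F f q b s :: real
    using that by (simp add: power2_eq_square divide_simps)
  moreover have "real j + 1 > 0" "real j + 2 > 0" by simp_all
  ultimately show ?thesis
    unfolding central_binomial_fact[of "j + 2", unfolded e] 1 2 using fact_nonzero by blast
qed

lemma odd_power_expand:
  "c * 4 ^ j * (b * s ^ (2 * j + 1) - 4 * d * s ^ (2 * (j + 1) + 1)) = s * (c * (4 * s\<^sup>2) ^ j * (b - 4 * s\<^sup>2 * d))" for b c d s :: real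
proof -
  have p: "(4 * s\<^sup>2) ^ j = 4 ^ j * s ^ (2 * j)" by (simp add: power_mult_distrib power_mult)
  have q: "s ^ (2 * (j + 1) + 1) = s * s\<^sup>2 * s ^ (2 * j)" "s ^ (2 * j + 1) = s * s ^ (2 * j)" by (simp_all add: power2_eq_square)
  show ?thesis unfolding p q by (simp only: right_diff_distrib mult_ac)
qed

lemma odd_power_expand_Suc:
  "s * (c * 4 ^ Suc j * (b * s ^ (2 * j + 1) - 4 * d * s ^ (2 * (j + 1) + 1))) = c * ((4 * s\<^sup>2) ^ Suc j * (b - 4 * s\<^sup>2 * d))" for b c d s :: real
proof -
  have p: "(4 * s\<^sup>2) ^ Suc j = 4 ^ Suc j * (s * s) * s ^ (2 * j)" by (simp add: power_mult_distrib power_mult power2_eq_square)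
  have q: "s ^ (2 * (j + 1) + 1) = s * s\<^sup>2 * s ^ (2 * j)" "s ^ (2 * j + 1) = s * s ^ (2 * j)" by (simp_all add: power2_eq_square)
  show ?thesis unfolding p q by (simp only: right_diff_distrib mult_ac)
qed

text \<open>The integral of \<open>sin x * hook_cos n x\<close> over a quarter period in two ways:
  the cosines contribute \<open>- 1 / (4 l^2 - 1)\<close> each, while \<open>hook_cos_eq\<close>
  leaves odd powers of \<open>sin\<close>, with Wallis integrals.\<close>

lemma sum_mean_hooks_quadratic:
  "(\<Sum>l=1..2*n. mean_hooks n l / (4 * (real l)\<^sup>2 - 1)) = lag_moment 2 n 4 / 4 - lag_moment 1 n 4 / 8 + lag_moment 0 n 4 / 64"
proof -
  let ?b = "\<lambda>j. real ((2 * j + 2) choose (j + 1))" and ?c = "\<lambda>j. real ((2 * j) choose j)"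
  have "((\<lambda>x. \<Sum>l=1..2*n. mean_hooks n l * (sin x * cos (2 * real l * x))) has_integral (\<Sum>l=1..2*n. mean_hooks n l * (- 1 / (4 * (real l)\<^sup>2 - 1)))) {0..pi/2}"
    by (intro has_integral_sum has_integral_mult_right has_integral_sin_cos_multiple) auto
  also have "(\<lambda>x. \<Sum>l=1..2*n. mean_hooks n l * (sin x * cos (2 * real l * x))) = (\<lambda>x. sin x * hook_cos n x)"
    by (rule ext) (simp add: hook_cos_def sum_distrib_left mult_ac)
  finally have 1: "((\<lambda>x. sin x * hook_cos n x) has_integral (\<Sum>l=1..2*n. mean_hooks n l * (- 1 / (4 * (real l)\<^sup>2 - 1)))) {0..pi/2}" .
  have "((\<lambda>x. (\<Sum>j<n. lag_coeff n j * 4 ^ j * (?b j * sin x ^ (2 * j + 1) - 4 * ?c j * sin x ^ (2 * (j + 1) + 1))) / 2) has_integral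
    (\<Sum>j<n. lag_coeff n j * 4 ^ j * (?b j * odd_wallis j - 4 * ?c j * odd_wallis (j + 1))) / 2) {0..pi/2}"
    by (intro has_integral_divide has_integral_sum has_integral_mult_right has_integral_diff has_integral_sin_odd) auto
  also have "(\<lambda>x. (\<Sum>j<n. lag_coeff n j * 4 ^ j * (?b j * sin x ^ (2 * j + 1) - 4 * ?c j * sin x ^ (2 * (j + 1) + 1))) / 2) = (\<lambda>x. sin x * hook_cos n x)"
  proof (rule ext)
    fix x :: real
    have "lag_coeff n j * 4 ^ j * (?b j * sin x ^ (2 * j + 1) - 4 * ?c j * sin x ^ (2 * (j + 1) + 1)) = sin x * (lag_coeff n j * (4 * (sin x)\<^sup>2) ^ j * (?b j - 4 * (sin x)\<^sup>2 * ?c j))" for j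
      by (rule odd_power_expand)
    then show "(\<Sum>j<n. lag_coeff n j * 4 ^ j * (?b j * sin x ^ (2 * j + 1) - 4 * ?c j * sin x ^ (2 * (j + 1) + 1))) / 2 = sin x * hook_cos n x"
      unfolding hook_cos_eq by (simp only: sum_distrib_left times_divide_eq_right)
  qed
  finally have "(\<Sum>l=1..2*n. mean_hooks n l * (- 1 / (4 * (real l)\<^sup>2 - 1))) = (\<Sum>j<n. lag_coeff n j * 4 ^ j * (?b j * odd_wallis j - 4 * ?c j * odd_wallis (j + 1))) / 2"
    by (rule has_integral_unique[OF 1])
  moreover have "(\<Sum>l=1..2*n. mean_hooks n l * (- 1 / (4 * (real l)\<^sup>2 - 1))) = - (\<Sum>l=1..2*n. mean_hooks n l / (4 * (real l)\<^sup>2 - 1))"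
    by (simp add: sum_negf)
  ultimately have "(\<Sum>l=1..2*n. mean_hooks n l / (4 * (real l)\<^sup>2 - 1)) = (\<Sum>j<n. lag_coeff n j * (- (4 ^ j * (?b j * odd_wallis j - 4 * ?c j * odd_wallis (j + 1))) / 2))"
    by (simp only: sum_divide_distrib sum_negf[symmetric] minus_equation_iff) (simp add: sum_negf mult.assoc del: binomial_Suc_Suc)
  also have "\<dots> = (\<Sum>j<n. lag_coeff n j * (4 ^ Suc (2 * j) / (real (Suc (2 * j))) / 4 - 4 ^ Suc (2 * j + 1) / real (Suc (2 * j + 1)) / 8 + 4 ^ Suc (2 * j + 2) / real (Suc (2 * j + 2)) / 64))"
  proof (intro sum.cong refl arg_cong2[where f = "(*)"])
    fix j
    have 4: "(4::real) ^ Suc (2 * j) = 4 * (4 ^ j * 4 ^ j)" "(4::real) ^ Suc (2 * j + 1) = 16 * (4 ^ j * 4 ^ j)" "(4::real) ^ Suc (2 * j + 2) = 64 * (4 ^ j * 4 ^ j)"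
      by (simp_all add: mult_2 power_add)
    \<comment> \<open>Partial fractions in \<open>2 j + 1\<close>, \<open>2 j + 2\<close> and
      \<open>2 j + 3\<close>, the denominators of \<open>lag_moment\<close> for the exponents 2, 1
      and 0.\<close>
    have "- (q * (2 * q / (t + 1) - 4 * (2 * q * (t + 1) / ((2 * t + 1) * (2 * t + 3))))) / 2
       = 4 * (q * q) / (2 * t + 1) / 4 - 16 * (q * q) / (2 * t + 2) / 8 + 64 * (q * q) / (2 * t + 3) / 64" if "t \<ge> 0" for q t :: real
      using that by (simp add: divide_simps) (simp add: algebra_simps)
    from this[of "real j" "4 ^ j"]
    show "- (4 ^ j * (?b j * odd_wallis j - 4 * ?c j * odd_wallis (j + 1))) / 2 = 4 ^ Suc (2 * j) / (real (Suc (2 * j))) / 4 - 4 ^ Suc (2 * j + 1) / real (Suc (2 * j + 1)) / 8 + 4 ^ Suc (2 * j + 2) / real (Suc (2 * j + 2)) / 64"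
      unfolding mult.assoc[of 4] wallis_binomial1 wallis_binomial2 4 by (simp add: add_ac)
  qed
  also have "\<dots> = lag_moment 2 n 4 / 4 - lag_moment 1 n 4 / 8 + lag_moment 0 n 4 / 64"
    unfolding lag_moment_def lag_coeff_def[symmetric] sum_divide_distrib sum_subtractf[symmetric] sum.distrib[symmetric]
    by (intro sum.cong refl) (simp add: algebra_simps del: power_Suc)
  finally show ?thesis .
qed

text \<open>By \<open>sin_times_sum_sin\<close> this is the integral of
  \<open>(n - hook_cos n x) / sin x\<close>. As \<open>n\<close> is the value of
  \<open>hook_cos\<close> at \<open>0\<close>, the numerator is divisible by \<open>sin^2 x\<close>,
  and the quotient \<open>?g\<close> is a polynomial in odd powers of \<open>sin\<close>.\<close>

lemma sum_mean_hooks_odd_harm: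
  "(\<Sum>l=1..2*n. mean_hooks n l * odd_harm l) = lag_moment3 n 4 + lag_moment 2 n 4 / 2 - lag_moment 1 n 4 / 16 + real n / 2"
proof -
  let ?b = "\<lambda>j. real ((2 * j + 4) choose (j + 2))" and ?c = "\<lambda>j. real ((2 * (j + 1)) choose (j + 1))"
  let ?g = "\<lambda>x. 2 * real n * sin x - (\<Sum>j<n. lag_coeff n (Suc j) * 4 ^ Suc j * (?b j * sin x ^ (2 * j + 1) - 4 * ?c j * sin x ^ (2 * (j + 1) + 1))) / 2"
  let ?h = "\<lambda>x. \<Sum>l=1..2*n. mean_hooks n l * (\<Sum>j<l. 2 * sin ((2 * real j + 1) * x))"
  \<comment> \<open>The constant term is set apart; the added term with index \<open>n\<close>
    vanishes because \<open>n choose Suc n = 0\<close>.\<close>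
  have shift: "(\<Sum>j<n. lag_coeff n j * f j) = real n * f 0 + (\<Sum>j<n. lag_coeff n (Suc j) * f (Suc j))" for f :: "nat \<Rightarrow> real"
  proof -
    have "(\<Sum>j<n. lag_coeff n j * f j) = (\<Sum>j<Suc n. lag_coeff n j * f j)" by (simp add: lag_coeff_def binomial_eq_0)
    also have "\<dots> = real n * f 0 + (\<Sum>j<n. lag_coeff n (Suc j) * f (Suc j))"
      by (subst sum.lessThan_Suc_shift) (simp add: lag_coeff_def)
    finally show ?thesis .
  qed
  have 1: "(?h has_integral (\<Sum>l=1..2*n. mean_hooks n l * odd_harm l)) {0..pi/2}"
    by (intro has_integral_sum has_integral_mult_right has_integral_sum_sin) auto
  have 2: "(?g has_integral (2 * real n * odd_wallis 0 - (\<Sum>j<n. lag_coeff n (Suc j) * 4 ^ Suc j * (?b j * odd_wallis j - 4 * ?c j * odd_wallis (j + 1))) / 2)) {0..pi/2}"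
    using has_integral_sin_odd[of 0]
    by (intro has_integral_divide has_integral_sum has_integral_mult_right has_integral_diff has_integral_sin_odd) auto
  have sh: "sin x * ?h x = real n - hook_cos n x" for x
  proof -
    have "sin x * ?h x = (\<Sum>l=1..2*n. mean_hooks n l * (sin x * (\<Sum>j<l. 2 * sin ((2 * real j + 1) * x))))"
      by (subst sum_distrib_left) (simp only: mult.left_commute[of "sin x"])
    also have "\<dots> = (\<Sum>l=1..2*n. mean_hooks n l) - hook_cos n x"
      by (simp only: sin_times_sum_sin hook_cos_def right_diff_distrib mult_1_right sum_subtractf)
    finally show ?thesis by (simp only: sum_mean_hooks)
  qed
  have sg: "sin x * ?g x = real n - hook_cos n x" for x
  proof -
    define f where "f j = (4 * (sin x)\<^sup>2) ^ j * (real ((2 * j + 2) choose (j + 1)) - 4 * (sin x)\<^sup>2 * real ((2 * j) choose j))" for j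
    have "hook_cos n x = (\<Sum>j<n. lag_coeff n j * f j) / 2" unfolding hook_cos_eq f_def by (simp only: mult.assoc)
    also have "\<dots> = (real n * f 0 + (\<Sum>j<n. lag_coeff n (Suc j) * f (Suc j))) / 2" by (simp only: shift)
    also have "f 0 = 2 - 4 * (sin x)\<^sup>2" by (simp add: f_def)
    finally have h: "hook_cos n x = (real n * (2 - 4 * (sin x)\<^sup>2) + (\<Sum>j<n. lag_coeff n (Suc j) * f (Suc j))) / 2" .
    have "sin x * (lag_coeff n (Suc j) * 4 ^ Suc j * (?b j * sin x ^ (2 * j + 1) - 4 * ?c j * sin x ^ (2 * (j + 1) + 1))) = lag_coeff n (Suc j) * f (Suc j)" for j
    proof -
      have i: "2 * Suc j + 2 = 2 * j + 4" "Suc j + 1 = j + 2" by simp_all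
      show ?thesis unfolding f_def i 
        using odd_power_expand_Suc[of "sin x" "lag_coeff n (Suc j)" j "?b j" "?c j"] by (simp only: Suc_eq_plus1)
    qed
    then have "sin x * (\<Sum>j<n. lag_coeff n (Suc j) * 4 ^ Suc j * (?b j * sin x ^ (2 * j + 1) - 4 * ?c j * sin x ^ (2 * (j + 1) + 1))) = (\<Sum>j<n. lag_coeff n (Suc j) * f (Suc j))"
      by (simp only: sum_distrib_left)
    moreover have "s * (2 * m * s - X / 2) = m - (m * (2 - 4 * s\<^sup>2) + Y) / 2" if "s * X = Y" for s m X Y :: real
      using that by (simp add: power2_eq_square algebra_simps diff_divide_distrib add_divide_distrib)
    ultimately show ?thesis unfolding h by blast
  qed
  \<comment> \<open>Cancelling \<open>sin x\<close> excludes only the point \<open>0\<close>, which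
    the integral ignores.\<close>
  have "?g x = ?h x" if "x \<in> {0..pi/2} - {0}" for x
  proof -
    have "sin x > 0" using that by (intro sin_gt_zero) auto
    then have s: "sin x \<noteq> 0" by simp
    have "sin x * ?g x = sin x * ?h x" unfolding sh sg ..
    then show ?thesis by (rule mult_left_cancel[OF s, THEN iffD1])
  qed
  then have "(?h has_integral (2 * real n * odd_wallis 0 - (\<Sum>j<n. lag_coeff n (Suc j) * 4 ^ Suc j * (?b j * odd_wallis j - 4 * ?c j * odd_wallis (j + 1))) / 2)) {0..pi/2}"
    using has_integral_spike_finite[of "{0}" "{0..pi/2}" ?h ?g] 2 by simp
  then have "(\<Sum>l=1..2*n. mean_hooks n l * odd_harm l) = 2 * real n * odd_wallis 0 - (\<Sum>j<n. lag_coeff n (Suc j) * 4 ^ Suc j * (?b j * odd_wallis j - 4 * ?c j * odd_wallis (j + 1))) / 2"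
    by (rule has_integral_unique[OF 1])
  also have "\<dots> = 2 * real n - (\<Sum>j<n. lag_coeff n (Suc j) * (4 ^ Suc j * (?b j * odd_wallis j - 4 * (?c j * odd_wallis (j + 1))))) / 2"
    by (simp add: mult.assoc del: binomial_Suc_Suc power_Suc)
  also have "(\<Sum>j<n. lag_coeff n (Suc j) * (4 ^ Suc j * (?b j * odd_wallis j - 4 * (?c j * odd_wallis (j + 1))))) = 
     (\<Sum>j<n. lag_coeff n (Suc j) * (4 ^ Suc (2 * Suc j + 1) / real (Suc (2 * Suc j + 1)) / 8)) 
     + 2 * (\<Sum>j<n. lag_coeff n (Suc j) * (4 ^ Suc (2 * j + 1) / real (Suc (2 * j + 1))))
     - (\<Sum>j<n. lag_coeff n (Suc j) * (4 ^ Suc (2 * Suc j) / real (Suc (2 * Suc j))))"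
    unfolding sum_distrib_left sum_subtractf[symmetric] sum.distrib[symmetric]
  proof (intro sum.cong refl)
    fix j
    have 4: "(4::real) ^ Suc (2 * Suc j) = 64 * (4 ^ j * 4 ^ j)" "(4::real) ^ Suc (2 * j + 1) = 16 * (4 ^ j * 4 ^ j)" "(4::real) ^ Suc (2 * Suc j + 1) = 256 * (4 ^ j * 4 ^ j)" "(4::real) ^ Suc j = 4 * 4 ^ j" "(4::real) ^ (j + 1) = 4 * 4 ^ j"
      by (simp_all add: mult_2 power_add)
    have "4 * q * (4 * q * (2 * t + 3) / ((t + 1) * (t + 2)) - 4 * (4 * q / (2 * (t + 1) + 1)))
       = 256 * (q * q) / (2 * t + 4) / 8 + 2 * (16 * (q * q) / (2 * t + 2)) - 64 * (q * q) / (2 * t + 3)" if "t \<ge> 0" for q t :: real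
      using that by (simp add: divide_simps) (simp add: algebra_simps)
    from this[of "real j" "4 ^ j"]
    have "4 ^ Suc j * (?b j * odd_wallis j - 4 * (?c j * odd_wallis (j + 1))) = 4 ^ Suc (2 * Suc j + 1) / real (Suc (2 * Suc j + 1)) / 8 + 2 * (4 ^ Suc (2 * j + 1) / real (Suc (2 * j + 1))) - 4 ^ Suc (2 * Suc j) / real (Suc (2 * Suc j))"
      unfolding wallis_binomial0[of "j + 1"] wallis_binomial3 unfolding 4 by (simp add: add_ac)
    then show "lag_coeff n (Suc j) * (4 ^ Suc j * (?b j * odd_wallis j - 4 * (?c j * odd_wallis (j + 1)))) = lag_coeff n (Suc j) * (4 ^ Suc (2 * Suc j + 1) / real (Suc (2 * Suc j + 1)) / 8) 
     + 2 * (lag_coeff n (Suc j) * (4 ^ Suc (2 * j + 1) / real (Suc (2 * j + 1))))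
     - lag_coeff n (Suc j) * (4 ^ Suc (2 * Suc j) / real (Suc (2 * Suc j)))"
      by (simp only: distrib_left right_diff_distrib mult.left_commute[of 2])
  qed
  also have "(\<Sum>j<n. lag_coeff n (Suc j) * (4 ^ Suc (2 * Suc j + 1) / real (Suc (2 * Suc j + 1)) / 8)) = lag_moment 1 n 4 / 8 - real n"
  proof -
    have "lag_moment 1 n 4 = (\<Sum>j<n. lag_coeff n j * (4 ^ Suc (2 * j + 1) / real (Suc (2 * j + 1))))"
      unfolding lag_moment_def lag_coeff_def[symmetric] by (intro sum.cong refl) simp
    also have "\<dots> = real n * 8 + (\<Sum>j<n. lag_coeff n (Suc j) * (4 ^ Suc (2 * Suc j + 1) / real (Suc (2 * Suc j + 1))))"
      unfolding shift by simp
    moreover have "(\<Sum>j<n. lag_coeff n (Suc j) * (4 ^ Suc (2 * Suc j + 1) / real (Suc (2 * Suc j + 1)) / 8)) = (\<Sum>j<n. lag_coeff n (Suc j) * (4 ^ Suc (2 * Suc j + 1) / real (Suc (2 * Suc j + 1)))) / 8"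
      by (simp only: sum_divide_distrib times_divide_eq_right)
    ultimately show ?thesis by linarith
  qed
  also have "(\<Sum>j<n. lag_coeff n (Suc j) * (4 ^ Suc (2 * Suc j) / real (Suc (2 * Suc j)))) = lag_moment 2 n 4 - 4 * real n"
  proof -
    have "lag_moment 2 n 4 = (\<Sum>j<n. lag_coeff n j * (4 ^ Suc (2 * j) / real (Suc (2 * j))))"
      unfolding lag_moment_def lag_coeff_def[symmetric] by (intro sum.cong refl) simp
    also have "\<dots> = real n * 4 + (\<Sum>j<n. lag_coeff n (Suc j) * (4 ^ Suc (2 * Suc j) / real (Suc (2 * Suc j))))"
      unfolding shift by simp
    finally show ?thesis by simp
  qed
  also have "(\<Sum>j<n. lag_coeff n (Suc j) * (4 ^ Suc (2 * j + 1) / real (Suc (2 * j + 1)))) = - lag_moment3 n 4"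
    unfolding lag_moment3_def sum_negf[symmetric] lag_coeff_def by (intro sum.cong refl) (simp del: fact_Suc power_Suc binomial_Suc_Suc add: power_Suc[of "-1"])
  finally show ?thesis by (simp add: field_simps)
qed

section \<open>Asymptotics of the mean hook counts\<close>

lemma one_minus_lag_bound:
  assumes "\<bar>s\<bar> \<le> 1" shows "\<bar>1 - lag n ((4 * s)\<^sup>2)\<bar> \<le> 1 + 2 * exp 16"
proof -
  have "s\<^sup>2 \<le> 1" using assms by (simp add: abs_square_le_1)
  then have y: "(4 * s)\<^sup>2 \<le> 16" by (simp add: power_mult_distrib)
  have "\<bar>lag n ((4 * s)\<^sup>2)\<bar> \<le> 2 * exp ((4 * s)\<^sup>2)"
    using lag_bound[of "(4 * s)\<^sup>2" n] sqrt_gauss_bound[of "4 * s"] by simp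
  also have "\<dots> \<le> 2 * exp 16" using y by simp
  finally show ?thesis by linarith
qed

text \<open>The argument \<open>4 s sin x\<close> never exceeds \<open>4\<close>, so
  \<open>lag\<close> is bounded uniformly in \<open>n\<close>, and it tends to \<open>0\<close>
  except at \<open>x = 0\<close>.\<close>

lemma sin_lag_asymp:
  assumes w: "continuous_on {0..pi/2} w" "\<And>x. x \<in> {0..pi/2} \<Longrightarrow> \<bar>w x\<bar> \<le> 1" and s: "0 < s" "s \<le> 1"
  shows "(\<lambda>x. w x * (1 - lag n ((4 * (s * sin x))\<^sup>2))) integrable_on {0..pi/2}"
    "\<bar>integral {0..pi/2} (\<lambda>x. w x * (1 - lag n ((4 * (s * sin x))\<^sup>2)))\<bar> \<le> pi / 2 * (1 + 2 * exp 16)"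
    "(\<lambda>n. integral {0..pi/2} (\<lambda>x. w x * (1 - lag n ((4 * (s * sin x))\<^sup>2)))) \<longlonglongrightarrow> integral {0..pi/2} w"
proof -
  let ?f = "\<lambda>n x. w x * (1 - lag n ((4 * (s * sin x))\<^sup>2))"
  have i: "?f n integrable_on {0..pi/2}" for n
    by (intro integrable_continuous_real continuous_intros w)
  show "?f n integrable_on {0..pi/2}" by (rule i)
  have b: "norm (?f n x) \<le> 1 + 2 * exp 16" if "x \<in> {0..pi/2}" for n x
  proof -
    have "\<bar>s * sin x\<bar> \<le> 1" using s abs_sin_le_one[of x] by (simp add: abs_mult mult_le_one)
    then have "\<bar>w x\<bar> * \<bar>1 - lag n ((4 * (s * sin x))\<^sup>2)\<bar> \<le> 1 * (1 + 2 * exp 16)"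
      by (intro mult_mono w(2) that one_minus_lag_bound) auto
    then show ?thesis by (simp add: abs_mult)
  qed
  have c: "(\<lambda>x::real. 1 + 2 * exp 16 :: real) integrable_on {0..pi/2}" by (rule integrable_const_ivl)
  have "norm (integral {0..pi/2} (?f n)) \<le> integral {0..pi/2} (\<lambda>x::real. 1 + 2 * exp 16)"
    by (rule integral_norm_bound_integral[OF i c b])
  then show "\<bar>integral {0..pi/2} (?f n)\<bar> \<le> pi / 2 * (1 + 2 * exp 16)" by simp
  have "(\<lambda>n. integral {0..pi/2} (?f n)) \<longlonglongrightarrow> integral {0..pi/2} (\<lambda>x. if x = 0 then 0 else w x)"
  proof (rule dominated_convergence(2)[OF i c b])
    fix x assume x: "x \<in> {0..pi/2}"
    show "(\<lambda>n. ?f n x) \<longlonglongrightarrow> (if x = 0 then 0 else w x)"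
    proof (cases "x = 0")
      case False
      then have "sin x > 0" using x by (intro sin_gt_zero) auto
      then have "4 * (s * sin x) \<noteq> 0" using s by simp
      from tendsto_mult[OF tendsto_const[of "w x"] tendsto_diff[OF tendsto_const[of 1] lag_tendsto_0[OF this]]]
      show ?thesis using False by simp
    qed simp
  qed
  also have "integral {0..pi/2} (\<lambda>x. if x = 0 then 0 else w x) = integral {0..pi/2} w"
    by (rule integral_spike[of "{0}"]) auto
  finally show "(\<lambda>n. integral {0..pi/2} (?f n)) \<longlonglongrightarrow> integral {0..pi/2} w" .
qed

lemma one_plus_cos_pos: "x \<in> {0..pi/2} \<Longrightarrow> 1 \<le> 1 + cos x" for x :: real
  using cos_ge_zero[of x] by auto

lemma has_integral_inverse_one_plus_cos: "((\<lambda>x. 1 / (1 + cos x)) has_integral 1) {0..pi/2}"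
proof -
  have "((\<lambda>x. 1 / (1 + cos x)) has_integral (sin (pi/2) / (1 + cos (pi/2)) - sin 0 / (1 + cos 0))) {0..pi/2}"
  proof (rule fundamental_theorem_of_calculus)
    fix x assume "x \<in> {0..pi/2}"
    then have c: "1 + cos x \<noteq> 0" using one_plus_cos_pos[of x] by simp
    have n: "cos x * (1 + cos x) - sin x * (- sin x) = 1 + cos x"
      using sin_cos_squared_add[of x] by (simp add: power2_eq_square algebra_simps)
    have "((\<lambda>x. sin x / (1 + cos x)) has_real_derivative ((cos x * (1 + cos x) - sin x * (- sin x)) / ((1 + cos x) * (1 + cos x)))) (at x)"
      using c by (auto intro!: derivative_eq_intros)
    then have "((\<lambda>x. sin x / (1 + cos x)) has_real_derivative (1 / (1 + cos x))) (at x)"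
      unfolding n using c by simp
    then show "((\<lambda>x. sin x / (1 + cos x)) has_vector_derivative (1 / (1 + cos x))) (at x within {0..pi/2})"
      unfolding has_real_derivative_iff_has_vector_derivative by (rule has_vector_derivative_at_within)
  qed simp
  then show ?thesis by simp
qed

lemma has_integral_cos_sin_power: "((\<lambda>x. cos x * sin x ^ k) has_integral (1 / (real k + 1))) {0..pi/2}"
proof -
  have d: "((\<lambda>x. sin x ^ Suc k / real (Suc k)) has_real_derivative cos x * sin x ^ k) (at x)" for x
    by (rule DERIV_cong[OF DERIV_cdivide[OF DERIV_power[OF DERIV_sin]]]) (simp del: of_nat_Suc add: mult_ac)
  have "((\<lambda>x. cos x * sin x ^ k) has_integral (sin (pi/2) ^ Suc k / real (Suc k) - sin 0 ^ Suc k / real (Suc k))) {0..pi/2}"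
    by (rule has_integral_FTC_deriv[OF _ d]) simp
  then show ?thesis by (simp add: add_ac)
qed

text \<open>The central binomial coefficients in \<open>hook_cos_eq\<close> are written as even
  Wallis integrals in a second variable \<open>y\<close>. This turns \<open>hook_cos\<close> into
  means of \<open>1 - lag\<close> and isolates its growth with \<open>n\<close> in one
  \<open>lag_moment\<close>.\<close>

lemma hook_cos_lag:
  fixes x :: real
  defines "s \<equiv> sin x"
  assumes s: "0 < s"
  shows "4 * pi * hook_cos n x = integral {0..pi/2} (\<lambda>y. 1 * (1 - lag n ((4 * (s * sin y))\<^sup>2))) / s\<^sup>2 
    - (4 * s * lag_moment 2 n (4 * s) + integral {0..pi/2} (\<lambda>y. 1 / (1 + cos y) * (1 - lag n ((4 * (s * sin y))\<^sup>2))))"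
proof -
  let ?c = "\<lambda>j. real ((2 * j) choose j)"
  let ?f = "\<lambda>y. \<Sum>j<n. lag_coeff n j * (16 * s\<^sup>2) ^ Suc j * sin y ^ (2 * j)"
  have f: "1 - lag n ((4 * (s * sin y))\<^sup>2) = (sin y)\<^sup>2 * ?f y" for y
  proof -
    have "((4 * (s * sin y))\<^sup>2) ^ Suc j = (sin y)\<^sup>2 * ((16 * s\<^sup>2) ^ Suc j * sin y ^ (2 * j))" for j
      by (simp add: power_mult_distrib power_mult)
    then show ?thesis unfolding lag_split sum_distrib_left by (simp only: mult_ac)
  qed
  have R: "((\<lambda>y. 1 * (1 - lag n ((4 * (s * sin y))\<^sup>2))) has_integral (\<Sum>j<n. lag_coeff n j * (16 * s\<^sup>2) ^ Suc j * (pi / 2 * (?c (Suc j) / 4 ^ Suc j)))) {0..pi/2}"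
  proof -
    have "((\<lambda>y. \<Sum>j<n. lag_coeff n j * (16 * s\<^sup>2) ^ Suc j * sin y ^ (2 * Suc j)) has_integral (\<Sum>j<n. lag_coeff n j * (16 * s\<^sup>2) ^ Suc j * (pi / 2 * (?c (Suc j) / 4 ^ Suc j)))) {0..pi/2}"
      by (intro has_integral_sum has_integral_mult_right has_integral_sin_even) auto
    also have "(\<lambda>y. \<Sum>j<n. lag_coeff n j * (16 * s\<^sup>2) ^ Suc j * sin y ^ (2 * Suc j)) = (\<lambda>y. 1 * (1 - lag n ((4 * (s * sin y))\<^sup>2)))"
      unfolding f sum_distrib_left by (intro ext sum.cong refl) (simp add: power2_eq_square mult_ac)
    finally show ?thesis .
  qed
  have F: "(?f has_integral (\<Sum>j<n. lag_coeff n j * (16 * s\<^sup>2) ^ Suc j * (pi / 2 * (?c j / 4 ^ j)))) {0..pi/2}"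
    by (intro has_integral_sum has_integral_mult_right has_integral_sin_even) auto
  have "((\<lambda>y. \<Sum>j<n. lag_coeff n j * (16 * s\<^sup>2) ^ Suc j * (cos y * sin y ^ (2 * j))) has_integral (\<Sum>j<n. lag_coeff n j * (16 * s\<^sup>2) ^ Suc j * (1 / (real (2 * j) + 1)))) {0..pi/2}"
    by (intro has_integral_sum has_integral_mult_right has_integral_cos_sin_power) auto
  also have "(\<Sum>j<n. lag_coeff n j * (16 * s\<^sup>2) ^ Suc j * (1 / (real (2 * j) + 1))) = 4 * s * lag_moment 2 n (4 * s)"
  proof -
    have p: "(16 * s\<^sup>2) ^ Suc j = 4 * s * (4 * s) ^ Suc (2 * j)" for j
    proof -
      have "(16 * s\<^sup>2) ^ Suc j = ((4 * s)\<^sup>2) ^ Suc j" by (simp add: power_mult_distrib)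
      also have "\<dots> = (4 * s) ^ Suc (Suc (2 * j))" unfolding power_mult[symmetric] by simp
      finally show ?thesis by simp
    qed
    have e: "Suc (2 * j + 2 - 2) = Suc (2 * j)" "real (2 * j) + 1 = real (Suc (2 * j))" for j by simp_all
    show ?thesis unfolding lag_moment_def lag_coeff_def[symmetric] sum_distrib_left p e
      by (intro sum.cong refl) (simp del: power_Suc of_nat_Suc)
  qed
  finally have C: "((\<lambda>y. cos y * ?f y) has_integral (4 * s * lag_moment 2 n (4 * s))) {0..pi/2}"
    by (simp only: sum_distrib_left mult_ac)
  \<comment> \<open>The splitting \<open>1 / sin^2 y = 1 / (1 + cos y) + cos y / sin^2 y\<close>:
    the first part is a bounded weight, the second becomes a Laguerre moment under the substitution
    of \<open>4 s sin y\<close>.\<close>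
  have "1 / (1 + cos y) * (1 - lag n ((4 * (s * sin y))\<^sup>2)) = ?f y - cos y * ?f y" if "y \<in> {0..pi/2}" for y
  proof -
    have sc: "(sin y)\<^sup>2 = (1 + cos y) * (1 - cos y)" using sin_cos_squared_add[of y] by (simp add: power2_eq_square algebra_simps)
    have gen: "1 / (1 + c) * ((1 + c) * (1 - c) * F) = F - c * F" if "1 \<le> 1 + c" for c F :: real
      using that by (simp add: left_diff_distrib)
    show ?thesis unfolding f sc by (rule gen[OF one_plus_cos_pos[OF that]])
  qed
  then have V: "integral {0..pi/2} (\<lambda>y. 1 / (1 + cos y) * (1 - lag n ((4 * (s * sin y))\<^sup>2))) = 
    (\<Sum>j<n. lag_coeff n j * (16 * s\<^sup>2) ^ Suc j * (pi / 2 * (?c j / 4 ^ j))) - 4 * s * lag_moment 2 n (4 * s)"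
    using integral_unique[OF has_integral_diff[OF F C]] by (subst integral_cong) (assumption, simp)
  have "(\<Sum>j<n. lag_coeff n j * (16 * s\<^sup>2) ^ Suc j * (pi / 2 * (?c (Suc j) / 4 ^ Suc j))) / s\<^sup>2 - (\<Sum>j<n. lag_coeff n j * (16 * s\<^sup>2) ^ Suc j * (pi / 2 * (?c j / 4 ^ j)))
     = 4 * pi * hook_cos n x"
    unfolding hook_cos_eq s_def[symmetric] sum_divide_distrib sum_distrib_left sum_subtractf[symmetric]
  proof (intro sum.cong refl)
    fix j
    have q: "(16 * s\<^sup>2) ^ Suc j = 16 * s\<^sup>2 * (4 ^ j * (4 * s\<^sup>2) ^ j)"
    proof -
      have "(16 * s\<^sup>2) ^ j = 4 ^ j * (4 * s\<^sup>2) ^ j" unfolding power_mult_distrib[symmetric] by simp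
      then show ?thesis by (simp only: power_Suc)
    qed
    have "L * (16 * S * (F * W)) * (p / 2 * (c' / (4 * F))) / S - L * (16 * S * (F * W)) * (p / 2 * (c / F)) = 4 * p * (L * W * (c' - 4 * S * c) / 2)"
      if "S \<noteq> 0" "F \<noteq> 0" for L S F W p c' c :: real
    proof -
      have "L * (16 * S * (F * W)) * (p / 2 * (c' / (4 * F))) / S = 2 * p * (L * W * c')" using that by (simp add: mult_ac)
      moreover have "L * (16 * S * (F * W)) * (p / 2 * (c / F)) = 2 * p * (L * W * (4 * S * c))" using that by simp
      ultimately show ?thesis by (simp only: right_diff_distrib diff_divide_distrib)
    qed
    from this[of "s\<^sup>2" "4 ^ j" "lag_coeff n j" "(4 * s\<^sup>2) ^ j" pi "?c (Suc j)" "?c j"]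
    show "lag_coeff n j * (16 * s\<^sup>2) ^ Suc j * (pi / 2 * (?c (Suc j) / 4 ^ Suc j)) / s\<^sup>2 - lag_coeff n j * (16 * s\<^sup>2) ^ Suc j * (pi / 2 * (?c j / 4 ^ j))
      = 4 * pi * (lag_coeff n j * (4 * s\<^sup>2) ^ j * (real ((2 * j + 2) choose (j + 1)) - 4 * s\<^sup>2 * ?c j) / 2)"
      unfolding q using s by (simp only: power_Suc[of 4] mult_Suc_right Suc_eq_plus1 add.commute[of 2] one_add_one) simp
  qed
  then show ?thesis using integral_unique[OF R] V by simp
qed

text \<open>The deviation of \<open>hook_cos\<close> from its leading term
  \<open>- 2 sqrt n sin x / pi\<close>. The factor \<open>sin^2 x\<close> keeps it bounded uniformly
  near the origin.\<close>

definition hook_err :: "nat \<Rightarrow> real \<Rightarrow> real" where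
  "hook_err n x = (sin x)\<^sup>2 * (hook_cos n x + 2 * sqrt (real n) / pi * sin x)"

text \<open>The limit does not depend on \<open>x\<close>, since the limits \<open>- 1\<close> of
  \<open>m\<close> and \<open>1\<close> of \<open>V\<close> cancel and only
  \<open>(pi / 2) / (4 pi)\<close> is left. The bound is uniform in \<open>x\<close> because
  \<open>lag_moment2_error\<close> carries the factor \<open>4 sin x\<close>.\<close>

lemma hook_err_asymp:
  assumes "0 < sin x"
  shows "(\<lambda>n. hook_err n x) \<longlonglongrightarrow> 1 / 8" "\<bar>hook_err n x\<bar> \<le> (11 + 32 * exp 16 + pi * (1 + 2 * exp 16)) / (4 * pi)"
proof -
  define s where "s = sin x"
  have s: "0 < s" "s \<le> 1" using assms by (auto simp: s_def)
  define R where "R n = integral {0..pi/2} (\<lambda>y. 1 * (1 - lag n ((4 * (s * sin y))\<^sup>2)))" for n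
  define V where "V n = integral {0..pi/2} (\<lambda>y. 1 / (1 + cos y) * (1 - lag n ((4 * (s * sin y))\<^sup>2)))" for n
  have R: "\<bar>R n\<bar> \<le> pi / 2 * (1 + 2 * exp 16)" "R \<longlonglongrightarrow> pi / 2" for n
    using sin_lag_asymp(2,3)[of "\<lambda>_. 1", OF _ _ s] unfolding R_def by simp_all
  have w: "continuous_on {0..pi/2} (\<lambda>y::real. 1 / (1 + cos y))"
    using one_plus_cos_pos by (intro continuous_intros) force
  have w1: "\<bar>1 / (1 + cos y)\<bar> \<le> 1" if "y \<in> {0..pi/2}" for y :: real
    using one_plus_cos_pos[OF that] by (simp add: abs_of_pos)
  have V: "\<bar>V n\<bar> \<le> pi / 2 * (1 + 2 * exp 16)" "V \<longlonglongrightarrow> 1" for n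
    using sin_lag_asymp(2,3)[OF w w1 s] integral_unique[OF has_integral_inverse_one_plus_cos] unfolding V_def by simp_all
  define m where "m n = 4 * s * (lag_moment 2 n (4 * s) - 2 * sqrt (real n))" for n
  have m: "\<bar>m n\<bar> \<le> 11 + 32 * exp 16" "m \<longlonglongrightarrow> - 1" for n
  proof -
    show "\<bar>m n\<bar> \<le> 11 + 32 * exp 16"
      using lag_moment2_error[of "4 * s" n] s by (simp add: m_def abs_mult)
    have "m \<longlonglongrightarrow> 4 * s * (- 1 / (4 * s))"
      unfolding m_def using s by (intro tendsto_intros lag_moment2_tendsto) simp
    then show "m \<longlonglongrightarrow> - 1" using s by simp
  qed
  have e: "hook_err n x = (R n - s\<^sup>2 * (m n + V n)) / (4 * pi)" for n
  proof -
    have h: "hook_cos n x = (R n / s\<^sup>2 - (4 * s * lag_moment 2 n (4 * s) + V n)) / (4 * pi)"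
      using hook_cos_lag[of x n] s by (simp add: s_def[symmetric] R_def V_def field_simps)
    show ?thesis unfolding hook_err_def h s_def[symmetric] m_def using s
      by (simp add: field_simps power2_eq_square)
  qed
  have "(\<lambda>n. (R n - s\<^sup>2 * (m n + V n)) / (4 * pi)) \<longlonglongrightarrow> (pi / 2 - s\<^sup>2 * (- 1 + 1)) / (4 * pi)"
    by (intro tendsto_intros R V m) simp
  then show "(\<lambda>n. hook_err n x) \<longlonglongrightarrow> 1 / 8" unfolding e by simp
  define Q where "Q = pi / 2 * (1 + 2 * exp (16::real))"
  have sm: "\<bar>s\<^sup>2 * (m n + V n)\<bar> \<le> 1 * (11 + 32 * exp 16 + Q)"
    unfolding abs_mult
  proof (rule mult_mono)
    show "\<bar>s\<^sup>2\<bar> \<le> 1" using s by (simp add: power_le_one)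
    show "\<bar>m n + V n\<bar> \<le> 11 + 32 * exp 16 + Q" using m(1)[of n] V(1)[of n] unfolding Q_def[symmetric] by linarith
  qed auto
  have "\<bar>R n - s\<^sup>2 * (m n + V n)\<bar> \<le> 11 + 32 * exp 16 + 2 * Q"
  proof -
    have "\<bar>a - b\<bar> \<le> c + 2 * q" if "\<bar>b\<bar> \<le> 1 * (c + q)" "\<bar>a\<bar> \<le> q" for a b c q :: real
      using abs_triangle_ineq4[of a b] that by simp
    then show ?thesis using sm R(1)[of n] unfolding Q_def[symmetric] by blast
  qed
  also have "\<dots> = 11 + 32 * exp 16 + pi * (1 + 2 * exp 16)" by (simp add: Q_def)
  finally show "\<bar>hook_err n x\<bar> \<le> (11 + 32 * exp 16 + pi * (1 + 2 * exp 16)) / (4 * pi)"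
    unfolding e by (simp add: abs_divide divide_right_mono)
qed

text \<open>The sum of the first \<open>l\<close> Dirichlet kernels in the variable
  \<open>2 x\<close>, thus \<open>l\<close> times a Fejer kernel.\<close>

definition fejer :: "nat \<Rightarrow> real \<Rightarrow> real" where
  "fejer l x = (\<Sum>j<l. 1 + 2 * (\<Sum>i=1..j. cos (2 * real i * x)))"

lemma dirichlet_kernel: "sin x * (1 + 2 * (\<Sum>i=1..j. cos (2 * real i * x))) = sin ((2 * real j + 1) * x)"
proof (induction j)
  case (Suc j)
  have a: "(2 * real j + 1) * x = 2 * real (Suc j) * x - x" "(2 * real (Suc j) + 1) * x = 2 * real (Suc j) * x + x"
    by (simp_all add: algebra_simps)
  have "sin ((2 * real j + 1) * x) + 2 * (sin x * cos (2 * real (Suc j) * x)) = sin ((2 * real (Suc j) + 1) * x)"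
    unfolding a by (simp add: sin_add sin_diff)
  then show ?case using Suc by (simp add: distrib_left)
qed simp

lemma fejer_kernel: "(sin x)\<^sup>2 * fejer l x = (sin (real l * x))\<^sup>2"
proof (induction l)
  case (Suc l)
  have a: "(2 * real l + 1) * x = real (Suc l) * x + real l * x" by (simp add: algebra_simps)
  have b: "x = real (Suc l) * x - real l * x" by (simp add: algebra_simps)
  have "sin x * sin ((2 * real l + 1) * x) = sin (real (Suc l) * x - real l * x) * sin (real (Suc l) * x + real l * x)"
    using a b by (simp only:)
  also have "\<dots> = (sin (real (Suc l) * x))\<^sup>2 * (cos (real l * x))\<^sup>2 - (cos (real (Suc l) * x))\<^sup>2 * (sin (real l * x))\<^sup>2"
  proof -
    have "sin (a - b) * sin (a + b) = (sin a)\<^sup>2 * (cos b)\<^sup>2 - (cos a)\<^sup>2 * (sin b)\<^sup>2" for a b :: real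
      by (simp add: sin_add sin_diff power2_eq_square algebra_simps)
    then show ?thesis .
  qed
  also have "\<dots> = (sin (real (Suc l) * x))\<^sup>2 - (sin (real l * x))\<^sup>2"
    by (simp only: cos_squared_eq) (simp add: algebra_simps)
  finally have "(sin x)\<^sup>2 * (1 + 2 * (\<Sum>i=1..l. cos (2 * real i * x))) = (sin (real (Suc l) * x))\<^sup>2 - (sin (real l * x))\<^sup>2"
    using dirichlet_kernel[of x l] by (simp only: power2_eq_square[of "sin x"] mult.assoc)
  then show ?case using Suc unfolding fejer_def sum.lessThan_Suc distrib_left by linarith
qed (simp add: fejer_def)

lemma has_integral_fejer: "(fejer l has_integral (real l * (pi / 2))) {0..pi/2}"
proof -
  have "(fejer l has_integral (\<Sum>j<l. pi / 2 + 2 * (\<Sum>i=1..j. 0))) {0..pi/2}"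
    unfolding fejer_def using has_integral_const_real[of "1::real" 0 "pi/2"]
    by (intro has_integral_sum has_integral_add has_integral_mult_right has_integral_cos_multiple) auto
  then show ?thesis by simp
qed

text \<open>The factor of \<open>sqrt n\<close> in the mean hook count, read off from the cosine
  coefficients of \<open>- 2 sin x / pi\<close>.\<close>

definition hook_limit :: "nat \<Rightarrow> real" where
  "hook_limit l = 32 / pi\<^sup>2 * ((real l)\<^sup>2 / (4 * (real l)\<^sup>2 - 1))"

text \<open>\<open>sin^2 (l x)\<close> is half of \<open>1 - cos (2 l x)\<close>. The constant
  contributes nothing for \<open>hook_cos\<close>, which has mean zero, so the integral isolates the
  coefficient at \<open>l\<close>.\<close>

lemma has_integral_fejer_hook_err:
  assumes l: "l > 0" "l \<le> 2 * n"
  shows "((\<lambda>x. (sin (real l * x))\<^sup>2 * (hook_cos n x + 2 * sqrt (real n) / pi * sin x)) has_integral (- (pi / 8) * (mean_hooks n l - hook_limit l * sqrt (real n)))) {0..pi/2}"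
proof -
  have sq: "(sin (real l * x))\<^sup>2 = (1 - cos (2 * real l * x)) / 2" for x
    using cos_double_sin[of "real l * x"] by (simp add: mult.assoc)
  have 1: "((\<lambda>x. cos (2 * real l * x) * hook_cos n x) has_integral (pi / 4 * mean_hooks n l)) {0..pi/2}"
  proof -
    have "((\<lambda>x. \<Sum>m=1..2*n. mean_hooks n m * (cos (2 * real l * x) * cos (2 * real m * x))) has_integral (\<Sum>m=1..2*n. mean_hooks n m * (if l = m then pi / 4 else 0))) {0..pi/2}"
      by (intro has_integral_sum has_integral_mult_right has_integral_cos_cos_multiple) (use l in auto)
    moreover have "(\<Sum>m=1..2*n. mean_hooks n m * (if l = m then pi / 4 else 0)) = pi / 4 * mean_hooks n l"
      using l by (simp add: if_distrib[of "\<lambda>x. _ * x"] sum.delta' cong: if_cong)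
    ultimately show ?thesis unfolding hook_cos_def sum_distrib_left by (simp only: mult.left_commute)
  qed
  have 0: "(hook_cos n has_integral 0) {0..pi/2}"
  proof -
    have "(hook_cos n has_integral (\<Sum>m=1..2*n. mean_hooks n m * 0)) {0..pi/2}"
      unfolding hook_cos_def by (intro has_integral_sum has_integral_mult_right has_integral_cos_multiple) auto
    then show ?thesis by simp
  qed
  have "(sin has_integral 1) {0..pi/2}" using has_integral_sin_odd_multiple[of 0] by simp
  then have "((\<lambda>x. (hook_cos n x - cos (2 * real l * x) * hook_cos n x) / 2 + 2 * sqrt (real n) / pi * ((sin x - sin x * cos (2 * real l * x)) / 2)) has_integral 
     ((0 - pi / 4 * mean_hooks n l) / 2 + 2 * sqrt (real n) / pi * ((1 - (- 1 / (4 * (real l)\<^sup>2 - 1))) / 2))) {0..pi/2}"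
    by (intro has_integral_add has_integral_divide has_integral_mult_right has_integral_diff 0 1 has_integral_sin_cos_multiple l)
  moreover have "(0 - pi / 4 * mean_hooks n l) / 2 + 2 * sqrt (real n) / pi * ((1 - (- 1 / (4 * (real l)\<^sup>2 - 1))) / 2) = - (pi / 8) * (mean_hooks n l - hook_limit l * sqrt (real n))"
  proof -
    have "1 \<le> (real l)\<^sup>2" using l by (simp add: Suc_leI)
    then have "4 * (real l)\<^sup>2 - 1 > 0" by linarith
    moreover have "(0 - p / 4 * M) / 2 + 2 * r / p * ((1 - (- 1 / (4 * L - 1))) / 2) = - (p / 8) * (M - 32 / p\<^sup>2 * (L / (4 * L - 1)) * r)"
      if "4 * L - 1 > 0" "p > 0" for p M r L :: real
    proof -
      have "1 - (- 1 / (4 * L - 1)) = 4 * L / (4 * L - 1)" using that by (simp add: divide_simps)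
      then show ?thesis using that by (simp add: divide_simps power2_eq_square) (simp add: algebra_simps)
    qed
    ultimately show ?thesis unfolding hook_limit_def by simp
  qed
  moreover have "(hook_cos n x - cos (2 * real l * x) * hook_cos n x) / 2 + 2 * sqrt (real n) / pi * ((sin x - sin x * cos (2 * real l * x)) / 2) = (sin (real l * x))\<^sup>2 * (hook_cos n x + 2 * sqrt (real n) / pi * sin x)" for x
    unfolding sq by (simp add: algebra_simps diff_divide_distrib add_divide_distrib)
  ultimately show ?thesis by (simp only:)
qed

lemma fejer_hook_err:
  assumes "x \<in> {0..pi/2}"
  shows "(sin (real l * x))\<^sup>2 * (hook_cos n x + 2 * sqrt (real n) / pi * sin x) = (if x = 0 then 0 else fejer l x * hook_err n x)"
  unfolding fejer_kernel[symmetric] hook_err_def by simp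

lemma fejer_nonneg: "x \<in> {0..pi/2} \<Longrightarrow> 0 \<le> fejer l x"
proof (cases "x = 0")
  case False
  assume "x \<in> {0..pi/2}"
  then have "(sin x)\<^sup>2 > 0" using False sin_gt_zero[of x] by simp
  moreover have "0 \<le> (sin x)\<^sup>2 * fejer l x" unfolding fejer_kernel by simp
  ultimately show ?thesis by (simp add: zero_le_mult_iff)
qed (simp add: fejer_def sum_nonneg)

text \<open>The integrand is \<open>fejer l x * hook_err n x\<close>. A uniform bound on
  \<open>hook_err\<close> and the mass \<open>l * pi / 2\<close> of the kernel give the error
  \<open>O(l)\<close>; the constant limit \<open>1 / 8\<close> gives \<open>l * pi / 16\<close>,
  hence \<open>- l / 2\<close> after division by \<open>- pi / 8\<close>.\<close>

lemma mean_hooks_asymp: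
  assumes l: "l > 0"
  shows "\<exists>B. \<forall>n l. 0 < l \<longrightarrow> l \<le> 2 * n \<longrightarrow> \<bar>mean_hooks n l - hook_limit l * sqrt (real n)\<bar> \<le> B * real l"
    "(\<lambda>n. mean_hooks n l - hook_limit l * sqrt (real n)) \<longlonglongrightarrow> - real l / 2"
proof -
  define B where "B = (11 + 32 * exp 16 + pi * (1 + 2 * exp 16)) / (4 * pi)"
  let ?G = "\<lambda>l n x. (sin (real l * x))\<^sup>2 * (hook_cos n x + 2 * sqrt (real n) / pi * sin x)"
  have B0: "B \<ge> 0" by (simp add: B_def)
  have b: "norm (?G l n x) \<le> B * fejer l x" if "x \<in> {0..pi/2}" for l n x
  proof (cases "x = 0")
    case False
    then have "sin x > 0" using that by (intro sin_gt_zero) auto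
    then have "\<bar>hook_err n x\<bar> * fejer l x \<le> B * fejer l x"
      unfolding B_def by (intro mult_right_mono hook_err_asymp(2) fejer_nonneg that)
    then show ?thesis unfolding fejer_hook_err[OF that] using False fejer_nonneg[OF that, of l]
      by (simp add: abs_mult mult.commute)
  qed (use B0 fejer_nonneg that in auto)
  have i: "(\<lambda>x. B * fejer l x) integrable_on {0..pi/2}" for l
    using has_integral_mult_right[OF has_integral_fejer, of B l] by blast
  have g: "?G l n integrable_on {0..pi/2}" for l n
    unfolding hook_cos_def by (intro integrable_continuous_real continuous_intros) auto
  have "\<bar>mean_hooks n l - hook_limit l * sqrt (real n)\<bar> \<le> 4 * B * real l" if "0 < l" "l \<le> 2 * n" for n l
  proof -
    have "norm (integral {0..pi/2} (?G l n)) \<le> integral {0..pi/2} (\<lambda>x. B * fejer l x)"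
      by (rule integral_norm_bound_integral[OF g i b])
    also have "\<dots> = B * (real l * (pi / 2))" by (rule integral_unique[OF has_integral_mult_right[OF has_integral_fejer]])
    finally have "\<bar>pi / 8 * (mean_hooks n l - hook_limit l * sqrt (real n))\<bar> \<le> B * (real l * (pi / 2))"
      unfolding integral_unique[OF has_integral_fejer_hook_err[OF that]] by (simp only: real_norm_def mult_minus_left abs_minus_cancel)
    then have "pi / 8 * \<bar>mean_hooks n l - hook_limit l * sqrt (real n)\<bar> \<le> pi / 8 * (4 * B * real l)" by (simp add: abs_mult)
    then show ?thesis by (subst (asm) mult_le_cancel_left_pos) auto
  qed
  then show "\<exists>B. \<forall>n l. 0 < l \<longrightarrow> l \<le> 2 * n \<longrightarrow> \<bar>mean_hooks n l - hook_limit l * sqrt (real n)\<bar> \<le> B * real l" by blast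
  have "(\<lambda>n. integral {0..pi/2} (?G l n)) \<longlonglongrightarrow> integral {0..pi/2} (\<lambda>x. if x = 0 then 0 else fejer l x * (1 / 8))"
  proof (rule dominated_convergence(2)[OF g i b])
    fix x assume x: "x \<in> {0..pi/2}"
    show "(\<lambda>n. ?G l n x) \<longlonglongrightarrow> (if x = 0 then 0 else fejer l x * (1 / 8))"
    proof (cases "x = 0")
      case False
      then have "sin x > 0" using x by (intro sin_gt_zero) auto
      then have "(\<lambda>n. fejer l x * hook_err n x) \<longlonglongrightarrow> fejer l x * (1 / 8)"
        by (intro tendsto_intros hook_err_asymp)
      then show ?thesis unfolding fejer_hook_err[OF x] using False by simp
    qed simp
  qed
  also have "integral {0..pi/2} (\<lambda>x. if x = 0 then 0 else fejer l x * (1 / 8)) = integral {0..pi/2} (\<lambda>x. fejer l x * (1 / 8))"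
    by (rule integral_spike[of "{0}"]) auto
  also have "\<dots> = real l * (pi / 2) * (1 / 8)" by (rule integral_unique[OF has_integral_mult_left[OF has_integral_fejer]])
  finally have "(\<lambda>n. integral {0..pi/2} (?G l n)) \<longlonglongrightarrow> real l * (pi / 2) * (1 / 8)" .
  moreover have "eventually (\<lambda>n. integral {0..pi/2} (?G l n) = - (pi / 8) * (mean_hooks n l - hook_limit l * sqrt (real n))) sequentially"
    using eventually_ge_at_top[of l] by eventually_elim (rule integral_unique[OF has_integral_fejer_hook_err], use l in auto)
  ultimately have "(\<lambda>n. - (pi / 8) * (mean_hooks n l - hook_limit l * sqrt (real n))) \<longlonglongrightarrow> real l * (pi / 2) * (1 / 8)"
    by (simp add: tendsto_cong)
  from tendsto_mult[OF tendsto_const[of "- (8 / pi)"] this]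
  have "(\<lambda>n. - (8 / pi) * (- (pi / 8) * (mean_hooks n l - hook_limit l * sqrt (real n)))) \<longlonglongrightarrow> - (8 / pi) * (real l * (pi / 2) * (1 / 8))" .
  moreover have "- (8 / pi) * (- (pi / 8) * X) = X" for X by simp
  moreover have "- (8 / pi) * (real l * (pi / 2) * (1 / 8)) = - real l / 2" by simp
  ultimately show "(\<lambda>n. mean_hooks n l - hook_limit l * sqrt (real n)) \<longlonglongrightarrow> - real l / 2" by (simp only:)
qed

section \<open>Harmonic numbers and the two series\<close>

text \<open>The remainder of \<open>harm l\<close> after the Euler--Maclaurin terms up to
  \<open>l^-2\<close>; \<open>eta_summand l\<close> is \<open>l * harm_eps l\<close>.\<close>

definition harm_eps :: "nat \<Rightarrow> real" where
  "harm_eps l = harm l - ln (real l) - euler_mascheroni - 1 / (2 * real l) + 1 / (12 * (real l)\<^sup>2)"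

text \<open>Compares \<open>odd_harm\<close> with \<open>harm\<close>. No logarithm of
  \<open>l\<close> occurs, so consecutive differences are rational and the sums against it have
  closed forms.\<close>

definition odd_kap :: "nat \<Rightarrow> real" where
  "odd_kap l = odd_harm l - harm l - 2 * ln 2 + 1 / (2 * real l)"

text \<open>The part of \<open>ln l\<close> not covered by exact hook sums; the coefficient
  \<open>1 / 6\<close> cancels its term of order \<open>l^-2\<close>.\<close>

definition hook_rho :: "nat \<Rightarrow> real" where
  "hook_rho l = ln (real l) - odd_harm l + euler_mascheroni + 2 * ln 2 + 1 / (6 * (4 * (real l)\<^sup>2 - 1))"

definition hook_weight :: "nat \<Rightarrow> real" where
  "hook_weight l = (real l)\<^sup>2 / (4 * (real l)\<^sup>2 - 1)"

text \<open>\<open>f - g\<close> is nondecreasing from \<open>N\<close> on and tends to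
  \<open>0\<close>, hence is not positive there.\<close>

lemma tail_le_of_diff:
  fixes f g :: "nat \<Rightarrow> real"
  assumes "f \<longlonglongrightarrow> 0" "g \<longlonglongrightarrow> 0" and d: "\<And>l. l \<ge> N \<Longrightarrow> f l - f (Suc l) \<le> g l - g (Suc l)" and l: "l \<ge> N"
  shows "f l \<le> g l"
proof -
  have "(\<lambda>k. (f (k + l) - g (k + l))) \<longlonglongrightarrow> 0 - 0"
    by (intro tendsto_diff LIMSEQ_ignore_initial_segment assms(1,2))
  moreover have "incseq (\<lambda>k. f (k + l) - g (k + l))"
  proof (rule incseq_SucI)
    fix k
    show "f (k + l) - g (k + l) \<le> f (Suc k + l) - g (Suc k + l)" using d[of "k + l"] l by simp
  qed
  ultimately have "f (0 + l) - g (0 + l) \<le> 0" using incseq_le[of "\<lambda>k. f (k + l) - g (k + l)" 0 0] by simp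
  then show ?thesis by simp
qed

lemma tail_bound_of_diff:
  fixes f s :: "nat \<Rightarrow> real"
  assumes "f \<longlonglongrightarrow> 0" "s \<longlonglongrightarrow> 0" and d: "\<And>l. l \<ge> N \<Longrightarrow> \<bar>f l - f (Suc l)\<bar> \<le> s l - s (Suc l)" and l: "l \<ge> N"
  shows "\<bar>f l\<bar> \<le> s l"
proof -
  have "f l \<le> s l" by (rule tail_le_of_diff[OF assms(1,2) _ l]) (use d in \<open>auto simp: abs_le_iff\<close>)
  moreover have "- f l \<le> s l"
    by (rule tail_le_of_diff[OF _ assms(2) _ l]) (use tendsto_minus[OF assms(1)] d in \<open>force simp: abs_le_iff\<close>)+
  ultimately show ?thesis by linarith
qed

text \<open>An equivalence, because both directions occur: evaluating series whose differences are
  rational, and passing from the given series to series in \<open>ln (1 + 1 / l)\<close>.\<close>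

lemma abel_sums:
  fixes B w f :: "nat \<Rightarrow> real"
  assumes B: "B 0 = 0" "\<And>k. B (Suc k) = B k + w (Suc k)" and c: "(\<lambda>M. B M * f (Suc M)) \<longlonglongrightarrow> c"
  shows "(\<lambda>k. w (Suc k) * f (Suc k)) sums (c + S) \<longleftrightarrow> (\<lambda>k. B (Suc k) * (f (Suc k) - f (Suc (Suc k)))) sums S"
proof -
  have e: "(\<Sum>k<M. w (Suc k) * f (Suc k)) = B M * f (Suc M) + (\<Sum>k<M. B (Suc k) * (f (Suc k) - f (Suc (Suc k))))" for M
    by (induction M) (simp_all add: B algebra_simps)
  show ?thesis
  proof
    assume "(\<lambda>k. w (Suc k) * f (Suc k)) sums (c + S)"
    then have "(\<lambda>M. (\<Sum>k<M. w (Suc k) * f (Suc k)) - B M * f (Suc M)) \<longlonglongrightarrow> (c + S) - c"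
      unfolding sums_def by (intro tendsto_diff c)
    then show "(\<lambda>k. B (Suc k) * (f (Suc k) - f (Suc (Suc k)))) sums S" unfolding sums_def e by simp
  next
    assume "(\<lambda>k. B (Suc k) * (f (Suc k) - f (Suc (Suc k)))) sums S"
    then show "(\<lambda>k. w (Suc k) * f (Suc k)) sums (c + S)"
      unfolding sums_def e by (intro tendsto_add c)
  qed
qed

lemma harm_eps_diff:
  assumes "l > 0"
  shows "harm_eps l - harm_eps (Suc l) = ln (1 + 1 / real l) - (1 / real l + 1 / (real l + 1)) / 2 + (1 / (real l)\<^sup>2 - 1 / (real l + 1)\<^sup>2) / 12"
proof -
  have "1 + 1 / real l = (real l + 1) / real l" using assms by (simp add: field_simps)
  then have "ln (1 + 1 / real l) = ln (real l + 1) - ln (real l)" using assms by (simp add: ln_div)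
  moreover have "harm (Suc l) = (harm l + 1 / (real l + 1) :: real)" by (simp add: harm_Suc inverse_eq_divide add_ac)
  moreover have s: "real (Suc l) = real l + 1" by simp
  moreover have "1 / (2 * real l) = 1 / real l / 2" "1 / (2 * (real l + 1)) = 1 / (real l + 1) / 2"
    "1 / (12 * (real l)\<^sup>2) = 1 / (real l)\<^sup>2 / 12" "1 / (12 * (real l + 1)\<^sup>2) = 1 / (real l + 1)\<^sup>2 / 12" by simp_all
  moreover have "h - u - g - p / 2 + q / 12 - (h + p' - u' - g - p' / 2 + q' / 12) = u' - u - (p + p') / 2 + (q - q') / 12"
    for h u g p q u' p' q' :: real by (simp add: field_simps)
  ultimately show ?thesis unfolding harm_eps_def s by (simp only:)
qed

lemma harm_eps_tendsto: "harm_eps \<longlonglongrightarrow> 0"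
proof -
  have "(\<lambda>n. - 1 / (2 * real n) + 1 / (12 * (real n)\<^sup>2)) \<longlonglongrightarrow> 0" by real_asymp
  from tendsto_add[OF tendsto_diff[OF euler_mascheroni_LIMSEQ tendsto_const[of euler_mascheroni]] this]
  show ?thesis unfolding harm_eps_def by (simp add: algebra_simps)
qed

lemma harm_eps_bound: "eventually (\<lambda>l. \<bar>harm_eps l\<bar> \<le> 1 / real l ^ 3) sequentially"
proof -
  have "eventually (\<lambda>l::nat. \<bar>ln (1 + 1 / real l) - (1 / real l + 1 / (real l + 1)) / 2 + (1 / (real l)\<^sup>2 - 1 / (real l + 1)\<^sup>2) / 12\<bar> \<le> 1 / real l ^ 3 - 1 / (real l + 1) ^ 3) sequentially"
    by real_asymp
  then have "eventually (\<lambda>l. \<bar>harm_eps l - harm_eps (Suc l)\<bar> \<le> 1 / real l ^ 3 - 1 / real (Suc l) ^ 3) sequentially"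
    using eventually_gt_at_top[of 0] by eventually_elim (simp add: harm_eps_diff add_ac)
  then obtain N where N: "\<And>l. l \<ge> N \<Longrightarrow> \<bar>harm_eps l - harm_eps (Suc l)\<bar> \<le> 1 / real l ^ 3 - 1 / real (Suc l) ^ 3"
    by (auto simp: eventually_sequentially)
  have "(\<lambda>l. 1 / real l ^ 3) \<longlonglongrightarrow> 0" by real_asymp
  from tail_bound_of_diff[OF harm_eps_tendsto this N] show ?thesis
    by (auto simp: eventually_sequentially)
qed

lemma odd_harm_eq: "odd_harm l = 2 * harm (2 * l) - harm l"
proof (induction l)
  case (Suc l)
  have "harm (2 * Suc l) = harm (2 * l) + 1 / (2 * real l + 1) + 1 / (2 * real l + 2)"
    by (simp add: harm_Suc inverse_eq_divide add_ac)
  moreover have "1 / (real l + 1) = 2 * (1 / (2 * real l + 2))" by (simp add: field_simps)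
  ultimately show ?case using Suc by (simp add: odd_harm_def harm_Suc inverse_eq_divide add_ac)
qed (simp add: odd_harm_def harm_def)

lemma odd_kap_eq:
  assumes "l > 0" shows "odd_kap l = 2 * harm_eps (2 * l) - 2 * harm_eps l + 1 / (8 * (real l)\<^sup>2)"
proof -
  have "ln (2 * real l) = ln 2 + ln (real l)" using assms by (simp add: ln_mult)
  then show ?thesis unfolding odd_kap_def odd_harm_eq harm_eps_def
    by (simp add: power_mult_distrib add_divide_distrib diff_divide_distrib algebra_simps)
qed

lemma harm_eps_cube: "(\<lambda>l. (real l)\<^sup>2 * harm_eps l) \<longlonglongrightarrow> 0"
proof (rule Lim_null_comparison)
  show "eventually (\<lambda>l. norm ((real l)\<^sup>2 * harm_eps l) \<le> 1 / real l) sequentially"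
    using harm_eps_bound eventually_gt_at_top[of 0]
  proof eventually_elim
    case (elim l)
    have "(real l)\<^sup>2 * \<bar>harm_eps l\<bar> \<le> (real l)\<^sup>2 * (1 / real l ^ 3)" using elim by (intro mult_left_mono) auto
    also have "\<dots> = 1 / real l" using elim by (simp add: power2_eq_square power3_eq_cube)
    finally show ?case by (simp add: abs_mult)
  qed
  show "(\<lambda>l. 1 / real l) \<longlonglongrightarrow> 0" by real_asymp
qed

lemma odd_kap_sq: "(\<lambda>l. (real l)\<^sup>2 * odd_kap l) \<longlonglongrightarrow> 1 / 8"
proof -
  have 2: "(\<lambda>l. (real (2 * l))\<^sup>2 * harm_eps (2 * l)) \<longlonglongrightarrow> 0"
    using LIMSEQ_subseq_LIMSEQ[OF harm_eps_cube, of "\<lambda>l. 2 * l"] by (simp add: strict_mono_def comp_def)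
  have "(\<lambda>l. (real (2 * l))\<^sup>2 * harm_eps (2 * l) / 2 - 2 * ((real l)\<^sup>2 * harm_eps l) + 1 / 8) \<longlonglongrightarrow> 0 / 2 - 2 * 0 + 1 / 8"
    by (intro tendsto_intros 2 harm_eps_cube) simp
  moreover have "eventually (\<lambda>l. (real (2 * l))\<^sup>2 * harm_eps (2 * l) / 2 - 2 * ((real l)\<^sup>2 * harm_eps l) + 1 / 8 = (real l)\<^sup>2 * odd_kap l) sequentially"
    using eventually_gt_at_top[of 0]
    by eventually_elim (simp add: odd_kap_eq power_mult_distrib algebra_simps)
  ultimately show ?thesis by (simp add: tendsto_cong)
qed

text \<open>The factor \<open>2 l + 1\<close> in the denominator is what makes the weighted sum a
  series over odd squares.\<close>

lemma odd_kap_diff: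
  assumes "l > 0" shows "odd_kap l - odd_kap (Suc l) = 1 / (2 * real l * (real l + 1) * (2 * real l + 1))"
proof -
  have "odd_kap l - odd_kap (Suc l) = - 2 / (2 * real l + 1) + 1 / (real l + 1) + 1 / (2 * real l) - 1 / (2 * (real l + 1))"
    by (simp add: odd_kap_def odd_harm_def harm_Suc inverse_eq_divide add_ac)
  also have "\<dots> = 1 / (2 * real l * (real l + 1) * (2 * real l + 1))"
  proof -
    have "- 2 / (2 * t + 1) + 1 / (t + 1) + 1 / (2 * t) - 1 / (2 * (t + 1)) = 1 / (2 * t * (t + 1) * (2 * t + 1))" if "t > 0" for t :: real
      using that by (simp add: divide_simps) (simp add: algebra_simps)
    then show ?thesis using assms by simp
  qed
  finally show ?thesis .
qed

lemma quadratic_pos: "l > 0 \<Longrightarrow> 0 < 4 * (real l)\<^sup>2 - 1"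
proof -
  assume "l > 0"
  then have "1 \<le> (real l)\<^sup>2" by (simp add: Suc_leI)
  then show ?thesis by linarith
qed

lemma hook_rho_eq:
  assumes "l > 0" shows "hook_rho l = - harm_eps l - odd_kap l + 1 / (12 * (real l)\<^sup>2) + 1 / (6 * (4 * (real l)\<^sup>2 - 1))"
  unfolding hook_rho_def harm_eps_def odd_kap_def by simp

text \<open>In terms of \<open>harm_eps\<close> the explicit terms of order \<open>l^-2\<close> have
  the coefficients \<open>- 1 / 8\<close>, \<open>1 / 12\<close> and \<open>1 / 24\<close>, whose
  sum is zero.\<close>

lemma hook_rho_bound: "eventually (\<lambda>l. \<bar>hook_rho l\<bar> \<le> 2 / real l ^ 3) sequentially"
proof -
  have b2: "eventually (\<lambda>l. \<bar>harm_eps (2 * l)\<bar> \<le> 1 / real (2 * l) ^ 3) sequentially"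
    by (rule eventually_compose_filterlim[OF harm_eps_bound]) (intro filterlim_subseq, simp add: strict_mono_def)
  have "eventually (\<lambda>l::nat. - (1 / (8 * (real l)\<^sup>2)) + 1 / (12 * (real l)\<^sup>2) + 1 / (6 * (4 * (real l)\<^sup>2 - 1)) \<le> 1 / 2 * (1 / real l ^ 3)) sequentially"
    "eventually (\<lambda>l::nat. - (1 / (8 * (real l)\<^sup>2)) + 1 / (12 * (real l)\<^sup>2) + 1 / (6 * (4 * (real l)\<^sup>2 - 1)) \<ge> - (1 / 2 * (1 / real l ^ 3))) sequentially"
    by real_asymp+
  with harm_eps_bound b2 eventually_gt_at_top[of 0] show ?thesis
  proof eventually_elim
    case (elim l)
    have "1 / real (2 * l) ^ 3 = 1 / 8 * (1 / real l ^ 3)" by (simp add: power_mult_distrib)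
    moreover have "hook_rho l = harm_eps l - 2 * harm_eps (2 * l) + (- (1 / (8 * (real l)\<^sup>2)) + 1 / (12 * (real l)\<^sup>2) + 1 / (6 * (4 * (real l)\<^sup>2 - 1)))"
      using elim by (simp add: hook_rho_eq odd_kap_eq)
    moreover have "2 / real l ^ 3 = 2 * (1 / real l ^ 3)" by simp
    moreover have "0 \<le> 1 / real l ^ 3" by simp
    ultimately show ?case using elim by linarith
  qed
qed

lemma summable_cubic_weight:
  assumes "eventually (\<lambda>l. \<bar>f l\<bar> \<le> 2 / real l ^ 3) sequentially"
  shows "summable (\<lambda>k. real (Suc k) * \<bar>f (Suc k)\<bar>)"
proof (rule summable_comparison_test_ev)
  have "eventually (\<lambda>k. \<bar>f (Suc k)\<bar> \<le> 2 / real (Suc k) ^ 3) sequentially"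
    using assms eventually_sequentially_Suc[of "\<lambda>l. \<bar>f l\<bar> \<le> 2 / real l ^ 3"] by simp
  then show "eventually (\<lambda>k. norm (real (Suc k) * \<bar>f (Suc k)\<bar>) \<le> 2 * (1 / real (k + 1) ^ 2)) sequentially"
  proof eventually_elim
    case (elim k)
    have "real (Suc k) * \<bar>f (Suc k)\<bar> \<le> real (Suc k) * (2 / real (Suc k) ^ 3)" using elim by (intro mult_left_mono) auto
    also have "\<dots> = 2 * (1 / real (Suc k) ^ 2)" by (simp add: power2_eq_square power3_eq_cube del: of_nat_Suc)
    finally show ?case by (simp add: abs_mult)
  qed
  show "summable (\<lambda>k. 2 * (1 / real (k + 1) ^ 2))"
    using inverse_squares_sums by (intro summable_mult) (auto simp: sums_iff add_ac)
qed

lemma odd_squares_sums: "(\<lambda>k. 1 / (2 * real k + 3)\<^sup>2) sums (pi\<^sup>2 / 8 - 1)"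
proof -
  let ?f = "\<lambda>n. 1 / (real n + 1)\<^sup>2"
  have s: "?f sums (pi\<^sup>2 / 6)" using inverse_squares_sums by (simp add: add_ac)
  have "(\<lambda>n. sum ?f {n * 2..<n * 2 + 2}) sums (pi\<^sup>2 / 6)" by (rule sums_group[OF s]) simp
  moreover have "sum ?f {n * 2..<n * 2 + 2} = 1 / (2 * real n + 1)\<^sup>2 + 1 / 4 * ?f n" for n
  proof -
    have "{n * 2..<n * 2 + 2} = {2 * n, 2 * n + 1}" by auto
    moreover have "1 / (2 * real n + 2)\<^sup>2 = 1 / 4 * ?f n"
    proof -
      have "2 * real n + 2 = 2 * (real n + 1)" by simp
      then show ?thesis by (simp only: power_mult_distrib) simp
    qed
    ultimately show ?thesis by (simp add: add_ac)
  qed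
  ultimately have "(\<lambda>n. 1 / (2 * real n + 1)\<^sup>2 + 1 / 4 * ?f n) sums (pi\<^sup>2 / 6)" by simp
  from sums_diff[OF this sums_mult[OF s, of "1 / 4"]]
  have "(\<lambda>n. 1 / (2 * real n + 1)\<^sup>2) sums (pi\<^sup>2 / 8)" by simp
  with sums_Suc_iff[of "\<lambda>n. 1 / (2 * real n + 1)\<^sup>2" "pi\<^sup>2 / 8 - 1"]
  show ?thesis by (simp add: add_ac)
qed

text \<open>The partial sums of \<open>hook_weight\<close> in closed form, as needed for Abel
  summation.\<close>

definition hook_beta :: "nat \<Rightarrow> real" where
  "hook_beta l = real l * (real l + 1) / (2 * (2 * real l + 1))"

lemma hook_beta_rec: "hook_beta 0 = 0" "hook_beta (Suc k) = hook_beta k + hook_weight (Suc k)"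
proof -
  have "(t + 1) * (t + 1 + 1) / (2 * (2 * (t + 1) + 1)) = t * (t + 1) / (2 * (2 * t + 1)) + (t + 1)\<^sup>2 / (4 * (t + 1)\<^sup>2 - 1)" if "t \<ge> 0" for t :: real
  proof -
    have "4 * (t + 1)\<^sup>2 - 1 = (2 * t + 1) * (2 * t + 3)" by (simp add: power2_eq_square algebra_simps)
    then show ?thesis using that by (simp add: divide_simps) (simp add: power2_eq_square algebra_simps)
  qed
  from this[of "real k"] show "hook_beta (Suc k) = hook_beta k + hook_weight (Suc k)"
    by (simp add: hook_beta_def hook_weight_def add_ac)
qed (simp add: hook_beta_def)

lemma hook_beta_tendsto:
  assumes "(\<lambda>l. (real l)\<^sup>2 * f l) \<longlonglongrightarrow> c"
  shows "(\<lambda>M. hook_beta M * f (Suc M)) \<longlonglongrightarrow> 0"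
proof -
  have "(\<lambda>M. (real (Suc M))\<^sup>2 * f (Suc M)) \<longlonglongrightarrow> c" using assms by (rule LIMSEQ_Suc)
  moreover have "(\<lambda>M. hook_beta M / (real (Suc M))\<^sup>2) \<longlonglongrightarrow> 0" unfolding hook_beta_def of_nat_Suc by real_asymp
  ultimately have "(\<lambda>M. hook_beta M / (real (Suc M))\<^sup>2 * ((real (Suc M))\<^sup>2 * f (Suc M))) \<longlonglongrightarrow> 0 * c"
    by (intro tendsto_mult)
  then show ?thesis by (simp del: of_nat_Suc)
qed

text \<open>After Abel summation the product of \<open>hook_beta\<close> with the rational
  difference of \<open>odd_kap\<close> collapses to \<open>1 / (4 (2 l + 1)^2)\<close>.\<close>

lemma weighted_kap_sums: "(\<lambda>k. hook_weight (Suc k) * odd_kap (Suc k)) sums (pi\<^sup>2 / 32 - 1 / 4)"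
proof -
  have "(\<lambda>k. 1 / 4 * (1 / (2 * real k + 3)\<^sup>2)) sums (1 / 4 * (pi\<^sup>2 / 8 - 1))" by (intro sums_mult odd_squares_sums)
  moreover have "hook_beta (Suc k) * (odd_kap (Suc k) - odd_kap (Suc (Suc k))) = 1 / 4 * (1 / (2 * real k + 3)\<^sup>2)" for k
  proof -
    have "(t + 1) * (t + 2) / (2 * (2 * t + 3)) * (1 / (2 * (t + 1) * (t + 2) * (2 * t + 3))) = 1 / 4 * (1 / (2 * t + 3)\<^sup>2)" if "t \<ge> 0" for t :: real
      using that by (simp add: divide_simps) (simp add: power2_eq_square algebra_simps)
    from this[of "real k"] show ?thesis by (simp add: hook_beta_def odd_kap_diff add_ac)
  qed
  ultimately have "(\<lambda>k. hook_beta (Suc k) * (odd_kap (Suc k) - odd_kap (Suc (Suc k)))) sums (pi\<^sup>2 / 32 - 1 / 4)" by (simp add: diff_divide_distrib)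
  with abel_sums[of hook_beta hook_weight odd_kap 0 "pi\<^sup>2 / 32 - 1 / 4", OF hook_beta_rec hook_beta_tendsto[OF odd_kap_sq]]
  show ?thesis by simp
qed

text \<open>Partial fractions leave twice the series of inverse odd squares and two telescoping
  series.\<close>

lemma weighted_quadratic_sums: "(\<lambda>k. hook_weight (Suc k) / (4 * (real (Suc k))\<^sup>2 - 1)) sums (pi\<^sup>2 / 64)"
proof -
  have t: "(\<lambda>k. 1 / (2 * real k + 1) - 1 / (2 * real (Suc k) + 1)) sums (1 / (2 * real 0 + 1) - 0)"
    by (rule telescope_sums') real_asymp
  have q: "(\<lambda>k. 1 / (2 * real k + 1)\<^sup>2 - 1 / (2 * real (Suc k) + 1)\<^sup>2) sums (1 / (2 * real 0 + 1)\<^sup>2 - 0)"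
    by (rule telescope_sums') real_asymp
  have "(\<lambda>k. (1 / 16) * (2 * (1 / (2 * real k + 3)\<^sup>2) + (1 / (2 * real k + 1) - 1 / (2 * real (Suc k) + 1)) + (1 / (2 * real k + 1)\<^sup>2 - 1 / (2 * real (Suc k) + 1)\<^sup>2)))
    sums ((1 / 16) * (2 * (pi\<^sup>2 / 8 - 1) + (1 / (2 * real 0 + 1) - 0) + (1 / (2 * real 0 + 1)\<^sup>2 - 0)))"
    by (intro sums_mult sums_add odd_squares_sums t q)
  moreover have "(1 / 16) * (2 * (1 / (2 * real k + 3)\<^sup>2) + (1 / (2 * real k + 1) - 1 / (2 * real (Suc k) + 1)) + (1 / (2 * real k + 1)\<^sup>2 - 1 / (2 * real (Suc k) + 1)\<^sup>2)) = 
     hook_weight (Suc k) / (4 * (real (Suc k))\<^sup>2 - 1)" for k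
  proof -
    have "(1 / 16) * (2 * (1 / (2 * t + 3)\<^sup>2) + (1 / (2 * t + 1) - 1 / (2 * t + 3)) + (1 / (2 * t + 1)\<^sup>2 - 1 / (2 * t + 3)\<^sup>2)) = (t + 1)\<^sup>2 / ((2 * t + 1) * (2 * t + 3)) / ((2 * t + 1) * (2 * t + 3))" if "t \<ge> 0" for t :: real
      using that by (simp add: divide_simps) (simp add: power2_eq_square algebra_simps)
    moreover have "4 * (real (Suc k))\<^sup>2 - 1 = (2 * real k + 1) * (2 * real k + 3)" by (simp add: power2_eq_square algebra_simps)
    ultimately show ?thesis by (simp add: hook_weight_def add_ac)
  qed
  moreover have "(1 / 16) * (2 * (pi\<^sup>2 / 8 - 1) + (1 / (2 * real 0 + 1) - 0) + (1 / (2 * real 0 + 1)\<^sup>2 - 0)) = pi\<^sup>2 / 64" by simp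
  ultimately show ?thesis by (simp only:)
qed

text \<open>The partial sums are explicit. Their harmonic parts combine to a twelfth of
  \<open>odd_harm M - harm M\<close> up to vanishing terms, which gives \<open>ln 2 / 6\<close>; the
  rest is \<open>1 / 16 - 5 / 24\<close>.\<close>

lemma linear_kap_sums:
  "(\<lambda>k. real (Suc k) * (odd_kap (Suc k) - 1 / (12 * (real (Suc k))\<^sup>2) - 1 / (6 * (4 * (real (Suc k))\<^sup>2 - 1)))) sums (ln 2 / 6 - 7 / 48)"
proof -
  have e: "(\<Sum>k<M. real (Suc k) * (odd_kap (Suc k) - 1 / (12 * (real (Suc k))\<^sup>2) - 1 / (6 * (4 * (real (Suc k))\<^sup>2 - 1))))
     = real M * (real M + 1) / 2 * odd_kap (Suc M) + (odd_harm (Suc M) / 2 - 1) / 4 - harm M / 12 - (odd_harm M + odd_harm (Suc M) - 2) / 48" for M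
  proof (induction M)
    case 0
    then show ?case by (simp add: odd_harm_def harm_def)
  next
    case (Suc M)
    define t where "t = real M"
    have k: "odd_kap (Suc (Suc M)) = odd_kap (Suc M) - 1 / (2 * (t + 1) * (t + 2) * (2 * t + 3))"
      using odd_kap_diff[of "Suc M"] by (simp add: t_def add_ac)
    have o: "odd_harm (Suc M) = odd_harm M + 2 / (2 * t + 1)" "odd_harm (Suc (Suc M)) = odd_harm M + 2 / (2 * t + 1) + 2 / (2 * t + 3)"
      by (simp_all add: odd_harm_def t_def add_ac)
    have h: "harm (Suc M) = harm M + 1 / (t + 1)" by (simp add: harm_Suc inverse_eq_divide t_def add_ac)
    have q: "4 * (t + 1)\<^sup>2 - 1 = (2 * t + 1) * (2 * t + 3)" by (simp add: power2_eq_square algebra_simps)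
    have r: "real (Suc M) = t + 1" "real M = t" and r': "t + 1 + 1 = t + 2" by (simp_all add: t_def)
    have "t * (t + 1) / 2 * X + ((Z + 2 / (2 * t + 1)) / 2 - 1) / 4 - W / 12 - (Z + (Z + 2 / (2 * t + 1)) - 2) / 48 + (t + 1) * (X - 1 / (12 * (t + 1)\<^sup>2) - 1 / (6 * ((2 * t + 1) * (2 * t + 3))))
      = (t + 1) * (t + 2) / 2 * (X - 1 / (2 * (t + 1) * (t + 2) * (2 * t + 3))) + ((Z + 2 / (2 * t + 1) + 2 / (2 * t + 3)) / 2 - 1) / 4 - (W + 1 / (t + 1)) / 12 - ((Z + 2 / (2 * t + 1)) + (Z + 2 / (2 * t + 1) + 2 / (2 * t + 3)) - 2) / 48"
      if "t \<ge> 0" for X Z W :: real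
    proof -
      have 1: "(t + 1) * (t + 2) / 2 * (1 / (2 * (t + 1) * (t + 2) * (2 * t + 3))) = (1 / (2 * t + 3)) / 4"
        using that by (simp add: divide_simps) (simp add: algebra_simps)
      have 2: "(t + 1) * (1 / (12 * (t + 1)\<^sup>2)) = (1 / (t + 1)) / 12" using that by (simp add: power2_eq_square)
      have 3: "(t + 1) * (1 / (6 * ((2 * t + 1) * (2 * t + 3)))) = (1 / (2 * t + 1) + 1 / (2 * t + 3)) / 24"
        using that by (simp add: divide_simps) (simp add: algebra_simps)
      have gen: "Y + ((Z + 2 * a) / 2 - 1) / 4 - W / 12 - (Z + (Z + 2 * a) - 2) / 48 + (Y' - c / 12 - (a + b) / 24)
        = Y + Y' - b / 4 + ((Z + 2 * a + 2 * b) / 2 - 1) / 4 - (W + c) / 12 - ((Z + 2 * a) + (Z + 2 * a + 2 * b) - 2) / 48" for Y Y' a b c :: real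
        by (simp add: field_simps)
      have 4: "2 / (2 * t + 1) = 2 * (1 / (2 * t + 1))" "2 / (2 * t + 3) = 2 * (1 / (2 * t + 3))" by simp_all
      have 5: "(t + 1) * (t + 2) / 2 * X = t * (t + 1) / 2 * X + (t + 1) * X" by (simp add: algebra_simps)
      show ?thesis unfolding right_diff_distrib 1 2 3 4 5 by (rule gen)
    qed
    from this[of "odd_kap (Suc M)" "odd_harm M" "harm M"] show ?case
      unfolding sum.lessThan_Suc Suc k o h r unfolding q r' by (simp add: t_def)
  qed
  have "(\<lambda>M. (real M * (real M + 1) / (2 * (real (Suc M))\<^sup>2)) * ((real (Suc M))\<^sup>2 * odd_kap (Suc M))) \<longlonglongrightarrow> (1 / 2) * (1 / 8)"
  proof (intro tendsto_mult)
    show "(\<lambda>M. real M * (real M + 1) / (2 * (real (Suc M))\<^sup>2)) \<longlonglongrightarrow> 1 / 2" unfolding of_nat_Suc by real_asymp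
    show "(\<lambda>M. (real (Suc M))\<^sup>2 * odd_kap (Suc M)) \<longlonglongrightarrow> 1 / 8" by (rule LIMSEQ_Suc[OF odd_kap_sq])
  qed
  then have 1: "(\<lambda>M. real M * (real M + 1) / 2 * odd_kap (Suc M)) \<longlonglongrightarrow> 1 / 16" by (simp del: of_nat_Suc add: mult.assoc)
  have k0: "odd_kap \<longlonglongrightarrow> 0"
  proof -
    have "(\<lambda>l. 1 / (real l)\<^sup>2 * ((real l)\<^sup>2 * odd_kap l)) \<longlonglongrightarrow> 0 * (1 / 8)"
      by (intro tendsto_mult odd_kap_sq) real_asymp
    moreover have "eventually (\<lambda>l. 1 / (real l)\<^sup>2 * ((real l)\<^sup>2 * odd_kap l) = odd_kap l) sequentially"
      using eventually_gt_at_top[of 0] by eventually_elim simp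
    ultimately show ?thesis by (simp add: tendsto_cong)
  qed
  have 2: "(\<lambda>M. (odd_harm (Suc M) / 2 - 1) / 4 - harm M / 12 - (odd_harm M + odd_harm (Suc M) - 2) / 48) \<longlonglongrightarrow> ln 2 / 6 - 5 / 24"
  proof -
    have r: "(\<lambda>M. 5 / 24 * (1 / (2 * real M + 1)) - 1 / (24 * real M)) \<longlonglongrightarrow> 0" by real_asymp
    have "(\<lambda>M. (odd_kap M + 2 * ln 2) / 12 - 5 / 24 + (5 / 24 * (1 / (2 * real M + 1)) - 1 / (24 * real M))) \<longlonglongrightarrow> (0 + 2 * ln 2) / 12 - 5 / 24 + 0"
      by (intro tendsto_intros k0 r) simp
    moreover have "(odd_kap M + 2 * ln 2) / 12 - 5 / 24 + (5 / 24 * (1 / (2 * real M + 1)) - 1 / (24 * real M)) = (odd_harm (Suc M) / 2 - 1) / 4 - harm M / 12 - (odd_harm M + odd_harm (Suc M) - 2) / 48" for M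
    proof -
      have "odd_harm (Suc M) = odd_harm M + 2 * (1 / (2 * real M + 1))" by (simp add: odd_harm_def)
      moreover have "odd_kap M = odd_harm M - harm M - 2 * ln 2 + 12 * (1 / (24 * real M))" by (simp add: odd_kap_def)
      moreover have "(b - h - k + 12 * x + k) / 12 - 5 / 24 + (5 / 24 * y - x) = ((b + 2 * y) / 2 - 1) / 4 - h / 12 - (b + (b + 2 * y) - 2) / 48" for b h k x y :: real
        by (simp add: field_simps)
      ultimately show ?thesis by (simp only:)
    qed
    ultimately show ?thesis by simp
  qed
  have "(\<lambda>M. real M * (real M + 1) / 2 * odd_kap (Suc M) + ((odd_harm (Suc M) / 2 - 1) / 4 - harm M / 12 - (odd_harm M + odd_harm (Suc M) - 2) / 48)) \<longlonglongrightarrow> 1 / 16 + (ln 2 / 6 - 5 / 24)"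
    by (rule tendsto_add[OF 1 2])
  then show ?thesis unfolding sums_def e by (simp add: algebra_simps)
qed

section \<open>Stirling's formula and the expansion\<close>

text \<open>Summable increments give convergence. The constant follows from the combination
  \<open>2 z (2 n) - 4 z n\<close>, in which all but the central binomial coefficient cancels, so
  the Wallis bounds apply.\<close>

lemma stirling: "(\<lambda>n. ln (fact n) - (real n * ln (real n) - real n + ln (real n) / 2)) \<longlonglongrightarrow> ln (2 * pi) / 2"
proof -
  define z where "z n = ln (fact n) - (real n * ln (real n) - real n + ln (real n) / 2)" for n
  have diff: "z (Suc n) - z n = 1 - (real n + 1 / 2) * ln (1 + 1 / real n)" if "n > 0" for n
  proof -
    have "1 + 1 / real n = (real n + 1) / real n" using that by (simp add: field_simps)
    then have "ln (1 + 1 / real n) = ln (real n + 1) - ln (real n)" using that by (simp add: ln_div)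
    moreover have "ln (fact (Suc n) :: real) = ln (real n + 1) + ln (fact n)" by (simp add: ln_mult add_ac)
    moreover have "a + F - ((t + 1) * a - (t + 1) + a / 2) - (F - (t * b - t + b / 2)) = 1 - (t + 1 / 2) * (a - b)" for a b F t :: real
      by (simp add: field_simps)
    moreover have "real (Suc n) = real n + 1" by simp
    ultimately show ?thesis unfolding z_def by (simp only:)
  qed
  have "summable (\<lambda>n. z (Suc n) - z n)"
  proof (rule summable_comparison_test_ev)
    have "eventually (\<lambda>n::nat. \<bar>1 - (real n + 1 / 2) * ln (1 + 1 / real n)\<bar> \<le> 1 / (real n + 1)\<^sup>2) sequentially"
      by real_asymp
    then show "eventually (\<lambda>n. norm (z (Suc n) - z n) \<le> 1 / (real n + 1)\<^sup>2) sequentially"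
      using eventually_gt_at_top[of 0] by eventually_elim (simp add: diff)
    show "summable (\<lambda>n. 1 / (real n + 1)\<^sup>2)" using sums_summable[OF inverse_squares_sums] by (simp add: add_ac)
  qed
  then have "convergent (\<lambda>n. z n - z 0)" by (simp add: summable_iff_convergent sum_lessThan_telescope)
  then have "convergent z" using convergent_diff_const_right_iff[of z "z 0"] by simp
  then obtain c where c: "z \<longlonglongrightarrow> c" by (auto simp: convergent_def)
  have c2: "(\<lambda>n. z (2 * n)) \<longlonglongrightarrow> c"
    using LIMSEQ_subseq_LIMSEQ[OF c, of "\<lambda>l. 2 * l"] by (simp add: strict_mono_def comp_def)
  define w where "w n = real ((2 * n) choose n) / 4 ^ n" for n
  have w: "(\<lambda>n. real n * (w n)\<^sup>2) \<longlonglongrightarrow> 1 / pi"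
  proof (rule tendsto_sandwich)
    show "eventually (\<lambda>n. real n / (2 * real n + 1) * (2 / pi) \<le> real n * (w n)\<^sup>2) sequentially"
      using eventually_gt_at_top[of 0]
    proof eventually_elim
      case (elim n)
      have "2 / pi \<le> (2 * real n + 1) * (w n)\<^sup>2" using central_binomial_bounds(1)[OF elim] by (simp add: w_def)
      then have "real n / (2 * real n + 1) * (2 / pi) \<le> real n / (2 * real n + 1) * ((2 * real n + 1) * (w n)\<^sup>2)"
        by (intro mult_left_mono) auto
      also have "\<dots> = real n * (w n)\<^sup>2"
      proof -
        have "t / (2 * t + 1) * ((2 * t + 1) * W) = t * W" if "t > 0" for t W :: real using that by simp
        then show ?thesis using elim by simp
      qed
      finally show ?case .
    qed
    show "eventually (\<lambda>n. real n * (w n)\<^sup>2 \<le> 1 / pi) sequentially"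
      using eventually_gt_at_top[of 0]
    proof eventually_elim
      case (elim n)
      then show ?case using central_binomial_bounds(2)[OF elim] by (simp add: w_def)
    qed
    have "(\<lambda>n. real n / (2 * real n + 1)) \<longlonglongrightarrow> 1 / 2" by real_asymp
    from tendsto_mult[OF this tendsto_const[of "2 / pi"]]
    show "(\<lambda>n. real n / (2 * real n + 1) * (2 / pi)) \<longlonglongrightarrow> 1 / pi" by simp
  qed simp
  have "(\<lambda>n. ln (real n * (w n)\<^sup>2)) \<longlonglongrightarrow> ln (1 / pi)" by (intro tendsto_ln w) simp
  moreover have "eventually (\<lambda>n. ln (real n * (w n)\<^sup>2) = 2 * z (2 * n) - 4 * z n + ln 2) sequentially"
    using eventually_gt_at_top[of 0]
  proof eventually_elim
    case (elim n)
    have "ln (w n) = ln (fact (2 * n)) - 2 * ln (fact n) - real n * (2 * ln 2)"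
    proof -
      have "ln (4::real) = 2 * ln 2" using ln_realpow[of 2 2] by simp
      then show ?thesis unfolding w_def central_binomial_fact by (simp add: ln_div ln_realpow ln_mult)
    qed
    moreover have "w n > 0" by (simp add: w_def)
    then have "ln (real n * (w n)\<^sup>2) = ln (real n) + 2 * ln (w n)" using elim by (simp add: ln_mult ln_realpow)
    moreover have "ln (real (2 * n)) = ln 2 + ln (real n)" using elim by (simp add: ln_mult)
    ultimately show ?case unfolding z_def by (simp add: algebra_simps add_divide_distrib)
  qed
  ultimately have "(\<lambda>n. 2 * z (2 * n) - 4 * z n + ln 2) \<longlonglongrightarrow> ln (1 / pi)" by (simp add: tendsto_cong)
  moreover have "(\<lambda>n. 2 * z (2 * n) - 4 * z n + ln 2) \<longlonglongrightarrow> 2 * c - 4 * c + ln 2" by (intro tendsto_intros c c2)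
  ultimately have "ln (1 / pi) = 2 * c - 4 * c + ln 2" by (rule LIMSEQ_unique)
  then have ceq: "c = ln (2 * pi) / 2" by (simp add: ln_div ln_mult)
  show ?thesis using c unfolding ceq z_def .
qed

lemma hook_weight_le: "l > 0 \<Longrightarrow> 0 \<le> hook_weight l" "l > 0 \<Longrightarrow> hook_weight l \<le> 1"
proof -
  assume l: "l > 0"
  then have "1 \<le> (real l)\<^sup>2" by (simp add: Suc_leI)
  then show "hook_weight l \<le> 1" using quadratic_pos[OF l] unfolding hook_weight_def by (simp add: divide_le_eq_1)
  show "0 \<le> hook_weight l" using quadratic_pos[OF l] unfolding hook_weight_def by simp
qed

lemma summable_rho:
  "summable (\<lambda>k. real (Suc k) * \<bar>hook_rho (Suc k)\<bar>)"
  "summable (\<lambda>k. real (Suc k) * hook_rho (Suc k))"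
  "summable (\<lambda>k. hook_weight (Suc k) * hook_rho (Suc k))"
proof -
  show a: "summable (\<lambda>k. real (Suc k) * \<bar>hook_rho (Suc k)\<bar>)" by (rule summable_cubic_weight[OF hook_rho_bound])
  show "summable (\<lambda>k. real (Suc k) * hook_rho (Suc k))"
    by (rule summable_comparison_test[OF _ a]) (auto simp: abs_mult)
  show "summable (\<lambda>k. hook_weight (Suc k) * hook_rho (Suc k))"
  proof (rule summable_comparison_test[OF _ a], intro exI allI impI)
    fix k
    show "norm (hook_weight (Suc k) * hook_rho (Suc k)) \<le> real (Suc k) * \<bar>hook_rho (Suc k)\<bar>"
      unfolding real_norm_def abs_mult using hook_weight_le[of "Suc k"] by (intro mult_right_mono) auto
  qed
qed

definition rho_sum_weighted :: real where
  "rho_sum_weighted = (\<Sum>k. hook_weight (Suc k) * hook_rho (Suc k))"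

definition rho_sum_linear :: real where
  "rho_sum_linear = (\<Sum>k. real (Suc k) * hook_rho (Suc k))"

text \<open>\<open>harm\<close> is replaced by \<open>odd_harm\<close>, so the summand becomes
  \<open>hook_weight * hook_rho\<close> plus two weighted parts whose sums are known.\<close>

lemma entropy_sums: "(\<lambda>k. entropy_summand (Suc k)) sums (rho_sum_weighted + 11 * pi\<^sup>2 / 384 - 1 / 4)"
proof -
  have "(\<lambda>k. hook_weight (Suc k) * hook_rho (Suc k) + hook_weight (Suc k) * odd_kap (Suc k) - (1 / 6) * (hook_weight (Suc k) / (4 * (real (Suc k))\<^sup>2 - 1)))
    sums (rho_sum_weighted + (pi\<^sup>2 / 32 - 1 / 4) - (1 / 6) * (pi\<^sup>2 / 64))"
    unfolding rho_sum_weighted_def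
    by (intro sums_add sums_diff sums_mult weighted_kap_sums weighted_quadratic_sums summable_sums summable_rho)
  moreover have "hook_weight (Suc k) * hook_rho (Suc k) + hook_weight (Suc k) * odd_kap (Suc k) - (1 / 6) * (hook_weight (Suc k) / (4 * (real (Suc k))\<^sup>2 - 1)) = entropy_summand (Suc k)" for k
  proof -
    have e: "ln (real l) - harm l + euler_mascheroni + 1 / (2 * real l) = hook_rho l + odd_kap l - (1 / 6) * (1 / (4 * (real l)\<^sup>2 - 1))" for l
      unfolding hook_rho_def odd_kap_def by simp
    show ?thesis unfolding entropy_summand_def hook_weight_def[symmetric] e by (simp only: distrib_left right_diff_distrib) simp
  qed
  moreover have "rho_sum_weighted + (pi\<^sup>2 / 32 - 1 / 4) - (1 / 6) * (pi\<^sup>2 / 64) = rho_sum_weighted + 11 * pi\<^sup>2 / 384 - 1 / 4" by simp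
  ultimately show ?thesis by (simp only:)
qed

lemma eta_sums: "(\<lambda>k. eta_summand (Suc k)) sums (- rho_sum_linear - (ln 2 / 6 - 7 / 48))"
proof -
  have "(\<lambda>k. - (real (Suc k) * hook_rho (Suc k)) - real (Suc k) * (odd_kap (Suc k) - 1 / (12 * (real (Suc k))\<^sup>2) - 1 / (6 * (4 * (real (Suc k))\<^sup>2 - 1))))
    sums (- rho_sum_linear - (ln 2 / 6 - 7 / 48))"
    unfolding rho_sum_linear_def by (intro sums_diff sums_minus linear_kap_sums summable_sums summable_rho)
  moreover have "- (real (Suc k) * hook_rho (Suc k)) - real (Suc k) * (odd_kap (Suc k) - 1 / (12 * (real (Suc k))\<^sup>2) - 1 / (6 * (4 * (real (Suc k))\<^sup>2 - 1))) = eta_summand (Suc k)" for k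
  proof -
    have e: "harm l - ln (real l) - euler_mascheroni - 1 / (2 * real l) + 1 / (12 * (real l)\<^sup>2) = - hook_rho l - (odd_kap l - 1 / (12 * (real l)\<^sup>2) - 1 / (6 * (4 * (real l)\<^sup>2 - 1)))" for l
      unfolding hook_rho_def odd_kap_def by simp
    show ?thesis unfolding eta_summand_def e by (simp only: right_diff_distrib mult_minus_right)
  qed
  ultimately show ?thesis by (simp only:)
qed

lemma summand_1: "entropy_summand 1 = (euler_mascheroni - 1 / 2) / 3" "eta_summand 1 = 7 / 12 - euler_mascheroni"
  by (simp_all add: entropy_summand_def eta_summand_def harm_def)

lemma entropy_const_sums: "(\<lambda>k. entropy_summand (k + 2)) sums (rho_sum_weighted + 11 * pi\<^sup>2 / 384 - 1 / 4 - (euler_mascheroni - 1 / 2) / 3)"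
proof -
  have "(\<lambda>k. entropy_summand (Suc (Suc k))) sums (rho_sum_weighted + 11 * pi\<^sup>2 / 384 - 1 / 4 - entropy_summand 1)"
    using entropy_sums by (subst sums_Suc_iff) simp
  then show ?thesis unfolding summand_1 by simp
qed

lemma eta_const_sums: "(\<lambda>k. eta_summand (k + 2)) sums (- rho_sum_linear - (ln 2 / 6 - 7 / 48) - (7 / 12 - euler_mascheroni))"
proof -
  have "(\<lambda>k. eta_summand (Suc (Suc k))) sums (- rho_sum_linear - (ln 2 / 6 - 7 / 48) - eta_summand 1)"
    using eta_sums by (subst sums_Suc_iff) simp
  then show ?thesis unfolding summand_1 by simp
qed

text \<open>The terms with Euler's constant in the prefactor and in the missing summand at
  \<open>l = 1\<close> cancel, and \<open>11 / 6\<close> is \<open>64 * 11 / 384\<close>.\<close>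

lemma plancherel_entropy_const_eq: "plancherel_entropy_const = 11 / 6 + 64 / pi\<^sup>2 * rho_sum_weighted"
proof -
  have "16 / (3 * p) * (4 * g + 1) + 64 / p * (R + 11 * p / 384 - 1 / 4 - (g - 1 / 2) / 3) = 11 / 6 + 64 / p * R" if "p > 0" for p g R :: real
    using that by (simp add: field_simps)
  then show ?thesis unfolding plancherel_entropy_const_def sums_unique[OF entropy_const_sums, symmetric] by simp
qed

lemma plancherel_eta_eq: "plancherel_eta = euler_mascheroni - ln 2 / 6 - 7 / 16 - rho_sum_linear"
  unfolding plancherel_eta_def sums_unique[OF eta_const_sums, symmetric] by simp

lemma rho_hooks_tendsto:
  "(\<lambda>n. (\<Sum>l=1..2*n. mean_hooks n l * hook_rho l) - sqrt (real n) * (32 / pi\<^sup>2 * rho_sum_weighted)) \<longlonglongrightarrow> - rho_sum_linear / 2"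
proof -
  \<comment> \<open>Counts beyond \<open>2 n\<close> are set to \<open>0\<close>, so that the finite
    hook sum and the full series for the constant become one series.\<close>
  define X where "X n l = (if l \<le> 2 * n then mean_hooks n l else 0) - hook_limit l * sqrt (real n)" for n l
  define a where "a k n = X n (Suc k) * hook_rho (Suc k)" for k n
  obtain B where B: "\<And>n l. 0 < l \<Longrightarrow> l \<le> 2 * n \<Longrightarrow> \<bar>mean_hooks n l - hook_limit l * sqrt (real n)\<bar> \<le> B * real l"
    using mean_hooks_asymp(1)[of 1] by auto
  define K where "K = 32 / pi\<^sup>2"
  have K: "K \<ge> 0" by (simp add: K_def)
  have X: "\<bar>X n l\<bar> \<le> (\<bar>B\<bar> + K) * real l" if l: "l > 0" for n l
  proof (cases "l \<le> 2 * n")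
    case True
    have "\<bar>X n l\<bar> \<le> B * real l" using B[OF l True] True by (simp add: X_def)
    also have "\<dots> \<le> (\<bar>B\<bar> + K) * real l" using K by (intro mult_right_mono) auto
    finally show ?thesis .
  next
    case False
    \<comment> \<open>Beyond \<open>2 n\<close> only the subtracted leading term survives, and
      \<open>n <= l^2\<close> keeps it within \<open>O(l)\<close>.\<close>
    have "sqrt (real n) \<le> real l"
    proof (rule real_le_lsqrt)
      have "n \<le> l" using False by simp
      also have "l \<le> l\<^sup>2" by (simp add: power2_eq_square)
      finally show "real n \<le> (real l)\<^sup>2" using of_nat_mono by fastforce
    qed simp
    then have "hook_weight l * sqrt (real n) \<le> 1 * real l" using hook_weight_le[OF l] by (intro mult_mono) auto
    then have "K * (hook_weight l * sqrt (real n)) \<le> K * (1 * real l)" using K by (intro mult_left_mono) auto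
    also have "\<dots> \<le> (\<bar>B\<bar> + K) * real l" by (simp add: distrib_right)
    finally have "K * (hook_weight l * sqrt (real n)) \<le> (\<bar>B\<bar> + K) * real l" .
    moreover have "\<bar>X n l\<bar> = K * (hook_weight l * sqrt (real n))"
      using False K hook_weight_le[OF l] by (simp add: X_def hook_limit_def hook_weight_def[symmetric] K_def[symmetric] abs_mult)
    ultimately show ?thesis by simp
  qed
  have lim: "(\<lambda>n. suminf (\<lambda>k. a k n)) \<longlonglongrightarrow> suminf (\<lambda>k. - (1 / 2) * (real (Suc k) * hook_rho (Suc k)))"
  proof (rule tannerys_theorem[THEN conjunct2, THEN conjunct2])
    fix k
    have "(\<lambda>n. mean_hooks n (Suc k) - hook_limit (Suc k) * sqrt (real n)) \<longlonglongrightarrow> - real (Suc k) / 2"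
      by (rule mean_hooks_asymp) simp
    moreover have "eventually (\<lambda>n. mean_hooks n (Suc k) - hook_limit (Suc k) * sqrt (real n) = X n (Suc k)) sequentially"
      using eventually_ge_at_top[of "Suc k"] by eventually_elim (simp add: X_def)
    ultimately have "(\<lambda>n. X n (Suc k)) \<longlonglongrightarrow> - real (Suc k) / 2" by (rule Lim_transform_eventually)
    from tendsto_mult[OF this tendsto_const[of "hook_rho (Suc k)"]]
    have "(\<lambda>n. a k n) \<longlonglongrightarrow> - real (Suc k) / 2 * hook_rho (Suc k)" unfolding a_def .
    moreover have "- real (Suc k) / 2 * hook_rho (Suc k) = - (1 / 2) * (real (Suc k) * hook_rho (Suc k))" by (simp del: of_nat_Suc)
    ultimately show "(\<lambda>n. a k n) \<longlonglongrightarrow> - (1 / 2) * (real (Suc k) * hook_rho (Suc k))" by (simp only:)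
  next
    have "norm (a k n) \<le> (\<bar>B\<bar> + K) * (real (Suc k) * \<bar>hook_rho (Suc k)\<bar>)" for k n
    proof -
      have "\<bar>X n (Suc k)\<bar> * \<bar>hook_rho (Suc k)\<bar> \<le> (\<bar>B\<bar> + K) * real (Suc k) * \<bar>hook_rho (Suc k)\<bar>"
        by (intro mult_right_mono X) auto
      then show ?thesis by (simp add: a_def abs_mult mult.assoc)
    qed
    then show "eventually (\<lambda>(k, n). norm (a k n) \<le> (\<bar>B\<bar> + K) * (real (Suc k) * \<bar>hook_rho (Suc k)\<bar>)) (at_top \<times>\<^sub>F sequentially)"
      by (intro always_eventually) auto
    show "summable (\<lambda>k. (\<bar>B\<bar> + K) * (real (Suc k) * \<bar>hook_rho (Suc k)\<bar>))"
      by (intro summable_mult summable_rho)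
  qed simp
  have "suminf (\<lambda>k. a k n) = (\<Sum>l=1..2*n. mean_hooks n l * hook_rho l) - sqrt (real n) * (32 / pi\<^sup>2 * rho_sum_weighted)" for n
  proof -
    have "(\<lambda>k. if k \<in> {..<2*n} then mean_hooks n (Suc k) * hook_rho (Suc k) else 0) sums (\<Sum>k<2*n. mean_hooks n (Suc k) * hook_rho (Suc k))"
      by (rule sums_If_finite_set) simp
    moreover have "(\<lambda>k. sqrt (real n) * (32 / pi\<^sup>2 * (hook_weight (Suc k) * hook_rho (Suc k)))) sums (sqrt (real n) * (32 / pi\<^sup>2 * rho_sum_weighted))"
      unfolding rho_sum_weighted_def by (intro sums_mult summable_sums summable_rho)
    ultimately have "(\<lambda>k. (if k \<in> {..<2*n} then mean_hooks n (Suc k) * hook_rho (Suc k) else 0) - sqrt (real n) * (32 / pi\<^sup>2 * (hook_weight (Suc k) * hook_rho (Suc k))))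
      sums ((\<Sum>k<2*n. mean_hooks n (Suc k) * hook_rho (Suc k)) - sqrt (real n) * (32 / pi\<^sup>2 * rho_sum_weighted))"
      by (rule sums_diff)
    moreover have "(if k \<in> {..<2*n} then mean_hooks n (Suc k) * hook_rho (Suc k) else 0) - sqrt (real n) * (32 / pi\<^sup>2 * (hook_weight (Suc k) * hook_rho (Suc k))) = a k n" for k
      by (auto simp: a_def X_def hook_limit_def hook_weight_def left_diff_distrib)
    moreover have "(\<Sum>k<2*n. mean_hooks n (Suc k) * hook_rho (Suc k)) = (\<Sum>l=1..2*n. mean_hooks n l * hook_rho l)"
      by (rule sum.reindex_bij_witness[of _ "\<lambda>l. l - 1" Suc]) auto
    ultimately show ?thesis by (simp add: sums_iff)
  qed
  moreover have "suminf (\<lambda>k. - (1 / 2) * (real (Suc k) * hook_rho (Suc k))) = - rho_sum_linear / 2"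
    unfolding rho_sum_linear_def by (subst suminf_mult[OF summable_rho(2)]) simp
  ultimately show ?thesis using lim by simp
qed

lemma expected_log_decomp:
  "- expected_log_plancherel n = 2 * (\<Sum>l=1..2*n. mean_hooks n l * hook_rho l) 
    + 2 * (lag_moment3 n 4 + lag_moment 2 n 4 / 2 - lag_moment 1 n 4 / 16 + real n / 2)
    - 2 * (euler_mascheroni + 2 * ln 2) * real n
    - (lag_moment 2 n 4 / 4 - lag_moment 1 n 4 / 8 + lag_moment 0 n 4 / 64) / 3 - ln (fact n)"
proof -
  have "(\<Sum>l=1..2*n. mean_hooks n l * ln (real l)) = (\<Sum>l=1..2*n. mean_hooks n l * hook_rho l + mean_hooks n l * odd_harm l
    - mean_hooks n l * (euler_mascheroni + 2 * ln 2) - mean_hooks n l / (4 * (real l)\<^sup>2 - 1) / 6)"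
  proof (intro sum.cong refl)
    fix l
    have e: "ln (real l) = hook_rho l + odd_harm l - (euler_mascheroni + 2 * ln 2) - 1 / (4 * (real l)\<^sup>2 - 1) / 6"
      unfolding hook_rho_def by simp
    show "mean_hooks n l * ln (real l) = mean_hooks n l * hook_rho l + mean_hooks n l * odd_harm l
      - mean_hooks n l * (euler_mascheroni + 2 * ln 2) - mean_hooks n l / (4 * (real l)\<^sup>2 - 1) / 6"
      unfolding e by (simp only: right_diff_distrib distrib_left times_divide_eq_right mult_1_right)
  qed
  also have "\<dots> = (\<Sum>l=1..2*n. mean_hooks n l * hook_rho l) + (lag_moment3 n 4 + lag_moment 2 n 4 / 2 - lag_moment 1 n 4 / 16 + real n / 2)
    - real n * (euler_mascheroni + 2 * ln 2) - (lag_moment 2 n 4 / 4 - lag_moment 1 n 4 / 8 + lag_moment 0 n 4 / 64) / 6"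
    by (simp only: sum_subtractf sum.distrib sum_distrib_right[symmetric] sum_divide_distrib[symmetric] sum_mean_hooks sum_mean_hooks_odd_harm sum_mean_hooks_quadratic)
  finally show ?thesis unfolding expected_log_eq by (simp add: algebra_simps add_divide_distrib diff_divide_distrib)
qed

lemma expected_log_asymp:
  "(\<lambda>n. - expected_log_plancherel n - (sqrt (real n) * plancherel_entropy_const
     - (13 / 24 * ln (real n) + 13 * euler_mascheroni / 12 + ln (sqrt (2 * pi)) + 1 / 4 - plancherel_eta))) \<longlonglongrightarrow> 0"
proof -
  let ?g = "euler_mascheroni :: real" and ?h = "\<lambda>n. harm n :: real"
  define r1 where "r1 n = (\<Sum>l=1..2*n. mean_hooks n l * hook_rho l) - sqrt (real n) * (32 / pi\<^sup>2 * rho_sum_weighted) - (- rho_sum_linear / 2)" for n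
  define r2 where "r2 n = lag_moment3 n 4 - (((real n + 1) * ?h n - 2 * real n) / 2 + real n * (?g / 2 + ln 4) - ?h n / 2) - (1 / (2 * 4\<^sup>2) - 1 / 2)" for n
  define r3 where "r3 n = lag_moment 2 n 4 - 2 * sqrt (real n) - (- 1 / 4)" for n
  define r4 where "r4 n = lag_moment 1 n 4 - ?h n / 2 - (?g / 2 + ln 4)" for n
  define r5 where "r5 n = lag_moment 0 n 4 - 4" for n
  define r6 where "r6 n = real n * (?h n - ln (real n) - ?g) - 1 / 2" for n
  define r7 where "r7 n = ?h n - ln (real n) - ?g" for n
  define r8 where "r8 n = ln (fact n) - (real n * ln (real n) - real n + ln (real n) / 2) - ln (2 * pi) / 2" for n
  have r1: "r1 \<longlonglongrightarrow> 0" unfolding r1_def by (rule LIM_zero[OF rho_hooks_tendsto])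
  have r2: "r2 \<longlonglongrightarrow> 0" unfolding r2_def by (rule LIM_zero[OF lag_moment3_tendsto]) simp
  have r3: "r3 \<longlonglongrightarrow> 0" unfolding r3_def by (rule LIM_zero[OF lag_moment2_tendsto]) simp
  have r4: "r4 \<longlonglongrightarrow> 0" unfolding r4_def by (rule LIM_zero[OF lag_moment1_tendsto]) simp
  have r5: "r5 \<longlonglongrightarrow> 0" unfolding r5_def by (rule LIM_zero[OF lag_moment0_tendsto]) simp
  have r7: "r7 \<longlonglongrightarrow> 0" unfolding r7_def by (rule LIM_zero[OF euler_mascheroni_LIMSEQ])
  have r8: "r8 \<longlonglongrightarrow> 0" unfolding r8_def by (rule LIM_zero[OF stirling])
  have r6: "r6 \<longlonglongrightarrow> 0"
  proof -
    have s: "(\<lambda>n. 1 / real n) \<longlonglongrightarrow> 0" by real_asymp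
    have "(\<lambda>n. 1 / real n * ((real n)\<^sup>2 * harm_eps n) - 1 / 12 * (1 / real n)) \<longlonglongrightarrow> 0 * 0 - 1 / 12 * 0"
      by (intro tendsto_intros s harm_eps_cube)
    moreover have "eventually (\<lambda>n. 1 / real n * ((real n)\<^sup>2 * harm_eps n) - 1 / 12 * (1 / real n) = r6 n) sequentially"
      using eventually_gt_at_top[of 0]
    proof eventually_elim
      case (elim n)
      have "1 / t * (t\<^sup>2 * (h - u - g - 1 / (2 * t) + 1 / (12 * t\<^sup>2))) - 1 / 12 * (1 / t) = t * (h - u - g) - 1 / 2" if "t > 0" for t h u g :: real
        using that by (simp add: field_simps power2_eq_square)
      from this[of "real n"] show ?case using elim by (simp add: r6_def harm_eps_def)
    qed
    ultimately show ?thesis by (simp add: tendsto_cong)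
  qed
  \<comment> \<open>The weights are the coefficients in \<open>expected_log_decomp\<close>:
    \<open>11 / 12 = 1 - 1 / 12\<close> for the second moment,
    \<open>1 / 12 = 1 / 8 - 1 / 24\<close> for the first, \<open>1 / 192\<close> for the zeroth. The
    last three terms expand \<open>n * harm n\<close>, the leftover \<open>- harm n / 24\<close>,
    and \<open>ln (fact n)\<close>. The factor \<open>11 / 12\<close> with \<open>2 sqrt n\<close>
    yields the \<open>11 / 6\<close> of the entropy constant.\<close>
  have "(\<lambda>n. 2 * r1 n + 2 * r2 n + 11 / 12 * r3 n - 1 / 12 * r4 n - 1 / 192 * r5 n + r6 n - 1 / 24 * r7 n - r8 n) \<longlonglongrightarrow> 2 * 0 + 2 * 0 + 11 / 12 * 0 - 1 / 12 * 0 - 1 / 192 * 0 + 0 - 1 / 24 * 0 - 0"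
    by (intro tendsto_intros r1 r2 r3 r4 r5 r6 r7 r8)
  moreover have "2 * r1 n + 2 * r2 n + 11 / 12 * r3 n - 1 / 12 * r4 n - 1 / 192 * r5 n + r6 n - 1 / 24 * r7 n - r8 n = 
    - expected_log_plancherel n - (sqrt (real n) * plancherel_entropy_const
     - (13 / 24 * ln (real n) + 13 * ?g / 12 + ln (sqrt (2 * pi)) + 1 / 4 - plancherel_eta))" for n
  proof -
    have l4: "ln (4::real) = 2 * ln 2" using ln_realpow[of 2 2] by simp
    have lp: "ln (sqrt (2 * pi)) = ln (2 * pi) / 2" by (simp add: ln_sqrt)
    have gen: "2 * (S1 - s * (32 / P * W) - (- T / 2)) + 2 * (M3 - (((m + 1) * h - 2 * m) / 2 + m * (g / 2 + 2 * L) - h / 2) - (1 / (2 * 4\<^sup>2) - 1 / 2)) + 11 / 12 * (M2 - 2 * s - (- 1 / 4))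
       - 1 / 12 * (M1 - h / 2 - (g / 2 + 2 * L)) - 1 / 192 * (M0 - 4) + (m * (h - u - g) - 1 / 2) - 1 / 24 * (h - u - g) - (F - (m * u - m + u / 2) - V / 2)
      = 2 * S1 + 2 * (M3 + M2 / 2 - M1 / 16 + m / 2) - 2 * (g + 2 * L) * m - (M2 / 4 - M1 / 8 + M0 / 64) / 3 - F - (s * (11 / 6 + 64 / P * W) - (13 / 24 * u + 13 * g / 12 + V / 2 + 1 / 4 - (g - L / 6 - 7 / 16 - T)))"
      for S1 s P W T M3 m h g L M2 M1 M0 u F V :: real
      by (simp add: algebra_simps add_divide_distrib diff_divide_distrib)
    show ?thesis
      unfolding r1_def r2_def r3_def r4_def r5_def r6_def r7_def r8_def expected_log_decomp plancherel_entropy_const_eq plancherel_eta_eq l4 lp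
      by (rule gen)
  qed
  ultimately show ?thesis by simp
qed

section \<open>Numerical bounds\<close>

text \<open>These inequalities compare, in the variable \<open>z = (2 l + 1)\<^sup>2\<close>, truncated series of the summands with the telescoping
differences of \<open>psi_tail\<close>, \<open>chi_tail\<close> and \<open>harm_tail\<close> below. The coefficients of the latter come from the
Euler--Maclaurin expansion at \<open>2 l\<close>; where truncation alone errs on the wrong side, the last coefficient is perturbed.\<close>

lemma psi_poly_lower:
  fixes z :: real
  assumes "441 \<le> z"
  shows "90090 * (24255 * (2 * (3 * z + 1)) * (z - 1) ^ 6 - 42273 * (2 * (5 * z\<^sup>2 + 10 * z + 1)) * (z - 1) ^ 4 + 141075 * (2 * (7 * z ^ 3 + 35 * z\<^sup>2 + 21 * z + 1)) * (z - 1) ^ 2 - 820673 * (2 * (9 * z ^ 4 + 84 * z ^ 3 + 126 * z\<^sup>2 + 36 * z + 1))) * z ^ 6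
    \<le> 4365900 * (3003 * z ^ 4 + 1287 * z ^ 3 + 715 * z\<^sup>2 + 455 * z + 315) * (z - 1) ^ 9"
proof -
  \<comment> \<open>After the shift to \<open>y = z - 441\<close> every coefficient of the
    difference is positive; \<open>441 = 21^2\<close> corresponds to \<open>l = 10\<close>. The
    other five inequalities work the same way.\<close>
  define y where "y = z - 441"
  have y: "0 \<le> y" and z: "z = y + 441" and z1: "y + 441 - 1 = y + 440" using assms by (simp_all add: y_def)
  have "(4365900 * (3003 * (y + 441) ^ 4 + 1287 * (y + 441) ^ 3 + 715 * (y + 441)\<^sup>2 + 455 * (y + 441) + 315) * (y + 440) ^ 9) - 90090 * (24255 * (2 * (3 * (y + 441) + 1)) * (y + 440) ^ 6 - 42273 * (2 * (5 * (y + 441)\<^sup>2 + 10 * (y + 441) + 1)) * (y + 440) ^ 4 + 141075 * (2 * (7 * (y + 441) ^ 3 + 35 * (y + 441)\<^sup>2 + 21 * (y + 441) + 1)) * (y + 440) ^ 2 - 820673 * (2 * (9 * (y + 441) ^ 4 + 84 * (y + 441) ^ 3 + 126 * (y + 441)\<^sup>2 + 36 * (y + 441) + 1))) * (y + 441) ^ 6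
    = 9443605165405312830875198143237463040 + 192670015322628176071590146262401280 * y + 1747060361496702585698885799491520 * y ^ 2 + 9240989316059724836912232706080 * y ^ 3 + 31422699003775268331546534900 * y ^ 4 + 71232342924604130549404740 * y ^ 5 + 107651404257645801971880 * y ^ 6 + 104586740678185670520 * y ^ 7 + 59272103217484080 * y ^ 8 + 14929371141300 * y ^ 9"
    by algebra
  also have "\<dots> \<ge> 0" using y by simp
  finally show ?thesis unfolding z z1 by simp
qed

lemma psi_poly_upper:
  fixes z :: real
  assumes "441 \<le> z"
  shows "44100 * (462 * z ^ 4 + 198 * z ^ 3 + 110 * z\<^sup>2 + 70 * z + 315) * (z - 1) ^ 9
    \<le> 13860 * (245 * (2 * (3 * z + 1)) * (z - 1) ^ 6 - 427 * (2 * (5 * z\<^sup>2 + 10 * z + 1)) * (z - 1) ^ 4 + 1425 * (2 * (7 * z ^ 3 + 35 * z\<^sup>2 + 21 * z + 1)) * (z - 1) ^ 2 - 7938 * (2 * (9 * z ^ 4 + 84 * z ^ 3 + 126 * z\<^sup>2 + 36 * z + 1))) * z ^ 6"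
proof -
  define y where "y = z - 441"
  have y: "0 \<le> y" and z: "z = y + 441" and z1: "y + 441 - 1 = y + 440" using assms by (simp_all add: y_def)
  have "(13860 * (245 * (2 * (3 * (y + 441) + 1)) * (y + 440) ^ 6 - 427 * (2 * (5 * (y + 441)\<^sup>2 + 10 * (y + 441) + 1)) * (y + 440) ^ 4 + 1425 * (2 * (7 * (y + 441) ^ 3 + 35 * (y + 441)\<^sup>2 + 21 * (y + 441) + 1)) * (y + 440) ^ 2 - 7938 * (2 * (9 * (y + 441) ^ 4 + 84 * (y + 441) ^ 3 + 126 * (y + 441)\<^sup>2 + 36 * (y + 441) + 1))) * (y + 441) ^ 6) - 44100 * (462 * (y + 441) ^ 4 + 198 * (y + 441) ^ 3 + 110 * (y + 441)\<^sup>2 + 70 * (y + 441) + 315) * (y + 440) ^ 9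
    = 10242007575340201110775630411223040 + 264447435292687132375911376481280 * y + 3026848927788540100597550411520 * y ^ 2 + 20287618058488120791038945280 * y ^ 3 + 88377568961696149335243120 * y ^ 4 + 261888885126883302555960 * y ^ 5 + 535302734678532623880 * y ^ 6 + 745973595180087120 * y ^ 7 + 678822233415480 * y ^ 8 + 364468339620 * y ^ 9 + 87723720 * y ^ 10"
    by algebra
  also have "\<dots> \<ge> 0" using y by simp
  finally show ?thesis unfolding z z1 by simp
qed

lemma chi_poly_lower:
  fixes z :: real
  assumes "441 \<le> z"
  shows "13860 * (700 * (4) * (z - 1) ^ 4 - 300 * (8 * (z + 1)) * (z - 1) ^ 2 + 567 * (4 * (3 * z\<^sup>2 + 10 * z + 3))) * z ^ 6
    \<le> 21000 * (2310 * z ^ 5 * (z - 1) ^ 5 - (462 * z ^ 4 + 198 * z ^ 3 + 110 * z\<^sup>2 + 70 * z + 315) * (z - 1) ^ 6)"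
proof -
  define y where "y = z - 441"
  have y: "0 \<le> y" and z: "z = y + 441" and z1: "y + 441 - 1 = y + 440" using assms by (simp_all add: y_def)
  have "(21000 * (2310 * (y + 441) ^ 5 * (y + 440) ^ 5 - (462 * (y + 441) ^ 4 + 198 * (y + 441) ^ 3 + 110 * (y + 441)\<^sup>2 + 70 * (y + 441) + 315) * (y + 440) ^ 6)) - 13860 * (700 * (4) * (y + 440) ^ 4 - 300 * (8 * ((y + 441) + 1)) * (y + 440) ^ 2 + 567 * (4 * (3 * (y + 441)\<^sup>2 + 10 * (y + 441) + 3))) * (y + 441) ^ 6
    = 834371257132639480625521920 + 19058109741645610810352640 * y + 182384615280019743378480 * y ^ 2 + 968327459915534278560 * y ^ 3 + 3144903713756019600 * y ^ 4 + 6431090035505520 * y ^ 5 + 8114718344040 * y ^ 6 + 5790734880 * y ^ 7 + 1792560 * y ^ 8"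
    by algebra
  also have "\<dots> \<ge> 0" using y by simp
  finally show ?thesis unfolding z z1 by simp
qed

lemma chi_poly_upper:
  fixes z :: real
  assumes "441 \<le> z"
  shows "1890 * (15015 * z ^ 5 * (z - 1) ^ 5 - (3003 * z ^ 4 + 1287 * z ^ 3 + 715 * z\<^sup>2 + 455 * z + 315) * (z - 1) ^ 6)
    \<le> 90090 * (63 * (4) * (z - 1) ^ 4 - 27 * (8 * (z + 1)) * (z - 1) ^ 2 + 52 * (4 * (3 * z\<^sup>2 + 10 * z + 3))) * z ^ 6"
proof -
  define y where "y = z - 441"
  have y: "0 \<le> y" and z: "z = y + 441" and z1: "y + 441 - 1 = y + 440" using assms by (simp_all add: y_def)
  have "(90090 * (63 * (4) * (y + 440) ^ 4 - 27 * (8 * ((y + 441) + 1)) * (y + 440) ^ 2 + 52 * (4 * (3 * (y + 441)\<^sup>2 + 10 * (y + 441) + 3))) * (y + 441) ^ 6) - 1890 * (15015 * (y + 441) ^ 5 * (y + 440) ^ 5 - (3003 * (y + 441) ^ 4 + 1287 * (y + 441) ^ 3 + 715 * (y + 441)\<^sup>2 + 455 * (y + 441) + 315) * (y + 440) ^ 6)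
    = 1023378287822944607809221120 + 16244603213738951014064640 * y + 110510930519215535232000 * y ^ 2 + 417665749467003261840 * y ^ 3 + 947117243880478440 * y ^ 4 + 1288634870927250 * y ^ 5 + 974055075840 * y ^ 6 + 315544320 * y ^ 7"
    by algebra
  also have "\<dots> \<ge> 0" using y by simp
  finally show ?thesis unfolding z z1 by simp
qed

lemma harm_poly_lower:
  fixes z :: real
  assumes "441 \<le> z"
  shows "90090 * (20 * (4) * (z - 1) ^ 4 - 8 * (8 * (z + 1)) * (z - 1) ^ 2 + 15 * (4 * (3 * z\<^sup>2 + 10 * z + 3))) * z ^ 6
    \<le> 60 * (8 * (15015 * z ^ 5 + (3003 * z ^ 4 + 1287 * z ^ 3 + 715 * z\<^sup>2 + 455 * z + 315))) * (z - 1) ^ 5"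
proof -
  define y where "y = z - 441"
  have y: "0 \<le> y" and z: "z = y + 441" and z1: "y + 441 - 1 = y + 440" using assms by (simp_all add: y_def)
  have "(60 * (8 * (15015 * (y + 441) ^ 5 + (3003 * (y + 441) ^ 4 + 1287 * (y + 441) ^ 3 + 715 * (y + 441)\<^sup>2 + 455 * (y + 441) + 315))) * (y + 440) ^ 5) - 90090 * (20 * (4) * (y + 440) ^ 4 - 8 * (8 * ((y + 441) + 1)) * (y + 440) ^ 2 + 15 * (4 * (3 * (y + 441)\<^sup>2 + 10 * (y + 441) + 3))) * (y + 441) ^ 6
    = 71816565504836407504233600 + 1974786573562618986508800 * y + 21006503038263118214520 * y ^ 2 + 119457700277204195280 * y ^ 3 + 407169197643533160 * y ^ 4 + 863027062524000 * y ^ 5 + 1119538335240 * y ^ 6 + 816713040 * y ^ 7 + 257400 * y ^ 8"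
    by algebra
  also have "\<dots> \<ge> 0" using y by simp
  finally show ?thesis unfolding z z1 by simp
qed

lemma harm_poly_upper:
  fixes z :: real
  assumes "441 \<le> z"
  shows "315 * (8 * (2310 * z ^ 5 + (462 * z ^ 4 + 198 * z ^ 3 + 110 * z\<^sup>2 + 70 * z + 315))) * (z - 1) ^ 5
    \<le> 13860 * (105 * (4) * (z - 1) ^ 4 - 42 * (8 * (z + 1)) * (z - 1) ^ 2 + 80 * (4 * (3 * z\<^sup>2 + 10 * z + 3))) * z ^ 6"
proof -
  define y where "y = z - 441"
  have y: "0 \<le> y" and z: "z = y + 441" and z1: "y + 441 - 1 = y + 440" using assms by (simp_all add: y_def)
  have "(13860 * (105 * (4) * (y + 440) ^ 4 - 42 * (8 * ((y + 441) + 1)) * (y + 440) ^ 2 + 80 * (4 * (3 * (y + 441)\<^sup>2 + 10 * (y + 441) + 3))) * (y + 441) ^ 6) - 315 * (8 * (2310 * (y + 441) ^ 5 + (462 * (y + 441) ^ 4 + 198 * (y + 441) ^ 3 + 110 * (y + 441)\<^sup>2 + 70 * (y + 441) + 315))) * (y + 440) ^ 5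
    = 241659097890906484009267200 + 3835971506834985734092800 * y + 26095811880065110001280 * y ^ 2 + 98626529461061891520 * y ^ 3 + 223649505690866640 * y ^ 4 + 304293998824200 * y ^ 5 + 230009794560 * y ^ 6 + 74511360 * y ^ 7"
    by algebra
  also have "\<dots> \<ge> 0" using y by simp
  finally show ?thesis unfolding z z1 by simp
qed

section \<open>Enclosures of the logarithms of \<open>1 + 1 / l\<close> and of the accelerated
  series\<close>

lemma ln_bounds_1: "0.69314718055994528 \<le> ln (2 :: real)" "ln (2 :: real) \<le> 0.69314718055994533"
  using ln_approx_bounds[of "2" 16] by (simp_all add: lessThan_nat_numeral power_divide)

lemma ln_bounds_2: "0.40546510810816436 \<le> ln (3 / 2 :: real)" "ln (3 / 2 :: real) \<le> 0.40546510810816441"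
  using ln_approx_bounds[of "3 / 2" 11] by (simp_all add: lessThan_nat_numeral power_divide)

lemma ln_bounds_3: "0.28768207245178090 \<le> ln (4 / 3 :: real)" "ln (4 / 3 :: real) \<le> 0.28768207245178095"
  using ln_approx_bounds[of "4 / 3" 9] by (simp_all add: lessThan_nat_numeral power_divide)

lemma ln_bounds_4: "0.22314355131420973 \<le> ln (5 / 4 :: real)" "ln (5 / 4 :: real) \<le> 0.22314355131420978"
  using ln_approx_bounds[of "5 / 4" 8] by (simp_all add: lessThan_nat_numeral power_divide)

lemma ln_bounds_5: "0.18232155679395460 \<le> ln (6 / 5 :: real)" "ln (6 / 5 :: real) \<le> 0.18232155679395465"
  using ln_approx_bounds[of "6 / 5" 8] by (simp_all add: lessThan_nat_numeral power_divide)

lemma ln_bounds_6: "0.15415067982725828 \<le> ln (7 / 6 :: real)" "ln (7 / 6 :: real) \<le> 0.15415067982725833"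
  using ln_approx_bounds[of "7 / 6" 7] by (simp_all add: lessThan_nat_numeral power_divide)

lemma ln_bounds_7: "0.13353139262452260 \<le> ln (8 / 7 :: real)" "ln (8 / 7 :: real) \<le> 0.13353139262452265"
  using ln_approx_bounds[of "8 / 7" 7] by (simp_all add: lessThan_nat_numeral power_divide)

lemma ln_bounds_8: "0.11778303565638343 \<le> ln (9 / 8 :: real)" "ln (9 / 8 :: real) \<le> 0.11778303565638348"
  using ln_approx_bounds[of "9 / 8" 6] by (simp_all add: lessThan_nat_numeral power_divide)

lemma ln_bounds_9: "0.10536051565782628 \<le> ln (10 / 9 :: real)" "ln (10 / 9 :: real) \<le> 0.10536051565782633"
  using ln_approx_bounds[of "10 / 9" 6] by (simp_all add: lessThan_nat_numeral power_divide)

text \<open>The summand of the entropy series after Abel summation, with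
  \<open>1 / (6 (2 l + 1)^2)\<close> subtracted. That series has a known sum, and the remainder
  decays like \<open>(2 l + 1)^-4\<close>.\<close>

definition hook_psi :: "nat \<Rightarrow> real" where
  "hook_psi l = 1 / 4 - 1 / (6 * (2 * real l + 1)\<^sup>2) - real l * (real l + 1) / (2 * (2 * real l + 1)) * ln (1 + 1 / real l)"

text \<open>With \<open>w = 2 l + 1\<close>, \<open>1 + 1 / l\<close> is
  \<open>(w + 1) / (w - 1)\<close>, so its logarithm is an odd series in \<open>1 / w\<close>. Six
  terms are kept; dividing by \<open>w\<close> makes everything rational in
  \<open>z = w^2\<close>.\<close>

lemma ln_ratio_bounds:
  assumes l: "l > 0"
  defines "w \<equiv> 2 * real l + 1"
  defines "z \<equiv> w\<^sup>2"
  shows "2 * (1 / z + 1 / (3 * z\<^sup>2) + 1 / (5 * z ^ 3) + 1 / (7 * z ^ 4) + 1 / (9 * z ^ 5) + 1 / (11 * z ^ 6)) \<le> ln (1 + 1 / real l) / w" (is "?L \<le> _")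
    "ln (1 + 1 / real l) / w \<le> 2 * (1 / z + 1 / (3 * z\<^sup>2) + 1 / (5 * z ^ 3) + 1 / (7 * z ^ 4) + 1 / (9 * z ^ 5) + 1 / (11 * z ^ 6)) + 2 / (13 * z ^ 6 * (z - 1))"
proof -
  have w: "w > 1" using l by (simp add: w_def)
  then have z: "z > 1" by (simp add: z_def)
  have y: "(1 + 1 / real l - 1) / (1 + 1 / real l + 1) = 1 / w" using l by (simp add: w_def field_simps)
  have p: "(1 / w) ^ (2 * k + 1) = w / z ^ (k + 1)" for k
  proof -
    have "w ^ (2 * k + 1) * w = z ^ (k + 1)" by (simp add: z_def power_mult[symmetric] power2_eq_square power_mult_distrib power_add mult_2)
    then show ?thesis using w z by (simp add: power_divide field_simps)
  qed
  have s: "(\<Sum>k<6. 2 * (1 / w) ^ (2 * k + 1) / real (2 * k + 1)) = w * ?L"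
    unfolding p
  proof -
    have "(\<Sum>k<6. 2 * (w / z ^ (k + 1)) / real (2 * k + 1)) = 2 * (w / z ^ (0 + 1)) / real (2 * 0 + 1) + 2 * (w / z ^ (1 + 1)) / real (2 * 1 + 1) + 2 * (w / z ^ (2 + 1)) / real (2 * 2 + 1) + 2 * (w / z ^ (3 + 1)) / real (2 * 3 + 1) + 2 * (w / z ^ (4 + 1)) / real (2 * 4 + 1) + 2 * (w / z ^ (5 + 1)) / real (2 * 5 + 1)"
      by (simp add: eval_nat_numeral)
    also have "\<dots> = w * ?L" by (simp add: distrib_left power2_eq_square mult.commute)
    finally show "(\<Sum>k<6. 2 * (w / z ^ (k + 1)) / real (2 * k + 1)) = w * ?L" .
  qed
  have d: "2 * ((1 / w) ^ (2 * 6 + 1) / (1 - (1 / w)\<^sup>2) / real (2 * 6 + 1)) = w * (2 / (13 * z ^ 6 * (z - 1)))"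
  proof -
    have q: "1 - (1 / w)\<^sup>2 = (z - 1) / z" using w z by (simp add: z_def power_divide diff_divide_distrib)
    have r: "real (2 * 6 + 1) = 13" by simp
    have gen: "2 * (W / (Y * Z) / (u / Z) / 13) = W * (2 / (13 * Y * u))" if "Z \<noteq> 0" for W Y Z u :: real
      using that by simp
    show ?thesis unfolding p q r unfolding power_add power_one_right by (rule gen) (use z in simp)
  qed
  have "ln (1 + 1 / real l) \<in> {w * ?L .. w * ?L + w * (2 / (13 * z ^ 6 * (z - 1)))}"
    using ln_approx_bounds[of "1 + 1 / real l" 6] l unfolding y s d by simp
  then have "w * ?L \<le> ln (1 + 1 / real l)" "ln (1 + 1 / real l) \<le> w * (?L + 2 / (13 * z ^ 6 * (z - 1)))"
    by (auto simp: distrib_left)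
  then show "?L \<le> ln (1 + 1 / real l) / w" "ln (1 + 1 / real l) / w \<le> ?L + 2 / (13 * z ^ 6 * (z - 1))"
    using w by (simp_all add: pos_le_divide_eq pos_divide_le_eq mult.commute)
qed

lemma hook_psi_eq:
  assumes "l > 0"
  defines "w \<equiv> 2 * real l + 1"
  shows "hook_psi l = 1 / 4 - 1 / (6 * w\<^sup>2) - (w\<^sup>2 - 1) / 8 * (ln (1 + 1 / real l) / w)"
proof -
  have "real l * (real l + 1) / (2 * w) = (w\<^sup>2 - 1) / 8 * (1 / w)"
    by (simp add: w_def power2_eq_square field_simps)
  then show ?thesis unfolding hook_psi_def w_def[symmetric] by simp
qed

text \<open>The logarithm enters with a negative factor, so its truncated series gives the upper
  bound. The remainder costs \<open>1 / (52 z ^ 6)\<close> in the lower one.\<close>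

lemma hook_psi_bounds:
  assumes l: "l > 0"
  defines "z \<equiv> (2 * real l + 1)\<^sup>2"
  shows "(3003 * z ^ 4 + 1287 * z ^ 3 + 715 * z\<^sup>2 + 455 * z + 315) / (90090 * z ^ 6) \<le> hook_psi l"
    "hook_psi l \<le> (462 * z ^ 4 + 198 * z ^ 3 + 110 * z\<^sup>2 + 70 * z + 315) / (13860 * z ^ 6)"
proof -
  define L where "L = 2 * (1 / z + 1 / (3 * z\<^sup>2) + 1 / (5 * z ^ 3) + 1 / (7 * z ^ 4) + 1 / (9 * z ^ 5) + 1 / (11 * z ^ 6))"
  define q where "q = ln (1 + 1 / real l) / (2 * real l + 1)"
  have z: "z > 1" using l by (simp add: z_def)
  have q: "L \<le> q" "q \<le> L + 2 / (13 * z ^ 6 * (z - 1))"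
    using ln_ratio_bounds[OF l] by (simp_all only: L_def q_def z_def)
  have e: "hook_psi l = 1 / 4 - 1 / (6 * z) - (z - 1) / 8 * q"
    using hook_psi_eq[OF l] by (simp only: q_def z_def)
  have up: "1 / 4 - 1 / (6 * z) - (z - 1) / 8 * L = (462 * z ^ 4 + 198 * z ^ 3 + 110 * z\<^sup>2 + 70 * z + 315) / (13860 * z ^ 6)"
    unfolding L_def using z by (simp add: divide_simps, algebra?)
  have lo: "(z - 1) / 8 * (2 / (13 * z ^ 6 * (z - 1))) = 1 / (52 * z ^ 6)" using z by (simp add: divide_simps)
  have lo': "(462 * z ^ 4 + 198 * z ^ 3 + 110 * z\<^sup>2 + 70 * z + 315) / (13860 * z ^ 6) - 1 / (52 * z ^ 6) = (3003 * z ^ 4 + 1287 * z ^ 3 + 715 * z\<^sup>2 + 455 * z + 315) / (90090 * z ^ 6)"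
    using z by (simp add: divide_simps, algebra?)
  have "(z - 1) / 8 * L \<le> (z - 1) / 8 * q" using q z by (intro mult_left_mono) auto
  then show "hook_psi l \<le> (462 * z ^ 4 + 198 * z ^ 3 + 110 * z\<^sup>2 + 70 * z + 315) / (13860 * z ^ 6)"
    unfolding e up[symmetric] by simp
  have "(z - 1) / 8 * q \<le> (z - 1) / 8 * (L + 2 / (13 * z ^ 6 * (z - 1)))" using q z by (intro mult_left_mono) auto
  then show "(3003 * z ^ 4 + 1287 * z ^ 3 + 715 * z\<^sup>2 + 455 * z + 315) / (90090 * z ^ 6) \<le> hook_psi l"
    unfolding e lo'[symmetric] up[symmetric] distrib_left lo by simp
qed

lemma inverse_power_diff:
  fixes w :: real
  assumes "w > 1"
  defines "z \<equiv> w\<^sup>2"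
  shows "1 / (w - 1)\<^sup>2 - 1 / (w + 1)\<^sup>2 = w * 4 / (z - 1)\<^sup>2"
    "1 / (w - 1) ^ 3 - 1 / (w + 1) ^ 3 = 2 * (3 * z + 1) / (z - 1) ^ 3"
    "1 / (w - 1) ^ 4 - 1 / (w + 1) ^ 4 = w * (8 * (z + 1)) / (z - 1) ^ 4"
    "1 / (w - 1) ^ 5 - 1 / (w + 1) ^ 5 = 2 * (5 * z\<^sup>2 + 10 * z + 1) / (z - 1) ^ 5"
    "1 / (w - 1) ^ 6 - 1 / (w + 1) ^ 6 = w * (4 * (3 * z\<^sup>2 + 10 * z + 3)) / (z - 1) ^ 6"
    "1 / (w - 1) ^ 7 - 1 / (w + 1) ^ 7 = 2 * (7 * z ^ 3 + 35 * z\<^sup>2 + 21 * z + 1) / (z - 1) ^ 7"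
    "1 / (w - 1) ^ 9 - 1 / (w + 1) ^ 9 = 2 * (9 * z ^ 4 + 84 * z ^ 3 + 126 * z\<^sup>2 + 36 * z + 1) / (z - 1) ^ 9"
proof -
  have e: "1 / (w - 1) ^ k - 1 / (w + 1) ^ k = ((w + 1) ^ k - (w - 1) ^ k) / (z - 1) ^ k" for k
  proof -
    have "z - 1 = (w - 1) * (w + 1)" unfolding z_def by algebra
    then show ?thesis using assms(1) by (simp add: power_mult_distrib diff_divide_distrib)
  qed
  show "1 / (w - 1)\<^sup>2 - 1 / (w + 1)\<^sup>2 = w * 4 / (z - 1)\<^sup>2"
    unfolding e by (rule arg_cong[where f = "\<lambda>x. x / _"]) algebra
  show "1 / (w - 1) ^ 3 - 1 / (w + 1) ^ 3 = 2 * (3 * z + 1) / (z - 1) ^ 3"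
    unfolding e by (rule arg_cong[where f = "\<lambda>x. x / _"]) (unfold z_def, algebra)
  show "1 / (w - 1) ^ 4 - 1 / (w + 1) ^ 4 = w * (8 * (z + 1)) / (z - 1) ^ 4"
    unfolding e by (rule arg_cong[where f = "\<lambda>x. x / _"]) (unfold z_def, algebra)
  show "1 / (w - 1) ^ 5 - 1 / (w + 1) ^ 5 = 2 * (5 * z\<^sup>2 + 10 * z + 1) / (z - 1) ^ 5"
    unfolding e by (rule arg_cong[where f = "\<lambda>x. x / _"]) (unfold z_def, algebra)
  show "1 / (w - 1) ^ 6 - 1 / (w + 1) ^ 6 = w * (4 * (3 * z\<^sup>2 + 10 * z + 3)) / (z - 1) ^ 6"
    unfolding e by (rule arg_cong[where f = "\<lambda>x. x / _"]) (unfold z_def, algebra)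
  show "1 / (w - 1) ^ 7 - 1 / (w + 1) ^ 7 = 2 * (7 * z ^ 3 + 35 * z\<^sup>2 + 21 * z + 1) / (z - 1) ^ 7"
    unfolding e by (rule arg_cong[where f = "\<lambda>x. x / _"]) (unfold z_def, algebra)
  show "1 / (w - 1) ^ 9 - 1 / (w + 1) ^ 9 = 2 * (9 * z ^ 4 + 84 * z ^ 3 + 126 * z\<^sup>2 + 36 * z + 1) / (z - 1) ^ 9"
    unfolding e by (rule arg_cong[where f = "\<lambda>x. x / _"]) (unfold z_def, algebra)
qed

lemma divide_power_shift: "t \<noteq> 0 \<Longrightarrow> x / t ^ i = x * t ^ j / t ^ (i + j)" for t x :: real
  by (simp add: power_add)

definition psi_tail :: "real \<Rightarrow> real \<Rightarrow> real" where
  "psi_tail c v = 1 / 180 * (1 / v ^ 3) - 61 / 6300 * (1 / v ^ 5) + 19 / 588 * (1 / v ^ 7) - c * (1 / v ^ 9)"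

definition chi_tail :: "real \<Rightarrow> real \<Rightarrow> real" where
  "chi_tail c v = 1 / 30 * (1 / v\<^sup>2) - 1 / 70 * (1 / v ^ 4) + c * (1 / v ^ 6)"

definition harm_tail :: "real \<Rightarrow> real \<Rightarrow> real" where
  "harm_tail c v = 1 / 3 * (1 / v\<^sup>2) - 2 / 15 * (1 / v ^ 4) + c * (1 / v ^ 6)"

lemma psi_tail_diff:
  assumes "w > 1"
  defines "z \<equiv> w\<^sup>2"
  shows "psi_tail c (w - 1) - psi_tail c (w + 1) = (2 * (3 * z + 1) * (z - 1) ^ 6 / 180 - 61 / 6300 * (2 * (5 * z\<^sup>2 + 10 * z + 1)) * (z - 1) ^ 4 + 19 / 588 * (2 * (7 * z ^ 3 + 35 * z\<^sup>2 + 21 * z + 1)) * (z - 1)\<^sup>2 - c * (2 * (9 * z ^ 4 + 84 * z ^ 3 + 126 * z\<^sup>2 + 36 * z + 1))) / (z - 1) ^ 9"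
proof -
  have "1 < z" using assms(1) by (simp add: z_def)
  then have z: "z - 1 \<noteq> 0" by simp
  have "psi_tail c (w - 1) - psi_tail c (w + 1) = 1 / 180 * (1 / (w - 1) ^ 3 - 1 / (w + 1) ^ 3) - 61 / 6300 * (1 / (w - 1) ^ 5 - 1 / (w + 1) ^ 5) + 19 / 588 * (1 / (w - 1) ^ 7 - 1 / (w + 1) ^ 7) - c * (1 / (w - 1) ^ 9 - 1 / (w + 1) ^ 9)"
    by (simp add: psi_tail_def right_diff_distrib)
  also have "\<dots> = 1 / 180 * (2 * (3 * z + 1) / (z - 1) ^ 3) - 61 / 6300 * (2 * (5 * z\<^sup>2 + 10 * z + 1) / (z - 1) ^ 5) + 19 / 588 * (2 * (7 * z ^ 3 + 35 * z\<^sup>2 + 21 * z + 1) / (z - 1) ^ 7) - c * (2 * (9 * z ^ 4 + 84 * z ^ 3 + 126 * z\<^sup>2 + 36 * z + 1) / (z - 1) ^ 9)"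
    unfolding inverse_power_diff[OF assms(1), folded z_def] ..
  also have "1 / 180 * (A / t ^ 3) - 61 / 6300 * (B / t ^ 5) + 19 / 588 * (C / t ^ 7) - c * (E / t ^ 9) = (A * t ^ 6 / 180 - 61 / 6300 * B * t ^ 4 + 19 / 588 * C * t\<^sup>2 - c * E) / t ^ 9" if "t \<noteq> 0" for A B C E t :: real
  proof -
    have "A / t ^ 3 = A * t ^ 6 / t ^ 9" "B / t ^ 5 = B * t ^ 4 / t ^ 9" "C / t ^ 7 = C * t\<^sup>2 / t ^ 9"
      using divide_power_shift[OF that, of A 3 6] divide_power_shift[OF that, of B 5 4] divide_power_shift[OF that, of C 7 2] by simp_all
    then show ?thesis by (simp only: diff_divide_distrib add_divide_distrib times_divide_eq_right mult.assoc, simp?)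
  qed
  note this[OF z]
  finally show ?thesis .
qed

lemma even_tail_diff:
  fixes w :: real
  assumes "w > 1"
  defines "z \<equiv> w\<^sup>2"
  shows "a * (1 / (w - 1)\<^sup>2 - 1 / (w + 1)\<^sup>2) + b * (1 / (w - 1) ^ 4 - 1 / (w + 1) ^ 4) + c * (1 / (w - 1) ^ 6 - 1 / (w + 1) ^ 6)
    = w * ((a * 4 * (z - 1) ^ 4 + b * (8 * (z + 1)) * (z - 1)\<^sup>2 + c * (4 * (3 * z\<^sup>2 + 10 * z + 3))) / (z - 1) ^ 6)"
proof -
  have "1 < z" using assms(1) by (simp add: z_def)
  then have z: "z - 1 \<noteq> 0" by simp
  have "a * (w * A / t\<^sup>2) + b * (w * B / t ^ 4) + c * (w * C / t ^ 6) = w * ((a * A * t ^ 4 + b * B * t\<^sup>2 + c * C) / t ^ 6)" if "t \<noteq> 0" for A B C t :: real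
  proof -
    have "a * (w * A / t\<^sup>2) = w * (a * A * t ^ 4 / t ^ 6)" "b * (w * B / t ^ 4) = w * (b * B * t\<^sup>2 / t ^ 6)"
      using divide_power_shift[OF that, of "a * (w * A)" 2 4] divide_power_shift[OF that, of "b * (w * B)" 4 2] by (simp_all add: mult_ac)
    then show ?thesis by (simp only: add_divide_distrib distrib_left) simp
  qed
  from this[OF z] show ?thesis unfolding inverse_power_diff[OF assms(1), folded z_def] .
qed

lemma frac_le_frac:
  fixes a b p q :: real
  assumes "p > 0" "q > 0" "a * q \<le> b * p" shows "a / p \<le> b / q"
  using assms by (simp add: divide_simps mult.commute)

lemma odd_square_ge:
  assumes "10 \<le> l" shows "441 \<le> (2 * real l + 1)\<^sup>2"
proof -
  have "21\<^sup>2 \<le> (2 * real l + 1)\<^sup>2" using assms by (intro power_mono) auto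
  then show ?thesis by simp
qed

text \<open>The points \<open>2 l\<close> and \<open>2 l + 2\<close> are \<open>w - 1\<close> and
  \<open>w + 1\<close>, so differences of odd inverse powers are rational in \<open>z = w^2\<close>.
  Clearing denominators leaves \<open>psi_poly_lower\<close> and
  \<open>psi_poly_upper\<close>.\<close>

lemma hook_psi_telescope:
  assumes l: "10 \<le> l"
  shows "psi_tail (117239 / 623700) (2 * real l) - psi_tail (117239 / 623700) (2 * real (Suc l)) \<le> hook_psi l"
    "hook_psi l \<le> psi_tail (9 / 50) (2 * real l) - psi_tail (9 / 50) (2 * real (Suc l))"
proof -
  define w where "w = 2 * real l + 1"
  define z where "z = w\<^sup>2"
  have w: "w > 1" "2 * real l = w - 1" "2 * real (Suc l) = w + 1" using l by (simp_all add: w_def)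
  have z: "441 \<le> z" using odd_square_ge[OF l] by (simp add: z_def w_def)
  have pos: "0 < 4365900 * (z - 1) ^ 9" "0 < 90090 * z ^ 6" "0 < 44100 * (z - 1) ^ 9" "0 < 13860 * z ^ 6" using z by auto
  have l0: "l > 0" using l by simp
  note b = hook_psi_bounds[OF l0, folded w_def, folded z_def]
  note d = psi_tail_diff[OF w(1), folded z_def]
  have i1: "(X / 180 - 61 / 6300 * Y + 19 / 588 * V - 117239 / 623700 * E) / T = (24255 * X - 42273 * Y + 141075 * V - 820673 * E) / (4365900 * T)" for X Y V E T :: real
    by (simp add: diff_divide_distrib add_divide_distrib)
  have i2: "(X / 180 - 61 / 6300 * Y + 19 / 588 * V - 9 / 50 * E) / T = (245 * X - 427 * Y + 1425 * V - 7938 * E) / (44100 * T)" for X Y V E T :: real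
    by (simp add: diff_divide_distrib add_divide_distrib)
  have "psi_tail (117239 / 623700) (w - 1) - psi_tail (117239 / 623700) (w + 1) \<le> (3003 * z ^ 4 + 1287 * z ^ 3 + 715 * z\<^sup>2 + 455 * z + 315) / (90090 * z ^ 6)"
    unfolding d mult.assoc[of "61 / 6300"] mult.assoc[of "19 / 588"] i1
    by (rule frac_le_frac[OF pos(1,2)]) (use psi_poly_lower[OF z] in \<open>simp only: mult_ac\<close>)
  also note b(1)
  finally show "psi_tail (117239 / 623700) (2 * real l) - psi_tail (117239 / 623700) (2 * real (Suc l)) \<le> hook_psi l"
    unfolding w .
  note b(2)
  also have "(462 * z ^ 4 + 198 * z ^ 3 + 110 * z\<^sup>2 + 70 * z + 315) / (13860 * z ^ 6) \<le> psi_tail (9 / 50) (w - 1) - psi_tail (9 / 50) (w + 1)"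
    unfolding d mult.assoc[of "61 / 6300"] mult.assoc[of "19 / 588"] i2
    by (rule frac_le_frac[OF pos(4,3)]) (use psi_poly_upper[OF z] in \<open>simp only: mult_ac\<close>)
  finally show "hook_psi l \<le> psi_tail (9 / 50) (2 * real l) - psi_tail (9 / 50) (2 * real (Suc l))"
    unfolding w .
qed

text \<open>The summand of the eta series after Abel summation with the partial sums
  \<open>l (l + 1) / 2\<close> of the weight \<open>l\<close>.\<close>

definition hook_chi :: "nat \<Rightarrow> real" where
  "hook_chi l = real l * (real l + 1) / 2 * ln (1 + 1 / real l) - (2 * real l + 1) / 4 + (2 * real l + 1) / (24 * (real l * (real l + 1)))"

definition harm_step :: "nat \<Rightarrow> real" where
  "harm_step l = (1 / real l + 1 / (real l + 1)) / 2 - ln (1 + 1 / real l)"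

text \<open>Both quantities are affine in \<open>ln (1 + 1 / l)\<close>, as is
  \<open>hook_psi\<close>, so \<open>hook_psi_bounds\<close> serves all three.\<close>

lemma hook_chi_eq:
  assumes l: "l > 0"
  defines "w \<equiv> 2 * real l + 1"
  defines "z \<equiv> w\<^sup>2"
  shows "hook_chi l = w * (1 / (6 * (z * (z - 1))) - hook_psi l)" (is ?chi)
    "harm_step l = w * (8 * (1 / (6 * z) + hook_psi l) / (z - 1))" (is ?step)
proof -
  define q where "q = ln (1 + 1 / real l) / w"
  have w: "w > 1" using l by (simp add: w_def)
  then have z: "z > 1" by (simp add: z_def)
  have ln: "ln (1 + 1 / real l) = w * q" using w by (simp add: q_def)
  have p: "hook_psi l = 1 / 4 - 1 / (6 * z) - (z - 1) / 8 * q"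
    using hook_psi_eq[OF l] by (simp only: q_def z_def w_def)
  have ll: "real l * (real l + 1) = (z - 1) / 4" by (simp add: z_def w_def power2_eq_square field_simps)
  have h: "1 / real l + 1 / (real l + 1) = 4 * w / (z - 1)"
  proof -
    have "1 / real l + 1 / (real l + 1) = w / (real l * (real l + 1))" using l by (simp add: w_def field_simps)
    then show ?thesis unfolding ll by simp
  qed
  have 1: "1 / (6 * (z * (z - 1))) = 1 / (6 * (z - 1)) - 1 / (6 * z)" using z by (simp add: divide_simps)
  have "24 * ((z - 1) / 4) = 6 * (z - 1)" by simp
  then have 2: "w / (24 * ((z - 1) / 4)) = w * (1 / (6 * (z - 1)))" by (simp only: times_divide_eq_right mult_1_right)
  show ?chi unfolding hook_chi_def w_def[symmetric] ll ln p 1 2 by (simp add: algebra_simps)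
  have g8: "8 * (c + (1 / 4 - c - u / 8 * q)) = 2 - u * q" for c u by (simp add: field_simps)
  have 3: "8 * (1 / (6 * z) + (1 / 4 - 1 / (6 * z) - (z - 1) / 8 * q)) / (z - 1) = 2 / (z - 1) - q"
    unfolding g8 using z by (simp add: diff_divide_distrib)
  have h2: "4 * w / t / 2 = w * (2 / t)" for t by (cases "t = 0") (auto simp: field_simps)
  show ?step unfolding harm_step_def h ln p 3 h2 by (simp only: right_diff_distrib)
qed

lemma hook_chi_telescope:
  assumes l: "10 \<le> l"
  shows "chi_tail (27 / 1000) (2 * real l) - chi_tail (27 / 1000) (2 * real (Suc l)) \<le> hook_chi l"
    "hook_chi l \<le> chi_tail (26 / 945) (2 * real l) - chi_tail (26 / 945) (2 * real (Suc l))"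
    "harm_tail (1 / 4) (2 * real l) - harm_tail (1 / 4) (2 * real (Suc l)) \<le> harm_step l"
    "harm_step l \<le> harm_tail (16 / 63) (2 * real l) - harm_tail (16 / 63) (2 * real (Suc l))"
proof -
  define w where "w = 2 * real l + 1"
  define z where "z = w\<^sup>2"
  have w: "w > 1" "w \<ge> 0" "2 * real l = w - 1" "2 * real (Suc l) = w + 1" using l by (simp_all add: w_def)
  have z: "441 \<le> z" using odd_square_ge[OF l] by (simp add: z_def w_def)
  then have z1: "z > 1" by simp
  have l0: "l > 0" using l by simp
  define t where "t = z - 1"
  have t: "t > 0" using z by (simp add: t_def)
  define lo where "lo = 3003 * z ^ 4 + 1287 * z ^ 3 + 715 * z\<^sup>2 + 455 * z + 315"
  define hi where "hi = 462 * z ^ 4 + 198 * z ^ 3 + 110 * z\<^sup>2 + 70 * z + 315"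
  have b: "lo / (90090 * z ^ 6) \<le> hook_psi l" "hook_psi l \<le> hi / (13860 * z ^ 6)"
    using hook_psi_bounds[OF l0, folded w_def, folded z_def] by (simp_all only: lo_def hi_def)
  note eq = hook_chi_eq[OF l0, folded w_def, folded z_def, folded t_def]
  have ct: "chi_tail c (w - 1) - chi_tail c (w + 1) = w * ((1 / 30 * 4 * t ^ 4 + (- (1 / 70)) * (8 * (z + 1)) * t\<^sup>2 + c * (4 * (3 * z\<^sup>2 + 10 * z + 3))) / t ^ 6)" for c
    unfolding even_tail_diff[OF w(1), folded z_def, folded t_def, symmetric] chi_tail_def by (simp add: right_diff_distrib)
  have ht: "harm_tail c (w - 1) - harm_tail c (w + 1) = w * ((1 / 3 * 4 * t ^ 4 + (- (2 / 15)) * (8 * (z + 1)) * t\<^sup>2 + c * (4 * (3 * z\<^sup>2 + 10 * z + 3))) / t ^ 6)" for c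
    unfolding even_tail_diff[OF w(1), folded z_def, folded t_def, symmetric] harm_tail_def by (simp add: right_diff_distrib)
  have zt: "0 < z ^ 6" "0 < t ^ 6" "0 < z ^ 6 * t ^ 6" using z t by auto
  have g: "1 / (6 * y) = D / 6 * x / (D * (y * x))" if "x > 0" "D > 0" for x y D :: real using that by simp
  have cfrac: "1 / (6 * (z * t)) - p / (D * z ^ 6) = (D / 6 * (z ^ 5 * t ^ 5) - p * t ^ 6) / (D * (z ^ 6 * t ^ 6))" if "D > 0" for p D
  proof -
    have e: "z ^ 6 * t ^ 6 = (z * t) * (z ^ 5 * t ^ 5)" by (simp add: eval_nat_numeral)
    have "0 < z ^ 5 * t ^ 5" using z t by auto
    then have "1 / (6 * (z * t)) = D / 6 * (z ^ 5 * t ^ 5) / (D * (z ^ 6 * t ^ 6))" unfolding e using that by (rule g)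
    moreover have "p / (D * z ^ 6) = p * t ^ 6 / (D * (z ^ 6 * t ^ 6))" using t by simp
    ultimately show ?thesis by (simp only: diff_divide_distrib)
  qed
  have hfrac: "8 * (1 / (6 * z) + p / (D * z ^ 6)) / t = 8 * (D / 6 * z ^ 5 + p) * t ^ 5 / (D * (z ^ 6 * t ^ 6))" if "D > 0" for p D
  proof -
    have e: "z ^ 6 = z * z ^ 5" "t ^ 6 = t * t ^ 5" by (simp_all add: eval_nat_numeral)
    have "0 < z ^ 5" using z by auto
    then have "1 / (6 * z) = D / 6 * z ^ 5 / (D * z ^ 6)" unfolding e using that by (rule g)
    then have "1 / (6 * z) + p / (D * z ^ 6) = (D / 6 * z ^ 5 + p) / (D * z ^ 6)" by (simp only: add_divide_distrib)
    moreover have "8 * (N / Q) / t = 8 * N * t ^ 5 / (Q * (t * t ^ 5))" for N Q using t by simp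
    ultimately show ?thesis unfolding e(2) by (simp only: mult.assoc)
  qed
  have num: "13860 / 6 = (2310 :: real)" "90090 / 6 = (15015 :: real)" by simp_all
  have pos: "0 < c * t ^ 6" "0 < c * (z ^ 6 * t ^ 6)" if "c > 0" for c using that zt by auto
  have "chi_tail (27 / 1000) (w - 1) - chi_tail (27 / 1000) (w + 1) \<le> w * (1 / (6 * (z * t)) - hi / (13860 * z ^ 6))"
  proof -
    have i: "(1 / 30 * 4 * X + (- (1 / 70)) * Y * V + 27 / 1000 * E) / T = (700 * (4 * X) - 300 * (Y * V) + 567 * E) / (21000 * T)" for X Y V E T :: real
      by (simp add: diff_divide_distrib add_divide_distrib)
    show ?thesis unfolding ct i cfrac[OF zero_less_numeral]
      by (rule mult_left_mono[OF frac_le_frac[OF pos(1)[OF zero_less_numeral] pos(2)[OF zero_less_numeral]] w(2)], unfold num)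
         (use chi_poly_lower[OF z, folded t_def hi_def, THEN mult_right_mono, OF less_imp_le[OF zt(2)]] in \<open>simp only: mult_ac\<close>)
  qed
  also have "\<dots> \<le> hook_chi l" unfolding eq by (rule mult_left_mono[OF diff_left_mono[OF b(2)] w(2)])
  finally show "chi_tail (27 / 1000) (2 * real l) - chi_tail (27 / 1000) (2 * real (Suc l)) \<le> hook_chi l" unfolding w .
  have "hook_chi l \<le> w * (1 / (6 * (z * t)) - lo / (90090 * z ^ 6))"
    unfolding eq by (rule mult_left_mono[OF diff_left_mono[OF b(1)] w(2)])
  also have "\<dots> \<le> chi_tail (26 / 945) (w - 1) - chi_tail (26 / 945) (w + 1)"
  proof -
    have i: "(1 / 30 * 4 * X + (- (1 / 70)) * Y * V + 26 / 945 * E) / T = (63 * (4 * X) - 27 * (Y * V) + 52 * E) / (1890 * T)" for X Y V E T :: real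
      by (simp add: diff_divide_distrib add_divide_distrib)
    show ?thesis unfolding ct i cfrac[OF zero_less_numeral]
      by (rule mult_left_mono[OF frac_le_frac[OF pos(2)[OF zero_less_numeral] pos(1)[OF zero_less_numeral]] w(2)], unfold num)
         (use chi_poly_upper[OF z, folded t_def lo_def, THEN mult_right_mono, OF less_imp_le[OF zt(2)]] in \<open>simp only: mult_ac\<close>)
  qed
  finally show "hook_chi l \<le> chi_tail (26 / 945) (2 * real l) - chi_tail (26 / 945) (2 * real (Suc l))" unfolding w .
  have "harm_tail (1 / 4) (w - 1) - harm_tail (1 / 4) (w + 1) \<le> w * (8 * (1 / (6 * z) + lo / (90090 * z ^ 6)) / t)"
  proof -
    have i: "(1 / 3 * 4 * X + (- (2 / 15)) * Y * V + 1 / 4 * E) / T = (20 * (4 * X) - 8 * (Y * V) + 15 * E) / (60 * T)" for X Y V E T :: real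
      by (simp add: diff_divide_distrib add_divide_distrib)
    show ?thesis unfolding ht i hfrac[OF zero_less_numeral]
      by (rule mult_left_mono[OF frac_le_frac[OF pos(1)[OF zero_less_numeral] pos(2)[OF zero_less_numeral]] w(2)], unfold num)
         (use harm_poly_lower[OF z, folded t_def lo_def, THEN mult_right_mono, OF less_imp_le[OF zt(2)]] in \<open>simp only: mult_ac\<close>)
  qed
  also have "\<dots> \<le> harm_step l"
    unfolding eq using t by (intro mult_left_mono[OF divide_right_mono[OF mult_left_mono[OF add_left_mono[OF b(1)]]] w(2)]) simp_all
  finally show "harm_tail (1 / 4) (2 * real l) - harm_tail (1 / 4) (2 * real (Suc l)) \<le> harm_step l" unfolding w .
  have "harm_step l \<le> w * (8 * (1 / (6 * z) + hi / (13860 * z ^ 6)) / t)"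
    unfolding eq using t by (intro mult_left_mono[OF divide_right_mono[OF mult_left_mono[OF add_left_mono[OF b(2)]]] w(2)]) simp_all
  also have "\<dots> \<le> harm_tail (16 / 63) (w - 1) - harm_tail (16 / 63) (w + 1)"
  proof -
    have i: "(1 / 3 * 4 * X + (- (2 / 15)) * Y * V + 16 / 63 * E) / T = (105 * (4 * X) - 42 * (Y * V) + 80 * E) / (315 * T)" for X Y V E T :: real
      by (simp add: diff_divide_distrib add_divide_distrib)
    show ?thesis unfolding ht i hfrac[OF zero_less_numeral]
      by (rule mult_left_mono[OF frac_le_frac[OF pos(2)[OF zero_less_numeral] pos(1)[OF zero_less_numeral]] w(2)], unfold num)
         (use harm_poly_upper[OF z, folded t_def hi_def, THEN mult_right_mono, OF less_imp_le[OF zt(2)]] in \<open>simp only: mult_ac\<close>)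
  qed
  finally show "harm_step l \<le> harm_tail (16 / 63) (2 * real l) - harm_tail (16 / 63) (2 * real (Suc l))" unfolding w .
qed

text \<open>Beyond \<open>N\<close> the terms are compared with differences of a null sequence
  \<open>g\<close>, so the tail of the series is compared with \<open>g (Suc N)\<close>.\<close>

lemma sums_telescope_bounds:
  fixes p g :: "nat \<Rightarrow> real"
  assumes s: "(\<lambda>k. p (Suc k)) sums S" and g: "g \<longlonglongrightarrow> 0"
  shows "(\<And>l. l > N \<Longrightarrow> g l - g (Suc l) \<le> p l) \<Longrightarrow> (\<Sum>k<N. p (Suc k)) + g (Suc N) \<le> S"
    "(\<And>l. l > N \<Longrightarrow> p l \<le> g l - g (Suc l)) \<Longrightarrow> S \<le> (\<Sum>k<N. p (Suc k)) + g (Suc N)"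
proof -
  let ?F = "\<lambda>j. S - (\<Sum>k<j. p (Suc k))"
  have F: "?F \<longlonglongrightarrow> 0" using tendsto_diff[OF tendsto_const[of S] s[unfolded sums_def]] by simp
  have g': "(\<lambda>j. g (Suc j)) \<longlonglongrightarrow> 0" by (rule LIMSEQ_Suc[OF g])
  show "(\<Sum>k<N. p (Suc k)) + g (Suc N) \<le> S" if "\<And>l. l > N \<Longrightarrow> g l - g (Suc l) \<le> p l"
    using tail_le_of_diff[OF g' F, of N N] that by simp
  show "S \<le> (\<Sum>k<N. p (Suc k)) + g (Suc N)" if "\<And>l. l > N \<Longrightarrow> p l \<le> g l - g (Suc l)"
    using tail_le_of_diff[OF F g', of N N] that by simp
qed

section \<open>Numerical values of Euler's constant and of the two constants\<close>

definition harm_dev :: "nat \<Rightarrow> real" where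
  "harm_dev l = ln (real l) - harm l + euler_mascheroni + 1 / (2 * real l)"

lemma harm_dev_eq: "harm_dev l = 1 / (12 * (real l)\<^sup>2) - harm_eps l"
  by (simp add: harm_dev_def harm_eps_def)

lemma harm_dev_tendsto: "harm_dev \<longlonglongrightarrow> 0"
proof -
  have "(\<lambda>l. 1 / (12 * (real l)\<^sup>2)) \<longlonglongrightarrow> 0" by real_asymp
  from tendsto_diff[OF this harm_eps_tendsto] show ?thesis unfolding harm_dev_eq by simp
qed

lemma harm_dev_diff: "l > 0 \<Longrightarrow> harm_dev l - harm_dev (Suc l) = harm_step l"
proof -
  assume "l > 0"
  have "A / 12 - a - (B / 12 - b) = m / 2 - u" if "a - b = u - m / 2 + (A - B) / 12" for A B a b m u :: real
    using that by (simp add: field_simps)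
  note this[OF harm_eps_diff[OF \<open>l > 0\<close>]]
  moreover have "1 / (12 * (real l)\<^sup>2) = 1 / (real l)\<^sup>2 / 12" "1 / (12 * (real (Suc l))\<^sup>2) = 1 / (real l + 1)\<^sup>2 / 12"
    by (simp_all add: add_ac)
  ultimately show ?thesis unfolding harm_dev_eq harm_step_def by (simp only:)
qed

text \<open>\<open>entropy_summand\<close> is \<open>hook_weight * harm_dev\<close>. Abel summation
  replaces it by \<open>hook_beta * harm_step\<close>, and the subtracted odd squares contribute
  \<open>(pi^2 / 8 - 1) / 6\<close>.\<close>

lemma psi_sums: "(\<lambda>k. hook_psi (Suc k)) sums (rho_sum_weighted + 11 * pi\<^sup>2 / 384 - 1 / 4 - (pi\<^sup>2 / 8 - 1) / 6)"
proof -
  have sq: "(\<lambda>l. (real l)\<^sup>2 * harm_dev l) \<longlonglongrightarrow> 1 / 12"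
  proof -
    have "(\<lambda>l. 1 / 12 - (real l)\<^sup>2 * harm_eps l) \<longlonglongrightarrow> 1 / 12 - 0" by (intro tendsto_intros harm_eps_cube)
    moreover have "eventually (\<lambda>l. 1 / 12 - (real l)\<^sup>2 * harm_eps l = (real l)\<^sup>2 * harm_dev l) sequentially"
      using eventually_gt_at_top[of 0] by eventually_elim (simp add: harm_dev_eq right_diff_distrib)
    ultimately show ?thesis by (simp add: tendsto_cong)
  qed
  have "entropy_summand l = hook_weight l * harm_dev l" for l
    by (simp add: entropy_summand_def hook_weight_def harm_dev_def)
  then have "(\<lambda>k. hook_weight (Suc k) * harm_dev (Suc k)) sums (0 + (rho_sum_weighted + 11 * pi\<^sup>2 / 384 - 1 / 4))"
    using entropy_sums by simp
  then have "(\<lambda>k. hook_beta (Suc k) * (harm_dev (Suc k) - harm_dev (Suc (Suc k)))) sums (rho_sum_weighted + 11 * pi\<^sup>2 / 384 - 1 / 4)"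
    by (rule abel_sums[OF hook_beta_rec hook_beta_tendsto[OF sq], THEN iffD1])
  from sums_diff[OF this sums_divide[OF odd_squares_sums, of 6]]
  have "(\<lambda>k. hook_beta (Suc k) * (harm_dev (Suc k) - harm_dev (Suc (Suc k))) - 1 / (2 * real k + 3)\<^sup>2 / 6) sums (rho_sum_weighted + 11 * pi\<^sup>2 / 384 - 1 / 4 - (pi\<^sup>2 / 8 - 1) / 6)" .
  moreover have "hook_beta (Suc k) * (harm_dev (Suc k) - harm_dev (Suc (Suc k))) - 1 / (2 * real k + 3)\<^sup>2 / 6 = hook_psi (Suc k)" for k
  proof -
    define t where "t = real (Suc k)"
    have t: "t > 0" "2 * real k + 3 = 2 * t + 1" by (simp_all add: t_def)
    have 1: "t * (t + 1) / (2 * (2 * t + 1)) * ((1 / t + 1 / (t + 1)) / 2) = 1 / 4"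
      using t(1) by (simp add: divide_simps) (simp add: algebra_simps)
    have 2: "1 / (2 * t + 1)\<^sup>2 / 6 = 1 / (6 * (2 * t + 1)\<^sup>2)" by simp
    have "a - b - c = a - c - b" for a b c :: real by simp
    then show ?thesis
      unfolding harm_dev_diff[OF zero_less_Suc] hook_beta_def harm_step_def hook_psi_def t_def[symmetric] t(2) right_diff_distrib 1 2 .
  qed
  ultimately show ?thesis by (simp only:)
qed

text \<open>Abel summation of \<open>l * harm_eps l\<close>; the series starts at
  \<open>l = 1\<close>, so \<open>eta_summand 1\<close> is added to the constant.\<close>

lemma chi_sums: "(\<lambda>k. hook_chi (Suc k)) sums (plancherel_eta + 7 / 12 - euler_mascheroni)"
proof -
  let ?B = "\<lambda>l. real l * (real l + 1) / 2"
  have c: "(\<lambda>M. ?B M * harm_eps (Suc M)) \<longlonglongrightarrow> 0"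
  proof -
    have "(\<lambda>M. real M * (real M + 1) / 2 / (real (Suc M))\<^sup>2) \<longlonglongrightarrow> 1 / 2" unfolding of_nat_Suc by real_asymp
    from tendsto_mult[OF this LIMSEQ_Suc[OF harm_eps_cube]]
    show ?thesis by (simp del: of_nat_Suc add: mult.assoc)
  qed
  have "eta_summand l = real l * harm_eps l" for l by (simp add: eta_summand_def harm_eps_def)
  moreover have "(\<lambda>k. eta_summand (Suc k)) sums (plancherel_eta + 7 / 12 - euler_mascheroni)"
    using eta_sums unfolding plancherel_eta_eq by (simp add: algebra_simps)
  ultimately have "(\<lambda>k. real (Suc k) * harm_eps (Suc k)) sums (0 + (plancherel_eta + 7 / 12 - euler_mascheroni))" by simp
  then have "(\<lambda>k. ?B (Suc k) * (harm_eps (Suc k) - harm_eps (Suc (Suc k)))) sums (plancherel_eta + 7 / 12 - euler_mascheroni)"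
    by (rule abel_sums[OF _ _ c, THEN iffD1, rotated -1]) (simp_all add: field_simps)
  moreover have "?B (Suc k) * (harm_eps (Suc k) - harm_eps (Suc (Suc k))) = hook_chi (Suc k)" for k
  proof -
    define t where "t = real (Suc k)"
    have t: "t > 0" by (simp add: t_def)
    have 1: "t * (t + 1) / 2 * ((1 / t + 1 / (t + 1)) / 2) = (2 * t + 1) / 4"
      using t by (simp add: divide_simps)
    have 2: "t * (t + 1) / 2 * ((1 / t\<^sup>2 - 1 / (t + 1)\<^sup>2) / 12) = (2 * t + 1) / (24 * (t * (t + 1)))"
      using t by (simp add: divide_simps) (simp add: power2_eq_square algebra_simps)
    show ?thesis
      by (simp only: harm_eps_diff[OF zero_less_Suc] hook_chi_def t_def[symmetric] right_diff_distrib[of "t * (t + 1) / 2"] distrib_left[of "t * (t + 1) / 2"] 1 2)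
  qed
  ultimately show ?thesis by (simp only:)
qed

lemma tail_limits:
  "(\<lambda>l. psi_tail (117239 / 623700) (2 * real l)) \<longlonglongrightarrow> 0" "(\<lambda>l. psi_tail (9 / 50) (2 * real l)) \<longlonglongrightarrow> 0"
  "(\<lambda>l. chi_tail (27 / 1000) (2 * real l)) \<longlonglongrightarrow> 0" "(\<lambda>l. chi_tail (26 / 945) (2 * real l)) \<longlonglongrightarrow> 0"
  "(\<lambda>l. harm_tail (1 / 4) (2 * real l)) \<longlonglongrightarrow> 0" "(\<lambda>l. harm_tail (16 / 63) (2 * real l)) \<longlonglongrightarrow> 0"
  unfolding psi_tail_def chi_tail_def harm_tail_def by real_asymp+

text \<open>\<open>harm_dev 10\<close> is Euler's constant plus known numbers, with
  \<open>ln 10\<close> split into the nine ratios already enclosed, and \<open>harm_tail\<close> at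
  \<open>20\<close> encloses it from both sides.\<close>

lemma euler_mascheroni_bounds_10: "0.5772156648 \<le> (euler_mascheroni :: real)" "euler_mascheroni \<le> (0.57721566495 :: real)"
proof -
  have ln10: "ln (10::real) = ln 2 + ln (3/2) + ln (4/3) + ln (5/4) + ln (6/5) + ln (7/6) + ln (8/7) + ln (9/8) + ln (10/9)"
    by (simp add: ln_div)
  have h: "harm 10 = (7381 / 2520 :: real)" by (simp add: harm_expand)
  have d: "harm_dev 10 = ln 10 - 7381 / 2520 + euler_mascheroni + 1 / 20" by (simp add: harm_dev_def h)
  have "harm_tail (1 / 4) (2 * real 10) \<le> harm_dev 10"
    by (rule tail_le_of_diff[OF tail_limits(5) harm_dev_tendsto, of 10]) (use hook_chi_telescope(3) in \<open>simp_all add: harm_dev_diff\<close>)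
  moreover have "harm_dev 10 \<le> harm_tail (16 / 63) (2 * real 10)"
    by (rule tail_le_of_diff[OF harm_dev_tendsto tail_limits(6), of 10]) (use hook_chi_telescope(4) in \<open>simp_all add: harm_dev_diff\<close>)
  ultimately show "0.5772156648 \<le> (euler_mascheroni :: real)" "euler_mascheroni \<le> (0.57721566495 :: real)"
    using ln_bounds_1 ln_bounds_2 ln_bounds_3 ln_bounds_4 ln_bounds_5 ln_bounds_6 ln_bounds_7 ln_bounds_8 ln_bounds_9
    unfolding d ln10 harm_tail_def by simp_all
qed

lemma sum_nine: "(\<Sum>k<9. f (Suc k)) = f 1 + f 2 + f 3 + f 4 + f 5 + f 6 + f 7 + f 8 + f 9" for f :: "nat \<Rightarrow> real"
  by (simp add: eval_nat_numeral)

lemma plancherel_eta_bounds: "\<bar>plancherel_eta - 0.001562493\<bar> \<le> 5 / 10 ^ 10"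
proof -
  have s: "(\<Sum>k<9. hook_chi (Suc k)) + chi_tail (27 / 1000) (2 * real (Suc 9)) \<le> plancherel_eta + 7 / 12 - euler_mascheroni"
    "plancherel_eta + 7 / 12 - euler_mascheroni \<le> (\<Sum>k<9. hook_chi (Suc k)) + chi_tail (26 / 945) (2 * real (Suc 9))"
    using sums_telescope_bounds(1)[OF chi_sums tail_limits(3), of 9] sums_telescope_bounds(2)[OF chi_sums tail_limits(4), of 9] hook_chi_telescope(1,2)
    by simp_all
  have c: "(\<Sum>k<9. hook_chi (Suc k)) = ln 2 + 3 * ln (3/2) + 6 * ln (4/3) + 10 * ln (5/4) + 15 * ln (6/5) + 21 * ln (7/6) + 28 * ln (8/7) + 36 * ln (9/8) + 45 * ln (10/9)
     - 99 / 4 + (3 / 48 + 5 / 144 + 7 / 288 + 9 / 480 + 11 / 720 + 13 / 1008 + 15 / 1344 + 17 / 1728 + 19 / 2160)"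
    by (simp only: sum_nine) (simp add: hook_chi_def)
  show ?thesis
    using s ln_bounds_1 ln_bounds_2 ln_bounds_3 ln_bounds_4 ln_bounds_5 ln_bounds_6 ln_bounds_7 ln_bounds_8 ln_bounds_9 euler_mascheroni_bounds_10
    unfolding c chi_tail_def by (simp add: abs_le_iff)
qed

lemma plancherel_entropy_const_bounds: "\<bar>plancherel_entropy_const - 1.87702830628\<bar> \<le> 5 / 10 ^ 12"
proof -
  define S where "S = rho_sum_weighted + 11 * pi\<^sup>2 / 384 - 1 / 4 - (pi\<^sup>2 / 8 - 1) / 6"
  have s: "(\<Sum>k<9. hook_psi (Suc k)) + psi_tail (117239 / 623700) (2 * real (Suc 9)) \<le> S"
    "S \<le> (\<Sum>k<9. hook_psi (Suc k)) + psi_tail (9 / 50) (2 * real (Suc 9))"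
    using sums_telescope_bounds(1)[OF psi_sums[folded S_def] tail_limits(1), of 9] sums_telescope_bounds(2)[OF psi_sums[folded S_def] tail_limits(2), of 9] hook_psi_telescope
    by simp_all
  have c: "(\<Sum>k<9. hook_psi (Suc k)) = 9 / 4 - (1 / 54 + 1 / 150 + 1 / 294 + 1 / 486 + 1 / 726 + 1 / 1014 + 1 / 1350 + 1 / 1734 + 1 / 2166)
    - (2 / 6 * ln 2 + 6 / 10 * ln (3/2) + 12 / 14 * ln (4/3) + 20 / 18 * ln (5/4) + 30 / 22 * ln (6/5) + 42 / 26 * ln (7/6) + 56 / 30 * ln (8/7) + 72 / 34 * ln (9/8) + 90 / 38 * ln (10/9))"
    by (simp only: sum_nine) (simp add: hook_psi_def)
  have S: "0.00051126507097446 \<le> S" "S \<le> 0.00051126507099065"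
    using s ln_bounds_1 ln_bounds_2 ln_bounds_3 ln_bounds_4 ln_bounds_5 ln_bounds_6 ln_bounds_7 ln_bounds_8 ln_bounds_9
    unfolding c psi_tail_def by simp_all
  \<comment> \<open>The multiples of \<open>pi^2\<close> in \<open>S\<close> lower
    \<open>11 / 6\<close> to \<open>4 / 3\<close>. Euler's constant is absent, so the accuracy
    depends only on the logarithms and on \<open>pi\<close>.\<close>
  have H: "plancherel_entropy_const = 4 / 3 + 64 * (S + 1 / 12) / pi\<^sup>2"
    unfolding plancherel_entropy_const_eq S_def by (simp add: field_simps)
  have p: "3.141592653588\<^sup>2 \<le> pi\<^sup>2" "pi\<^sup>2 \<le> 3.1415926535899\<^sup>2"
    using pi_approx by (intro power_mono; simp)+
  define Q where "Q = 64 * (S + 1 / 12) / pi\<^sup>2"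
  have "Q \<le> 64 * (0.00051126507099065 + 1 / 12) / 3.141592653588\<^sup>2"
    unfolding Q_def using S p by (intro frac_le mult_left_mono) auto
  also have "\<dots> \<le> 1.87702830628 + 5 / 10 ^ 12 - 4 / 3" by (simp add: power2_eq_square)
  finally have u: "Q \<le> 1.87702830628 + 5 / 10 ^ 12 - 4 / 3" .
  have "1.87702830628 - 5 / 10 ^ 12 - 4 / 3 \<le> 64 * (0.00051126507097446 + 1 / 12) / (3.1415926535899\<^sup>2 :: real)"
    by (simp add: power2_eq_square)
  also have "\<dots> \<le> Q"
    unfolding Q_def using S p by (intro frac_le mult_left_mono) auto
  finally show ?thesis using u unfolding H Q_def[symmetric] abs_le_iff by linarith
qed

theorem theorem3p1:
  shows "summable (\<lambda>k. entropy_summand (k + 2))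
    \<and> summable (\<lambda>k. eta_summand (k + 2))
    \<and> \<bar>plancherel_entropy_const - 1.87702830628\<bar> \<le> 5 / 10 ^ 12
    \<and> \<bar>plancherel_eta - 0.001562493\<bar> \<le> 5 / 10 ^ 10
    \<and> (\<lambda>n::nat. - expected_log_plancherel n / sqrt (real n)
         - (plancherel_entropy_const
            - (13 / 24 * ln (real n) + 13 * euler_mascheroni / 12 + ln (sqrt (2 * pi)) + 1 / 4
               - plancherel_eta) * (1 / sqrt (real n))))
       \<in> o(\<lambda>n. real n powr (- 1 / 2))"
proof (intro conjI plancherel_entropy_const_bounds plancherel_eta_bounds sums_summable[OF entropy_const_sums] sums_summable[OF eta_const_sums])
  let ?B = "\<lambda>n. 13 / 24 * ln (real n) + 13 * euler_mascheroni / 12 + ln (sqrt (2 * pi)) + 1 / 4 - plancherel_eta"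
  let ?f = "\<lambda>n::nat. - expected_log_plancherel n / sqrt (real n) - (plancherel_entropy_const - ?B n * (1 / sqrt (real n)))"
  have "?f n / real n powr (- 1 / 2) = - expected_log_plancherel n - (sqrt (real n) * plancherel_entropy_const - ?B n)" if "n > 0" for n
  proof -
    have p: "real n powr (- 1 / 2) = 1 / sqrt (real n)"
      using that powr_minus_divide[of "real n" "1 / 2"] by (simp add: powr_half_sqrt)
    have gen: "(a / s - (H - b * (1 / s))) / (1 / s) = a - (s * H - b)" if "s > 0" for a s H b :: real
      using that by (simp add: field_simps)
    show ?thesis unfolding p by (rule gen) (use that in simp)
  qed
  then have "eventually (\<lambda>n. - expected_log_plancherel n - (sqrt (real n) * plancherel_entropy_const - ?B n) = ?f n / real n powr (- 1 / 2)) sequentially"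
    by (auto intro: eventually_mono[OF eventually_gt_at_top[of 0]])
  with expected_log_asymp have "(\<lambda>n. ?f n / real n powr (- 1 / 2)) \<longlonglongrightarrow> 0"
    by (rule Lim_transform_eventually)
  moreover have "eventually (\<lambda>n::nat. real n powr (- 1 / 2) \<noteq> 0) sequentially"
    by (rule eventually_mono[OF eventually_gt_at_top[of 0]]) simp
  ultimately show "?f \<in> o(\<lambda>n. real n powr (- 1 / 2))" by (intro smalloI_tendsto)
qed

end
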